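(* Let $i\in\mathcal S$ be the initial regime and let the standing assumptions on the coefficients (given in the context) hold. Define $$\bar\gamma:=\inf\{\gamma>0:\ \overline V^0_{\gamma'}(0,0,i)=0\ \text{ for all }\gamma'>\gamma\},$$ $$\gamma^*:=\inf_{u\in L^2_{\mathbb G}(0,T;\mathbb R^m)}\ \sup_{v\in L^2_{\mathbb F}(0,T;\mathbb R^{n_v}),\,v\ne0}\ \frac{J^0(0,0,i;u,v)^{1/2}}{\big(\mathbb E\int_0^T|v(s)|^2ds\big)^{1/2}}.$$ Then $\gamma^*=\bar\gamma$.
   Context: Let $T\in(0,\infty)$. On a complete probability space $(\Omega,\mathcal F,\mathbb P)$ let $W,\overline W$ be independent one-dimensional standard Brownian motions and let $\alpha$ be a continuous-time homogeneous irreducible Markov chain, independent of $(W,\overline W)$, with finite state space $\mathcal S=\{1,\dots,D\}$ and generator $(\lambda_{ij})_{i,j=1}^D$, $\lambda_{ij}>0$ for $i\ne j$, $\sum_j\lambda_{ij}=0$. $\mathbb F=\{\mathcal F_t\}$ is the filtration generated by $(W,\overline W,\alpha)$ and $\mathbb G=\{\mathcal G_t\}$ the filtration generated by $(W,\alpha)$, both augmented by the $\mathbb P$-null sets. $L^2_{\mathbb F}(0,T;\mathbb R^k)$ (resp. $L^2_{\mathbb G}(0,T;\mathbb R^k)$) is the set of $\mathbb F$- (resp. $\mathbb G$-) progressively measurable $\mathbb R^k$-valued processes $\phi$ with $\mathbb E\int_0^T|\phi(s)|^2ds<\infty$. $\mathbb S^n$ is the set of real symmetric $n\times n$ matrices.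 $M\gg0$ means $M\ge\delta I$ for some constant $\delta>0$ (uniformly in a.e. $s$). Coefficients (deterministic, for each $j\in\mathcal S$): $A(\cdot,j)\in L^1(0,T;\mathbb R^{n\times n})$; $C(\cdot,j),\bar C(\cdot,j)\in L^2(0,T;\mathbb R^{n\times n})$; $B=(B_1\ B_2)$ with $B(\cdot,j)\in L^2(0,T;\mathbb R^{n\times(m+n_v)})$; $D=(D_1\ D_2)$, $\bar D=(\bar D_1\ \bar D_2)$ with $D(\cdot,j),\bar D(\cdot,j)\in L^\infty(0,T;\mathbb R^{n\times(m+n_v)})$; $Q(\cdot,j)\in L^1(0,T;\mathbb S^n)$; $S=\binom{S_1}{S_2}$ with $S(\cdot,j)\in L^2(0,T;\mathbb R^{(m+n_v)\times n})$; $R=\mathrm{diag}(R_1,R_2)$ with $R(\cdot,j)\in L^\infty(0,T;\mathbb S^{m+n_v})$; $G(T,j)\in\mathbb S^n$. The indices $1,2$ refer to the blocks of sizes $m$ and $n_v$. Moreover, for every $j\in\mathcal S$ and a.e. $s\in[0,T]$: $G(T,j)\ge0$, $R(s,j)\gg0$, $Q(s,j)-S(s,j)^\top R(s,j)^{-1}S(s,j)\ge0$ (so that $J^0$ below is non-negative). For $u\in L^2_{\mathbb G}(0,T;\mathbb R^m)$ and $v\in L^2_{\mathbb F}(0,T;\mathbb R^{n_v})$ let $x^0$ be the solution (coefficients evaluated at $(s,\alpha(s))$) of $$dx^0=[Ax^0+B_1u+B_2v]ds+[Cx^0+D_1u+D_2v]dW+[\bar Cx^0+\bar D_1u+\bar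 D_2v]d\overline W,\quad x^0(0)=0,\ \alpha(0)=i,$$ and set $$J^0(0,0,i;u,v)=\mathbb E\Big\{\langle G(T,\alpha(T))x^0(T),x^0(T)\rangle+\int_0^T\big[\langle Qx^0,x^0\rangle+\langle R_1u,u\rangle+\langle R_2v,v\rangle+2\langle S_1x^0,u\rangle+2\langle S_2x^0,v\rangle\big]ds\Big\},$$ $$J^0_\gamma(0,0,i;u,v)=J^0(0,0,i;u,v)-\gamma^2\,\mathbb E\int_0^T|v(s)|^2ds.$$ The open-loop upper value (an extended real number) is $$\overline V^0_\gamma(0,0,i)=\inf_{u\in L^2_{\mathbb G}(0,T;\mathbb R^m)}\ \sup_{v\in L^2_{\mathbb F}(0,T;\mathbb R^{n_v})}J^0_\gamma(0,0,i;u,v).$$ *)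

theory Defs
  imports "HOL-Probability.Probability"
begin

section \<open>Driving noise\<close>

text \<open>Standard one-dimensional Brownian motion on the time axis $[0,\infty)$.
  Paths are continuous almost surely.\<close>

definition brownian_motion :: "'w measure \<Rightarrow> (real \<Rightarrow> 'w \<Rightarrow> real) \<Rightarrow> bool" where
  "brownian_motion M W \<longleftrightarrow>
     (\<forall>t\<ge>0. W t \<in> borel_measurable M) \<and>
     (AE \<omega> in M. W 0 \<omega> = 0) \<and>
     (\<forall>s t. 0 \<le> s \<and> s < t \<longrightarrow>
        distributed M lborel (\<lambda>\<omega>. W t \<omega> - W s \<omega>)
          (\<lambda>x. ennreal (normal_density 0 (sqrt (t - s)) x))) \<and>
     (\<forall>(n::nat) \<tau>. 0 \<le> \<tau> 0 \<and> (\<forall>k<n. \<tau> k \<le> \<tau> (Suc k)) \<longrightarrow>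
        prob_space.indep_vars M (\<lambda>_. borel) (\<lambda>k \<omega>. W (\<tau> (Suc k)) \<omega> - W (\<tau> k) \<omega>) {..<n}) \<and>
     (AE \<omega> in M. continuous_on {0..} (\<lambda>t. W t \<omega>))"

definition transition_semigroup :: "(real \<Rightarrow> 's::finite \<Rightarrow> 's \<Rightarrow> real) \<Rightarrow> bool" where
  "transition_semigroup p \<longleftrightarrow>
     (\<forall>t\<ge>0. \<forall>i j. 0 \<le> p t i j) \<and>
     (\<forall>t\<ge>0. \<forall>i. (\<Sum>j\<in>UNIV. p t i j) = 1) \<and>
     (\<forall>i j. p 0 i j = (if i = j then 1 else 0)) \<and>
     (\<forall>s\<ge>0. \<forall>t\<ge>0. \<forall>i j. p (s + t) i j = (\<Sum>k\<in>UNIV. p s i k * p t k j))"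

text \<open>A homogeneous continuous-time Markov chain with generator \<open>\<Lambda>\<close>: its finite-dimensional
  distributions are those of a transition semigroup whose right derivative at time 0 is \<open>\<Lambda>\<close>, and
  its paths are step functions (right-continuous with left limits in the discrete state space).\<close>

definition markov_chain ::
  "'w measure \<Rightarrow> ('s::finite \<Rightarrow> 's \<Rightarrow> real) \<Rightarrow> (real \<Rightarrow> 'w \<Rightarrow> 's) \<Rightarrow> bool" where
  "markov_chain M \<Lambda> \<alpha> \<longleftrightarrow>
     (\<forall>t\<ge>0. \<alpha> t \<in> measurable M (count_space UNIV)) \<and>
     (\<exists>p. transition_semigroup p \<and>
        (\<forall>i j. ((\<lambda>t. p t i j) has_real_derivative \<Lambda> i j) (at 0 within {0..})) \<and>
        (\<forall>(n::nat) \<tau> c. \<tau> 0 = 0 \<and> (\<forall>k<n. \<tau> k \<le> \<tau> (Suc k)) \<longrightarrow>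
           measure M {\<omega> \<in> space M. \<forall>k\<le>n. \<alpha> (\<tau> k) \<omega> = c k} =
           measure M {\<omega> \<in> space M. \<alpha> 0 \<omega> = c 0} *
             (\<Prod>k<n. p (\<tau> (Suc k) - \<tau> k) (c k) (c (Suc k))))) \<and>
     (\<forall>\<omega>\<in>space M. \<forall>t\<ge>0. \<forall>\<^sub>F s in at_right t. \<alpha> s \<omega> = \<alpha> t \<omega>) \<and>
     (\<forall>\<omega>\<in>space M. \<forall>t>0. \<exists>j. \<forall>\<^sub>F s in at_left t. \<alpha> s \<omega> = j)"

definition process_events ::
  "'w measure \<Rightarrow> 'a measure \<Rightarrow> (real \<Rightarrow> 'w \<Rightarrow> 'a) \<Rightarrow> real set \<Rightarrow> 'w set set" where
  "process_events M N X I = {X s -` B \<inter> space M | s B. s \<in> I \<and> B \<in> sets N}"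

text \<open>\<open>W\<close> and \<open>Wb\<close> (the process $\overline W$) are independent, and \<open>\<alpha>\<close> is independent
  of the pair \<open>(W, Wb)\<close>.\<close>

definition independent_noise ::
  "'w measure \<Rightarrow> (real \<Rightarrow> 'w \<Rightarrow> real) \<Rightarrow> (real \<Rightarrow> 'w \<Rightarrow> real) \<Rightarrow> (real \<Rightarrow> 'w \<Rightarrow> 's) \<Rightarrow> bool" where
  "independent_noise M W Wb \<alpha> \<longleftrightarrow>
     prob_space.indep_set M
       (sigma_sets (space M) (process_events M borel W {0..}))
       (sigma_sets (space M) (process_events M borel Wb {0..})) \<and>
     prob_space.indep_set M
       (sigma_sets (space M) (process_events M borel W {0..} \<union> process_events M borel Wb {0..}))
       (sigma_sets (space M) (process_events M (count_space UNIV) \<alpha> {0..}))"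

definition filt_F ::
  "'w measure \<Rightarrow> (real \<Rightarrow> 'w \<Rightarrow> real) \<Rightarrow> (real \<Rightarrow> 'w \<Rightarrow> real) \<Rightarrow> (real \<Rightarrow> 'w \<Rightarrow> 's) \<Rightarrow> real \<Rightarrow> 'w measure"
  where
  "filt_F M W Wb \<alpha> t = sigma (space M)
     (process_events M borel W {0..t} \<union> process_events M borel Wb {0..t} \<union>
      process_events M (count_space UNIV) \<alpha> {0..t} \<union> null_sets M)"

definition filt_G ::
  "'w measure \<Rightarrow> (real \<Rightarrow> 'w \<Rightarrow> real) \<Rightarrow> (real \<Rightarrow> 'w \<Rightarrow> 's) \<Rightarrow> real \<Rightarrow> 'w measure" where
  "filt_G M W \<alpha> t = sigma (space M)
     (process_events M borel W {0..t} \<union> process_events M (count_space UNIV) \<alpha> {0..t} \<union>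
      null_sets M)"


section \<open>Processes and Ito integrals on a finite horizon\<close>

definition progressive ::
  "real \<Rightarrow> (real \<Rightarrow> 'w measure) \<Rightarrow> (real \<Rightarrow> 'w \<Rightarrow> 'a::topological_space) \<Rightarrow> bool" where
  "progressive T F \<phi> \<longleftrightarrow>
     (\<forall>t\<in>{0..T}. (\<lambda>(s, \<omega>). \<phi> s \<omega>) \<in> borel_measurable (restrict_space borel {0..t} \<Otimes>\<^sub>M F t))"

text \<open>The square $\mathbb{E}\int_0^T|\phi(s)|^2\,ds$ of the $L^2$ norm, in $[0,\infty]$ and as a
  real number.\<close>

definition nn_energy ::
  "'w measure \<Rightarrow> real \<Rightarrow> (real \<Rightarrow> 'w \<Rightarrow> 'a::euclidean_space) \<Rightarrow> ennreal" where
  "nn_energy M T \<phi> =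
     (\<integral>\<^sup>+ \<omega>. (\<integral>\<^sup>+ s. ennreal ((norm (\<phi> s \<omega>))\<^sup>2) * indicator {0..T} s \<partial>lborel) \<partial>M)"

definition energy ::
  "'w measure \<Rightarrow> real \<Rightarrow> (real \<Rightarrow> 'w \<Rightarrow> 'a::euclidean_space) \<Rightarrow> real" where
  "energy M T \<phi> = (LINT \<omega>|M. (LINT s:{0..T}|lborel. (norm (\<phi> s \<omega>))\<^sup>2))"

definition L2_process ::
  "'w measure \<Rightarrow> real \<Rightarrow> (real \<Rightarrow> 'w measure) \<Rightarrow> (real \<Rightarrow> 'w \<Rightarrow> 'a::euclidean_space) set" where
  "L2_process M T F = {\<phi>. progressive T F \<phi> \<and> nn_energy M T \<phi> < \<infinity>}"

text \<open>Simple integrands $\sum_{k<N} \xi_k 1_{(\tau_k,\tau_{k+1}]}$ with bounded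
  $\mathcal F_{\tau_k}$-measurable $\xi_k$, and their elementary stochastic integrals.\<close>

definition simple_data ::
  "'w measure \<Rightarrow> real \<Rightarrow> (real \<Rightarrow> 'w measure) \<Rightarrow> nat \<Rightarrow> (nat \<Rightarrow> real) \<Rightarrow>
   (nat \<Rightarrow> 'w \<Rightarrow> 'a::euclidean_space) \<Rightarrow> bool" where
  "simple_data M T F N \<tau> \<xi> \<longleftrightarrow>
     \<tau> 0 = 0 \<and> \<tau> N = T \<and> (\<forall>k<N. \<tau> k < \<tau> (Suc k)) \<and>
     (\<forall>k<N. \<xi> k \<in> borel_measurable (F (\<tau> k))) \<and>
     (\<exists>K. \<forall>k<N. \<forall>\<omega>\<in>space M. norm (\<xi> k \<omega>) \<le> K)"

definition simple_process ::
  "nat \<Rightarrow> (nat \<Rightarrow> real) \<Rightarrow> (nat \<Rightarrow> 'w \<Rightarrow> 'a::euclidean_space) \<Rightarrow> real \<Rightarrow> 'w \<Rightarrow> 'a" where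
  "simple_process N \<tau> \<xi> t \<omega> = (\<Sum>k<N. indicator {\<tau> k<..\<tau> (Suc k)} t *\<^sub>R \<xi> k \<omega>)"

definition simple_integral ::
  "(real \<Rightarrow> 'w \<Rightarrow> real) \<Rightarrow> nat \<Rightarrow> (nat \<Rightarrow> real) \<Rightarrow> (nat \<Rightarrow> 'w \<Rightarrow> 'a::euclidean_space) \<Rightarrow> real \<Rightarrow> 'w \<Rightarrow> 'a"
  where
  "simple_integral W N \<tau> \<xi> t \<omega> =
     (\<Sum>k<N. (W (min t (\<tau> (Suc k))) \<omega> - W (min t (\<tau> k)) \<omega>) *\<^sub>R \<xi> k \<omega>)"

text \<open>\<open>I\<close> is (a continuous version of) the Ito integral process $\int_0^\cdot\phi\,dW$ on
  $[0,T]$: the integrand is in $L^2$, and \<open>I\<close> is the mean-square limit of the elementary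
  integrals of simple integrands converging to \<open>\<phi>\<close> in $L^2(\Omega\times[0,T])$.\<close>

definition ito_integral ::
  "'w measure \<Rightarrow> real \<Rightarrow> (real \<Rightarrow> 'w measure) \<Rightarrow> (real \<Rightarrow> 'w \<Rightarrow> real) \<Rightarrow>
   (real \<Rightarrow> 'w \<Rightarrow> 'a::euclidean_space) \<Rightarrow> (real \<Rightarrow> 'w \<Rightarrow> 'a) \<Rightarrow> bool" where
  "ito_integral M T F W \<phi> I \<longleftrightarrow>
     \<phi> \<in> L2_process M T F \<and>
     (\<forall>t\<in>{0..T}. I t \<in> borel_measurable (F t)) \<and>
     (AE \<omega> in M. continuous_on {0..T} (\<lambda>t. I t \<omega>)) \<and>
     (\<exists>N \<tau> \<xi>.
        (\<forall>k::nat. simple_data M T F (N k) (\<tau> k) (\<xi> k)) \<and>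
        (\<lambda>k. nn_energy M T (\<lambda>s \<omega>. \<phi> s \<omega> - simple_process (N k) (\<tau> k) (\<xi> k) s \<omega>)) \<longlonglongrightarrow> 0 \<and>
        (\<forall>t\<in>{0..T}.
           (\<lambda>k. \<integral>\<^sup>+ \<omega>. ennreal ((norm (I t \<omega> - simple_integral W (N k) (\<tau> k) (\<xi> k) t \<omega>))\<^sup>2) \<partial>M)
             \<longlonglongrightarrow> 0))"


section \<open>Coefficients\<close>

text \<open>The spaces $L^p(0,T;\cdot)$, by Borel representatives.\<close>

definition Lp_fun :: "real \<Rightarrow> real \<Rightarrow> (real \<Rightarrow> 'a::euclidean_space) \<Rightarrow> bool" where
  "Lp_fun p T f \<longleftrightarrow>
     set_borel_measurable lborel {0..T} f \<and>
     (\<integral>\<^sup>+ s. ennreal (norm (f s) powr p) * indicator {0..T} s \<partial>lborel) < \<infinity>"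

definition Linf_fun :: "real \<Rightarrow> (real \<Rightarrow> 'a::euclidean_space) \<Rightarrow> bool" where
  "Linf_fun T f \<longleftrightarrow>
     set_borel_measurable lborel {0..T} f \<and>
     (\<exists>K. AE s in lborel. s \<in> {0..T} \<longrightarrow> norm (f s) \<le> K)"

text \<open>Block matrices \<open>(X Y)\<close>, \<open>X\<close> above \<open>Y\<close>, and \<open>diag(X, Y)\<close>; the index set of size
  $m+n_v$ is the sum of the index types.\<close>

definition hcat :: "real^'m^'n \<Rightarrow> real^'k^'n \<Rightarrow> real^('m + 'k)^'n" where
  "hcat X Y = (\<chi> i j. case j of Inl a \<Rightarrow> X $ i $ a | Inr b \<Rightarrow> Y $ i $ b)"

definition vcat :: "real^'n^'m \<Rightarrow> real^'n^'k \<Rightarrow> real^'n^('m + 'k)" where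
  "vcat X Y = (\<chi> i j. case i of Inl a \<Rightarrow> X $ a $ j | Inr b \<Rightarrow> Y $ b $ j)"

definition block_diag :: "real^'m^'m \<Rightarrow> real^'k^'k \<Rightarrow> real^('m + 'k)^('m + 'k)" where
  "block_diag X Y = (\<chi> i j. case (i, j) of
      (Inl a, Inl b) \<Rightarrow> X $ a $ b | (Inr a, Inr b) \<Rightarrow> Y $ a $ b | _ \<Rightarrow> 0)"

definition symmetric_matrix :: "real^'n^'n \<Rightarrow> bool" where
  "symmetric_matrix X \<longleftrightarrow> transpose X = X"

text \<open>The order $X\ge\delta I$ of symmetric matrices.\<close>

definition ge_scalar :: "real^'n^'n \<Rightarrow> real \<Rightarrow> bool" where
  "ge_scalar X \<delta> \<longleftrightarrow> (\<forall>z. z \<bullet> (X *v z) \<ge> \<delta> * (z \<bullet> z))"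

record ('n, 'm, 'k, 's) coeffs =
  cA   :: "real \<Rightarrow> 's \<Rightarrow> real^'n^'n"
  cB1  :: "real \<Rightarrow> 's \<Rightarrow> real^'m^'n"
  cB2  :: "real \<Rightarrow> 's \<Rightarrow> real^'k^'n"
  cC   :: "real \<Rightarrow> 's \<Rightarrow> real^'n^'n"
  cD1  :: "real \<Rightarrow> 's \<Rightarrow> real^'m^'n"
  cD2  :: "real \<Rightarrow> 's \<Rightarrow> real^'k^'n"
  cCb  :: "real \<Rightarrow> 's \<Rightarrow> real^'n^'n"
  cDb1 :: "real \<Rightarrow> 's \<Rightarrow> real^'m^'n"
  cDb2 :: "real \<Rightarrow> 's \<Rightarrow> real^'k^'n"
  cQ   :: "real \<Rightarrow> 's \<Rightarrow> real^'n^'n"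
  cS1  :: "real \<Rightarrow> 's \<Rightarrow> real^'n^'m"
  cS2  :: "real \<Rightarrow> 's \<Rightarrow> real^'n^'k"
  cR1  :: "real \<Rightarrow> 's \<Rightarrow> real^'m^'m"
  cR2  :: "real \<Rightarrow> 's \<Rightarrow> real^'k^'k"
  cG   :: "'s \<Rightarrow> real^'n^'n"

definition cS :: "('n::finite, 'm::finite, 'k::finite, 's) coeffs \<Rightarrow> real \<Rightarrow> 's \<Rightarrow> real^'n^('m + 'k)" where
  "cS c s j = vcat (cS1 c s j) (cS2 c s j)"

definition cR :: "('n::finite, 'm::finite, 'k::finite, 's) coeffs \<Rightarrow> real \<Rightarrow> 's \<Rightarrow> real^('m + 'k)^('m + 'k)" where
  "cR c s j = block_diag (cR1 c s j) (cR2 c s j)"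

definition integrable_coeffs :: "real \<Rightarrow> ('n::finite, 'm::finite, 'k::finite, 's) coeffs \<Rightarrow> bool" where
  "integrable_coeffs T c \<longleftrightarrow> (\<forall>j.
     Lp_fun 1 T (\<lambda>s. cA c s j) \<and>
     Lp_fun 2 T (\<lambda>s. cC c s j) \<and>
     Lp_fun 2 T (\<lambda>s. cCb c s j) \<and>
     Lp_fun 2 T (\<lambda>s. hcat (cB1 c s j) (cB2 c s j)) \<and>
     Linf_fun T (\<lambda>s. hcat (cD1 c s j) (cD2 c s j)) \<and>
     Linf_fun T (\<lambda>s. hcat (cDb1 c s j) (cDb2 c s j)) \<and>
     Lp_fun 1 T (\<lambda>s. cQ c s j) \<and> (AE s in lborel. s \<in> {0..T} \<longrightarrow> symmetric_matrix (cQ c s j)) \<and>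
     Lp_fun 2 T (\<lambda>s. cS c s j) \<and>
     Linf_fun T (\<lambda>s. cR c s j) \<and> (AE s in lborel. s \<in> {0..T} \<longrightarrow> symmetric_matrix (cR c s j)) \<and>
     symmetric_matrix (cG c j))"

definition nonneg_cost_coeffs :: "real \<Rightarrow> ('n::finite, 'm::finite, 'k::finite, 's) coeffs \<Rightarrow> bool" where
  "nonneg_cost_coeffs T c \<longleftrightarrow> (\<forall>j.
     ge_scalar (cG c j) 0 \<and>
     (\<exists>\<delta>>0. AE s in lborel. s \<in> {0..T} \<longrightarrow> ge_scalar (cR c s j) \<delta>) \<and>
     (AE s in lborel. s \<in> {0..T} \<longrightarrow>
        ge_scalar (cQ c s j - transpose (cS c s j) ** matrix_inv (cR c s j) ** cS c s j) 0))"


section \<open>State equation, cost and values\<close>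

text \<open>\<open>x\<close> solves the state equation with \<open>x(0) = 0\<close>, in the space
  $L^2_{\mathbb F}(\Omega;C([0,T];\mathbb R^n))$ in which the linear equation is well-posed.\<close>

definition state_solution ::
  "'w measure \<Rightarrow> real \<Rightarrow> (real \<Rightarrow> 'w \<Rightarrow> real) \<Rightarrow> (real \<Rightarrow> 'w \<Rightarrow> real) \<Rightarrow> (real \<Rightarrow> 'w \<Rightarrow> 's) \<Rightarrow>
   ('n::finite, 'm::finite, 'k::finite, 's) coeffs \<Rightarrow>
   (real \<Rightarrow> 'w \<Rightarrow> real^'m) \<Rightarrow> (real \<Rightarrow> 'w \<Rightarrow> real^'k) \<Rightarrow> (real \<Rightarrow> 'w \<Rightarrow> real^'n) \<Rightarrow> bool" where
  "state_solution M T W Wb \<alpha> c u v x \<longleftrightarrow>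
     (let F = filt_F M W Wb \<alpha>;
          drift = (\<lambda>s \<omega>. cA c s (\<alpha> s \<omega>) *v x s \<omega> + cB1 c s (\<alpha> s \<omega>) *v u s \<omega> + cB2 c s (\<alpha> s \<omega>) *v v s \<omega>);
          \<sigma> = (\<lambda>s \<omega>. cC c s (\<alpha> s \<omega>) *v x s \<omega> + cD1 c s (\<alpha> s \<omega>) *v u s \<omega> + cD2 c s (\<alpha> s \<omega>) *v v s \<omega>);
          \<sigma>b = (\<lambda>s \<omega>. cCb c s (\<alpha> s \<omega>) *v x s \<omega> + cDb1 c s (\<alpha> s \<omega>) *v u s \<omega> + cDb2 c s (\<alpha> s \<omega>) *v v s \<omega>)
      in
        progressive T F x \<and>
        (AE \<omega> in M. continuous_on {0..T} (\<lambda>t. x t \<omega>)) \<and>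
        (\<integral>\<^sup>+ \<omega>. (SUP t\<in>{0..T}. ennreal ((norm (x t \<omega>))\<^sup>2)) \<partial>M) < \<infinity> \<and>
        (AE \<omega> in M. set_integrable lborel {0..T} (\<lambda>s. drift s \<omega>)) \<and>
        (\<exists>I Ib. ito_integral M T F W \<sigma> I \<and> ito_integral M T F Wb \<sigma>b Ib \<and>
           (AE \<omega> in M. \<forall>t\<in>{0..T}.
              x t \<omega> = (LINT s:{0..t}|lborel. drift s \<omega>) + I t \<omega> + Ib t \<omega>)))"

text \<open>Solutions are unique only up to indistinguishability, hence \<open>SOME\<close>; the cost does not
  depend on the choice.\<close>

definition state ::
  "'w measure \<Rightarrow> real \<Rightarrow> (real \<Rightarrow> 'w \<Rightarrow> real) \<Rightarrow> (real \<Rightarrow> 'w \<Rightarrow> real) \<Rightarrow> (real \<Rightarrow> 'w \<Rightarrow> 's) \<Rightarrow>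
   ('n::finite, 'm::finite, 'k::finite, 's) coeffs \<Rightarrow>
   (real \<Rightarrow> 'w \<Rightarrow> real^'m) \<Rightarrow> (real \<Rightarrow> 'w \<Rightarrow> real^'k) \<Rightarrow> real \<Rightarrow> 'w \<Rightarrow> real^'n" where
  "state M T W Wb \<alpha> c u v = (SOME x. state_solution M T W Wb \<alpha> c u v x)"

definition J0 ::
  "'w measure \<Rightarrow> real \<Rightarrow> (real \<Rightarrow> 'w \<Rightarrow> real) \<Rightarrow> (real \<Rightarrow> 'w \<Rightarrow> real) \<Rightarrow> (real \<Rightarrow> 'w \<Rightarrow> 's) \<Rightarrow>
   ('n::finite, 'm::finite, 'k::finite, 's) coeffs \<Rightarrow>
   (real \<Rightarrow> 'w \<Rightarrow> real^'m) \<Rightarrow> (real \<Rightarrow> 'w \<Rightarrow> real^'k) \<Rightarrow> real" where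
  "J0 M T W Wb \<alpha> c u v =
     (let x = state M T W Wb \<alpha> c u v in
      LINT \<omega>|M. (cG c (\<alpha> T \<omega>) *v x T \<omega>) \<bullet> x T \<omega> +
        (LINT s:{0..T}|lborel.
           (cQ c s (\<alpha> s \<omega>) *v x s \<omega>) \<bullet> x s \<omega> +
           (cR1 c s (\<alpha> s \<omega>) *v u s \<omega>) \<bullet> u s \<omega> +
           (cR2 c s (\<alpha> s \<omega>) *v v s \<omega>) \<bullet> v s \<omega> +
           2 * ((cS1 c s (\<alpha> s \<omega>) *v x s \<omega>) \<bullet> u s \<omega>) +
           2 * ((cS2 c s (\<alpha> s \<omega>) *v x s \<omega>) \<bullet> v s \<omega>)))"

definition J0_gamma ::
  "'w measure \<Rightarrow> real \<Rightarrow> (real \<Rightarrow> 'w \<Rightarrow> real) \<Rightarrow> (real \<Rightarrow> 'w \<Rightarrow> real) \<Rightarrow> (real \<Rightarrow> 'w \<Rightarrow> 's) \<Rightarrow>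
   ('n::finite, 'm::finite, 'k::finite, 's) coeffs \<Rightarrow> real \<Rightarrow>
   (real \<Rightarrow> 'w \<Rightarrow> real^'m) \<Rightarrow> (real \<Rightarrow> 'w \<Rightarrow> real^'k) \<Rightarrow> real" where
  "J0_gamma M T W Wb \<alpha> c \<gamma> u v = J0 M T W Wb \<alpha> c u v - \<gamma>\<^sup>2 * energy M T v"

definition upper_value ::
  "'w measure \<Rightarrow> real \<Rightarrow> (real \<Rightarrow> 'w \<Rightarrow> real) \<Rightarrow> (real \<Rightarrow> 'w \<Rightarrow> real) \<Rightarrow> (real \<Rightarrow> 'w \<Rightarrow> 's) \<Rightarrow>
   ('n::finite, 'm::finite, 'k::finite, 's) coeffs \<Rightarrow> real \<Rightarrow> ereal" where
  "upper_value M T W Wb \<alpha> c \<gamma> =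
     (INF u\<in>L2_process M T (filt_G M W \<alpha>). SUP v\<in>L2_process M T (filt_F M W Wb \<alpha>).
        ereal (J0_gamma M T W Wb \<alpha> c \<gamma> u v))"

text \<open>The infimum of an empty set of real thresholds is \<open>\<infinity>\<close>.\<close>

definition gamma_bar ::
  "'w measure \<Rightarrow> real \<Rightarrow> (real \<Rightarrow> 'w \<Rightarrow> real) \<Rightarrow> (real \<Rightarrow> 'w \<Rightarrow> real) \<Rightarrow> (real \<Rightarrow> 'w \<Rightarrow> 's) \<Rightarrow>
   ('n::finite, 'm::finite, 'k::finite, 's) coeffs \<Rightarrow> ereal" where
  "gamma_bar M T W Wb \<alpha> c =
     (INF \<gamma>\<in>{\<gamma>. \<gamma> > 0 \<and> (\<forall>\<gamma>'>\<gamma>. upper_value M T W Wb \<alpha> c \<gamma>' = 0)}. ereal \<gamma>)"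

text \<open>The condition $v\neq 0$ refers to $v$ as an element of $L^2$, i.e. to its norm.\<close>

definition gamma_star ::
  "'w measure \<Rightarrow> real \<Rightarrow> (real \<Rightarrow> 'w \<Rightarrow> real) \<Rightarrow> (real \<Rightarrow> 'w \<Rightarrow> real) \<Rightarrow> (real \<Rightarrow> 'w \<Rightarrow> 's) \<Rightarrow>
   ('n::finite, 'm::finite, 'k::finite, 's) coeffs \<Rightarrow> ereal" where
  "gamma_star M T W Wb \<alpha> c =
     (INF u\<in>L2_process M T (filt_G M W \<alpha>).
      SUP v\<in>{v \<in> L2_process M T (filt_F M W Wb \<alpha>). energy M T v \<noteq> 0}.
        ereal (sqrt (J0 M T W Wb \<alpha> c u v) / sqrt (energy M T v)))"

end

theory Submission
  imports Defs
begin

text \<open>The cost \<open>J\<close> is a nonnegative quadratic form in \<open>(u, v)\<close>: the state depends linearly on the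
  controls, by existence and uniqueness for the linear stochastic equation, and the running cost is
  nonnegative by completing the square. Only the parallelogram law, homogeneity and nonnegativity are
  used afterwards. If \<open>J(u, v) \<le> g\<^sup>2 |v|\<^sup>2\<close> for one \<open>u\<close> and all \<open>v \<noteq> 0\<close>, then
  \<open>J\<^sub>\<gamma>(u, \<cdot>)\<close> is bounded above for \<open>\<gamma> > g\<close>, and replacing \<open>u\<close> by \<open>\<epsilon> u\<close> shrinks the bound
  to zero, so the upper value vanishes. Conversely, if the upper value vanishes at \<open>\<gamma>\<close>, then
  \<open>J\<^sub>\<gamma>(u, \<plusminus>v) \<le> 1\<close> for some \<open>u\<close>; the parallelogram law gives \<open>J\<^sub>\<gamma>(0, v) \<le> 1\<close> for all \<open>v\<close>, and
  homogeneity \<open>J(0, v) \<le> \<gamma>\<^sup>2 |v|\<^sup>2\<close>.\<close>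

section \<open>Filtrations and Brownian motion\<close>

text \<open>Most of the work goes into making the form well defined. \<open>state\<close> is a
  choice among solutions, so existence is needed for it to solve the equation and uniqueness for it
  to be linear in the controls, and then only up to indistinguishability. Both rest on one estimate
  for the map that sends x to the right-hand side of the equation. The obstacle is that A is only
  L^1 in time and C, Cb only L^2, so there is no uniform Lipschitz constant. The estimate is
  therefore a Volterra inequality with an integrable kernel, and the map contracts in the norm sup_t
  exp(-c t) E|x(t)|^2, where c is found by cutting the kernel at a large height. Squares are kept
  throughout, so triangle inequalities cost factors 2 and 4; none of these constants has to be
  sharp. In the final comparison the G-adapted controls that occur are u, its multiples and 0.
  Nontrivial sums are formed of F-adapted disturbances only, so every competitor u stays in the
  smaller filtration.\<close>

locale filtered_space = prob_space M for M :: "'w measure" +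
  fixes F :: "real \<Rightarrow> 'w measure"
  assumes space_F [simp]: "\<And>t. space (F t) = space M"
    and F_subalgebra: "\<And>t. 0 \<le> t \<Longrightarrow> sets (F t) \<subseteq> sets M"
    and F_mono: "\<And>s t. 0 \<le> s \<Longrightarrow> s \<le> t \<Longrightarrow> sets (F s) \<subseteq> sets (F t)"
    and F_null: "\<And>t. null_sets M \<subseteq> sets (F t)"
begin

lemma F_measurable: "f \<in> measurable (F t) N \<Longrightarrow> 0 \<le> t \<Longrightarrow> f \<in> measurable M N"
  using F_subalgebra[of t] by (auto simp: measurable_def)

lemma F_measurable_mono: "f \<in> measurable (F s) N \<Longrightarrow> 0 \<le> s \<Longrightarrow> s \<le> t \<Longrightarrow> f \<in> measurable (F t) N"
  using F_mono[of s t] by (auto simp: measurable_def)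

text \<open>Given \<open>F a\<close>, the increment has mean 0 and variance b - a. Testing against
  integrable Z expresses this without conditional expectations, and relative to a filtration that
  may be larger than the one generated by W.\<close>

definition brownian :: "(real \<Rightarrow> 'w \<Rightarrow> real) \<Rightarrow> bool" where
  "brownian W \<longleftrightarrow> (\<forall>t\<ge>0. W t \<in> borel_measurable (F t)) \<and>
     (AE \<omega> in M. continuous_on {0..} (\<lambda>t. W t \<omega>)) \<and>
     (\<forall>a b Z. 0 \<le> a \<and> a < b \<and> Z \<in> borel_measurable (F a) \<and> integrable M Z \<longrightarrow>
        integrable M (\<lambda>\<omega>. Z \<omega> * (W b \<omega> - W a \<omega>)) \<and>
        (LINT \<omega>|M. Z \<omega> * (W b \<omega> - W a \<omega>)) = 0 \<and>
        integrable M (\<lambda>\<omega>. Z \<omega> * (W b \<omega> - W a \<omega>)\<^sup>2) \<and>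
        (LINT \<omega>|M. Z \<omega> * (W b \<omega> - W a \<omega>)\<^sup>2) = (b - a) * (LINT \<omega>|M. Z \<omega>))"

end

section \<open>Independence of Brownian increments from the augmented past\<close>

lemma process_events_subset:
  assumes "\<And>s. s \<in> I \<Longrightarrow> X s \<in> measurable M N"
  shows "process_events M N X I \<subseteq> sets M"
  using assms by (auto simp: process_events_def intro: measurable_sets)

lemma process_events_space: "process_events M N X I \<subseteq> Pow (space M)"
  by (auto simp: process_events_def)

lemma null_sets_space: "null_sets M \<subseteq> Pow (space M)"
  using sets.space_closed[of M] by blast

lemma process_events_mono: "I \<subseteq> J \<Longrightarrow> process_events M N X I \<subseteq> process_events M N X J"
  by (auto simp: process_events_def)

lemma process_events_measurable:
  assumes "s \<in> I" "\<And>\<omega>. \<omega> \<in> space M \<Longrightarrow> X s \<omega> \<in> space N"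
    and "process_events M N X I \<subseteq> sets A" "space A = space M"
  shows "X s \<in> measurable A N"
  using assms by (intro measurableI) (auto simp: process_events_def)

lemma (in prob_space) indep_set_commute: "indep_set A B \<Longrightarrow> indep_set B A"
proof (rule indep_setI)
  assume AB: "indep_set A B"
  show "B \<subseteq> events" "A \<subseteq> events" using AB by (auto simp: indep_sets2_eq)
  fix a b assume "a \<in> B" "b \<in> A"
  then show "prob (a \<inter> b) = prob a * prob b"
    using indep_setD[OF AB, of b a] by (simp only: Int_commute[of a b] mult.commute[of "prob a"])
qed

text \<open>Independence of increments is given along increasing grids, so the past times are merged
  with 0 and a into one grid that ends in b. Each W s - W 0 with s in S is then a sum of increments
  before a, and these form a block independent of the last increment.\<close>

lemma (in prob_space) indep_set_finite_past:
  assumes bm: "brownian_motion M W" and S: "finite S" "S \<subseteq> {0..a}" and ab: "0 \<le> a" "a < b"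
  shows "indep_set {(\<lambda>\<omega>. W b \<omega> - W a \<omega>) -` B \<inter> space M | B. B \<in> sets borel}
     (sigma_sets (space M) (process_events M borel (\<lambda>s \<omega>. W s \<omega> - W 0 \<omega>) S))"
proof -
  let ?D = "\<lambda>\<omega>. W b \<omega> - W a \<omega>"
  \<comment> \<open>Adding 0 and a makes the grid start at 0 and puts a at its end, since S lies in
    [0, a].\<close>
  define L where "L = sorted_list_of_set (insert 0 (insert a S))"
  have fin: "finite (insert 0 (insert a S))" using S by simp
  have setL: "set L = insert 0 (insert a S)" and sortL: "sorted L"
    unfolding L_def using fin by (simp_all del: sorted_list_of_set_insert_remove)
  have Lne: "L \<noteq> []" using setL by auto
  define n where "n = length L - 1"
  have lenL: "length L = Suc n" using Lne by (simp add: n_def)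
  \<comment> \<open>Index \<open>n\<close> is the last past time a and index \<open>Suc n\<close> is
    b, so the increment of interest has index \<open>n\<close>.\<close>
  define \<tau> where "\<tau> k = (if k \<le> n then L ! k else b)" for k
  have \<tau>0: "\<tau> 0 = 0"
  proof -
    obtain i where i: "i < length L" "L ! i = 0" using setL by (metis in_set_conv_nth insertI1)
    have "L ! 0 \<le> L ! i" using sorted_nth_mono[OF sortL, of 0 i] i by simp
    moreover have "L ! 0 \<in> set L" using lenL by simp
    hence "L ! 0 \<ge> 0" using setL S ab by auto
    ultimately show ?thesis using i by (simp add: \<tau>_def)
  qed
  have \<tau>n: "\<tau> n = a"
  proof -
    obtain i where i: "i < length L" "L ! i = a" using setL by (metis in_set_conv_nth insertCI)
    have "L ! i \<le> L ! n" using sorted_nth_mono[OF sortL, of i n] i lenL by simp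
    moreover have "L ! n \<in> set L" using lenL by simp
    hence "L ! n \<le> a" using setL S ab by auto
    ultimately show ?thesis using i by (simp add: \<tau>_def)
  qed
  have \<tau>S: "\<tau> (Suc n) = b" by (simp add: \<tau>_def)
  have mono: "\<forall>k<Suc n. \<tau> k \<le> \<tau> (Suc k)"
  proof (intro allI impI)
    fix k assume "k < Suc n"
    show "\<tau> k \<le> \<tau> (Suc k)"
    proof (cases "k = n")
      case True then show ?thesis using \<tau>n \<tau>S ab by simp
    next
      case False then show ?thesis using \<open>k < Suc n\<close> sortL lenL by (auto simp: \<tau>_def sorted_nth_mono)
    qed
  qed
  let ?X = "\<lambda>k \<omega>. W (\<tau> (Suc k)) \<omega> - W (\<tau> k) \<omega>"
  have iv: "indep_vars (\<lambda>_. borel) ?X {..<Suc n}"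
    using bm mono \<tau>0 unfolding brownian_motion_def by auto
  \<comment> \<open>The increments are regrouped into the last one and the block of all earlier
    ones.\<close>
  have iv2: "indep_var (PiM {n} (\<lambda>_. borel)) (\<lambda>\<omega>. restrict (\<lambda>i. ?X i \<omega>) {n})
          (PiM {..<n} (\<lambda>_. borel)) (\<lambda>\<omega>. restrict (\<lambda>i. ?X i \<omega>) {..<n})"
    by (rule indep_var_restrict[OF iv]) auto
  have ind: "indep_set (sigma_sets (space M) {(\<lambda>\<omega>. restrict (\<lambda>i. ?X i \<omega>) {n}) -` A \<inter> space M | A. A \<in> sets (PiM {n} (\<lambda>_. borel))})
     (sigma_sets (space M) {(\<lambda>\<omega>. restrict (\<lambda>i. ?X i \<omega>) {..<n}) -` A \<inter> space M | A. A \<in> sets (PiM {..<n} (\<lambda>_. borel))})"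
    using iv2 unfolding indep_var_eq by blast
  have rvR: "random_variable (PiM {..<n} (\<lambda>_. borel)) (\<lambda>\<omega>. restrict (\<lambda>i. ?X i \<omega>) {..<n})"
    using iv2 unfolding indep_var_eq by blast
  have D: "{?D -` B \<inter> space M | B. B \<in> sets borel} \<subseteq>
      {(\<lambda>\<omega>. restrict (\<lambda>i. ?X i \<omega>) {n}) -` A \<inter> space M | A. A \<in> sets (PiM {n} (\<lambda>_. borel))}"
  proof safe
    fix B :: "real set" assume B: "B \<in> sets borel"
    have "(\<lambda>f::nat \<Rightarrow> real. f n) -` B \<inter> space (PiM {n} (\<lambda>_. borel)) \<in> sets (PiM {n} (\<lambda>_. borel))"
      using measurable_component_singleton[of n "{n}" "\<lambda>_. borel :: real measure"] B by (auto intro: measurable_sets)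
    moreover have "?D -` B \<inter> space M = (\<lambda>\<omega>. restrict (\<lambda>i. ?X i \<omega>) {n}) -`
       ((\<lambda>f::nat \<Rightarrow> real. f n) -` B \<inter> space (PiM {n} (\<lambda>_. borel))) \<inter> space M"
      by (auto simp: space_PiM \<tau>n \<tau>S)
    ultimately show "\<exists>A. ?D -` B \<inter> space M = (\<lambda>\<omega>. restrict (\<lambda>i. ?X i \<omega>) {n}) -` A \<inter> space M \<and>
        A \<in> sets (PiM {n} (\<lambda>_. borel))" by blast
  qed
  have "process_events M borel (\<lambda>s \<omega>. W s \<omega> - W 0 \<omega>) S \<subseteq>
     {(\<lambda>\<omega>. restrict (\<lambda>i. ?X i \<omega>) {..<n}) -` A \<inter> space M | A. A \<in> sets (PiM {..<n} (\<lambda>_. borel))}"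
  proof
    fix E assume "E \<in> process_events M borel (\<lambda>s \<omega>. W s \<omega> - W 0 \<omega>) S"
    then obtain s B where sB: "s \<in> S" "B \<in> sets borel" "E = (\<lambda>\<omega>. W s \<omega> - W 0 \<omega>) -` B \<inter> space M"
      by (auto simp: process_events_def)
    obtain k where k: "k < length L" "L ! k = s" using setL sB by (metis in_set_conv_nth insertCI)
    have \<tau>k: "\<tau> k = s" "k \<le> n" using k lenL by (auto simp: \<tau>_def)
    \<comment> \<open>W s - W 0 telescopes into the first k increments, a measurable function of the
      earlier block.\<close>
    let ?g = "\<lambda>f::nat \<Rightarrow> real. \<Sum>j<k. f j"
    have tel: "W s \<omega> - W 0 \<omega> = ?g (restrict (\<lambda>i. ?X i \<omega>) {..<n})" for \<omega>
    proof -
      have "?g (restrict (\<lambda>i. ?X i \<omega>) {..<n}) = (\<Sum>j<k. ?X j \<omega>)"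
        using \<tau>k by (intro sum.cong) auto
      also have "\<dots> = W (\<tau> k) \<omega> - W (\<tau> 0) \<omega>" by (rule sum_lessThan_telescope)
      finally show ?thesis using \<tau>k \<tau>0 by simp
    qed
    have gm: "?g \<in> borel_measurable (PiM {..<n} (\<lambda>_. borel))"
      using \<tau>k by (intro borel_measurable_sum measurable_component_singleton) auto
    have "E = (\<lambda>\<omega>. restrict (\<lambda>i. ?X i \<omega>) {..<n}) -` (?g -` B \<inter> space (PiM {..<n} (\<lambda>_. borel))) \<inter> space M"
      unfolding sB tel using measurable_space[OF rvR] by (auto simp: vimage_def)
    moreover have "?g -` B \<inter> space (PiM {..<n} (\<lambda>_. borel)) \<in> sets (PiM {..<n} (\<lambda>_. borel))"
      using gm sB(2) by (rule measurable_sets)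
    ultimately show "E \<in> {(\<lambda>\<omega>. restrict (\<lambda>i. ?X i \<omega>) {..<n}) -` A \<inter> space M | A. A \<in> sets (PiM {..<n} (\<lambda>_. borel))}"
      by blast
  qed
  then have sub: "sigma_sets (space M) (process_events M borel (\<lambda>s \<omega>. W s \<omega> - W 0 \<omega>) S) \<subseteq>
    sigma_sets (space M) {(\<lambda>\<omega>. restrict (\<lambda>i. ?X i \<omega>) {..<n}) -` A \<inter> space M | A. A \<in> sets (PiM {..<n} (\<lambda>_. borel))}"
    by (rule sigma_sets_mono')
  have "{?D -` B \<inter> space M | B. B \<in> sets borel} \<subseteq>
     sigma_sets (space M) {(\<lambda>\<omega>. restrict (\<lambda>i. ?X i \<omega>) {n}) -` A \<inter> space M | A. A \<in> sets (PiM {n} (\<lambda>_. borel))}"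
    using D sigma_sets_superset_generator by (rule subset_trans)
  then show ?thesis
    using ind sub by (meson indep_sets2_eq subset_eq)
qed

lemma sigma_sets_IntI:
  assumes "A \<subseteq> Pow \<Omega>" "x \<in> sigma_sets \<Omega> A" "y \<in> sigma_sets \<Omega> A"
  shows "x \<inter> y \<in> sigma_sets \<Omega> A"
proof -
  interpret sigma_algebra \<Omega> "sigma_sets \<Omega> A" by (rule sigma_algebra_sigma_sets[OF assms(1)])
  show ?thesis using assms(2,3) by (rule Int)
qed

lemma sigma_sets_DiffI:
  assumes "A \<subseteq> Pow \<Omega>" "x \<in> sigma_sets \<Omega> A" "y \<in> sigma_sets \<Omega> A"
  shows "x - y \<in> sigma_sets \<Omega> A"
proof -
  interpret sigma_algebra \<Omega> "sigma_sets \<Omega> A" by (rule sigma_algebra_sigma_sets[OF assms(1)])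
  show ?thesis using assms(2,3) by (rule Diff)
qed

lemma sigma_sets_subsetI:
  assumes "A \<subseteq> Pow \<Omega>" "B \<subseteq> sigma_sets \<Omega> A"
  shows "sigma_sets \<Omega> B \<subseteq> sigma_sets \<Omega> A"
  using sigma_algebra.sigma_sets_subset[OF sigma_algebra_sigma_sets[OF assms(1)] assms(2)] .

text \<open>A pi-lambda argument. Events s \<inter> v \<inter> c, with s from finitely many past
  values of W - W 0 and v, c from the full paths of Wb and \<alpha>, form together with the null
  sets a pi-system whose sigma-algebra contains \<open>filt_F\<close> at time a. On it the product
  formula follows from the finite case and the two independence assumptions.\<close>

lemma (in prob_space) indep_set_increment_past:
  assumes bm: "brownian_motion M W" and ind: "independent_noise M W Wb \<alpha>"
    and Wb: "\<And>t. t \<ge> 0 \<Longrightarrow> Wb t \<in> borel_measurable M"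
    and al: "\<And>t. t \<ge> 0 \<Longrightarrow> \<alpha> t \<in> measurable M (count_space UNIV)"
    and ab: "0 \<le> a" "a < b"
  shows "indep_set (sigma_sets (space M) {(\<lambda>\<omega>. W b \<omega> - W a \<omega>) -` B \<inter> space M | B. B \<in> sets borel})
     (sets (filt_F M W Wb \<alpha> a))"
proof -
  let ?Wd = "\<lambda>s \<omega>. W s \<omega> - W 0 \<omega>"
  have Wm: "W t \<in> borel_measurable M" if "t \<ge> 0" for t using bm that by (auto simp: brownian_motion_def)
  let ?\<DD> = "{(\<lambda>\<omega>. W b \<omega> - W a \<omega>) -` B \<inter> space M | B. B \<in> sets borel}"
  define sig where "sig S = sigma_sets (space M) (process_events M borel ?Wd S)" for S
  let ?\<W> = "sigma_sets (space M) (process_events M borel W {0..})"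
  let ?\<V> = "sigma_sets (space M) (process_events M borel Wb {0..})"
  let ?\<WW> = "sigma_sets (space M) (process_events M borel W {0..} \<union> process_events M borel Wb {0..})"
  let ?\<A> = "sigma_sets (space M) (process_events M (count_space UNIV) \<alpha> {0..})"
  have subs: "process_events M borel W {0..} \<subseteq> Pow (space M)" "process_events M borel Wb {0..} \<subseteq> Pow (space M)"
    "process_events M (count_space UNIV) \<alpha> {0..} \<subseteq> Pow (space M)"
    by (auto simp: process_events_def)
  have iWV: "indep_set ?\<W> ?\<V>" and iA: "indep_set ?\<WW> ?\<A>"
    using ind unfolding independent_noise_def by blast+
  \<comment> \<open>A directed union of sigma-algebras: two finite sets of times have a finite
    union, which gives stability under intersection. It need not be a sigma-algebra itself.\<close>
  define \<S> where "\<S> = (\<Union>S\<in>{S. finite S \<and> S \<subseteq> {0..a}}. sig S)"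
  have Wgen: "W s \<in> borel_measurable (sigma (space M) (process_events M borel W {0..}))" if "s \<ge> 0" for s
    by (rule process_events_measurable[of s "{0..}" M W borel]) (use that in \<open>auto simp: process_events_space\<close>)
  have Wd\<W>: "?Wd s \<in> borel_measurable (sigma (space M) (process_events M borel W {0..}))" if "s \<ge> 0" for s
    using that by (intro borel_measurable_diff Wgen) auto
  have inc\<W>: "(\<lambda>\<omega>. W b \<omega> - W a \<omega>) \<in> borel_measurable (sigma (space M) (process_events M borel W {0..}))"
    using ab by (intro borel_measurable_diff Wgen) auto
  have D\<W>: "?\<DD> \<subseteq> ?\<W>"
    using measurable_sets[OF inc\<W>] subs(1) by (auto simp: sets_measure_of space_measure_of)
  have pe\<W>: "process_events M borel ?Wd S \<subseteq> ?\<W>" if "S \<subseteq> {0..}" for S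
  proof
    fix E assume "E \<in> process_events M borel ?Wd S"
    then obtain s B where sB: "s \<in> S" "B \<in> sets borel" "E = ?Wd s -` B \<inter> space M"
      unfolding process_events_def by blast
    have "s \<ge> 0" using sB(1) that by (meson atLeast_iff subsetD)
    from measurable_sets[OF Wd\<W>[OF this] sB(2)] show "E \<in> ?\<W>"
      unfolding sB(3) by (simp only: sets_measure_of[OF subs(1)] space_measure_of[OF subs(1)])
  qed
  have sig\<W>: "sig S \<subseteq> ?\<W>" if "S \<subseteq> {0..}" for S
    unfolding sig_def by (rule sigma_sets_subsetI[OF subs(1) pe\<W>[OF that]])
  have \<S>\<W>: "\<S> \<subseteq> ?\<W>"
  proof
    fix E assume "E \<in> \<S>"
    then obtain S where S: "S \<subseteq> {0..a}" "E \<in> sig S" unfolding \<S>_def by blast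
    have "S \<subseteq> {0..}" using S(1) by auto
    from subsetD[OF sig\<W>[OF this] S(2)] show "E \<in> ?\<W>" .
  qed
  have iDS: "prob (d \<inter> s) = prob d * prob s" if d: "d \<in> ?\<DD>" and s: "s \<in> \<S>" for d s
  proof -
    obtain S where S: "finite S" "S \<subseteq> {0..a}" "s \<in> sig S" using s unfolding \<S>_def by blast
    show ?thesis by (rule indep_setD[OF indep_set_finite_past[OF bm S(1,2) ab] d S(3)[unfolded sig_def]])
  qed
  have Sint: "s \<inter> s' \<in> \<S>" if ss: "s \<in> \<S>" "s' \<in> \<S>" for s s'
  proof -
    obtain S S' where S: "finite S" "S \<subseteq> {0..a}" "s \<in> sig S" "finite S'" "S' \<subseteq> {0..a}" "s' \<in> sig S'"
      using ss unfolding \<S>_def by blast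
    have "sig S \<subseteq> sig (S \<union> S')" "sig S' \<subseteq> sig (S \<union> S')"
      unfolding sig_def by (rule sigma_sets_mono'[OF process_events_mono]; rule Un_upper1 Un_upper2)+
    then have "s \<in> sig (S \<union> S')" "s' \<in> sig (S \<union> S')" using S(3,6) by (auto dest: subsetD)
    then have "s \<inter> s' \<in> sig (S \<union> S')"
      unfolding sig_def by (rule sigma_sets_IntI[OF process_events_space])
    moreover have "finite (S \<union> S')" "S \<union> S' \<subseteq> {0..a}" using S by auto
    ultimately show ?thesis unfolding \<S>_def by blast
  qed
  \<comment> \<open>The null sets belong to the generator because the filtration is augmented; a
    null set is independent of every event.\<close>
  define P where "P = {s \<inter> v \<inter> c | s v c. s \<in> \<S> \<and> v \<in> ?\<V> \<and> c \<in> ?\<A>} \<union> null_sets M"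
  have \<W>M: "?\<W> \<subseteq> sets M" and \<V>M: "?\<V> \<subseteq> sets M" and \<A>M: "?\<A> \<subseteq> sets M"
    using iWV iA unfolding indep_sets2_eq by blast+
  have WWW: "?\<W> \<subseteq> ?\<WW>" "?\<V> \<subseteq> ?\<WW>" by (auto intro!: sigma_sets_mono')
  \<comment> \<open>Joint independence of three sigma-algebras from two statements on pairs: first
    the pair of Brownian motions against \<alpha>, then W against Wb.\<close>
  have prod: "prob (w \<inter> v \<inter> c) = prob w * prob v * prob c" if "w \<in> ?\<W>" "v \<in> ?\<V>" "c \<in> ?\<A>" for w v c
  proof -
    have "w \<in> ?\<WW>" "v \<in> ?\<WW>" using that WWW by auto
    then have "w \<inter> v \<in> ?\<WW>" using subs by (intro sigma_sets_IntI) auto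
    from indep_setD[OF iA this that(3)] indep_setD[OF iWV that(1,2)] show ?thesis by simp
  qed
  have "indep_set ?\<DD> P"
  proof (rule indep_setI)
    show "?\<DD> \<subseteq> events" using D\<W> \<W>M by blast
    show "P \<subseteq> events"
    proof
      fix p assume "p \<in> P"
      then consider "p \<in> null_sets M" | s v c where "p = s \<inter> v \<inter> c" "s \<in> \<S>" "v \<in> ?\<V>" "c \<in> ?\<A>"
        unfolding P_def by blast
      then show "p \<in> events"
      proof cases
        case 2
        then have "s \<in> events" "v \<in> events" "c \<in> events" using \<S>\<W> \<W>M \<V>M \<A>M by blast+
        then show ?thesis using 2 by simp
      qed auto
    qed
    fix d p assume d: "d \<in> ?\<DD>" and "p \<in> P"
    have dM: "d \<in> sets M" using d D\<W> \<W>M by blast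
    consider "p \<in> null_sets M" | s v c where "p = s \<inter> v \<inter> c" "s \<in> \<S>" "v \<in> ?\<V>" "c \<in> ?\<A>"
      using \<open>p \<in> P\<close> unfolding P_def by blast
    then show "prob (d \<inter> p) = prob d * prob p"
    proof cases
      case 1
      then have "d \<inter> p \<in> null_sets M" using dM by (auto intro: null_set_Int1)
      then show ?thesis using 1 by (simp add: null_sets_def measure_def)
    next
      case 2
      have s: "s \<in> ?\<W>" and dW: "d \<in> ?\<W>" using 2 \<S>\<W> d D\<W> by blast+
      have "prob (d \<inter> p) = prob ((d \<inter> s) \<inter> v \<inter> c)" by (simp add: 2 Int_assoc)
      also have "\<dots> = prob (d \<inter> s) * prob v * prob c"
        using 2 s dW sigma_sets_IntI[OF subs(1) dW s] by (intro prod) auto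
      also have "\<dots> = prob d * (prob s * prob v * prob c)" using iDS[OF d 2(2)] by simp
      also have "\<dots> = prob d * prob p" using prod[OF s 2(3,4)] 2 by simp
      finally show ?thesis .
    qed
  qed
  moreover have "Int_stable ?\<DD>"
  proof (rule Int_stableI)
    fix x y assume "x \<in> ?\<DD>" "y \<in> ?\<DD>"
    then obtain B C where "B \<in> sets borel" "C \<in> sets borel" "x = (\<lambda>\<omega>. W b \<omega> - W a \<omega>) -` B \<inter> space M"
      "y = (\<lambda>\<omega>. W b \<omega> - W a \<omega>) -` C \<inter> space M" by auto
    then show "x \<inter> y \<in> ?\<DD>" by (intro CollectI exI[of _ "B \<inter> C"]) auto
  qed
  moreover have "Int_stable P"
  proof (rule Int_stableI)
    fix x y assume xy: "x \<in> P" "y \<in> P"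
    have PM: "P \<subseteq> sets M" using \<open>indep_set ?\<DD> P\<close> by (simp add: indep_sets2_eq)
    show "x \<inter> y \<in> P"
    proof (cases "x \<in> null_sets M \<or> y \<in> null_sets M")
      case True
      then have "x \<inter> y \<in> null_sets M" using xy PM by (auto intro: null_set_Int1 null_set_Int2)
      then show ?thesis by (simp add: P_def)
    next
      case False
      then obtain s v c s' v' c' where e: "x = s \<inter> v \<inter> c" "s \<in> \<S>" "v \<in> ?\<V>" "c \<in> ?\<A>"
        "y = s' \<inter> v' \<inter> c'" "s' \<in> \<S>" "v' \<in> ?\<V>" "c' \<in> ?\<A>" using xy unfolding P_def by blast
      have "x \<inter> y = (s \<inter> s') \<inter> (v \<inter> v') \<inter> (c \<inter> c')" using e by auto
      then show ?thesis unfolding P_def using Sint[OF e(2,6)] sigma_sets_IntI[OF subs(2) e(3,7)] sigma_sets_IntI[OF subs(3) e(4,8)] by blast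
    qed
  qed
  ultimately have ind': "indep_set (sigma_sets (space M) ?\<DD>) (sigma_sets (space M) P)"
    by (intro indep_set_sigma_sets)
  have PM: "P \<subseteq> sets M" using \<open>indep_set ?\<DD> P\<close> by (simp add: indep_sets2_eq)
  have Psp: "P \<subseteq> Pow (space M)" using PM sets.space_closed[of M] by blast
  have spS: "space M \<in> \<S>" unfolding \<S>_def sig_def using sigma_sets_top[of "space M"] by blast
  have sub: "process_events M borel W {0..a} \<union> process_events M borel Wb {0..a} \<union>
      process_events M (count_space UNIV) \<alpha> {0..a} \<union> null_sets M \<subseteq> sigma_sets (space M) P"
  proof (intro Un_least)
    show "null_sets M \<subseteq> sigma_sets (space M) P" by (auto simp: P_def)
    show "process_events M borel Wb {0..a} \<subseteq> sigma_sets (space M) P"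
    proof
      fix E assume "E \<in> process_events M borel Wb {0..a}"
      then have "E \<in> process_events M borel Wb {0..}" by (auto simp: process_events_def)
      then have "E \<in> ?\<V>" "E \<subseteq> space M" using subs by auto
      then have "E = space M \<inter> E \<inter> space M" by auto
      then have "E \<in> P" unfolding P_def using spS \<open>E \<in> ?\<V>\<close> sigma_sets_top[of "space M" "process_events M (count_space UNIV) \<alpha> {0..}"] by blast
      then show "E \<in> sigma_sets (space M) P" by auto
    qed
    show "process_events M (count_space UNIV) \<alpha> {0..a} \<subseteq> sigma_sets (space M) P"
    proof
      fix E assume "E \<in> process_events M (count_space UNIV) \<alpha> {0..a}"
      then have "E \<in> process_events M (count_space UNIV) \<alpha> {0..}" by (auto simp: process_events_def)
      then have "E \<in> ?\<A>" "E \<subseteq> space M" using subs by auto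
      then have "E = space M \<inter> space M \<inter> E" by auto
      then have "E \<in> P" unfolding P_def using spS \<open>E \<in> ?\<A>\<close> sigma_sets_top[of "space M" "process_events M borel Wb {0..}"] by blast
      then show "E \<in> sigma_sets (space M) P" by auto
    qed
    show "process_events M borel W {0..a} \<subseteq> sigma_sets (space M) P"
    proof
      fix E assume "E \<in> process_events M borel W {0..a}"
      then obtain s B where sB: "s \<in> {0..a}" "B \<in> sets borel" "E = W s -` B \<inter> space M"
        unfolding process_events_def by blast
      \<comment> \<open>The pi-system is built from W s - W 0, the filtration from W s. The two
        differ only on the null set where W 0 is nonzero.\<close>
      define N where "N = {\<omega>\<in>space M. W 0 \<omega> \<noteq> 0}"
      have NM: "N \<in> sets M" unfolding N_def using Wm[of 0] by measurable
      have "AE \<omega> in M. W 0 \<omega> = 0" using bm by (simp add: brownian_motion_def)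
      then have N: "N \<in> null_sets M" using NM unfolding N_def by (simp add: AE_iff_null)
      have EM: "E \<in> sets M" using sB Wm[of s] by auto
      have EN: "E \<inter> N \<in> null_sets M" using N EM by (auto intro: null_set_Int1)
      let ?E' = "?Wd s -` B \<inter> space M"
      have "?E' \<in> sig {s}" unfolding sig_def using sB by (intro sigma_sets.Basic) (auto simp: process_events_def)
      moreover have "finite {s}" "{s} \<subseteq> {0..a}" using sB(1) by simp_all
      ultimately have E\<S>: "?E' \<in> \<S>" unfolding \<S>_def by blast
      have "?E' = ?E' \<inter> space M \<inter> space M" by auto
      then have "?E' \<in> P" unfolding P_def
        using E\<S> sigma_sets_top[of "space M" "process_events M borel Wb {0..}"]
          sigma_sets_top[of "space M" "process_events M (count_space UNIV) \<alpha> {0..}"] by blast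
      then have "?E' \<in> sigma_sets (space M) P" by (rule sigma_sets.Basic)
      moreover have "N \<in> sigma_sets (space M) P" "E \<inter> N \<in> sigma_sets (space M) P"
        using N EN by (auto simp: P_def)
      ultimately have "(?E' - N) \<union> (E \<inter> N) \<in> sigma_sets (space M) P"
        by (intro sigma_sets_Un sigma_sets_DiffI[OF Psp])
      moreover have "(?E' - N) \<union> (E \<inter> N) = E" unfolding sB N_def by auto
      ultimately show "E \<in> sigma_sets (space M) P" by (simp only:)
    qed
  qed
  have "sets (filt_F M W Wb \<alpha> a) \<subseteq> sigma_sets (space M) P"
    unfolding filt_F_def using sigma_sets_subsetI[OF Psp sub]
    by (subst sets_measure_of) (auto simp: process_events_space null_sets_space)
  then show ?thesis using ind' unfolding indep_sets2_eq by blast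
qed

lemma (in prob_space) filtered_space_filt_F:
  assumes W: "\<And>t. t \<ge> 0 \<Longrightarrow> W t \<in> borel_measurable M"
    and Wb: "\<And>t. t \<ge> 0 \<Longrightarrow> Wb t \<in> borel_measurable M"
    and al: "\<And>t. t \<ge> 0 \<Longrightarrow> \<alpha> t \<in> measurable M (count_space UNIV)"
  shows "filtered_space M (filt_F M W Wb \<alpha>)"
proof
  let ?E = "\<lambda>t. process_events M borel W {0..t} \<union> process_events M borel Wb {0..t} \<union>
      process_events M (count_space UNIV) \<alpha> {0..t} \<union> null_sets M"
  have EM: "?E t \<subseteq> sets M" for t
    using W Wb al by (intro Un_least process_events_subset) auto
  have E: "?E t \<subseteq> Pow (space M)" for t using EM[of t] sets.space_closed[of M] by blast
  show "space (filt_F M W Wb \<alpha> t) = space M" for t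
    unfolding filt_F_def using E by (simp add: space_measure_of)
  have s: "sets (filt_F M W Wb \<alpha> t) = sigma_sets (space M) (?E t)" for t
    unfolding filt_F_def using E by (simp add: sets_measure_of)
  show "sets (filt_F M W Wb \<alpha> t) \<subseteq> sets M" for t
    unfolding s using EM[of t] by (rule sets.sigma_sets_subset)
  show "sets (filt_F M W Wb \<alpha> r) \<subseteq> sets (filt_F M W Wb \<alpha> t)" if "r \<le> t" for r t
    unfolding s using that by (intro sigma_sets_mono' Un_mono process_events_mono) auto
  show "null_sets M \<subseteq> sets (filt_F M W Wb \<alpha> t)" for t
    unfolding s by auto
qed

text \<open>An \<open>F a\<close>-measurable Z is independent of the increment and of its square, so
  expectations factor, and the moments of the normal law supply 0 and b - a.\<close>

lemma (in prob_space) brownian_filt_F: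
  assumes bm: "brownian_motion M W" and ind: "independent_noise M W Wb \<alpha>"
    and Wb: "\<And>t. t \<ge> 0 \<Longrightarrow> Wb t \<in> borel_measurable M"
    and al: "\<And>t. t \<ge> 0 \<Longrightarrow> \<alpha> t \<in> measurable M (count_space UNIV)"
  shows "filtered_space.brownian M (filt_F M W Wb \<alpha>) W"
proof -
  have Wm: "W t \<in> borel_measurable M" if "t \<ge> 0" for t using bm that by (auto simp: brownian_motion_def)
  interpret F: filtered_space M "filt_F M W Wb \<alpha>" by (rule filtered_space_filt_F[OF Wm Wb al])
  show ?thesis unfolding F.brownian_def
  proof (intro conjI allI impI)
    show "W t \<in> borel_measurable (filt_F M W Wb \<alpha> t)" if "t \<ge> 0" for t
    proof (rule process_events_measurable[of t "{0..t}" M W borel])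
      show "process_events M borel W {0..t} \<subseteq> sets (filt_F M W Wb \<alpha> t)"
        unfolding filt_F_def
        by (subst sets_measure_of) (auto simp: process_events_space null_sets_space)
    qed (use that in auto)
    show "AE \<omega> in M. continuous_on {0..} (\<lambda>t. W t \<omega>)" using bm by (simp add: brownian_motion_def)
    fix a b :: real and Z :: "'a \<Rightarrow> real"
    assume *: "0 \<le> a \<and> a < b \<and> Z \<in> borel_measurable (filt_F M W Wb \<alpha> a) \<and> integrable M Z"
    let ?D = "\<lambda>\<omega>. W b \<omega> - W a \<omega>"
    have Dm: "?D \<in> borel_measurable M" using * Wm by auto
    have dist: "distributed M lborel ?D (\<lambda>x. ennreal (normal_density 0 (sqrt (b - a)) x))"
      using bm * by (auto simp: brownian_motion_def)
    have sp: "sqrt (b - a) > 0" using * by simp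
    have i1: "integrable M ?D"
      using distributed_integrable[OF dist, of "\<lambda>x. x"] integrable_normal_moment_nz_1[OF sp, of 0]
      by (simp add: mult.commute)
    have e1: "expectation ?D = 0" using normal_distributed_expectation[OF sp dist] .
    have i2: "integrable M (\<lambda>\<omega>. (?D \<omega>)\<^sup>2)"
      using distributed_integrable[OF dist, of "\<lambda>x. x\<^sup>2"] integrable_normal_moment[OF sp, of 0 2] by simp
    have e2: "expectation (\<lambda>\<omega>. (?D \<omega>)\<^sup>2) = b - a"
      using normal_distributed_variance[OF sp dist] e1 * by simp
    have iv: "indep_var borel Z borel ?D"
    proof -
      have "indep_set (sigma_sets (space M) {?D -` B \<inter> space M | B. B \<in> sets borel}) (sets (filt_F M W Wb \<alpha> a))"
        using * by (intro indep_set_increment_past[OF bm ind Wb al]) auto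
      moreover have "sigma_sets (space M) {Z -` B \<inter> space M | B. B \<in> sets borel} \<subseteq> sets (filt_F M W Wb \<alpha> a)"
      proof -
        have "{Z -` B \<inter> space M | B. B \<in> sets borel} \<subseteq> sets (filt_F M W Wb \<alpha> a)"
          using * measurable_sets[of Z "filt_F M W Wb \<alpha> a" borel] by auto
        from sets.sigma_sets_subset[OF this] show ?thesis by simp
      qed
      moreover have "Z \<in> borel_measurable M" using * by auto
      ultimately have "indep_set (sigma_sets (space M) {?D -` B \<inter> space M | B. B \<in> sets borel})
          (sigma_sets (space M) {Z -` B \<inter> space M | B. B \<in> sets borel})" "Z \<in> borel_measurable M"
        unfolding indep_sets2_eq by blast+
      then show ?thesis unfolding indep_var_eq using Dm indep_set_commute by blast
    qed
    have iv2: "indep_var borel Z borel (\<lambda>\<omega>. (?D \<omega>)\<^sup>2)"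
      using indep_var_compose[OF iv, of "\<lambda>x. x" borel "\<lambda>x. x\<^sup>2" borel] by (simp add: comp_def)
    show "integrable M (\<lambda>\<omega>. Z \<omega> * ?D \<omega>)" using indep_var_integrable[OF iv] * i1 by auto
    show "expectation (\<lambda>\<omega>. Z \<omega> * ?D \<omega>) = 0" using indep_var_lebesgue_integral[OF iv] * i1 e1 by auto
    show "integrable M (\<lambda>\<omega>. Z \<omega> * (?D \<omega>)\<^sup>2)" using indep_var_integrable[OF iv2] * i2 by auto
    show "expectation (\<lambda>\<omega>. Z \<omega> * (?D \<omega>)\<^sup>2) = (b - a) * expectation Z"
      using indep_var_lebesgue_integral[OF iv2] * i2 e2 by auto
  qed
qed

text \<open>Lets what is proved for W be read off for Wb, since the filtration is symmetric in the
  two.\<close>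

lemma (in prob_space) independent_noise_swap:
  "independent_noise M W Wb \<alpha> \<Longrightarrow> independent_noise M Wb W \<alpha>"
  by (simp add: independent_noise_def Un_commute indep_set_commute)

lemma filt_F_swap: "filt_F M W Wb \<alpha> = filt_F M Wb W \<alpha>"
  unfolding filt_F_def by (simp add: Un_commute Un_left_commute)

section \<open>Elementary stochastic integrals\<close>

text \<open>Mean squares are taken in [0, \<infinity>], so estimates ask only for measurability and
  finiteness can be settled afterwards.\<close>

abbreviation nn_sq :: "'a measure \<Rightarrow> ('a \<Rightarrow> 'b::real_normed_vector) \<Rightarrow> ennreal" where
  "nn_sq M f \<equiv> \<integral>\<^sup>+ x. ennreal ((norm (f x))\<^sup>2) \<partial>M"

lemma norm_add_sq_le: "(norm (x + y))\<^sup>2 \<le> 2 * (norm x)\<^sup>2 + 2 * (norm (y::'a::real_normed_vector))\<^sup>2"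
proof -
  have "(norm (x + y))\<^sup>2 \<le> (norm x + norm y)\<^sup>2" by (intro power_mono norm_triangle_ineq) auto
  also have "\<dots> \<le> 2 * (norm x)\<^sup>2 + 2 * (norm y)\<^sup>2"
    using sum_squares_bound[of "norm x" "norm y"] by (simp add: power2_sum)
  finally show ?thesis .
qed

text \<open>The factors 2 stand in for Minkowski's inequality, so that squares never have to be
  turned into norms.\<close>

lemma nn_sq_add_le:
  assumes [measurable]: "f \<in> borel_measurable M" "g \<in> borel_measurable M"
  shows "nn_sq M (\<lambda>x. f x + g x) \<le> 2 * nn_sq M f + 2 * nn_sq M (g::_ \<Rightarrow> 'b::euclidean_space)"
proof -
  have "nn_sq M (\<lambda>x. f x + g x) \<le> (\<integral>\<^sup>+ x. 2 * ennreal ((norm (f x))\<^sup>2) + 2 * ennreal ((norm (g x))\<^sup>2) \<partial>M)"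
  proof (rule nn_integral_mono)
    fix x
    have "ennreal ((norm (f x + g x))\<^sup>2) \<le> ennreal (2 * (norm (f x))\<^sup>2 + 2 * (norm (g x))\<^sup>2)"
      by (rule ennreal_leI[OF norm_add_sq_le])
    then show "ennreal ((norm (f x + g x))\<^sup>2) \<le> 2 * ennreal ((norm (f x))\<^sup>2) + 2 * ennreal ((norm (g x))\<^sup>2)"
      by (simp add: ennreal_plus ennreal_mult)
  qed
  then show ?thesis by (simp add: nn_integral_add nn_integral_cmult)
qed

lemma nn_sq_scaleR: "f \<in> borel_measurable M \<Longrightarrow> nn_sq M (\<lambda>x. c *\<^sub>R (f x::'b::euclidean_space)) = ennreal (c\<^sup>2) * nn_sq M f"
  by (simp add: power_mult_distrib ennreal_mult nn_integral_cmult)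

lemma nn_sq_triangle:
  assumes [measurable]: "f \<in> borel_measurable M" "g \<in> borel_measurable M" "h \<in> borel_measurable M"
  shows "nn_sq M (\<lambda>x. f x - h x) \<le> 2 * nn_sq M (\<lambda>x. f x - g x) + 2 * nn_sq M (\<lambda>x. g x - h x :: 'b::euclidean_space)"
  using nn_sq_add_le[of "\<lambda>x. f x - g x" M "\<lambda>x. g x - h x"] by simp

lemma nn_sq_commute: "nn_sq M (\<lambda>x. f x - g x) = nn_sq M (\<lambda>x. g x - f x)"
  by (simp add: norm_minus_commute)

text \<open>Extension by zero outside [0, t], with the arguments in the order (\<omega>, s): the
  process becomes a function on the product with the whole line, where Tonelli and Fubini apply
  without restricted spaces.\<close>

definition clipped :: "real \<Rightarrow> (real \<Rightarrow> 'w \<Rightarrow> 'a::real_vector) \<Rightarrow> 'w \<times> real \<Rightarrow> 'a" where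
  "clipped t \<phi> = (\<lambda>(\<omega>, s). indicator {0..t} s *\<^sub>R \<phi> s \<omega>)"

lemma clipped_add: "clipped t (\<lambda>s \<omega>. \<phi> s \<omega> + \<psi> s \<omega>) = (\<lambda>p. clipped t \<phi> p + clipped t \<psi> p)"
  and clipped_diff: "clipped t (\<lambda>s \<omega>. \<phi> s \<omega> - \<psi> s \<omega>) = (\<lambda>p. clipped t \<phi> p - clipped t \<psi> p)"
  and clipped_scaleR: "clipped t (\<lambda>s \<omega>. r *\<^sub>R \<phi> s \<omega>) = (\<lambda>p. r *\<^sub>R clipped t \<phi> p)"
  and clipped_0: "clipped t (\<lambda>s \<omega>. 0) = (\<lambda>p. 0)"
  by (auto simp: clipped_def scaleR_add_right scaleR_diff_right mult.commute)

text \<open>Replaces the restricted time space in the definition by the zero extension, so that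
  closure under sums, multiples and integration in time reduces to measurability on one product
  space.\<close>

lemma progressive_iff:
  fixes \<phi> :: "real \<Rightarrow> 'w \<Rightarrow> 'a::euclidean_space"
  shows "progressive T F \<phi> \<longleftrightarrow> (\<forall>t\<in>{0..T}. clipped t \<phi> \<in> borel_measurable (F t \<Otimes>\<^sub>M borel))"
proof -
  have "(\<lambda>(s, \<omega>). \<phi> s \<omega>) \<in> borel_measurable (restrict_space borel {0..t} \<Otimes>\<^sub>M F t) \<longleftrightarrow>
    clipped t \<phi> \<in> borel_measurable (F t \<Otimes>\<^sub>M borel)" for t
  proof
    assume a: "(\<lambda>(s, \<omega>). \<phi> s \<omega>) \<in> borel_measurable (restrict_space borel {0..t} \<Otimes>\<^sub>M F t)"
    let ?R = "restrict_space (F t \<Otimes>\<^sub>M borel) {p. snd p \<in> {0..t}}"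
    have sw: "(\<lambda>p. (snd p, fst p)) \<in> measurable ?R (restrict_space borel {0..t} \<Otimes>\<^sub>M F t)"
    proof (rule measurable_Pair)
      show "snd \<in> measurable ?R (restrict_space borel {0..t})"
        by (rule measurable_restrict_space2) (auto simp: space_restrict_space intro: measurable_restrict_space1)
      show "fst \<in> measurable ?R (F t)" by (rule measurable_restrict_space1) simp
    qed
    have "(\<lambda>p. \<phi> (snd p) (fst p)) \<in> borel_measurable ?R"
      using measurable_compose[OF sw a] by simp
    then have "(\<lambda>p. if snd p \<in> {0..t} then \<phi> (snd p) (fst p) else 0) \<in> borel_measurable (F t \<Otimes>\<^sub>M borel)"
      by (subst measurable_If_restrict_space_iff) auto
    moreover have "(\<lambda>p. if snd p \<in> {0..t} then \<phi> (snd p) (fst p) else 0) = clipped t \<phi>"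
      by (auto simp: clipped_def)
    ultimately show "clipped t \<phi> \<in> borel_measurable (F t \<Otimes>\<^sub>M borel)" by simp
  next
    assume a: "clipped t \<phi> \<in> borel_measurable (F t \<Otimes>\<^sub>M borel)"
    let ?R = "restrict_space borel {0..t} \<Otimes>\<^sub>M F t"
    have "(\<lambda>p. (snd p, fst p)) \<in> measurable ?R (F t \<Otimes>\<^sub>M borel)"
    proof (rule measurable_Pair)
      show "snd \<in> measurable ?R (F t)" by simp
      have "id \<in> measurable (restrict_space borel {0..t}) borel" by (rule measurable_restrict_space1) simp
      from measurable_compose[OF measurable_fst this]
      show "fst \<in> measurable ?R borel" by (simp add: comp_def)
    qed
    from measurable_compose[OF this a]
    have "(\<lambda>p. clipped t \<phi> (snd p, fst p)) \<in> borel_measurable ?R" .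
    moreover have "(\<lambda>(s, \<omega>). \<phi> s \<omega>) \<in> borel_measurable ?R \<longleftrightarrow> (\<lambda>p. clipped t \<phi> (snd p, fst p)) \<in> borel_measurable ?R"
      by (rule measurable_cong) (auto simp: clipped_def space_pair_measure space_restrict_space)
    ultimately show "(\<lambda>(s, \<omega>). \<phi> s \<omega>) \<in> borel_measurable ?R" by simp
  qed
  then show ?thesis by (simp add: progressive_def)
qed

lemma nn_energy_clipped:
  fixes \<phi> :: "real \<Rightarrow> 'w \<Rightarrow> 'a::euclidean_space"
  assumes "clipped t \<phi> \<in> borel_measurable (M \<Otimes>\<^sub>M lborel)"
  shows "nn_energy M t \<phi> = nn_sq (M \<Otimes>\<^sub>M lborel) (clipped t \<phi>)"
proof -
  have "nn_sq (M \<Otimes>\<^sub>M lborel) (clipped t \<phi>) = (\<integral>\<^sup>+ \<omega>. \<integral>\<^sup>+ s. ennreal ((norm (clipped t \<phi> (\<omega>, s)))\<^sup>2) \<partial>lborel \<partial>M)"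
    by (subst lborel.nn_integral_fst[symmetric]) (use assms in auto)
  also have "\<dots> = nn_energy M t \<phi>"
    unfolding nn_energy_def clipped_def
    by (intro nn_integral_cong) (auto simp: indicator_def)
  finally show ?thesis by simp
qed

lemma nn_energy_mono: "t \<le> T \<Longrightarrow> nn_energy M t \<phi> \<le> nn_energy M T \<phi>"
  unfolding nn_energy_def by (intro nn_integral_mono) (auto simp: indicator_def)

lemma sum_lessThan_add:
  "(\<Sum>k<(m::nat) + n. f k) = (\<Sum>k<m. f k) + (\<Sum>k<n. f (m + k) :: 'a::comm_monoid_add)"
  by (induction n) (auto simp: add.assoc)

lemma integral_double_sum:
  fixes f :: "nat \<Rightarrow> nat \<Rightarrow> 'x \<Rightarrow> real"
  assumes "\<And>k l. k < N \<Longrightarrow> l < N \<Longrightarrow> integrable M (f k l)"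
  shows "(LINT x|M. (\<Sum>k<N. \<Sum>l<N. f k l x)) = (\<Sum>k<N. \<Sum>l<N. LINT x|M. f k l x)"
proof -
  have "(LINT x|M. (\<Sum>k<N. \<Sum>l<N. f k l x)) = (\<Sum>k<N. LINT x|M. (\<Sum>l<N. f k l x))"
    using assms by (intro Bochner_Integration.integral_sum Bochner_Integration.integrable_sum) auto
  also have "\<dots> = (\<Sum>k<N. \<Sum>l<N. LINT x|M. f k l x)"
    using assms by (intro sum.cong refl Bochner_Integration.integral_sum) auto
  finally show ?thesis .
qed

text \<open>Left and right endpoints are independent sequences, so the intervals may overlap and
  need not be adjacent. A sum of two such processes is then obtained by concatenation, without a
  common refinement of partitions.\<close>

definition elem_proc :: "nat \<Rightarrow> (nat \<Rightarrow> real) \<Rightarrow> (nat \<Rightarrow> real) \<Rightarrow> (nat \<Rightarrow> 'w \<Rightarrow> 'a) \<Rightarrow> real \<Rightarrow> 'w \<Rightarrow> 'a::euclidean_space" where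
  "elem_proc N a b \<xi> s \<omega> = (\<Sum>k<N. indicator {a k<..b k} s *\<^sub>R \<xi> k \<omega>)"

definition elem_int :: "(real \<Rightarrow> 'w \<Rightarrow> real) \<Rightarrow> nat \<Rightarrow> (nat \<Rightarrow> real) \<Rightarrow> (nat \<Rightarrow> real) \<Rightarrow> (nat \<Rightarrow> 'w \<Rightarrow> 'a) \<Rightarrow> real \<Rightarrow> 'w \<Rightarrow> 'a::euclidean_space" where
  "elem_int W N a b \<xi> t \<omega> = (\<Sum>k<N. (W (min t (b k)) \<omega> - W (min t (a k)) \<omega>) *\<^sub>R \<xi> k \<omega>)"

context filtered_space begin

definition elem_data :: "nat \<Rightarrow> (nat \<Rightarrow> real) \<Rightarrow> (nat \<Rightarrow> real) \<Rightarrow> (nat \<Rightarrow> 'w \<Rightarrow> 'a::euclidean_space) \<Rightarrow> bool" where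
  "elem_data N a b \<xi> \<longleftrightarrow> (\<forall>k<N. 0 \<le> a k \<and> a k \<le> b k \<and> \<xi> k \<in> borel_measurable (F (a k)) \<and>
     (\<exists>K. \<forall>\<omega>\<in>space M. norm (\<xi> k \<omega>) \<le> K))"

lemma elem_concat:
  assumes 1: "elem_data N a b \<xi>" and 2: "elem_data N' a' b' \<xi>'"
  obtains a'' b'' \<xi>'' where "elem_data (N + N') a'' b'' \<xi>''"
    "elem_proc (N + N') a'' b'' \<xi>'' = (\<lambda>s \<omega>. p *\<^sub>R elem_proc N a b \<xi> s \<omega> + q *\<^sub>R elem_proc N' a' b' \<xi>' s \<omega>)"
    "elem_int W (N + N') a'' b'' \<xi>'' = (\<lambda>s \<omega>. p *\<^sub>R elem_int W N a b \<xi> s \<omega> + q *\<^sub>R elem_int W N' a' b' \<xi>' s \<omega>)"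
proof
  let ?a = "\<lambda>k. if k < N then a k else a' (k - N)"
  let ?b = "\<lambda>k. if k < N then b k else b' (k - N)"
  let ?\<xi> = "\<lambda>k \<omega>. if k < N then p *\<^sub>R \<xi> k \<omega> else q *\<^sub>R \<xi>' (k - N) \<omega>"
  show "elem_data (N + N') ?a ?b ?\<xi>"
    unfolding elem_data_def
  proof (intro allI impI)
    fix k assume k: "k < N + N'"
    show "0 \<le> ?a k \<and> ?a k \<le> ?b k \<and> ?\<xi> k \<in> borel_measurable (F (?a k)) \<and> (\<exists>K. \<forall>\<omega>\<in>space M. norm (?\<xi> k \<omega>) \<le> K)"
    proof (cases "k < N")
      case True
      then obtain K where "\<forall>\<omega>\<in>space M. norm (\<xi> k \<omega>) \<le> K" using 1 by (auto simp: elem_data_def)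
      then have "\<forall>\<omega>\<in>space M. norm (p *\<^sub>R \<xi> k \<omega>) \<le> \<bar>p\<bar> * K" by (auto intro: mult_left_mono)
      moreover have "(\<lambda>\<omega>. p *\<^sub>R \<xi> k \<omega>) \<in> borel_measurable (F (a k))"
        using 1 True by (auto simp: elem_data_def)
      ultimately show ?thesis using True 1 by (auto simp: elem_data_def)
    next
      case False
      then have "k - N < N'" using k by auto
      then obtain K where "\<forall>\<omega>\<in>space M. norm (\<xi>' (k - N) \<omega>) \<le> K" using 2 by (auto simp: elem_data_def)
      then have "\<forall>\<omega>\<in>space M. norm (q *\<^sub>R \<xi>' (k - N) \<omega>) \<le> \<bar>q\<bar> * K" by (auto intro: mult_left_mono)
      moreover have "(\<lambda>\<omega>. q *\<^sub>R \<xi>' (k - N) \<omega>) \<in> borel_measurable (F (a' (k - N)))"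
        using 2 \<open>k - N < N'\<close> by (auto simp: elem_data_def)
      ultimately show ?thesis using False \<open>k - N < N'\<close> 2 by (auto simp: elem_data_def)
    qed
  qed
  show "elem_proc (N + N') ?a ?b ?\<xi> = (\<lambda>s \<omega>. p *\<^sub>R elem_proc N a b \<xi> s \<omega> + q *\<^sub>R elem_proc N' a' b' \<xi>' s \<omega>)"
    unfolding elem_proc_def sum_lessThan_add scaleR_sum_right scaleR_scaleR
    by (intro ext arg_cong2[where f="(+)"] sum.cong) (simp_all only: lessThan_iff if_True scaleR_scaleR mult.commute, simp_all)
  show "elem_int W (N + N') ?a ?b ?\<xi> = (\<lambda>s \<omega>. p *\<^sub>R elem_int W N a b \<xi> s \<omega> + q *\<^sub>R elem_int W N' a' b' \<xi>' s \<omega>)"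
    by (intro ext) (simp add: elem_int_def sum_lessThan_add scaleR_sum_right mult.commute)
qed

section \<open>Moments of products of Brownian increments\<close>

lemma brownian_measurable:
  "brownian W \<Longrightarrow> 0 \<le> s \<Longrightarrow> s \<le> t \<Longrightarrow> W s \<in> borel_measurable (F t)"
  by (auto simp: brownian_def intro: F_measurable_mono)

text \<open>Covers the degenerate interval a = b, which arises when intervals are cut at t by
  \<open>min t\<close>.\<close>

lemma brownian_increment:
  assumes "brownian W" "0 \<le> a" "a \<le> b" "Z \<in> borel_measurable (F a)" "integrable M Z"
  shows "integrable M (\<lambda>\<omega>. Z \<omega> * (W b \<omega> - W a \<omega>))" "(LINT \<omega>|M. Z \<omega> * (W b \<omega> - W a \<omega>)) = 0"
    "integrable M (\<lambda>\<omega>. Z \<omega> * (W b \<omega> - W a \<omega>)\<^sup>2)" "(LINT \<omega>|M. Z \<omega> * (W b \<omega> - W a \<omega>)\<^sup>2) = (b - a) * (LINT \<omega>|M. Z \<omega>)"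
  using assms by (cases "a = b"; force simp: brownian_def)+

text \<open>Write W q - W c as (W p - W c) + (W q - W p). The first part yields a square over
  [c, p]; the second has mean zero against what is known at time p.\<close>

lemma brownian_product:
  assumes W: "brownian W" and c: "0 \<le> c" "c \<le> p" "p \<le> q" and Z: "Z \<in> borel_measurable (F c)" "integrable M Z"
  shows "integrable M (\<lambda>\<omega>. (W p \<omega> - W c \<omega>) * (W q \<omega> - W c \<omega>) * Z \<omega>)"
    "(LINT \<omega>|M. (W p \<omega> - W c \<omega>) * (W q \<omega> - W c \<omega>) * Z \<omega>) = (p - c) * (LINT \<omega>|M. Z \<omega>)"
proof -
  note i = brownian_increment[OF W c(1,2) Z]
  have [measurable]: "W c \<in> borel_measurable (F p)" "W p \<in> borel_measurable (F p)" "Z \<in> borel_measurable (F p)"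
    using W c Z by (auto intro: brownian_measurable F_measurable_mono)
  have "(\<lambda>\<omega>. Z \<omega> * (W p \<omega> - W c \<omega>)) \<in> borel_measurable (F p)" by measurable
  note j = brownian_increment[OF W _ c(3) this i(1)]
  have eq: "(\<lambda>\<omega>. (W p \<omega> - W c \<omega>) * (W q \<omega> - W c \<omega>) * Z \<omega>) =
    (\<lambda>\<omega>. Z \<omega> * (W p \<omega> - W c \<omega>)\<^sup>2 + Z \<omega> * (W p \<omega> - W c \<omega>) * (W q \<omega> - W p \<omega>))"
    by (auto simp: power2_eq_square algebra_simps)
  show "integrable M (\<lambda>\<omega>. (W p \<omega> - W c \<omega>) * (W q \<omega> - W c \<omega>) * Z \<omega>)"
    unfolding eq using i(3) j(1) c by (intro Bochner_Integration.integrable_add) auto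
  show "(LINT \<omega>|M. (W p \<omega> - W c \<omega>) * (W q \<omega> - W c \<omega>) * Z \<omega>) = (p - c) * (LINT \<omega>|M. Z \<omega>)"
    unfolding eq using i(3,4) j(1,2) c by (subst Bochner_Integration.integral_add) auto
qed

lemma integrable_bounded_mult:
  fixes Z D :: "'w \<Rightarrow> real"
  assumes "integrable M D" "Z \<in> borel_measurable M" "\<And>\<omega>. \<omega> \<in> space M \<Longrightarrow> \<bar>Z \<omega>\<bar> \<le> K"
  shows "integrable M (\<lambda>\<omega>. Z \<omega> * D \<omega>)"
proof (rule Bochner_Integration.integrable_bound[OF integrable_mult_right[OF assms(1), of K]])
  show "(\<lambda>\<omega>. Z \<omega> * D \<omega>) \<in> borel_measurable M" using assms by measurable
  show "AE \<omega> in M. norm (Z \<omega> * D \<omega>) \<le> norm (K * D \<omega>)"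
  proof (rule AE_I2)
    fix \<omega> assume "\<omega> \<in> space M"
    then have "\<bar>Z \<omega>\<bar> \<le> \<bar>K\<bar>" using assms(3)[of \<omega>] by linarith
    then show "norm (Z \<omega> * D \<omega>) \<le> norm (K * D \<omega>)" by (simp add: abs_mult mult_right_mono)
  qed
qed

text \<open>The covariance of two increments is the length of the overlap of their intervals. What
  [a, b] covers before c is known at time c and contributes nothing; what it covers after c starts
  at the same point as [c, d] and falls under \<open>brownian_product\<close>.\<close>

lemma brownian_pair:
  assumes W: "brownian W" and ac: "0 \<le> a" "a \<le> c" "a \<le> b" "c \<le> d"
    and Z: "Z \<in> borel_measurable (F c)" and K: "\<And>\<omega>. \<omega> \<in> space M \<Longrightarrow> \<bar>Z \<omega>\<bar> \<le> K"
  shows "integrable M (\<lambda>\<omega>. (W b \<omega> - W a \<omega>) * (W d \<omega> - W c \<omega>) * Z \<omega>)"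
    "(LINT \<omega>|M. (W b \<omega> - W a \<omega>) * (W d \<omega> - W c \<omega>) * Z \<omega>) = max 0 (min b d - c) * (LINT \<omega>|M. Z \<omega>)"
proof -
  have c0: "0 \<le> c" using ac by simp
  have ZM: "Z \<in> borel_measurable M" using F_measurable[OF Z c0] .
  have Zi: "integrable M Z" by (rule integrable_const_bound[of _ K]) (use K ZM in auto)
  have iW: "integrable M (\<lambda>\<omega>. W b \<omega> - W a \<omega>)" if "0 \<le> a" "a \<le> b" for a b :: real
  proof -
    have "(\<lambda>\<omega>. 1::real) \<in> borel_measurable (F a)" "integrable M (\<lambda>\<omega>. 1::real)" by simp_all
    from brownian_increment(1)[OF W that this] show ?thesis by (simp only: mult_1_left)
  qed
  \<comment> \<open>An increment over [a, e] with e \<le> c is known at time c and can be joined to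
    Z as a test variable for the increment from c on.\<close>
  have past: "integrable M (\<lambda>\<omega>. (W e \<omega> - W a \<omega>) * (W d \<omega> - W c \<omega>) * Z \<omega>)"
    "(LINT \<omega>|M. (W e \<omega> - W a \<omega>) * (W d \<omega> - W c \<omega>) * Z \<omega>) = 0" if "a \<le> e" "e \<le> c" for e
  proof -
    have [measurable]: "W e \<in> borel_measurable (F c)" "W a \<in> borel_measurable (F c)"
      using that ac by (auto intro!: brownian_measurable[OF W])
    have "(\<lambda>\<omega>. Z \<omega> * (W e \<omega> - W a \<omega>)) \<in> borel_measurable (F c)" using Z by measurable
    moreover have "integrable M (\<lambda>\<omega>. Z \<omega> * (W e \<omega> - W a \<omega>))"
      using that ac by (intro integrable_bounded_mult[OF iW ZM K]) auto
    ultimately have "integrable M (\<lambda>\<omega>. Z \<omega> * (W e \<omega> - W a \<omega>) * (W d \<omega> - W c \<omega>))"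
      "(LINT \<omega>|M. Z \<omega> * (W e \<omega> - W a \<omega>) * (W d \<omega> - W c \<omega>)) = 0"
      by (auto intro!: brownian_increment[OF W c0 ac(4)])
    then show "integrable M (\<lambda>\<omega>. (W e \<omega> - W a \<omega>) * (W d \<omega> - W c \<omega>) * Z \<omega>)"
      "(LINT \<omega>|M. (W e \<omega> - W a \<omega>) * (W d \<omega> - W c \<omega>) * Z \<omega>) = 0" by (simp_all add: mult_ac)
  qed
  have "integrable M (\<lambda>\<omega>. (W b \<omega> - W a \<omega>) * (W d \<omega> - W c \<omega>) * Z \<omega>) \<and>
    (LINT \<omega>|M. (W b \<omega> - W a \<omega>) * (W d \<omega> - W c \<omega>) * Z \<omega>) = max 0 (min b d - c) * (LINT \<omega>|M. Z \<omega>)"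
  proof (cases "b \<le> c")
    case True
    then show ?thesis using past[of b] ac by (auto simp: max_def)
  next
    case False
    have *: "integrable M (\<lambda>\<omega>. (W b \<omega> - W c \<omega>) * (W d \<omega> - W c \<omega>) * Z \<omega>) \<and>
      (LINT \<omega>|M. (W b \<omega> - W c \<omega>) * (W d \<omega> - W c \<omega>) * Z \<omega>) = (min b d - c) * (LINT \<omega>|M. Z \<omega>)"
    proof (cases "b \<le> d")
      case True
      then show ?thesis using brownian_product[OF W c0 _ True Z Zi] False by auto
    next
      case db: False
      then have "d \<le> b" by simp
      from brownian_product[OF W c0 ac(4) this Z Zi] show ?thesis using db by (simp add: mult_ac)
    qed
    have eq: "(\<lambda>\<omega>. (W b \<omega> - W a \<omega>) * (W d \<omega> - W c \<omega>) * Z \<omega>) =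
      (\<lambda>\<omega>. (W c \<omega> - W a \<omega>) * (W d \<omega> - W c \<omega>) * Z \<omega> + (W b \<omega> - W c \<omega>) * (W d \<omega> - W c \<omega>) * Z \<omega>)"
      by (auto simp: algebra_simps)
    show ?thesis unfolding eq using past[of c] * False ac by (auto simp: max_def)
  qed
  then show "integrable M (\<lambda>\<omega>. (W b \<omega> - W a \<omega>) * (W d \<omega> - W c \<omega>) * Z \<omega>)"
    "(LINT \<omega>|M. (W b \<omega> - W a \<omega>) * (W d \<omega> - W c \<omega>) * Z \<omega>) = max 0 (min b d - c) * (LINT \<omega>|M. Z \<omega>)" by auto
qed

text \<open>With a k \<le> a l both coefficients are known at a l, the later left endpoint, as
  \<open>brownian_pair\<close> requires. The overlap is written as a Lebesgue measure because
  integrating the squared integrand over [0, t] produces the same number.\<close>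

lemma elem_term:
  fixes \<xi> :: "nat \<Rightarrow> 'w \<Rightarrow> 'a::euclidean_space"
  assumes W: "brownian W" and e: "elem_data N a b \<xi>" and k: "k < N" and l: "l < N" and le: "a k \<le> a l" and t: "0 \<le> t"
  shows "integrable M (\<lambda>\<omega>. (W (min t (b k)) \<omega> - W (min t (a k)) \<omega>) * (W (min t (b l)) \<omega> - W (min t (a l)) \<omega>) * (\<xi> k \<omega> \<bullet> \<xi> l \<omega>))"
    "(LINT \<omega>|M. (W (min t (b k)) \<omega> - W (min t (a k)) \<omega>) * (W (min t (b l)) \<omega> - W (min t (a l)) \<omega>) * (\<xi> k \<omega> \<bullet> \<xi> l \<omega>)) =
      measure lborel ({a k<..b k} \<inter> {a l<..b l} \<inter> {0..t}) * (LINT \<omega>|M. \<xi> k \<omega> \<bullet> \<xi> l \<omega>)"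
proof -
  have ek: "0 \<le> a k" "a k \<le> b k" "\<xi> k \<in> borel_measurable (F (a k))" and el: "0 \<le> a l" "a l \<le> b l" "\<xi> l \<in> borel_measurable (F (a l))"
    using e k l by (auto simp: elem_data_def)
  obtain K L where K: "\<And>\<omega>. \<omega> \<in> space M \<Longrightarrow> norm (\<xi> k \<omega>) \<le> K" and L: "\<And>\<omega>. \<omega> \<in> space M \<Longrightarrow> norm (\<xi> l \<omega>) \<le> L"
    using e k l unfolding elem_data_def by meson
  have KL: "\<bar>\<xi> k \<omega> \<bullet> \<xi> l \<omega>\<bar> \<le> K * L" if "\<omega> \<in> space M" for \<omega>
  proof -
    have "\<bar>\<xi> k \<omega> \<bullet> \<xi> l \<omega>\<bar> \<le> norm (\<xi> k \<omega>) * norm (\<xi> l \<omega>)" by (rule Cauchy_Schwarz_ineq2)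
    also have "\<dots> \<le> K * L" using K[OF that] L[OF that] norm_ge_zero order_trans by (blast intro: mult_mono)
    finally show ?thesis .
  qed
  have "integrable M (\<lambda>\<omega>. (W (min t (b k)) \<omega> - W (min t (a k)) \<omega>) * (W (min t (b l)) \<omega> - W (min t (a l)) \<omega>) * (\<xi> k \<omega> \<bullet> \<xi> l \<omega>)) \<and>
    (LINT \<omega>|M. (W (min t (b k)) \<omega> - W (min t (a k)) \<omega>) * (W (min t (b l)) \<omega> - W (min t (a l)) \<omega>) * (\<xi> k \<omega> \<bullet> \<xi> l \<omega>)) =
      measure lborel ({a k<..b k} \<inter> {a l<..b l} \<inter> {0..t}) * (LINT \<omega>|M. \<xi> k \<omega> \<bullet> \<xi> l \<omega>)"
  proof (cases "a l < t")
    case False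
    then have "{a k<..b k} \<inter> {a l<..b l} \<inter> {0..t} = {}" "min t (a l) = t" "min t (b l) = t" using el by auto
    then show ?thesis by simp
  next
    case True
    have m: "(\<lambda>\<omega>. \<xi> k \<omega> \<bullet> \<xi> l \<omega>) \<in> borel_measurable (F (min t (a l)))"
      using True el F_measurable_mono[OF ek(3,1) le] by (simp add: min_def)
    have s: "{a k<..b k} \<inter> {a l<..b l} \<inter> {0..t} = {a l<..min (min t (b k)) (min t (b l))}"
      using le el by auto
    have "max 0 (min (min t (b k)) (min t (b l)) - min t (a l)) = measure lborel ({a k<..b k} \<inter> {a l<..b l} \<inter> {0..t})"
      unfolding s using True by (auto simp: max_def)
    moreover have "0 \<le> min t (a k)" "min t (a k) \<le> min t (a l)" "min t (a k) \<le> min t (b k)" "min t (a l) \<le> min t (b l)"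
      using t ek el le by auto
    note brownian_pair[OF W this m KL]
    ultimately show ?thesis by simp
  qed
  then show "integrable M (\<lambda>\<omega>. (W (min t (b k)) \<omega> - W (min t (a k)) \<omega>) * (W (min t (b l)) \<omega> - W (min t (a l)) \<omega>) * (\<xi> k \<omega> \<bullet> \<xi> l \<omega>))"
    "(LINT \<omega>|M. (W (min t (b k)) \<omega> - W (min t (a k)) \<omega>) * (W (min t (b l)) \<omega> - W (min t (a l)) \<omega>) * (\<xi> k \<omega> \<bullet> \<xi> l \<omega>)) =
      measure lborel ({a k<..b k} \<inter> {a l<..b l} \<inter> {0..t}) * (LINT \<omega>|M. \<xi> k \<omega> \<bullet> \<xi> l \<omega>)" by auto
qed

text \<open>The order of the left endpoints is removed by the symmetry of the pair.\<close>

lemma elem_term':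
  fixes \<xi> :: "nat \<Rightarrow> 'w \<Rightarrow> 'a::euclidean_space"
  assumes W: "brownian W" and e: "elem_data N a b \<xi>" and k: "k < N" and l: "l < N" and t: "0 \<le> t"
  shows "integrable M (\<lambda>\<omega>. (W (min t (b k)) \<omega> - W (min t (a k)) \<omega>) * (W (min t (b l)) \<omega> - W (min t (a l)) \<omega>) * (\<xi> k \<omega> \<bullet> \<xi> l \<omega>))"
    "(LINT \<omega>|M. (W (min t (b k)) \<omega> - W (min t (a k)) \<omega>) * (W (min t (b l)) \<omega> - W (min t (a l)) \<omega>) * (\<xi> k \<omega> \<bullet> \<xi> l \<omega>)) =
      measure lborel ({a k<..b k} \<inter> {a l<..b l} \<inter> {0..t}) * (LINT \<omega>|M. \<xi> k \<omega> \<bullet> \<xi> l \<omega>)"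
proof -
  let ?X = "\<lambda>k l \<omega>. (W (min t (b k)) \<omega> - W (min t (a k)) \<omega>) * (W (min t (b l)) \<omega> - W (min t (a l)) \<omega>) * (\<xi> k \<omega> \<bullet> \<xi> l \<omega>)"
  have "integrable M (?X k l) \<and> (LINT \<omega>|M. ?X k l \<omega>) =
    measure lborel ({a k<..b k} \<inter> {a l<..b l} \<inter> {0..t}) * (LINT \<omega>|M. \<xi> k \<omega> \<bullet> \<xi> l \<omega>)"
  proof (cases "a k \<le> a l")
    case True
    then show ?thesis using elem_term[OF W e k l True t] by blast
  next
    case False
    have "?X k l = ?X l k" by (intro ext) (simp only: inner_commute[of "\<xi> k _"] mult.commute)
    moreover have "{a k<..b k} \<inter> {a l<..b l} \<inter> {0..t} = {a l<..b l} \<inter> {a k<..b k} \<inter> {0..t}" by (simp only: Int_commute)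
    moreover have "(LINT \<omega>|M. \<xi> k \<omega> \<bullet> \<xi> l \<omega>) = (LINT \<omega>|M. \<xi> l \<omega> \<bullet> \<xi> k \<omega>)" by (simp only: inner_commute[of "\<xi> k _"])
    ultimately show ?thesis using elem_term[OF W e l k _ t] False by (simp only:)
  qed
  then show "integrable M (?X k l)" "(LINT \<omega>|M. ?X k l \<omega>) =
    measure lborel ({a k<..b k} \<inter> {a l<..b l} \<inter> {0..t}) * (LINT \<omega>|M. \<xi> k \<omega> \<bullet> \<xi> l \<omega>)" by blast+
qed

section \<open>Isometry and martingale property of elementary integrals\<close>

lemma elem_data_measurable: "elem_data N a b \<xi> \<Longrightarrow> k < N \<Longrightarrow> \<xi> k \<in> borel_measurable M"
  by (auto simp: elem_data_def intro: F_measurable)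

text \<open>Both squares expand into double sums over pairs of intervals, and the sums agree term by
  term. The intervals may overlap freely, which is what concatenated families require.\<close>

lemma elem_isometry:
  fixes \<xi> :: "nat \<Rightarrow> 'w \<Rightarrow> 'a::euclidean_space"
  assumes W: "brownian W" and e: "elem_data N a b \<xi>" and t: "0 \<le> t"
  shows "nn_sq M (elem_int W N a b \<xi> t) = nn_energy M t (elem_proc N a b \<xi>)"
    and "nn_sq M (elem_int W N a b \<xi> t) < \<infinity>"
proof -
  define m where "m k l = measure lborel ({a k<..b k} \<inter> {a l<..b l} \<inter> {0..t})" for k l
  \<comment> \<open>The common value of the two sides.\<close>
  define R where "R = (\<Sum>k<N. \<Sum>l<N. m k l * (LINT \<omega>|M. \<xi> k \<omega> \<bullet> \<xi> l \<omega>))"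
  let ?D = "\<lambda>k \<omega>. W (min t (b k)) \<omega> - W (min t (a k)) \<omega>"
  have sq: "(norm (elem_int W N a b \<xi> t \<omega>))\<^sup>2 = (\<Sum>k<N. \<Sum>l<N. ?D k \<omega> * ?D l \<omega> * (\<xi> k \<omega> \<bullet> \<xi> l \<omega>))" for \<omega>
    unfolding elem_int_def power2_norm_eq_inner
    by (subst inner_sum_left, subst inner_sum_right) (simp add: mult_ac)
  have i1: "integrable M (\<lambda>\<omega>. (norm (elem_int W N a b \<xi> t \<omega>))\<^sup>2)"
    unfolding sq using elem_term'(1)[OF W e _ _ t] by (intro Bochner_Integration.integrable_sum) auto
  have "(LINT \<omega>|M. (norm (elem_int W N a b \<xi> t \<omega>))\<^sup>2) = R"
    unfolding sq R_def m_def using elem_term'(1)[OF W e _ _ t]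
    by (subst integral_double_sum) (auto intro!: sum.cong elem_term'(2)[OF W e _ _ t] simp del: Int_greaterThanAtMost)
  then have 1: "nn_sq M (elem_int W N a b \<xi> t) = ennreal R"
    using nn_integral_eq_integral[OF i1] by simp
  have in_i: "integrable M (\<lambda>\<omega>. \<xi> k \<omega> \<bullet> \<xi> l \<omega>)" if kl: "k < N" "l < N" for k l
  proof -
    obtain K L where K: "\<And>\<omega>. \<omega> \<in> space M \<Longrightarrow> norm (\<xi> k \<omega>) \<le> K" and L: "\<And>\<omega>. \<omega> \<in> space M \<Longrightarrow> norm (\<xi> l \<omega>) \<le> L"
      using e kl unfolding elem_data_def by meson
    have "norm (\<xi> k \<omega> \<bullet> \<xi> l \<omega>) \<le> K * L" if "\<omega> \<in> space M" for \<omega>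
    proof -
      have "norm (\<xi> k \<omega> \<bullet> \<xi> l \<omega>) \<le> norm (\<xi> k \<omega>) * norm (\<xi> l \<omega>)" using Cauchy_Schwarz_ineq2 by simp
      also have "\<dots> \<le> K * L" using K[OF that] L[OF that] norm_ge_zero order_trans by (blast intro: mult_mono)
      finally show ?thesis .
    qed
    then show ?thesis using elem_data_measurable[OF e] kl by (intro integrable_const_bound[of _ "K * L"]) auto
  qed
  have inner: "(\<integral>\<^sup>+ s. ennreal ((norm (elem_proc N a b \<xi> s \<omega>))\<^sup>2) * indicator {0..t} s \<partial>lborel) =
    ennreal (\<Sum>k<N. \<Sum>l<N. m k l * (\<xi> k \<omega> \<bullet> \<xi> l \<omega>))"
    "0 \<le> (\<Sum>k<N. \<Sum>l<N. m k l * (\<xi> k \<omega> \<bullet> \<xi> l \<omega>))" for \<omega>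
  proof -
    let ?S = "\<lambda>k l. {a k<..b k} \<inter> {a l<..b l} \<inter> {0..t}"
    let ?f = "\<lambda>s. \<Sum>k<N. \<Sum>l<N. indicator (?S k l) s * (\<xi> k \<omega> \<bullet> \<xi> l \<omega>)"
    have eq: "(norm (elem_proc N a b \<xi> s \<omega>))\<^sup>2 * indicator {0..t} s = ?f s" for s
      unfolding elem_proc_def power2_norm_eq_inner
      by (subst inner_sum_left, subst inner_sum_right, unfold sum_distrib_right)
        (intro sum.cong refl, auto simp: indicator_def)
    have "emeasure lborel (?S k l) < \<infinity>" for k l
      by (rule le_less_trans[OF emeasure_mono, of _ "{0..t}"]) (auto simp: t)
    then have i: "integrable lborel (\<lambda>s. indicator (?S k l) s * (\<xi> k \<omega> \<bullet> \<xi> l \<omega>))" for k l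
      by (intro integrable_mult_left integrable_real_indicator) auto
    then have int: "integrable lborel ?f" by (intro Bochner_Integration.integrable_sum) auto
    have val: "(LINT s|lborel. ?f s) = (\<Sum>k<N. \<Sum>l<N. m k l * (\<xi> k \<omega> \<bullet> \<xi> l \<omega>))"
      unfolding m_def by (subst integral_double_sum[OF i]) (intro sum.cong refl, simp)
    have nn: "0 \<le> ?f s" for s unfolding eq[symmetric] by simp
    have "(\<integral>\<^sup>+ s. ennreal ((norm (elem_proc N a b \<xi> s \<omega>))\<^sup>2) * indicator {0..t} s \<partial>lborel) = (\<integral>\<^sup>+ s. ennreal (?f s) \<partial>lborel)"
      unfolding eq[symmetric] by (intro nn_integral_cong) (auto simp: indicator_def)
    also have "\<dots> = ennreal (LINT s|lborel. ?f s)" by (rule nn_integral_eq_integral[OF int AE_I2[OF nn]])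
    finally show "(\<integral>\<^sup>+ s. ennreal ((norm (elem_proc N a b \<xi> s \<omega>))\<^sup>2) * indicator {0..t} s \<partial>lborel) =
      ennreal (\<Sum>k<N. \<Sum>l<N. m k l * (\<xi> k \<omega> \<bullet> \<xi> l \<omega>))" unfolding val .
    show "0 \<le> (\<Sum>k<N. \<Sum>l<N. m k l * (\<xi> k \<omega> \<bullet> \<xi> l \<omega>))"
      unfolding val[symmetric] by (rule integral_nonneg_AE[OF AE_I2[OF nn]])
  qed
  have i2: "integrable M (\<lambda>\<omega>. \<Sum>k<N. \<Sum>l<N. m k l * (\<xi> k \<omega> \<bullet> \<xi> l \<omega>))"
    using in_i by (intro Bochner_Integration.integrable_sum integrable_mult_right) auto
  have "nn_energy M t (elem_proc N a b \<xi>) = (\<integral>\<^sup>+ \<omega>. ennreal (\<Sum>k<N. \<Sum>l<N. m k l * (\<xi> k \<omega> \<bullet> \<xi> l \<omega>)) \<partial>M)"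
    unfolding nn_energy_def inner ..
  also have "\<dots> = ennreal (LINT \<omega>|M. (\<Sum>k<N. \<Sum>l<N. m k l * (\<xi> k \<omega> \<bullet> \<xi> l \<omega>)))"
    by (rule nn_integral_eq_integral[OF i2]) (simp add: inner)
  also have "(LINT \<omega>|M. (\<Sum>k<N. \<Sum>l<N. m k l * (\<xi> k \<omega> \<bullet> \<xi> l \<omega>))) = R"
    unfolding R_def using in_i by (subst integral_double_sum) auto
  finally show "nn_sq M (elem_int W N a b \<xi> t) = nn_energy M t (elem_proc N a b \<xi>)" using 1 by simp
  show "nn_sq M (elem_int W N a b \<xi> t) < \<infinity>" using 1 by simp
qed

lemma elem_int_measurable:
  fixes \<xi> :: "nat \<Rightarrow> 'w \<Rightarrow> 'a::euclidean_space"
  assumes W: "brownian W" and e: "elem_data N a b \<xi>" and t: "0 \<le> t"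
  shows "elem_int W N a b \<xi> t \<in> borel_measurable (F t)"
proof -
  have "(\<lambda>\<omega>. (W (min t (b k)) \<omega> - W (min t (a k)) \<omega>) *\<^sub>R \<xi> k \<omega>) \<in> borel_measurable (F t)" if "k < N" for k
  proof -
    have k: "0 \<le> a k" "a k \<le> b k" "\<xi> k \<in> borel_measurable (F (a k))" using e that by (auto simp: elem_data_def)
    show ?thesis
    proof (cases "a k \<le> t")
      case True
      have "W (min t (b k)) \<in> borel_measurable (F t)" "W (min t (a k)) \<in> borel_measurable (F t)"
        using k t by (auto intro!: brownian_measurable[OF W])
      then show ?thesis using F_measurable_mono[OF k(3,1) True] by measurable
    next
      case False
      then have "min t (b k) = t" "min t (a k) = t" using k by auto
      then show ?thesis by simp
    qed
  qed
  then show ?thesis unfolding elem_int_def[abs_def] by (intro borel_measurable_sum) auto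
qed

lemma integrable_of_nn_sq:
  fixes Z :: "'w \<Rightarrow> 'a::euclidean_space"
  assumes [measurable]: "Z \<in> borel_measurable M" and "nn_sq M Z < \<infinity>"
  shows "integrable M Z" "integrable M (\<lambda>\<omega>. (norm (Z \<omega>))\<^sup>2)"
proof -
  show i: "integrable M (\<lambda>\<omega>. (norm (Z \<omega>))\<^sup>2)"
    using assms by (intro integrableI_bounded) auto
  have "integrable M (\<lambda>\<omega>. 1 + (norm (Z \<omega>))\<^sup>2)" using i by simp
  then show "integrable M Z"
  proof (rule Bochner_Integration.integrable_bound)
    have "norm x \<le> 1 + (norm x)\<^sup>2" for x :: 'a
      using sum_squares_bound[of "norm x" 1] norm_ge_zero[of x] unfolding power2_eq_square by linarith
    then show "AE \<omega> in M. norm (Z \<omega>) \<le> norm (1 + (norm (Z \<omega>))\<^sup>2)" by (simp add: add_nonneg_nonneg)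
  qed simp
qed

text \<open>Between s and t only the parts of the intervals inside [s, t] move. Such a part starts
  no earlier than s and a k, so Z and the coefficient are known there and the increment has mean
  zero against their product.\<close>

lemma elem_martingale:
  fixes \<xi> :: "nat \<Rightarrow> 'w \<Rightarrow> 'a::euclidean_space"
  assumes W: "brownian W" and e: "elem_data N a b \<xi>" and st: "0 \<le> s" "s \<le> t"
    and Z: "Z \<in> borel_measurable (F s)" "nn_sq M Z < \<infinity>"
  shows "(LINT \<omega>|M. Z \<omega> \<bullet> (elem_int W N a b \<xi> t \<omega> - elem_int W N a b \<xi> s \<omega>)) = 0"
proof -
  \<comment> \<open>Both endpoints are clamped to [s, t]; an interval outside degenerates to a
    point.\<close>
  let ?D = "\<lambda>k \<omega>. W (max s (min t (b k))) \<omega> - W (max s (min t (a k))) \<omega>"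
  have cl: "W (min t c) \<omega> - W (min s c) \<omega> = W (max s (min t c)) \<omega> - W s \<omega>" for c \<omega>
    using st by (auto simp: min_def max_def)
  have eq: "Z \<omega> \<bullet> (elem_int W N a b \<xi> t \<omega> - elem_int W N a b \<xi> s \<omega>) = (\<Sum>k<N. (Z \<omega> \<bullet> \<xi> k \<omega>) * ?D k \<omega>)" for \<omega>
  proof -
    have "elem_int W N a b \<xi> t \<omega> - elem_int W N a b \<xi> s \<omega> = (\<Sum>k<N. ?D k \<omega> *\<^sub>R \<xi> k \<omega>)"
      unfolding elem_int_def sum_subtractf[symmetric]
    proof (intro sum.cong refl)
      fix k
      have "(W (min t (b k)) \<omega> - W (min t (a k)) \<omega>) - (W (min s (b k)) \<omega> - W (min s (a k)) \<omega>) = ?D k \<omega>"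
        using cl[of "b k" \<omega>] cl[of "a k" \<omega>] by linarith
      then show "(W (min t (b k)) \<omega> - W (min t (a k)) \<omega>) *\<^sub>R \<xi> k \<omega> - (W (min s (b k)) \<omega> - W (min s (a k)) \<omega>) *\<^sub>R \<xi> k \<omega>
        = ?D k \<omega> *\<^sub>R \<xi> k \<omega>" by (metis scaleR_diff_left)
    qed
    then show ?thesis by (simp add: inner_sum_right mult.commute)
  qed
  have Zi: "integrable M Z" using Z st by (intro integrable_of_nn_sq F_measurable[of Z s]) auto
  have t: "integrable M (\<lambda>\<omega>. (Z \<omega> \<bullet> \<xi> k \<omega>) * ?D k \<omega>) \<and> (LINT \<omega>|M. (Z \<omega> \<bullet> \<xi> k \<omega>) * ?D k \<omega>) = 0" if kN: "k < N" for k
  proof -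
    have k: "0 \<le> a k" "a k \<le> b k" "\<xi> k \<in> borel_measurable (F (a k))" using e kN by (auto simp: elem_data_def)
    obtain K where K: "\<And>\<omega>. \<omega> \<in> space M \<Longrightarrow> norm (\<xi> k \<omega>) \<le> K" using e kN unfolding elem_data_def by meson
    show ?thesis
    proof (cases "a k < t")
      case False
      then have "min t (a k) = t" "min t (b k) = t" using k by auto
      then show ?thesis by simp
    next
      case True
      let ?a = "max s (min t (a k))"
      have "Z \<in> borel_measurable (F ?a)" "\<xi> k \<in> borel_measurable (F ?a)"
        using F_measurable_mono[OF Z(1) st(1), of ?a] F_measurable_mono[OF k(3,1), of ?a] True by auto
      then have m: "(\<lambda>\<omega>. Z \<omega> \<bullet> \<xi> k \<omega>) \<in> borel_measurable (F ?a)" by measurable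
      have i: "integrable M (\<lambda>\<omega>. Z \<omega> \<bullet> \<xi> k \<omega>)"
      proof (rule Bochner_Integration.integrable_bound[OF integrable_mult_right[OF integrable_norm[OF Zi], of K]])
        show "(\<lambda>\<omega>. Z \<omega> \<bullet> \<xi> k \<omega>) \<in> borel_measurable M" using F_measurable[OF m] st by simp
        show "AE \<omega> in M. norm (Z \<omega> \<bullet> \<xi> k \<omega>) \<le> norm (K * norm (Z \<omega>))"
        proof (rule AE_I2)
          fix \<omega> assume "\<omega> \<in> space M"
          from K[OF this] have K': "norm (\<xi> k \<omega>) \<le> \<bar>K\<bar>" by linarith
          have "norm (Z \<omega> \<bullet> \<xi> k \<omega>) \<le> norm (Z \<omega>) * norm (\<xi> k \<omega>)" using Cauchy_Schwarz_ineq2 by simp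
          also have "\<dots> \<le> norm (Z \<omega>) * \<bar>K\<bar>" using K' by (intro mult_left_mono) auto
          finally show "norm (Z \<omega> \<bullet> \<xi> k \<omega>) \<le> norm (K * norm (Z \<omega>))" by (simp add: abs_mult mult.commute)
        qed
      qed
      show ?thesis using brownian_increment(1,2)[OF W _ _ m i, of "max s (min t (b k))"] st k by auto
    qed
  qed
  show ?thesis unfolding eq using t by (simp add: Bochner_Integration.integral_sum)
qed

end

section \<open>Doob's inequality\<close>

primrec run_max :: "(nat \<Rightarrow> real) \<Rightarrow> nat \<Rightarrow> real" where
  "run_max s 0 = s 0"
| "run_max s (Suc n) = max (run_max s n) (s (Suc n))"

lemma run_max_ge: "k \<le> n \<Longrightarrow> s k \<le> run_max s n"
  by (induction n) (auto simp: le_Suc_eq max.coboundedI1)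

lemma run_max_attained: "\<exists>k\<le>n. run_max s n = s k"
proof (induction n)
  case (Suc n)
  then obtain k where "k \<le> n" "run_max s n = s k" by auto
  then show ?case by (cases "s k \<le> s (Suc n)") (auto simp: max_def intro: exI[of _ k])
qed simp

lemma run_max_square_le_sum: "(run_max s n)\<^sup>2 \<le> (\<Sum>k\<le>n. (s k)\<^sup>2)"
proof -
  obtain k where k: "k \<le> n" "run_max s n = s k" using run_max_attained by blast
  have "(s k)\<^sup>2 \<le> (\<Sum>k\<le>n. (s k)\<^sup>2)" by (rule member_le_sum) (use k in auto)
  then show ?thesis using k by simp
qed

text \<open>The sum is a discrete stochastic integral of the running maximum. For norms of a
  martingale its expectation is nonnegative, so taking expectations turns this deterministic
  inequality into Doob's L^2 inequality with its constant 4.\<close>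

lemma doob_pathwise:
  "(run_max s n)\<^sup>2 + 4 * (\<Sum>k<n. run_max s k * (s (Suc k) - s k)) \<le> 4 * (s n)\<^sup>2"
proof -
  \<comment> \<open>Summation by parts as an invariant. At a new maximum x its right side becomes 2
    x^2, which exceeds the value 4 m x - 2 m^2 for the old maximum m by 2 (m - x)^2. Completing a
    square in the end gives the claim.\<close>
  have "4 * (\<Sum>k<n. run_max s k * (s (Suc k) - s k)) \<le> 4 * run_max s n * s n - 2 * (run_max s n)\<^sup>2"
  proof (induction n)
    case 0
    show ?case by (simp add: power2_eq_square)
  next
    case (Suc n)
    let ?m = "run_max s n" and ?x = "s (Suc n)"
    have 1: "4 * (\<Sum>k<Suc n. run_max s k * (s (Suc k) - s k)) \<le> 4 * ?m * ?x - 2 * ?m\<^sup>2"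
      using Suc by (simp add: algebra_simps)
    have 2: "4 * ?m * ?x - 2 * ?m\<^sup>2 \<le> 2 * ?x\<^sup>2"
      using zero_le_power2[of "?m - ?x"] unfolding power2_diff by (simp add: algebra_simps)
    show ?case
    proof (cases "?m \<le> ?x")
      case True
      then have "run_max s (Suc n) = ?x" by simp
      then show ?thesis using 1 2 by (simp add: power2_eq_square)
    next
      case False
      then have "run_max s (Suc n) = ?m" by simp
      then show ?thesis using 1 by simp
    qed
  qed
  moreover have "0 \<le> (2 * s n - run_max s n)\<^sup>2" by simp
  ultimately show ?thesis unfolding power2_diff power_mult_distrib by (simp add: algebra_simps)
qed

text \<open>Young's inequality instead of Cauchy-Schwarz: the free \<delta> lets one factor stay
  bounded while the other tends to zero.\<close>

lemma integrable_inner_sq: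
  fixes f g :: "'w \<Rightarrow> 'a::euclidean_space"
  assumes [measurable]: "f \<in> borel_measurable M" "g \<in> borel_measurable M"
    and i: "integrable M (\<lambda>\<omega>. (norm (f \<omega>))\<^sup>2)" "integrable M (\<lambda>\<omega>. (norm (g \<omega>))\<^sup>2)"
  shows "integrable M (\<lambda>\<omega>. f \<omega> \<bullet> g \<omega>)"
    and "\<delta> > 0 \<Longrightarrow> \<bar>LINT \<omega>|M. f \<omega> \<bullet> g \<omega>\<bar> \<le> \<delta> * (LINT \<omega>|M. (norm (f \<omega>))\<^sup>2) + (LINT \<omega>|M. (norm (g \<omega>))\<^sup>2) / \<delta>"
proof -
  have bd: "\<bar>x \<bullet> y\<bar> \<le> \<delta> * (norm x)\<^sup>2 + (norm y)\<^sup>2 / \<delta>" if "\<delta> > 0" for x y :: 'a and \<delta>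
  proof -
    have "0 \<le> (sqrt \<delta> * norm x - norm y / sqrt \<delta>)\<^sup>2" by simp
    also have "\<dots> = \<delta> * (norm x)\<^sup>2 + (norm y)\<^sup>2 / \<delta> - 2 * (norm x * norm y)"
      using that by (simp add: power2_diff power_mult_distrib power_divide)
    finally have "2 * (norm x * norm y) \<le> \<delta> * (norm x)\<^sup>2 + (norm y)\<^sup>2 / \<delta>" by simp
    moreover have "\<bar>x \<bullet> y\<bar> \<le> norm x * norm y" by (rule Cauchy_Schwarz_ineq2)
    moreover have "0 \<le> norm x * norm y" by simp
    ultimately show ?thesis by linarith
  qed
  show i3: "integrable M (\<lambda>\<omega>. f \<omega> \<bullet> g \<omega>)"
  proof (rule Bochner_Integration.integrable_bound)
    show "integrable M (\<lambda>\<omega>. (norm (f \<omega>))\<^sup>2 + (norm (g \<omega>))\<^sup>2)" using i by simp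
    show "AE \<omega> in M. norm (f \<omega> \<bullet> g \<omega>) \<le> norm ((norm (f \<omega>))\<^sup>2 + (norm (g \<omega>))\<^sup>2)"
    proof (rule AE_I2)
      fix \<omega>
      show "norm (f \<omega> \<bullet> g \<omega>) \<le> norm ((norm (f \<omega>))\<^sup>2 + (norm (g \<omega>))\<^sup>2)"
        using bd[of 1 "f \<omega>" "g \<omega>"] by (simp add: abs_of_nonneg)
    qed
  qed simp
  assume d: "\<delta> > 0"
  have "\<bar>LINT \<omega>|M. f \<omega> \<bullet> g \<omega>\<bar> \<le> (LINT \<omega>|M. \<bar>f \<omega> \<bullet> g \<omega>\<bar>)" by (rule integral_abs_bound)
  also have "\<dots> \<le> (LINT \<omega>|M. \<delta> * (norm (f \<omega>))\<^sup>2 + (norm (g \<omega>))\<^sup>2 / \<delta>)"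
    using i i3 bd[OF d] by (intro integral_mono) auto
  also have "\<dots> = \<delta> * (LINT \<omega>|M. (norm (f \<omega>))\<^sup>2) + (LINT \<omega>|M. (norm (g \<omega>))\<^sup>2) / \<delta>"
    using i by simp
  finally show "\<bar>LINT \<omega>|M. f \<omega> \<bullet> g \<omega>\<bar> \<le> \<delta> * (LINT \<omega>|M. (norm (f \<omega>))\<^sup>2) + (LINT \<omega>|M. (norm (g \<omega>))\<^sup>2) / \<delta>" .
qed

text \<open>The dyadic points of [0, T] are countable and nested in n, so for continuous paths they
  carry suprema over time and identities at all times. Rounding down keeps the points inside
  [0, T].\<close>

lemma dyadic_approx:
  fixes T t :: real
  assumes T: "0 < T" and t: "t \<in> {0..T}"
  shows "\<exists>k. (\<forall>n. k n \<le> (2::nat) ^ n) \<and> (\<lambda>n. T * real (k n) / 2 ^ n) \<longlonglongrightarrow> t"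
proof -
  define k where "k n = nat \<lfloor>t * 2 ^ n / T\<rfloor>" for n :: nat
  have k0: "real (k n) = of_int \<lfloor>t * 2 ^ n / T\<rfloor>" for n
    using t T by (simp add: k_def)
  have k1: "real (k n) \<le> t * 2 ^ n / T" "t * 2 ^ n / T - 1 \<le> real (k n)" for n
    unfolding k0 by linarith+
  have "t * 2 ^ n / T \<le> 2 ^ n" for n using t T by (auto simp: divide_simps)
  then have "real (k n) \<le> real (2 ^ n)" for n using k1(1)[of n] order_trans by fastforce
  then have kn: "k n \<le> 2 ^ n" for n by (simp only: of_nat_le_iff)
  have 2: "T * real (k n) / 2 ^ n \<le> t" "t - T / 2 ^ n \<le> T * real (k n) / 2 ^ n" for n
  proof -
    show "T * real (k n) / 2 ^ n \<le> t" using k1[of n] T by (auto simp: field_simps)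
    have "t * 2 ^ n - T \<le> T * real (k n)" using k1(2)[of n] T by (simp add: field_simps)
    then have "(t * 2 ^ n - T) / 2 ^ n \<le> T * real (k n) / 2 ^ n" by (rule divide_right_mono) simp
    then show "t - T / 2 ^ n \<le> T * real (k n) / 2 ^ n" by (simp add: diff_divide_distrib)
  qed
  have "(\<lambda>n. t - T / 2 ^ n) \<longlonglongrightarrow> t - 0"
    by (intro tendsto_diff tendsto_const LIMSEQ_divide_realpow_zero) auto
  then have lim: "(\<lambda>n. T * real (k n) / 2 ^ n) \<longlonglongrightarrow> t"
    by (intro tendsto_sandwich[of "\<lambda>n. t - T / 2 ^ n" "\<lambda>n. T * real (k n) / 2 ^ n" sequentially "\<lambda>n. t"]) (use 2 in auto)
  then show ?thesis using kn by blast
qed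

context filtered_space begin

text \<open>Square-integrable martingales, with the martingale property tested against
  square-integrable \<open>F s\<close>-measurable Z in place of conditional expectations; this form
  passes directly to mean-square limits.\<close>

definition l2mart :: "real \<Rightarrow> (real \<Rightarrow> 'w \<Rightarrow> 'a::euclidean_space) \<Rightarrow> bool" where
  "l2mart T X \<longleftrightarrow> (\<forall>t\<in>{0..T}. X t \<in> borel_measurable (F t) \<and> nn_sq M (X t) < \<infinity>) \<and>
    (\<forall>s t Z. 0 \<le> s \<and> s \<le> t \<and> t \<le> T \<and> Z \<in> borel_measurable (F s) \<and> nn_sq M Z < \<infinity> \<longrightarrow>
       (LINT \<omega>|M. Z \<omega> \<bullet> (X t \<omega> - X s \<omega>)) = 0)"

lemma l2mart_measurable: "l2mart T X \<Longrightarrow> t \<in> {0..T} \<Longrightarrow> X t \<in> borel_measurable (F t)"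
  and l2mart_measurable_M: "l2mart T X \<Longrightarrow> t \<in> {0..T} \<Longrightarrow> X t \<in> borel_measurable M"
  and l2mart_finite: "l2mart T X \<Longrightarrow> t \<in> {0..T} \<Longrightarrow> nn_sq M (X t) < \<infinity>"
  by (auto simp: l2mart_def intro: F_measurable)

lemma l2mart_orthogonal:
  "l2mart T X \<Longrightarrow> 0 \<le> s \<Longrightarrow> s \<le> t \<Longrightarrow> t \<le> T \<Longrightarrow> Z \<in> borel_measurable (F s) \<Longrightarrow> nn_sq M Z < \<infinity>
    \<Longrightarrow> (LINT \<omega>|M. Z \<omega> \<bullet> (X t \<omega> - X s \<omega>)) = 0"
  by (auto simp: l2mart_def)

lemma integrable_diff_sq:
  fixes f g :: "'w \<Rightarrow> 'a::euclidean_space"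
  assumes [measurable]: "f \<in> borel_measurable M" "g \<in> borel_measurable M"
    and "nn_sq M f < \<infinity>" "nn_sq M g < \<infinity>"
  shows "integrable M (\<lambda>\<omega>. (norm (f \<omega> - g \<omega>))\<^sup>2)"
proof (rule integrable_of_nn_sq(2))
  have "nn_sq M (\<lambda>\<omega>. f \<omega> - g \<omega>) \<le> 2 * nn_sq M f + 2 * nn_sq M (\<lambda>\<omega>. - g \<omega>)"
    using nn_sq_add_le[of f M "\<lambda>\<omega>. - g \<omega>"] by simp
  also have "\<dots> < \<infinity>" using assms by (simp add: ennreal_mult_less_top)
  finally show "nn_sq M (\<lambda>\<omega>. f \<omega> - g \<omega>) < \<infinity>" .
qed simp

text \<open>X is vector valued, so the increment of |X| is bounded below by the increment of X in
  the direction of its current value. Multiplied by the running maximum this is an increment tested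
  against a past variable, which has mean zero; \<open>doob_pathwise\<close> then gives the constant
  4.\<close>

lemma doob_discrete:
  fixes X :: "real \<Rightarrow> 'w \<Rightarrow> 'a::euclidean_space"
  assumes X: "l2mart T X" and \<tau>: "\<And>k. k \<le> n \<Longrightarrow> \<tau> k \<in> {0..T}" "\<And>k. k < n \<Longrightarrow> \<tau> k \<le> \<tau> (Suc k)"
  shows "(\<integral>\<^sup>+ \<omega>. ennreal ((run_max (\<lambda>k. norm (X (\<tau> k) \<omega>)) n)\<^sup>2) \<partial>M) \<le> 4 * nn_sq M (X (\<tau> n))"
proof -
  let ?s = "\<lambda>\<omega> k. norm (X (\<tau> k) \<omega>)"
  let ?m = "\<lambda>k \<omega>. run_max (?s \<omega>) k"
  have Xi: "integrable M (\<lambda>\<omega>. (?s \<omega> k)\<^sup>2)" if "k \<le> n" for k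
    using integrable_of_nn_sq(2)[OF l2mart_measurable_M[OF X \<tau>(1)[OF that]] l2mart_finite[OF X \<tau>(1)[OF that]]] .
  have mm: "?m k \<in> borel_measurable (F (\<tau> k))" if "k \<le> n" for k
    using that
  proof (induction k)
    case 0
    then show ?case using l2mart_measurable[OF X \<tau>(1)[of 0]] by simp
  next
    case (Suc k)
    have "k \<le> n" "k < n" using Suc.prems by auto
    then have "?m k \<in> borel_measurable (F (\<tau> (Suc k)))"
      using Suc.IH \<tau>(1)[of k] \<tau>(2)[of k] by (meson F_measurable_mono atLeastAtMost_iff)
    then show ?case using l2mart_measurable[OF X \<tau>(1)[OF Suc.prems]] by simp
  qed
  have mM: "?m k \<in> borel_measurable M" if "k \<le> n" for k
    using F_measurable[OF mm[OF that]] \<tau>(1)[OF that] by simp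
  have mi: "integrable M (\<lambda>\<omega>. (?m k \<omega>)\<^sup>2)" if "k \<le> n" for k
  proof (rule Bochner_Integration.integrable_bound)
    show "integrable M (\<lambda>\<omega>. \<Sum>j\<le>k. (?s \<omega> j)\<^sup>2)" using Xi that by (intro Bochner_Integration.integrable_sum) auto
    show "(\<lambda>\<omega>. (?m k \<omega>)\<^sup>2) \<in> borel_measurable M" using mM[OF that] by simp
    show "AE \<omega> in M. norm ((?m k \<omega>)\<^sup>2) \<le> norm (\<Sum>j\<le>k. (?s \<omega> j)\<^sup>2)"
    proof (rule AE_I2)
      fix \<omega>
      have "(?m k \<omega>)\<^sup>2 \<le> (\<Sum>j\<le>k. (?s \<omega> j)\<^sup>2)" by (rule run_max_square_le_sum)
      moreover have "0 \<le> (\<Sum>j\<le>k. (?s \<omega> j)\<^sup>2)" by (intro sum_nonneg) auto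
      ultimately show "norm ((?m k \<omega>)\<^sup>2) \<le> norm (\<Sum>j\<le>k. (?s \<omega> j)\<^sup>2)" by simp
    qed
  qed
  \<comment> \<open>The running maximum times the unit vector along X. Where X vanishes the
    expression is 0, and \<open>Zle\<close> reduces to nonnegativity of its right side.\<close>
  let ?Z = "\<lambda>k \<omega>. (?m k \<omega> / ?s \<omega> k) *\<^sub>R X (\<tau> k) \<omega>"
  have m0: "0 \<le> ?m k \<omega>" for k \<omega> using run_max_ge[of k k "?s \<omega>"] norm_ge_zero order_trans by blast
  have Zn: "norm (?Z k \<omega>) \<le> ?m k \<omega>" for k \<omega> using m0[of \<omega> k] by (auto simp: divide_simps)
  have Zm: "?Z k \<in> borel_measurable (F (\<tau> k))" if "k \<le> n" for k
    using mm[OF that] l2mart_measurable[OF X \<tau>(1)[OF that]] by measurable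
  have Zsq: "nn_sq M (?Z k) < \<infinity>" if "k \<le> n" for k
  proof -
    have "nn_sq M (?Z k) \<le> (\<integral>\<^sup>+ \<omega>. ennreal ((?m k \<omega>)\<^sup>2) \<partial>M)"
      by (intro nn_integral_mono ennreal_leI power_mono Zn) auto
    also have "\<dots> < \<infinity>" using mi[OF that] by (subst nn_integral_eq_integral) auto
    finally show ?thesis .
  qed
  have Zi: "integrable M (\<lambda>\<omega>. ?Z k \<omega> \<bullet> (X (\<tau> (Suc k)) \<omega> - X (\<tau> k) \<omega>))"
    "(LINT \<omega>|M. ?Z k \<omega> \<bullet> (X (\<tau> (Suc k)) \<omega> - X (\<tau> k) \<omega>)) = 0" if "k < n" for k
  proof -
    have k: "k \<le> n" "Suc k \<le> n" using that by auto
    have [measurable]: "X (\<tau> (Suc k)) \<in> borel_measurable M" "X (\<tau> k) \<in> borel_measurable M"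
      using l2mart_measurable_M[OF X \<tau>(1)] k by auto
    have ZM[measurable]: "?Z k \<in> borel_measurable M" using F_measurable[OF Zm] \<tau>(1) k by auto
    show "integrable M (\<lambda>\<omega>. ?Z k \<omega> \<bullet> (X (\<tau> (Suc k)) \<omega> - X (\<tau> k) \<omega>))"
      by (rule integrable_inner_sq(1)[OF ZM _ integrable_of_nn_sq(2)[OF ZM Zsq[OF k(1)]]
          integrable_diff_sq[OF _ _ l2mart_finite[OF X \<tau>(1)[OF k(2)]] l2mart_finite[OF X \<tau>(1)[OF k(1)]]]]) measurable
    show "(LINT \<omega>|M. ?Z k \<omega> \<bullet> (X (\<tau> (Suc k)) \<omega> - X (\<tau> k) \<omega>)) = 0"
      using \<tau>(1)[OF k(1)] \<tau>(1)[OF k(2)] \<tau>(2)[OF that]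
      by (intro l2mart_orthogonal[OF X _ _ _ Zm[OF k(1)] Zsq[OF k(1)]]) auto
  qed
  have Zle: "?Z k \<omega> \<bullet> (X (\<tau> (Suc k)) \<omega> - X (\<tau> k) \<omega>) \<le> ?m k \<omega> * (?s \<omega> (Suc k) - ?s \<omega> k)" for k \<omega>
  proof -
    have "?Z k \<omega> \<bullet> X (\<tau> (Suc k)) \<omega> \<le> norm (?Z k \<omega>) * ?s \<omega> (Suc k)" by (rule norm_cauchy_schwarz)
    also have "\<dots> \<le> ?m k \<omega> * ?s \<omega> (Suc k)" by (rule mult_right_mono[OF Zn]) simp
    finally have 1: "?Z k \<omega> \<bullet> X (\<tau> (Suc k)) \<omega> \<le> ?m k \<omega> * ?s \<omega> (Suc k)" .
    have "?Z k \<omega> \<bullet> X (\<tau> k) \<omega> = ?m k \<omega> * ?s \<omega> k"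
      by (cases "X (\<tau> k) \<omega> = 0") (auto simp: power2_norm_eq_inner[symmetric] power2_eq_square)
    then show ?thesis using 1 by (simp add: inner_diff_right right_diff_distrib)
  qed
  have pw: "(?m n \<omega>)\<^sup>2 + 4 * (\<Sum>k<n. ?Z k \<omega> \<bullet> (X (\<tau> (Suc k)) \<omega> - X (\<tau> k) \<omega>)) \<le> 4 * (?s \<omega> n)\<^sup>2" for \<omega>
  proof -
    have "(\<Sum>k<n. ?Z k \<omega> \<bullet> (X (\<tau> (Suc k)) \<omega> - X (\<tau> k) \<omega>)) \<le> (\<Sum>k<n. ?m k \<omega> * (?s \<omega> (Suc k) - ?s \<omega> k))"
      by (intro sum_mono Zle)
    then show ?thesis using doob_pathwise[of "?s \<omega>" n] by linarith
  qed
  have iS: "integrable M (\<lambda>\<omega>. \<Sum>k<n. ?Z k \<omega> \<bullet> (X (\<tau> (Suc k)) \<omega> - X (\<tau> k) \<omega>))"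
    using Zi(1) by (intro Bochner_Integration.integrable_sum) auto
  have S0: "(LINT \<omega>|M. (\<Sum>k<n. ?Z k \<omega> \<bullet> (X (\<tau> (Suc k)) \<omega> - X (\<tau> k) \<omega>))) = 0"
  proof -
    have "(LINT \<omega>|M. (\<Sum>k<n. ?Z k \<omega> \<bullet> (X (\<tau> (Suc k)) \<omega> - X (\<tau> k) \<omega>))) =
       (\<Sum>k<n. (LINT \<omega>|M. ?Z k \<omega> \<bullet> (X (\<tau> (Suc k)) \<omega> - X (\<tau> k) \<omega>)))"
      using Zi(1) by (intro Bochner_Integration.integral_sum) auto
    also have "\<dots> = 0" using Zi(2) by (intro sum.neutral) auto
    finally show ?thesis .
  qed
  have "(LINT \<omega>|M. (?m n \<omega>)\<^sup>2) = (LINT \<omega>|M. (?m n \<omega>)\<^sup>2 + 4 * (\<Sum>k<n. ?Z k \<omega> \<bullet> (X (\<tau> (Suc k)) \<omega> - X (\<tau> k) \<omega>)))"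
    using iS mi[of n] S0 by (subst Bochner_Integration.integral_add) auto
  also have "\<dots> \<le> (LINT \<omega>|M. 4 * (?s \<omega> n)\<^sup>2)"
    using iS mi[of n] Xi[of n] by (intro integral_mono pw Bochner_Integration.integrable_add integrable_mult_right) auto
  finally have "(LINT \<omega>|M. (?m n \<omega>)\<^sup>2) \<le> 4 * (LINT \<omega>|M. (?s \<omega> n)\<^sup>2)" by simp
  then have "ennreal (LINT \<omega>|M. (?m n \<omega>)\<^sup>2) \<le> ennreal (4 * (LINT \<omega>|M. (?s \<omega> n)\<^sup>2))" by (rule ennreal_leI)
  then show ?thesis
    using mi[of n] Xi[of n] by (simp add: nn_integral_eq_integral ennreal_mult)
qed

text \<open>A supremum over uncountably many times need not be measurable, so a measurable majorant
  G is produced, the supremum over dyadic times. The grids are nested, so monotone convergence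
  applies, and continuity makes G dominate the full supremum almost everywhere.\<close>

lemma doob_majorant:
  fixes X :: "real \<Rightarrow> 'w \<Rightarrow> 'a::euclidean_space"
  assumes X: "l2mart T X" and T: "0 < T" and cont: "AE \<omega> in M. continuous_on {0..T} (\<lambda>t. X t \<omega>)"
  obtains G where "G \<in> borel_measurable M" "(\<integral>\<^sup>+ \<omega>. G \<omega> \<partial>M) \<le> 4 * nn_sq M (X T)"
    "AE \<omega> in M. (SUP t\<in>{0..T}. ennreal ((norm (X t \<omega>))\<^sup>2)) \<le> G \<omega>"
proof -
  define \<tau> where "\<tau> n k = T * real k / 2 ^ n" for n k :: nat
  have \<tau>T: "\<tau> n k \<in> {0..T}" if "k \<le> 2 ^ n" for n k
  proof -
    have "real k \<le> 2 ^ n" using that by (metis of_nat_le_iff of_nat_numeral of_nat_power)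
    then show ?thesis using T by (auto simp: \<tau>_def divide_simps)
  qed
  define h where "h n \<omega> = (SUP k\<in>{..(2::nat) ^ n}. ennreal ((norm (X (\<tau> n k) \<omega>))\<^sup>2))" for n \<omega>
  have hm: "h n \<in> borel_measurable M" for n
    unfolding h_def[abs_def] using l2mart_measurable_M[OF X \<tau>T] by (intro borel_measurable_SUP) auto
  have hle: "(\<integral>\<^sup>+ \<omega>. h n \<omega> \<partial>M) \<le> 4 * nn_sq M (X T)" for n
  proof -
    have "(\<integral>\<^sup>+ \<omega>. h n \<omega> \<partial>M) \<le> (\<integral>\<^sup>+ \<omega>. ennreal ((run_max (\<lambda>k. norm (X (\<tau> n k) \<omega>)) (2 ^ n))\<^sup>2) \<partial>M)"
      unfolding h_def
      by (intro nn_integral_mono SUP_least ennreal_leI power_mono run_max_ge) auto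
    also have "\<dots> \<le> 4 * nn_sq M (X (\<tau> n (2 ^ n)))"
      using T by (intro doob_discrete[OF X \<tau>T]) (auto simp: \<tau>_def divide_simps)
    finally show ?thesis by (simp add: \<tau>_def)
  qed
  have "incseq h"
  proof (intro incseq_SucI le_funI)
    fix n \<omega>
    show "h n \<omega> \<le> h (Suc n) \<omega>" unfolding h_def
    proof (rule SUP_least)
      fix k assume "k \<in> {..(2::nat) ^ n}"
      then have "2 * k \<in> {..2 ^ Suc n}" by auto
      moreover have "\<tau> n k = \<tau> (Suc n) (2 * k)" by (simp add: \<tau>_def)
      ultimately show "ennreal ((norm (X (\<tau> n k) \<omega>))\<^sup>2) \<le> (SUP k\<in>{..(2::nat) ^ Suc n}. ennreal ((norm (X (\<tau> (Suc n) k) \<omega>))\<^sup>2))"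
        by (metis (no_types, lifting) SUP_upper)
    qed
  qed
  have "AE \<omega> in M. (SUP t\<in>{0..T}. ennreal ((norm (X t \<omega>))\<^sup>2)) \<le> (SUP n. h n \<omega>)"
    using cont
  proof eventually_elim
    case (elim \<omega>)
    show ?case
    proof (rule SUP_least)
      fix t assume t: "t \<in> {0..T}"
      obtain k where kn: "\<And>n. k n \<le> 2 ^ n" and lim: "(\<lambda>n. \<tau> n (k n)) \<longlonglongrightarrow> t"
        using dyadic_approx[OF T t] unfolding \<tau>_def by blast
      have "(\<lambda>n. X (\<tau> n (k n)) \<omega>) \<longlonglongrightarrow> X t \<omega>"
        using continuous_on_tendsto_compose[OF elim lim t] \<tau>T[OF kn] by auto
      then have lim': "(\<lambda>n. ennreal ((norm (X (\<tau> n (k n)) \<omega>))\<^sup>2)) \<longlonglongrightarrow> ennreal ((norm (X t \<omega>))\<^sup>2)"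
        by (intro tendsto_ennrealI tendsto_power tendsto_norm)
      have le: "ennreal ((norm (X (\<tau> n (k n)) \<omega>))\<^sup>2) \<le> (SUP n. h n \<omega>)" for n
      proof -
        have "ennreal ((norm (X (\<tau> n (k n)) \<omega>))\<^sup>2) \<le> h n \<omega>" unfolding h_def using kn by (intro SUP_upper) auto
        also have "\<dots> \<le> (SUP n. h n \<omega>)" by (rule SUP_upper) simp
        finally show ?thesis .
      qed
      show "ennreal ((norm (X t \<omega>))\<^sup>2) \<le> (SUP n. h n \<omega>)"
        by (rule LIMSEQ_le_const2[OF lim']) (use le in blast)
    qed
  qed
  moreover have "(\<lambda>\<omega>. SUP n. h n \<omega>) \<in> borel_measurable M" using hm by measurable
  moreover have "(\<integral>\<^sup>+ \<omega>. (SUP n. h n \<omega>) \<partial>M) \<le> 4 * nn_sq M (X T)"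
  proof -
    have "(\<integral>\<^sup>+ \<omega>. (SUP n. h n \<omega>) \<partial>M) = (SUP n. \<integral>\<^sup>+ \<omega>. h n \<omega> \<partial>M)"
      by (rule nn_integral_monotone_convergence_SUP[OF \<open>incseq h\<close> hm])
    also have "\<dots> \<le> 4 * nn_sq M (X T)" by (intro SUP_least hle)
    finally show ?thesis .
  qed
  ultimately show thesis using that by blast
qed

text \<open>X t - X s is compared with Y k t - Y k s, whose pairing with Z vanishes; the two errors
  are small by Young's inequality.\<close>

lemma l2mart_limit:
  fixes X :: "real \<Rightarrow> 'w \<Rightarrow> 'a::euclidean_space"
  assumes Y: "\<And>k. l2mart T (Y k)" and Xm: "\<And>t. t \<in> {0..T} \<Longrightarrow> X t \<in> borel_measurable (F t)"
    and lim: "\<And>t. t \<in> {0..T} \<Longrightarrow> (\<lambda>k::nat. nn_sq M (\<lambda>\<omega>. X t \<omega> - Y k t \<omega>)) \<longlonglongrightarrow> 0"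
  shows "l2mart T X"
proof -
  have XM: "X t \<in> borel_measurable M" if "t \<in> {0..T}" for t using F_measurable[OF Xm[OF that]] that by simp
  have YM: "Y k t \<in> borel_measurable M" if "t \<in> {0..T}" for t k using l2mart_measurable_M[OF Y that] .
  have fin: "nn_sq M (X t) < \<infinity>" if t: "t \<in> {0..T}" for t
  proof -
    have "eventually (\<lambda>k. nn_sq M (\<lambda>\<omega>. X t \<omega> - Y k t \<omega>) < 1) sequentially"
      using order_tendstoD(2)[OF lim[OF t]] by auto
    then obtain k where k: "nn_sq M (\<lambda>\<omega>. X t \<omega> - Y k t \<omega>) < 1" by (auto dest: eventually_happens)
    have "nn_sq M (X t) \<le> 2 * nn_sq M (\<lambda>\<omega>. X t \<omega> - Y k t \<omega>) + 2 * nn_sq M (Y k t)"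
      using nn_sq_add_le[of "\<lambda>\<omega>. X t \<omega> - Y k t \<omega>" M "Y k t"] XM[OF t] YM[OF t] by simp
    also have "\<dots> < \<infinity>" using k l2mart_finite[OF Y t] by (auto simp: ennreal_mult_less_top intro: less_trans)
    finally show ?thesis .
  qed
  show ?thesis unfolding l2mart_def
  proof (intro conjI ballI allI impI)
    fix s t and Z :: "'w \<Rightarrow> 'a"
    assume a: "0 \<le> s \<and> s \<le> t \<and> t \<le> T \<and> Z \<in> borel_measurable (F s) \<and> nn_sq M Z < \<infinity>"
    have ts: "t \<in> {0..T}" "s \<in> {0..T}" using a by auto
    have ZM[measurable]: "Z \<in> borel_measurable M" using a by (auto intro: F_measurable)
    note [measurable] = XM[OF ts(1)] XM[OF ts(2)] YM[OF ts(1)] YM[OF ts(2)]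
    have Zi: "integrable M (\<lambda>\<omega>. (norm (Z \<omega>))\<^sup>2)" using integrable_of_nn_sq(2)[OF ZM] a by auto
    define A where "A = (LINT \<omega>|M. (norm (Z \<omega>))\<^sup>2)"
    have A0: "0 \<le> A" by (simp add: A_def)
    let ?x = "LINT \<omega>|M. Z \<omega> \<bullet> (X t \<omega> - X s \<omega>)"
    have bound: "\<bar>?x\<bar> \<le> \<delta> * (2 * A + 2)" if d: "\<delta> > 0" for \<delta>
    proof -
      have "eventually (\<lambda>k. nn_sq M (\<lambda>\<omega>. X r \<omega> - Y k r \<omega>) < ennreal (\<delta>\<^sup>2)) sequentially" if "r \<in> {0..T}" for r
        using order_tendstoD(2)[OF lim[OF that], of "ennreal (\<delta>\<^sup>2)"] d by auto
      from eventually_conj[OF this[OF ts(1)] this[OF ts(2)]]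
      obtain k where k: "nn_sq M (\<lambda>\<omega>. X t \<omega> - Y k t \<omega>) < ennreal (\<delta>\<^sup>2)" "nn_sq M (\<lambda>\<omega>. X s \<omega> - Y k s \<omega>) < ennreal (\<delta>\<^sup>2)"
        by (auto dest!: eventually_happens)
      have e: "integrable M (\<lambda>\<omega>. Z \<omega> \<bullet> (X r \<omega> - Y k r \<omega>))" "\<bar>LINT \<omega>|M. Z \<omega> \<bullet> (X r \<omega> - Y k r \<omega>)\<bar> \<le> \<delta> * A + \<delta>"
        if r: "r \<in> {0..T}" and kr: "nn_sq M (\<lambda>\<omega>. X r \<omega> - Y k r \<omega>) < ennreal (\<delta>\<^sup>2)" for r
      proof -
        note [measurable] = XM[OF r] YM[OF r]
        have i: "integrable M (\<lambda>\<omega>. (norm (X r \<omega> - Y k r \<omega>))\<^sup>2)"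
          using kr by (intro integrable_of_nn_sq(2)) (auto intro: less_trans)
        have "ennreal (LINT \<omega>|M. (norm (X r \<omega> - Y k r \<omega>))\<^sup>2) < ennreal (\<delta>\<^sup>2)"
          using kr i by (simp add: nn_integral_eq_integral)
        then have "(LINT \<omega>|M. (norm (X r \<omega> - Y k r \<omega>))\<^sup>2) \<le> \<delta>\<^sup>2" by (simp add: ennreal_less_iff)
        then have "(LINT \<omega>|M. (norm (X r \<omega> - Y k r \<omega>))\<^sup>2) / \<delta> \<le> \<delta>" using d by (simp add: divide_simps power2_eq_square)
        moreover have "(\<lambda>\<omega>. X r \<omega> - Y k r \<omega>) \<in> borel_measurable M" by measurable
        note integrable_inner_sq(1)[OF ZM this Zi i] integrable_inner_sq(2)[OF ZM this Zi i d]
        ultimately show "integrable M (\<lambda>\<omega>. Z \<omega> \<bullet> (X r \<omega> - Y k r \<omega>))" "\<bar>LINT \<omega>|M. Z \<omega> \<bullet> (X r \<omega> - Y k r \<omega>)\<bar> \<le> \<delta> * A + \<delta>"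
          unfolding A_def by - (assumption, linarith)
      qed
      have iY: "integrable M (\<lambda>\<omega>. Z \<omega> \<bullet> (Y k t \<omega> - Y k s \<omega>))"
        using integrable_diff_sq[OF _ _ l2mart_finite[OF Y ts(1)] l2mart_finite[OF Y ts(2)], of k k]
        by (intro integrable_inner_sq(1) Zi) auto
      have Y0: "(LINT \<omega>|M. Z \<omega> \<bullet> (Y k t \<omega> - Y k s \<omega>)) = 0" using a by (intro l2mart_orthogonal[OF Y]) auto
      have "?x = (LINT \<omega>|M. (Z \<omega> \<bullet> (X t \<omega> - Y k t \<omega>) - Z \<omega> \<bullet> (X s \<omega> - Y k s \<omega>)) + Z \<omega> \<bullet> (Y k t \<omega> - Y k s \<omega>))"
        by (intro Bochner_Integration.integral_cong) (auto simp: inner_diff_right)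
      also have "\<dots> = (LINT \<omega>|M. Z \<omega> \<bullet> (X t \<omega> - Y k t \<omega>)) - (LINT \<omega>|M. Z \<omega> \<bullet> (X s \<omega> - Y k s \<omega>)) + 0"
        using e(1)[OF ts(1) k(1)] e(1)[OF ts(2) k(2)] iY Y0
        by (simp del: Bochner_Integration.integral_diff add: Bochner_Integration.integral_add Bochner_Integration.integral_diff)
      finally have "\<bar>?x\<bar> \<le> (\<delta> * A + \<delta>) + (\<delta> * A + \<delta>)" using e(2)[OF ts(1) k(1)] e(2)[OF ts(2) k(2)] by linarith
      then show ?thesis by (simp add: algebra_simps)
    qed
    have "\<bar>?x\<bar> \<le> 0"
    proof (rule field_le_epsilon)
      fix e :: real assume "e > 0"
      \<comment> \<open>This \<delta> turns the bound into e; the summand 2 keeps the denominator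
        positive when A = 0.\<close>
      then have "\<bar>?x\<bar> \<le> e / (2 * A + 2) * (2 * A + 2)" using A0 by (intro bound) auto
      then show "\<bar>?x\<bar> \<le> 0 + e" using A0 by (simp add: divide_simps split: if_splits)
    qed
    then show "?x = 0" by simp
  qed (use Xm fin in auto)
qed

end

section \<open>Density of simple processes\<close>

abbreviation nn_L1 :: "real \<Rightarrow> (real \<Rightarrow> 'a::real_normed_vector) \<Rightarrow> ennreal" where
  "nn_L1 T f \<equiv> \<integral>\<^sup>+ s. ennreal (norm (f s)) * indicator {0..T} s \<partial>lborel"

section \<open>Shifted step averages of a bounded function\<close>

definition cell :: "real \<Rightarrow> nat \<Rightarrow> nat \<Rightarrow> real set" where
  "cell T n k = {T * real k / real n<..T * real (Suc k) / real n}"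

text \<open>The first cell has no predecessor, and 0 is a value known at time 0.\<close>

definition cell_avg :: "real \<Rightarrow> nat \<Rightarrow> (real \<Rightarrow> 'a::euclidean_space) \<Rightarrow> nat \<Rightarrow> 'a" where
  "cell_avg T n f k = (if k = 0 then 0 else (real n / T) *\<^sub>R (LINT s|lborel. indicator (cell T n (k - 1)) s *\<^sub>R f s))"

text \<open>The average over a cell is used on the following cell, so that the resulting step process is
  non-anticipating.\<close>

definition step_avg :: "real \<Rightarrow> nat \<Rightarrow> (real \<Rightarrow> 'a::euclidean_space) \<Rightarrow> real \<Rightarrow> 'a" where
  "step_avg T n f t = (\<Sum>k<n. indicator (cell T n k) t *\<^sub>R cell_avg T n f k)"

lemma cell_borel [measurable]: "cell T n k \<in> sets borel"
  by (simp add: cell_def)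

lemma emeasure_cell: "0 < T \<Longrightarrow> 0 < n \<Longrightarrow> emeasure lborel (cell T n k) = ennreal (T / real n)"
  by (simp add: cell_def divide_simps algebra_simps)

lemma integrable_cell:
  fixes f :: "real \<Rightarrow> 'a::euclidean_space"
  assumes T: "0 < T" "k < n" and [measurable]: "f \<in> borel_measurable borel" and K: "\<And>s. norm (f s) \<le> K"
  shows "integrable lborel (\<lambda>s. indicator (cell T n k) s *\<^sub>R f s)"
proof (rule Bochner_Integration.integrable_bound)
  have "emeasure lborel (cell T n k) < \<infinity>" using emeasure_cell[of T n k] T by simp
  then show "integrable lborel (\<lambda>s. indicator (cell T n k) s * K)" by (intro integrable_mult_left integrable_real_indicator) auto
  have "0 \<le> K" using K[of 0] norm_ge_zero order_trans by blast
  then show "AE s in lborel. norm (indicator (cell T n k) s *\<^sub>R f s) \<le> norm (indicator (cell T n k) s * K)"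
    using K by (intro AE_I2) (auto simp: indicator_def)
qed simp

text \<open>Averaging with a shift contracts L^1, uniformly in n: the mass on a cell is at most the
  mass of f on the preceding one, and those cells are disjoint. This carries convergence over from
  continuous functions to bounded measurable ones.\<close>

lemma step_avg_L1_le:
  fixes f :: "real \<Rightarrow> 'a::euclidean_space"
  assumes T: "0 < T" and n: "0 < n" and [measurable]: "f \<in> borel_measurable borel" and K: "\<And>s. norm (f s) \<le> K"
  shows "nn_L1 T (step_avg T n f) \<le> nn_L1 T f"
proof -
  have "nn_L1 T (step_avg T n f) \<le> (\<integral>\<^sup>+ s. (\<Sum>k<n. ennreal (norm (cell_avg T n f k)) * indicator (cell T n k) s) \<partial>lborel)"
  proof (rule nn_integral_mono)
    fix s
    have "norm (step_avg T n f s) \<le> (\<Sum>k<n. norm (cell_avg T n f k) * indicator (cell T n k) s)"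
      unfolding step_avg_def by (rule order_trans[OF norm_sum]) (auto intro!: sum_mono simp: indicator_def)
    then have "ennreal (norm (step_avg T n f s)) \<le> (\<Sum>k<n. ennreal (norm (cell_avg T n f k)) * indicator (cell T n k) s)"
      by (subst ennreal_indicator[symmetric], subst ennreal_mult''[symmetric], simp, subst sum_ennreal) (auto intro!: ennreal_leI)
    then show "ennreal (norm (step_avg T n f s)) * indicator {0..T} s \<le> (\<Sum>k<n. ennreal (norm (cell_avg T n f k)) * indicator (cell T n k) s)"
      by (auto simp: indicator_def intro: order_trans)
  qed
  also have "\<dots> = (\<Sum>k<n. ennreal (norm (cell_avg T n f k)) * ennreal (T / real n))"
  proof -
    have "(\<integral>\<^sup>+ s. (\<Sum>k<n. ennreal (norm (cell_avg T n f k)) * indicator (cell T n k) s) \<partial>lborel) =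
      (\<Sum>k<n. \<integral>\<^sup>+ s. ennreal (norm (cell_avg T n f k)) * indicator (cell T n k) s \<partial>lborel)"
      by (rule nn_integral_sum) measurable
    then show ?thesis using emeasure_cell[OF T n] by (simp add: nn_integral_cmult)
  qed
  also have "\<dots> \<le> (\<Sum>k<n. if k = 0 then 0 else \<integral>\<^sup>+ s. ennreal (norm (f s)) * indicator (cell T n (k - 1)) s \<partial>lborel)"
  proof (rule sum_mono)
    fix k assume k: "k \<in> {..<n}"
    show "ennreal (norm (cell_avg T n f k)) * ennreal (T / real n) \<le>
      (if k = 0 then 0 else \<integral>\<^sup>+ s. ennreal (norm (f s)) * indicator (cell T n (k - 1)) s \<partial>lborel)"
    proof (cases "k = 0")
      case False
      let ?I = "LINT s|lborel. indicator (cell T n (k - 1)) s *\<^sub>R f s"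
      have "ennreal (norm (cell_avg T n f k)) * ennreal (T / real n) = ennreal (norm ?I)"
        using False T n by (simp add: cell_avg_def ennreal_mult''[symmetric])
      also have "\<dots> \<le> (\<integral>\<^sup>+ s. ennreal (norm (indicator (cell T n (k - 1)) s *\<^sub>R f s)) \<partial>lborel)"
        using False k by (intro integral_norm_bound_ennreal integrable_cell[OF T _ _ K]) auto
      also have "\<dots> = (\<integral>\<^sup>+ s. ennreal (norm (f s)) * indicator (cell T n (k - 1)) s \<partial>lborel)"
        by (intro nn_integral_cong) (auto simp: indicator_def)
      finally show ?thesis using False by simp
    qed (simp add: cell_avg_def)
  qed
  also have "\<dots> \<le> nn_L1 T f"
  proof -
    \<comment> \<open>The integrals over the first m - 1 cells combine into one over (0, T (m - 1) /
      n]; the last cell is lost by the shift.\<close>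
    have tel: "(\<Sum>k<m. if k = 0 then 0 else \<integral>\<^sup>+ s. ennreal (norm (f s)) * indicator (cell T n (k - 1)) s \<partial>lborel)
      = (\<integral>\<^sup>+ s. ennreal (norm (f s)) * indicator {0<..T * real (m - 1) / real n} s \<partial>lborel)" for m
    proof (induction m)
      case (Suc m)
      show ?case
      proof (cases "m = 0")
        case False
        have "indicator {0<..T * real (m - 1) / real n} s + indicator (cell T n (m - 1)) s =
          (indicator {0<..T * real m / real n} s :: ennreal)" for s
        proof -
          have "T * real (m - 1) / real n \<le> T * real m / real n" using T by (intro divide_right_mono mult_left_mono) auto
          moreover have "0 \<le> T * real (m - 1) / real n" using T by auto
          moreover have "Suc (m - 1) = m" using False by simp
          ultimately show ?thesis by (auto simp: indicator_def cell_def simp del: of_nat_Suc)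
        qed
        then have "(\<integral>\<^sup>+ s. ennreal (norm (f s)) * indicator {0<..T * real m / real n} s \<partial>lborel) =
          (\<integral>\<^sup>+ s. ennreal (norm (f s)) * indicator {0<..T * real (m - 1) / real n} s + ennreal (norm (f s)) * indicator (cell T n (m - 1)) s \<partial>lborel)"
          by (intro nn_integral_cong) (simp add: distrib_left[symmetric])
        also have "\<dots> = (\<integral>\<^sup>+ s. ennreal (norm (f s)) * indicator {0<..T * real (m - 1) / real n} s \<partial>lborel) +
          (\<integral>\<^sup>+ s. ennreal (norm (f s)) * indicator (cell T n (m - 1)) s \<partial>lborel)"
          by (intro nn_integral_add) auto
        finally show ?thesis using Suc.IH False by simp
      qed simp
    qed simp
    have "T * real (n - 1) / real n \<le> T" using T n by (simp add: divide_le_eq)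
    then show ?thesis unfolding tel by (intro nn_integral_mono) (auto simp: indicator_def)
  qed
  finally show ?thesis .
qed

text \<open>The bound is asked for on the preceding cell only, so near a continuity point it can be
  applied to the local oscillation of a function.\<close>

lemma cell_avg_bound:
  fixes f :: "real \<Rightarrow> 'a::euclidean_space"
  assumes T: "0 < T" and k: "k < n" and [measurable]: "f \<in> borel_measurable borel"
    and "0 \<le> K" and K: "\<And>s. s \<in> cell T n (k - 1) \<Longrightarrow> norm (f s) \<le> K"
  shows "norm (cell_avg T n f k) \<le> K"
proof (cases "k = 0")
  case False
  have n: "0 < n" using k by simp
  have "ennreal (norm (LINT s|lborel. indicator (cell T n (k - 1)) s *\<^sub>R f s)) \<le> ennreal (K * (T / real n))"
  proof (cases "integrable lborel (\<lambda>s. indicator (cell T n (k - 1)) s *\<^sub>R f s)")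
    case True
    then have "ennreal (norm (LINT s|lborel. indicator (cell T n (k - 1)) s *\<^sub>R f s)) \<le>
      (\<integral>\<^sup>+ s. ennreal (norm (indicator (cell T n (k - 1)) s *\<^sub>R f s)) \<partial>lborel)"
      by (rule integral_norm_bound_ennreal)
    also have "\<dots> \<le> (\<integral>\<^sup>+ s. ennreal K * indicator (cell T n (k - 1)) s \<partial>lborel)"
      by (intro nn_integral_mono) (auto simp: indicator_def simp del: One_nat_def intro!: ennreal_leI K)
    also have "\<dots> = ennreal (K * (T / real n))"
      using T n \<open>0 \<le> K\<close> emeasure_cell[OF T n] by (simp add: nn_integral_cmult ennreal_mult''[symmetric])
    finally show ?thesis .
  qed (use T \<open>0 \<le> K\<close> in \<open>simp add: not_integrable_integral_eq\<close>)
  then have "norm (LINT s|lborel. indicator (cell T n (k - 1)) s *\<^sub>R f s) \<le> K * (T / real n)"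
    using T \<open>0 \<le> K\<close> by (subst (asm) ennreal_le_iff) auto
  then have "real n / T * norm (LINT s|lborel. indicator (cell T n (k - 1)) s *\<^sub>R f s) \<le> real n / T * (K * (T / real n))"
    using T by (intro mult_left_mono) auto
  then show ?thesis using False T n by (simp add: cell_avg_def)
qed (simp add: cell_avg_def \<open>0 \<le> K\<close>)

lemma step_avg_eq:
  assumes T: "0 < T" and t: "t \<in> cell T n k" and k: "k < n"
  shows "step_avg T n f t = cell_avg T n f k"
proof -
  have "t \<notin> cell T n j" if "j \<noteq> k" for j
  proof
    assume j: "t \<in> cell T n j"
    have n: "0 < n" using k by simp
    have "T * real k < t * real n" "t * real n \<le> T * real (Suc k)" "T * real j < t * real n" "t * real n \<le> T * real (Suc j)"
      using t j n by (auto simp: cell_def field_simps)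
    then have "T * real k < T * real (Suc j)" "T * real j < T * real (Suc k)" by linarith+
    then have "k < Suc j" "j < Suc k" using T by (auto simp del: of_nat_Suc)
    then show False using that by simp
  qed
  then have "step_avg T n f t = (\<Sum>j<n. if j = k then cell_avg T n f k else 0)"
    unfolding step_avg_def using t by (intro sum.cong) auto
  then show ?thesis using k by simp
qed

lemma cell_exists:
  assumes T: "0 < T" and n: "0 < n" and t: "t \<in> {0<..T}"
  obtains k where "k < n" "t \<in> cell T n k"
proof
  \<comment> \<open>Cells are closed on the right, hence the ceiling minus one.\<close>
  define k where "k = nat (\<lceil>t * real n / T\<rceil> - 1)"
  have "0 < t * real n / T" using t T n by simp
  then have c: "1 \<le> \<lceil>t * real n / T\<rceil>" by linarith
  then have rk: "real k = of_int \<lceil>t * real n / T\<rceil> - 1" by (simp add: k_def)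
  then have b: "real k < t * real n / T" "t * real n / T \<le> real k + 1" by linarith+
  show "t \<in> cell T n k" using b T n by (simp add: cell_def field_simps)
  have "t * real n \<le> T * real n" using t by (intro mult_right_mono) auto
  then have "t * real n / T \<le> real n" using T by (simp add: divide_le_eq mult.commute)
  then show "k < n" using b by linarith
qed

lemma step_avg_bound:
  fixes f :: "real \<Rightarrow> 'a::euclidean_space"
  assumes T: "0 < T" and [measurable]: "f \<in> borel_measurable borel" and K: "\<And>s. norm (f s) \<le> K"
  shows "norm (step_avg T n f t) \<le> K"
proof (cases "\<exists>k<n. t \<in> cell T n k")
  case True
  then obtain k where k: "k < n" "t \<in> cell T n k" by auto
  have "0 \<le> K" using K[of 0] norm_ge_zero order_trans by blast
  then show ?thesis unfolding step_avg_eq[OF T k(2,1)] by (intro cell_avg_bound[OF T k(1)] K) auto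
next
  case False
  then have "step_avg T n f t = 0" unfolding step_avg_def by (intro sum.neutral) auto
  then show ?thesis using order_trans[OF norm_ge_zero K[of 0]] by simp
qed

lemma cell_avg_diff:
  fixes f g :: "real \<Rightarrow> 'a::euclidean_space"
  assumes T: "0 < T" "k < n" and f: "f \<in> borel_measurable borel" "\<And>s. norm (f s) \<le> K"
    and g: "g \<in> borel_measurable borel" "\<And>s. norm (g s) \<le> L"
  shows "cell_avg T n (\<lambda>s. f s - g s) k = cell_avg T n f k - cell_avg T n g k"
proof (cases "k = 0")
  case False
  then have "k - 1 < n" using T by simp
  then show ?thesis using False integrable_cell[OF T(1) _ f] integrable_cell[OF T(1) _ g]
    by (simp add: cell_avg_def scaleR_diff_right)
qed (simp add: cell_avg_def)

lemma step_avg_diff: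
  fixes f g :: "real \<Rightarrow> 'a::euclidean_space"
  assumes "0 < T" "f \<in> borel_measurable borel" "\<And>s. norm (f s) \<le> K"
    "g \<in> borel_measurable borel" "\<And>s. norm (g s) \<le> L"
  shows "step_avg T n (\<lambda>s. f s - g s) t = step_avg T n f t - step_avg T n g t"
  unfolding step_avg_def sum_subtractf[symmetric]
  using cell_avg_diff[OF assms(1) _ assms(2-5)] by (intro sum.cong) (auto simp: scaleR_diff_right)

lemma step_avg_borel [measurable]: "step_avg T n f \<in> borel_measurable borel"
  unfolding step_avg_def[abs_def] by measurable

lemma cell_avg_const: "0 < T \<Longrightarrow> 0 < k \<Longrightarrow> k < n \<Longrightarrow> cell_avg T n (\<lambda>s. v) k = (v::'a::euclidean_space)"
  using emeasure_cell[of T n "k - 1"] by (simp add: cell_avg_def measure_def integral_scaleR_left[OF integrable_real_indicator] less_imp_neq)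

text \<open>The preceding cell lies within two cell lengths of t, so the average samples g only
  where it is close to its value at t.\<close>

lemma step_avg_tendsto_continuous:
  fixes g :: "real \<Rightarrow> 'a::euclidean_space"
  assumes T: "0 < T" and cont: "continuous_on UNIV g" and K: "\<And>s. norm (g s) \<le> K" and t: "t \<in> {0<..T}"
  shows "(\<lambda>n. step_avg T n g t) \<longlonglongrightarrow> g t"
proof (rule LIMSEQ_I)
  have [measurable]: "g \<in> borel_measurable borel" using cont by (rule borel_measurable_continuous_onI)
  fix e :: real assume e: "0 < e"
  have "\<exists>d>0. \<forall>s. dist s t < d \<longrightarrow> dist (g s) (g t) < e / 2"
    using cont[unfolded continuous_on_iff] e by (meson UNIV_I half_gt_zero)
  then obtain d where d: "d > 0" "\<And>s. \<bar>s - t\<bar> < d \<Longrightarrow> norm (g s - g t) < e / 2"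
    unfolding dist_norm real_norm_def by blast
  \<comment> \<open>n > 2 T / d makes two cells shorter than d; n > T / t keeps t out of the first
    cell, where the average is 0.\<close>
  obtain n0 :: nat where n0': "max (2 * T / d + 1) (T / t) < real n0" using reals_Archimedean2 by blast
  have "0 < 2 * T / d" using T d by simp
  then have n0: "real n0 > 2 * T / d + 1" "real n0 > T / t" "n0 > 0" using n0' by auto
  show "\<exists>no. \<forall>n\<ge>no. norm (step_avg T n g t - g t) < e"
  proof (intro exI allI impI)
    fix n assume "n \<ge> n0"
    then have n: "real n > 2 * T / d" "real n > T / t" "n > 0" using n0 by auto
    obtain k where k: "k < n" "t \<in> cell T n k" using cell_exists[OF T n(3) t] .
    have k0: "k \<noteq> 0"
    proof
      assume "k = 0"
      then have "t \<le> T / real n" using k by (simp add: cell_def)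
      then show False using n t T by (simp add: field_simps)
    qed
    have "norm (cell_avg T n (\<lambda>s. g s - g t) k) \<le> e / 2"
    proof (rule cell_avg_bound[OF T k(1)])
      fix s assume s: "s \<in> cell T n (k - 1)"
      have "Suc (k - 1) = k" using k0 by simp
      then have "s \<le> T * real k / real n" "T * (real k - 1) / real n < s" using s k0
        by (auto simp: cell_def simp del: of_nat_Suc simp flip: One_nat_def)
      moreover have "T * real k / real n < t" "t \<le> T * (real k + 1) / real n" using k by (auto simp: cell_def algebra_simps)
      ultimately have "\<bar>s - t\<bar> < T * (real k + 1) / real n - T * (real k - 1) / real n" by linarith
      also have "\<dots> = 2 * T / real n" by (simp add: diff_divide_distrib[symmetric] algebra_simps)
      also have "\<dots> < d" using n d T by (simp add: field_simps)
      finally show "norm (g s - g t) \<le> e / 2" using d(2) less_imp_le by blast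
    qed (use e in auto)
    moreover have "cell_avg T n (\<lambda>s. g s - g t) k = step_avg T n g t - g t"
      using cell_avg_diff[OF T k(1) _ K, where g="\<lambda>s. g t" and L="norm (g t)"] cell_avg_const[OF T _ k(1), of "g t"] k0
      by (simp add: step_avg_eq[OF T k(2,1)])
    ultimately show "norm (step_avg T n g t - g t) < e" using e by simp
  qed
qed

lemma nn_L1_triangle:
  fixes f g :: "real \<Rightarrow> 'a::euclidean_space"
  assumes [measurable]: "f \<in> borel_measurable borel" "g \<in> borel_measurable borel" "h \<in> borel_measurable borel"
  shows "nn_L1 T (\<lambda>s. f s - h s) \<le> nn_L1 T (\<lambda>s. f s - g s) + nn_L1 T (\<lambda>s. g s - h s)"
proof -
  have "nn_L1 T (\<lambda>s. f s - h s) \<le> (\<integral>\<^sup>+ s. ennreal (norm (f s - g s)) * indicator {0..T} s + ennreal (norm (g s - h s)) * indicator {0..T} s \<partial>lborel)"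
  proof (rule nn_integral_mono)
    fix s
    have "norm (f s - h s) \<le> norm (f s - g s) + norm (g s - h s)" using dist_triangle[of "f s" "h s" "g s"] by (simp add: dist_norm)
    then show "ennreal (norm (f s - h s)) * indicator {0..T} s \<le>
      ennreal (norm (f s - g s)) * indicator {0..T} s + ennreal (norm (g s - h s)) * indicator {0..T} s"
      by (auto simp: indicator_def ennreal_plus[symmetric] simp del: ennreal_plus intro: ennreal_leI)
  qed
  also have "\<dots> = nn_L1 T (\<lambda>s. f s - g s) + nn_L1 T (\<lambda>s. g s - h s)" by (intro nn_integral_add) auto
  finally show ?thesis .
qed

text \<open>A three-term argument: f against a continuous g', g' against its averages, and the
  averages of g' against those of f. The first two differences vanish by dominated convergence, the
  third is controlled by the first through the L^1 contraction.\<close>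

lemma step_avg_L1_tendsto:
  fixes f :: "real \<Rightarrow> 'a::euclidean_space"
  assumes T: "0 < T" and fm: "f \<in> borel_measurable borel" and K: "\<And>s. norm (f s) \<le> K"
  shows "(\<lambda>n. nn_L1 T (\<lambda>s. f s - step_avg T n f s)) \<longlonglongrightarrow> 0"
proof -
  note [measurable] = fm
  have K0: "0 \<le> K" using K[of 0] norm_ge_zero order_trans by blast
  \<comment> \<open>Dominated convergence on a bounded interval, shared by two of the three terms;
    the point 0 lies in no cell and is discarded as a null set.\<close>
  have dct: "(\<lambda>n. nn_L1 T (\<lambda>s. u s - v n s)) \<longlonglongrightarrow> 0"
    if [measurable]: "u \<in> borel_measurable borel" "\<And>n. v n \<in> borel_measurable borel"
      and B: "\<And>s. norm (u s) \<le> K" "\<And>n s. norm (v n s) \<le> K"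
      and l: "AE s in lborel. s \<in> {0<..T} \<longrightarrow> (\<lambda>n. v n s) \<longlonglongrightarrow> u s" for u and v :: "nat \<Rightarrow> real \<Rightarrow> 'a"
  proof -
    have "(\<lambda>n. nn_L1 T (\<lambda>s. u s - v n s)) \<longlonglongrightarrow> (\<integral>\<^sup>+ s. 0 \<partial>(lborel :: real measure))"
    proof (rule nn_integral_dominated_convergence[where w="\<lambda>s. ennreal (2 * K) * indicator {0..T} s" and M=lborel and u'="\<lambda>s. 0" and u="\<lambda>n s. ennreal (norm (u s - v n s)) * indicator {0..T} s"])
      show "(\<integral>\<^sup>+ s. ennreal (2 * K) * indicator {0..T} s \<partial>lborel) < \<infinity>"
        using T K0 by (simp add: nn_integral_cmult ennreal_mult_less_top)
      have "norm (u s - v n s) \<le> 2 * K" for n s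
        using norm_triangle_ineq4[of "u s" "v n s"] B(1)[of s] B(2)[of n s] by linarith
      then show "AE s in lborel. ennreal (norm (u s - v n s)) * indicator {0..T} s \<le> ennreal (2 * K) * indicator {0..T} s" for n
        by (intro AE_I2) (auto simp: indicator_def intro: ennreal_leI)
      have "AE s in lborel. s \<noteq> (0::real)" by (rule AE_lborel_singleton)
      with l show "AE s in lborel. (\<lambda>n. ennreal (norm (u s - v n s)) * indicator {0..T} s) \<longlonglongrightarrow> 0"
      proof eventually_elim
        case (elim s)
        show ?case
        proof (cases "s \<in> {0<..T}")
          case True
          then have "(\<lambda>n. norm (u s - v n s)) \<longlonglongrightarrow> norm (u s - u s)" using elim by (intro tendsto_intros) auto
          then have "(\<lambda>n. ennreal (norm (u s - v n s))) \<longlonglongrightarrow> ennreal 0" by (intro tendsto_ennrealI) simp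
          then show ?thesis using True by (simp add: indicator_def)
        next
          case False
          then show ?thesis using elim by (auto simp: indicator_def)
        qed
      qed
    qed measurable
    then show ?thesis by simp
  qed
  have "f measurable_on UNIV"
    using sets.top[of "lebesgue :: real measure"]
    by (intro lebesgue_measurable_imp_measurable_on) (simp_all add: measurable_completion)
  then obtain N g where N: "negligible N" and gc: "\<And>n. continuous_on UNIV (g n)" and gl: "\<And>x. x \<notin> N \<Longrightarrow> (\<lambda>n. g n x) \<longlonglongrightarrow> f x"
    unfolding measurable_on_def by auto
  \<comment> \<open>Radial retraction onto the ball of radius K. It keeps the continuous
    approximants uniformly bounded, as dominated convergence demands, and leaves the values of f in
    place.\<close>
  define c where "c x = (if norm x \<le> K then x else (K / norm x) *\<^sub>R x)" for x :: 'a
  have c_eq: "c x = (K / max K (norm x)) *\<^sub>R x" if "0 < K" for x using that by (auto simp: c_def max_def)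
  define g' where "g' n s = (if K = 0 then 0 else c (g n s))" for n s
  have g'c: "continuous_on UNIV (g' n)" for n
  proof (cases "K = 0")
    case False
    then have "0 < K" using K0 by simp
    then have "g' n = (\<lambda>s. (K / max K (norm (g n s))) *\<^sub>R g n s)" using c_eq False by (auto simp: g'_def)
    moreover have "max K (norm (g n s)) \<noteq> 0" for s using \<open>0 < K\<close> by auto
    ultimately show ?thesis using gc[of n] by (auto intro!: continuous_intros)
  qed (simp add: g'_def)
  have g'b: "norm (g' n s) \<le> K" for n s using K0 by (auto simp: g'_def c_def)
  have g'l: "(\<lambda>n. g' n x) \<longlonglongrightarrow> f x" if "x \<notin> N" for x
  proof (cases "K = 0")
    case True
    then have "f x = 0" using K[of x] by simp
    then show ?thesis using True by (simp add: g'_def)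
  next
    case False
    then have "0 < K" using K0 by simp
    then have "(\<lambda>n. (K / max K (norm (g n x))) *\<^sub>R g n x) \<longlonglongrightarrow> (K / max K (norm (f x))) *\<^sub>R f x"
      using gl[OF that] by (intro tendsto_intros) (auto simp: max_def)
    then show ?thesis using c_eq \<open>0 < K\<close> K[of x] False by (simp add: g'_def max_def)
  qed
  have "AE x in lborel. x \<notin> N"
    using AE_not_in[of N lebesgue] N by (simp add: negligible_iff_null_sets AE_completion_iff)
  have g'm[measurable]: "g' n \<in> borel_measurable borel" for n using g'c by (rule borel_measurable_continuous_onI)
  have 1: "(\<lambda>j. nn_L1 T (\<lambda>s. f s - g' j s)) \<longlonglongrightarrow> 0"
    using \<open>AE x in lborel. x \<notin> N\<close> g'l by (intro dct K g'b) auto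
  have 2: "(\<lambda>n. nn_L1 T (\<lambda>s. g' j s - step_avg T n (g' j) s)) \<longlonglongrightarrow> 0" for j
    by (intro dct g'b step_avg_bound[OF T]) (auto intro!: AE_I2 step_avg_tendsto_continuous[OF T g'c g'b])
  show ?thesis
  proof (rule order_tendstoI)
    fix e :: ennreal assume "0 < e"
    define e3 where "e3 = (if e = \<top> then 1 else e / 3)"
    have e3: "0 < e3" "e3 + e3 + e3 \<le> e"
    proof -
      show "0 < e3" using \<open>0 < e\<close> by (auto simp: e3_def ennreal_zero_less_divide)
      show "e3 + e3 + e3 \<le> e"
      proof (cases e)
        case (real r)
        then have "e / 3 = ennreal (r / 3)" by (metis divide_ennreal ennreal_numeral zero_less_numeral zero_le_numeral)
        then show ?thesis using real by (simp add: e3_def ennreal_plus[symmetric] del: ennreal_plus)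
      qed simp
    qed
    obtain j where j: "nn_L1 T (\<lambda>s. f s - g' j s) < e3"
      using order_tendstoD(2)[OF 1 e3(1)] by (auto dest: eventually_happens)
    have "eventually (\<lambda>n. nn_L1 T (\<lambda>s. g' j s - step_avg T n (g' j) s) < e3) sequentially"
      using order_tendstoD(2)[OF 2 e3(1)] .
    moreover have "eventually (\<lambda>n. n > 0) sequentially" by (rule eventually_gt_at_top)
    ultimately show "eventually (\<lambda>n. nn_L1 T (\<lambda>s. f s - step_avg T n f s) < e) sequentially"
    proof eventually_elim
      case (elim n)
      have "nn_L1 T (\<lambda>s. step_avg T n (g' j) s - step_avg T n f s) = nn_L1 T (step_avg T n (\<lambda>s. g' j s - f s))"
        by (simp add: step_avg_diff[OF T g'm g'b fm K])
      also have "\<dots> \<le> nn_L1 T (\<lambda>s. g' j s - f s)"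
      proof (rule step_avg_L1_le[OF T elim(2)])
        show "norm (g' j s - f s) \<le> 2 * K" for s
          using norm_triangle_ineq4[of "g' j s" "f s"] g'b[of j s] K[of s] by linarith
      qed measurable
      also have "\<dots> < e3" using j by (simp add: norm_minus_commute)
      finally have 3: "nn_L1 T (\<lambda>s. step_avg T n (g' j) s - step_avg T n f s) < e3" .
      have "nn_L1 T (\<lambda>s. f s - step_avg T n f s) \<le> nn_L1 T (\<lambda>s. f s - g' j s) + nn_L1 T (\<lambda>s. g' j s - step_avg T n f s)"
        by (rule nn_L1_triangle) measurable
      also have "\<dots> \<le> nn_L1 T (\<lambda>s. f s - g' j s) + (nn_L1 T (\<lambda>s. g' j s - step_avg T n (g' j) s) + nn_L1 T (\<lambda>s. step_avg T n (g' j) s - step_avg T n f s))"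
        by (intro add_left_mono nn_L1_triangle) measurable
      also have "\<dots> < e3 + (e3 + e3)" using j elim(1) 3 by (intro add_strict_mono)
      also have "\<dots> \<le> e" using e3(2) by (simp add: add.assoc)
      finally show ?case .
    qed
  qed simp
qed

section \<open>Density of simple processes in energy\<close>

lemma nn_energy_add_le:
  fixes \<phi> \<psi> :: "real \<Rightarrow> 'w \<Rightarrow> 'a::euclidean_space"
  assumes "clipped t \<phi> \<in> borel_measurable (M \<Otimes>\<^sub>M lborel)" "clipped t \<psi> \<in> borel_measurable (M \<Otimes>\<^sub>M lborel)"
  shows "nn_energy M t (\<lambda>s \<omega>. \<phi> s \<omega> + \<psi> s \<omega>) \<le> 2 * nn_energy M t \<phi> + 2 * nn_energy M t \<psi>"
  using assms nn_sq_add_le[OF assms]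
  by (subst (1 2 3) nn_energy_clipped) (auto simp: clipped_add)

lemma nn_energy_scaleR:
  fixes \<phi> :: "real \<Rightarrow> 'w \<Rightarrow> 'a::euclidean_space"
  assumes "clipped t \<phi> \<in> borel_measurable (M \<Otimes>\<^sub>M lborel)"
  shows "nn_energy M t (\<lambda>s \<omega>. r *\<^sub>R \<phi> s \<omega>) = ennreal (r\<^sup>2) * nn_energy M t \<phi>"
  using assms nn_sq_scaleR[OF assms] by (subst (1 2) nn_energy_clipped) (auto simp: clipped_scaleR)

lemma nn_energy_triangle:
  fixes f g h :: "real \<Rightarrow> 'w \<Rightarrow> 'a::euclidean_space"
  assumes "clipped t f \<in> borel_measurable (M \<Otimes>\<^sub>M lborel)" "clipped t g \<in> borel_measurable (M \<Otimes>\<^sub>M lborel)"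
    "clipped t h \<in> borel_measurable (M \<Otimes>\<^sub>M lborel)"
  shows "nn_energy M t (\<lambda>s \<omega>. f s \<omega> - h s \<omega>) \<le> 2 * nn_energy M t (\<lambda>s \<omega>. f s \<omega> - g s \<omega>) + 2 * nn_energy M t (\<lambda>s \<omega>. g s \<omega> - h s \<omega>)"
  using nn_energy_add_le[of t "\<lambda>s \<omega>. f s \<omega> - g s \<omega>" M "\<lambda>s \<omega>. g s \<omega> - h s \<omega>"] assms
  by (auto simp: clipped_diff)

lemma nn_energy_commute: "nn_energy M t (\<lambda>s \<omega>. f s \<omega> - g s \<omega>) = nn_energy M t (\<lambda>s \<omega>. g s \<omega> - f s \<omega>)"
  by (simp add: nn_energy_def norm_minus_commute)

lemma clipped_clipped: "t \<le> T \<Longrightarrow> clipped t \<phi> p = indicator {0..t} (snd p) *\<^sub>R clipped T \<phi> p"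
  by (auto simp: clipped_def indicator_def split: prod.splits)

lemma clipped_measurable_le:
  fixes \<phi> :: "real \<Rightarrow> 'w \<Rightarrow> 'a::euclidean_space"
  assumes [measurable]: "clipped T \<phi> \<in> borel_measurable (M \<Otimes>\<^sub>M lborel)" and "t \<le> T"
  shows "clipped t \<phi> \<in> borel_measurable (M \<Otimes>\<^sub>M lborel)"
proof -
  have "clipped t \<phi> = (\<lambda>p. indicator {0..t} (snd p) *\<^sub>R clipped T \<phi> p)"
    using clipped_clipped[OF assms(2)] by (intro ext)
  then show ?thesis by (simp only:) measurable
qed

lemma simple_process_eq_elem_proc: "simple_process N \<tau> \<xi> = elem_proc N \<tau> (\<lambda>k. \<tau> (Suc k)) \<xi>"
  by (intro ext) (simp add: simple_process_def elem_proc_def)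

lemma simple_integral_eq_elem_int: "simple_integral W N \<tau> \<xi> = elem_int W N \<tau> (\<lambda>k. \<tau> (Suc k)) \<xi>"
  by (intro ext) (simp add: simple_integral_def elem_int_def)

context filtered_space begin

lemma F_pair_measurable:
  assumes "f \<in> measurable (F t \<Otimes>\<^sub>M borel) N" "0 \<le> t"
  shows "f \<in> measurable (M \<Otimes>\<^sub>M lborel) N"
proof -
  have "(\<lambda>x. x) \<in> measurable M (F t)" using F_subalgebra[OF assms(2)] by (auto simp: measurable_def)
  from measurable_compose[OF measurable_fst this]
  have "(\<lambda>p. (fst p, snd p)) \<in> measurable (M \<Otimes>\<^sub>M lborel) (F t \<Otimes>\<^sub>M borel)"
    by (intro measurable_Pair) (auto simp: comp_def)
  from measurable_compose[OF this assms(1)] show ?thesis by simp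
qed

lemma progressive_clipped:
  fixes \<phi> :: "real \<Rightarrow> 'w \<Rightarrow> 'a::euclidean_space"
  shows "progressive T F \<phi> \<Longrightarrow> t \<in> {0..T} \<Longrightarrow> clipped t \<phi> \<in> borel_measurable (M \<Otimes>\<^sub>M lborel)"
  using F_pair_measurable[of "clipped t \<phi>" t borel] by (auto simp: progressive_iff)

lemma L2_process_clipped:
  fixes \<phi> :: "real \<Rightarrow> 'w \<Rightarrow> 'a::euclidean_space"
  shows "\<phi> \<in> L2_process M T F \<Longrightarrow> t \<in> {0..T} \<Longrightarrow> clipped t \<phi> \<in> borel_measurable (M \<Otimes>\<^sub>M lborel)"
  by (auto simp: L2_process_def intro: progressive_clipped)

text \<open>Each path is replaced by its shifted averages. The value on a cell uses the path only up
  to the left end of the cell, so it is measurable there. The bound K turns L^1 convergence of the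
  paths into L^2 convergence and permits dominated convergence in \<omega>.\<close>

lemma simple_dense_bounded:
  fixes \<phi> :: "real \<Rightarrow> 'w \<Rightarrow> 'a::euclidean_space"
  assumes T: "0 < T" and prog: "progressive T F \<phi>" and K0: "0 \<le> K"
    and K: "\<And>s \<omega>. norm (\<phi> s \<omega>) \<le> K" and e: "0 < e"
  shows "\<exists>N \<tau> \<xi>. simple_data M T F N \<tau> \<xi> \<and> nn_energy M T (\<lambda>s \<omega>. \<phi> s \<omega> - simple_process N \<tau> \<xi> s \<omega>) < e"
proof -
  define f where "f \<omega> s = clipped T \<phi> (\<omega>, s)" for \<omega> s
  define \<tau> where "\<tau> n k = T * real k / real n" for n k :: nat
  define \<xi> where "\<xi> n k \<omega> = cell_avg T n (f \<omega>) k" for n k \<omega>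
  have cm[measurable]: "clipped T \<phi> \<in> borel_measurable (M \<Otimes>\<^sub>M lborel)"
    using progressive_clipped[OF prog] T by simp
  have fK: "norm (f \<omega> s) \<le> K" for \<omega> s using K K0 by (auto simp: f_def clipped_def indicator_def)
  have fm: "f \<omega> \<in> borel_measurable borel" if "\<omega> \<in> space M" for \<omega>
    using measurable_Pair2[OF cm that] by (simp add: f_def[abs_def])
  have sp: "simple_process n (\<tau> n) (\<xi> n) s \<omega> = step_avg T n (f \<omega>) s" for n s \<omega>
    by (simp add: simple_process_def step_avg_def cell_def \<tau>_def \<xi>_def)
  have \<xi>m: "\<xi> n k \<in> borel_measurable (F (\<tau> n k))" if k: "k < n" for n k
  proof (cases "k = 0")
    case False
    then have Suc: "Suc (k - 1) = k" by simp
    have \<tau>T: "\<tau> n k \<in> {0..T}" using k T by (auto simp: \<tau>_def divide_le_eq)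
    have [measurable]: "clipped (\<tau> n k) \<phi> \<in> borel_measurable (F (\<tau> n k) \<Otimes>\<^sub>M borel)"
      using prog \<tau>T by (simp add: progressive_iff)
    have "0 \<le> T * real (k - 1) / real n" using T by simp
    \<comment> \<open>On the preceding cell the process clipped at T agrees with the one clipped at
      \<open>\<tau> n k\<close>, and the latter is measurable for
      \<open>F (\<tau> n k)\<close>.\<close>
    then have eqf: "indicator (cell T n (k - 1)) s *\<^sub>R f \<omega> s = indicator (cell T n (k - 1)) s *\<^sub>R clipped (\<tau> n k) \<phi> (\<omega>, s)" for \<omega> s
      using \<tau>T unfolding f_def clipped_def cell_def Suc \<tau>_def by (auto simp: indicator_def)
    then have "\<xi> n k = (\<lambda>\<omega>. (real n / T) *\<^sub>R (LINT s|lborel. indicator (cell T n (k - 1)) s *\<^sub>R clipped (\<tau> n k) \<phi> (\<omega>, s)))"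
      by (intro ext) (simp only: \<xi>_def cell_avg_def if_not_P[OF False] eqf)
    moreover have "(\<lambda>\<omega>. (real n / T) *\<^sub>R (LINT s|lborel. indicator (cell T n (k - 1)) s *\<^sub>R clipped (\<tau> n k) \<phi> (\<omega>, s))) \<in> borel_measurable (F (\<tau> n k))"
      by measurable
    ultimately show ?thesis by simp
  qed (simp add: \<xi>_def[abs_def] cell_avg_def)
  have sd: "simple_data M T F n (\<tau> n) (\<xi> n)" if "0 < n" for n
    unfolding simple_data_def
  proof (intro conjI allI impI)
    show "\<tau> n 0 = 0" "\<tau> n n = T" using that by (auto simp: \<tau>_def)
    show "\<tau> n k < \<tau> n (Suc k)" for k using that T by (auto simp: \<tau>_def divide_strict_right_mono)
    have "norm (\<xi> n k \<omega>) \<le> K" if "k < n" "\<omega> \<in> space M" for k \<omega>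
      unfolding \<xi>_def using fm[OF that(2)] by (intro cell_avg_bound[OF T that(1)] K0 fK) auto
    then show "\<exists>K. \<forall>k<n. \<forall>\<omega>\<in>space M. norm (\<xi> n k \<omega>) \<le> K" by blast
  qed (rule \<xi>m)
  define E where "E n \<omega> = (\<integral>\<^sup>+ s. ennreal ((norm (\<phi> s \<omega> - step_avg T n (f \<omega>) s))\<^sup>2) * indicator {0..T} s \<partial>lborel)" for n \<omega>
  have diffK: "norm (f \<omega> s - step_avg T n (f \<omega>) s) \<le> 2 * K" if "\<omega> \<in> space M" for \<omega> s n
    using norm_triangle_ineq4[of "f \<omega> s" "step_avg T n (f \<omega>) s"] fK[of \<omega> s] step_avg_bound[OF T fm[OF that] fK, of n s] by linarith
  have E': "E n \<omega> = (\<integral>\<^sup>+ s. ennreal ((norm (f \<omega> s - step_avg T n (f \<omega>) s))\<^sup>2) * indicator {0..T} s \<partial>lborel)" for n \<omega>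
    unfolding E_def f_def clipped_def by (intro nn_integral_cong) (auto simp: indicator_def)
  have E1: "E n \<omega> \<le> ennreal (2 * K) * nn_L1 T (\<lambda>s. f \<omega> s - step_avg T n (f \<omega>) s)" if w: "\<omega> \<in> space M" for n \<omega>
  proof -
    have "E n \<omega> \<le> (\<integral>\<^sup>+ s. ennreal (2 * K) * (ennreal (norm (f \<omega> s - step_avg T n (f \<omega>) s)) * indicator {0..T} s) \<partial>lborel)"
      unfolding E'
    proof (rule nn_integral_mono)
      fix s
      let ?x = "norm (f \<omega> s - step_avg T n (f \<omega>) s)"
      have "?x\<^sup>2 \<le> 2 * K * ?x" using diffK[OF w, of s n] by (simp add: power2_eq_square mult_right_mono)
      then have "ennreal (?x\<^sup>2) \<le> ennreal (2 * K) * ennreal ?x" using K0 by (simp add: ennreal_mult[symmetric] ennreal_leI)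
      then show "ennreal (?x\<^sup>2) * indicator {0..T} s \<le> ennreal (2 * K) * (ennreal ?x * indicator {0..T} s)"
        by (auto simp: indicator_def)
    qed
    also have "\<dots> = ennreal (2 * K) * nn_L1 T (\<lambda>s. f \<omega> s - step_avg T n (f \<omega>) s)"
    proof -
      note [measurable] = fm[OF w]
      show ?thesis by (rule nn_integral_cmult) measurable
    qed
    finally show ?thesis .
  qed
  have E2: "E n \<omega> \<le> ennreal ((2 * K)\<^sup>2 * T)" if w: "\<omega> \<in> space M" for n \<omega>
  proof -
    have "E n \<omega> \<le> (\<integral>\<^sup>+ s. ennreal ((2 * K)\<^sup>2) * indicator {0..T} s \<partial>lborel)"
      unfolding E' by (intro nn_integral_mono mult_right_mono ennreal_leI power_mono diffK[OF w]) auto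
    also have "\<dots> = ennreal ((2 * K)\<^sup>2 * T)" using T by (simp add: nn_integral_cmult ennreal_mult)
    finally show ?thesis .
  qed
  have Em: "E n \<in> borel_measurable M" for n
  proof -
    have [measurable]: "\<xi> n k \<in> borel_measurable M" if "k < n" for k
      using F_measurable[OF \<xi>m[OF that]] T by (simp add: \<tau>_def)
    have "(\<lambda>p. \<Sum>k<n. indicator (cell T n k) (snd p) *\<^sub>R \<xi> n k (fst p)) \<in> borel_measurable (M \<Otimes>\<^sub>M lborel)"
      by (intro borel_measurable_sum borel_measurable_scaleR) (auto intro!: measurable_compose[OF measurable_fst])
    then have [measurable]: "(\<lambda>p. clipped T \<phi> p - step_avg T n (f (fst p)) (snd p)) \<in> borel_measurable (M \<Otimes>\<^sub>M lborel)"
      unfolding step_avg_def \<xi>_def by measurable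
    have "E n = (\<lambda>\<omega>. \<integral>\<^sup>+ s. (\<lambda>p. ennreal ((norm (clipped T \<phi> p - step_avg T n (f (fst p)) (snd p)))\<^sup>2) * indicator {0..T} (snd p)) (\<omega>, s) \<partial>lborel)"
      by (intro ext) (simp add: E' f_def)
    moreover have "\<dots> \<in> borel_measurable M"
      by (rule lborel.borel_measurable_nn_integral_fst) measurable
    ultimately show ?thesis by simp
  qed
  have "(\<lambda>n. \<integral>\<^sup>+ \<omega>. E n \<omega> \<partial>M) \<longlonglongrightarrow> (\<integral>\<^sup>+ \<omega>. 0 \<partial>M)"
  proof (rule nn_integral_dominated_convergence[where w="\<lambda>\<omega>. ennreal ((2 * K)\<^sup>2 * T)" and u=E and u'="\<lambda>\<omega>. 0"])
    show "AE \<omega> in M. E n \<omega> \<le> ennreal ((2 * K)\<^sup>2 * T)" for n using E2 by (intro AE_I2)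
    show "(\<integral>\<^sup>+ \<omega>. ennreal ((2 * K)\<^sup>2 * T) \<partial>M) < \<infinity>" by (simp add: emeasure_space_1)
    show "AE \<omega> in M. (\<lambda>n. E n \<omega>) \<longlonglongrightarrow> 0"
    proof (rule AE_I2)
      fix \<omega> assume w: "\<omega> \<in> space M"
      have "(\<lambda>n. ennreal (2 * K) * nn_L1 T (\<lambda>s. f \<omega> s - step_avg T n (f \<omega>) s)) \<longlonglongrightarrow> ennreal (2 * K) * 0"
        by (intro tendsto_mult_ennreal step_avg_L1_tendsto[OF T fm[OF w] fK] tendsto_const) auto
      then show "(\<lambda>n. E n \<omega>) \<longlonglongrightarrow> 0"
        by (intro tendsto_sandwich[of "\<lambda>_. 0" "\<lambda>n. E n \<omega>" sequentially]) (auto intro!: always_eventually E1[OF w])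
    qed
  qed (use Em in auto)
  then have "(\<lambda>n. nn_energy M T (\<lambda>s \<omega>. \<phi> s \<omega> - simple_process n (\<tau> n) (\<xi> n) s \<omega>)) \<longlonglongrightarrow> 0"
    unfolding nn_energy_def sp E_def by simp
  from order_tendstoD(2)[OF this e] have "eventually (\<lambda>n. 0 < n \<and> nn_energy M T (\<lambda>s \<omega>. \<phi> s \<omega> - simple_process n (\<tau> n) (\<xi> n) s \<omega>) < e) sequentially"
    using eventually_gt_at_top[of 0] by eventually_elim auto
  then show ?thesis using sd by (auto dest!: eventually_happens)
qed

lemma simple_data_elem:
  assumes "simple_data M T F N \<tau> \<xi>"
  shows "elem_data N \<tau> (\<lambda>k. \<tau> (Suc k)) \<xi>"
proof -
  have "0 \<le> \<tau> k" if "k \<le> N" for k using that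
  proof (induction k)
    case (Suc k)
    then have "\<tau> k < \<tau> (Suc k)" using assms by (auto simp: simple_data_def)
    then show ?case using Suc by simp
  qed (use assms in \<open>simp add: simple_data_def\<close>)
  then show ?thesis using assms unfolding elem_data_def simple_data_def by (meson less_imp_le)
qed

lemma elem_proc_clipped:
  fixes \<xi> :: "nat \<Rightarrow> 'w \<Rightarrow> 'a::euclidean_space"
  assumes e: "elem_data N a b \<xi>"
  shows "clipped t (elem_proc N a b \<xi>) \<in> borel_measurable (M \<Otimes>\<^sub>M lborel)"
proof -
  have [measurable]: "\<xi> k \<in> borel_measurable M" if "k < N" for k using elem_data_measurable[OF e that] .
  have "(\<lambda>p. indicator {0..t} (snd p) *\<^sub>R (\<Sum>k<N. indicator {a k<..b k} (snd p) *\<^sub>R \<xi> k (fst p))) \<in> borel_measurable (M \<Otimes>\<^sub>M lborel)"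
    by (intro borel_measurable_sum borel_measurable_scaleR) (auto intro!: measurable_compose[OF measurable_fst])
  moreover have "(\<lambda>p. indicator {0..t} (snd p) *\<^sub>R (\<Sum>k<N. indicator {a k<..b k} (snd p) *\<^sub>R \<xi> k (fst p))) = clipped t (elem_proc N a b \<xi>)"
    by (auto simp: clipped_def elem_proc_def)
  ultimately show ?thesis by simp
qed

text \<open>Values of norm above n are replaced by 0, which preserves progressive measurability and
  converges in energy; the bounded case applies to the truncation.\<close>

lemma simple_dense:
  fixes \<phi> :: "real \<Rightarrow> 'w \<Rightarrow> 'a::euclidean_space"
  assumes T: "0 < T" and \<phi>: "\<phi> \<in> L2_process M T F" and e: "0 < e"
  shows "\<exists>N \<tau> \<xi>. simple_data M T F N \<tau> \<xi> \<and> nn_energy M T (\<lambda>s \<omega>. \<phi> s \<omega> - simple_process N \<tau> \<xi> s \<omega>) < e"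
proof -
  have prog: "progressive T F \<phi>" and fin: "nn_energy M T \<phi> < \<infinity>" using \<phi> by (auto simp: L2_process_def)
  \<comment> \<open>The squared triangle inequality costs a factor 2 on each term, so each error
    gets a quarter of e; an infinite e is treated apart.\<close>
  define e4 where "e4 = (if e = \<top> then 1 else e / 4)"
  have e4: "0 < e4" "2 * e4 + 2 * e4 \<le> e"
  proof -
    show "0 < e4" using e by (auto simp: e4_def ennreal_zero_less_divide)
    show "2 * e4 + 2 * e4 \<le> e"
    proof (cases e)
      case (real r)
      then have "e / 4 = ennreal (r / 4)" by (metis divide_ennreal ennreal_numeral zero_less_numeral zero_le_numeral)
      then have "2 * e4 = ennreal 2 * ennreal (r / 4)" using real by (simp add: e4_def)
      also have "\<dots> = ennreal (2 * (r / 4))" using real by (intro ennreal_mult[symmetric]) auto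
      finally have "2 * e4 = ennreal (r / 2)" by simp
      then show ?thesis using real by (simp add: ennreal_plus[symmetric] del: ennreal_plus)
    qed simp
  qed
  define tr where "tr n s \<omega> = (if norm (\<phi> s \<omega>) \<le> real n then \<phi> s \<omega> else 0)" for n :: nat and s \<omega>
  have trp: "progressive T F (tr n)" for n
    unfolding progressive_def
  proof
    fix t assume "t \<in> {0..T}"
    then have [measurable]: "(\<lambda>p. \<phi> (fst p) (snd p)) \<in> borel_measurable (restrict_space borel {0..t} \<Otimes>\<^sub>M F t)"
      using prog by (simp add: progressive_def split_beta')
    have "(\<lambda>p. if norm (\<phi> (fst p) (snd p)) \<le> real n then \<phi> (fst p) (snd p) else 0) \<in> borel_measurable (restrict_space borel {0..t} \<Otimes>\<^sub>M F t)"
      by measurable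
    then show "(\<lambda>(s, \<omega>). tr n s \<omega>) \<in> borel_measurable (restrict_space borel {0..t} \<Otimes>\<^sub>M F t)"
      by (simp add: tr_def split_beta')
  qed
  have T': "T \<in> {0..T}" using T by simp
  note cm[measurable] = progressive_clipped[OF prog T'] progressive_clipped[OF trp T']
  have "(\<lambda>n. nn_sq (M \<Otimes>\<^sub>M lborel) (\<lambda>p. clipped T \<phi> p - clipped T (tr n) p)) \<longlonglongrightarrow> (\<integral>\<^sup>+ p. 0 \<partial>(M \<Otimes>\<^sub>M (lborel :: real measure)))"
  proof (rule nn_integral_dominated_convergence[where w="\<lambda>p. ennreal ((norm (clipped T \<phi> p))\<^sup>2)"
        and u="\<lambda>n p. ennreal ((norm (clipped T \<phi> p - clipped T (tr n) p))\<^sup>2)" and u'="\<lambda>p. 0"])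
    show "nn_sq (M \<Otimes>\<^sub>M lborel) (clipped T \<phi>) < \<infinity>" using fin nn_energy_clipped[OF cm(1)] by simp
    show "AE p in M \<Otimes>\<^sub>M lborel. ennreal ((norm (clipped T \<phi> p - clipped T (tr n) p))\<^sup>2) \<le> ennreal ((norm (clipped T \<phi> p))\<^sup>2)" for n
      by (intro AE_I2) (auto simp: clipped_def tr_def split: prod.splits)
    show "AE p in M \<Otimes>\<^sub>M lborel. (\<lambda>n. ennreal ((norm (clipped T \<phi> p - clipped T (tr n) p))\<^sup>2)) \<longlonglongrightarrow> 0"
    proof (rule AE_I2)
      fix p :: "'w \<times> real"
      obtain n0 :: nat where n0: "norm (\<phi> (snd p) (fst p)) \<le> real n0" using real_arch_simple by blast
      have "eventually (\<lambda>n. ennreal ((norm (clipped T \<phi> p - clipped T (tr n) p))\<^sup>2) = 0) sequentially"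
        using eventually_ge_at_top[of n0]
      proof eventually_elim
        case (elim n)
        then have "norm (\<phi> (snd p) (fst p)) \<le> real n" using n0 by linarith
        then show ?case by (simp add: clipped_def tr_def split_beta')
      qed
      then show "(\<lambda>n. ennreal ((norm (clipped T \<phi> p - clipped T (tr n) p))\<^sup>2)) \<longlonglongrightarrow> 0"
        by (rule tendsto_eventually)
    qed
  qed measurable
  then have "(\<lambda>n. nn_energy M T (\<lambda>s \<omega>. \<phi> s \<omega> - tr n s \<omega>)) \<longlonglongrightarrow> 0"
    by (subst nn_energy_clipped) (auto simp: clipped_diff)
  from order_tendstoD(2)[OF this e4(1)] obtain n where n: "nn_energy M T (\<lambda>s \<omega>. \<phi> s \<omega> - tr n s \<omega>) < e4"
    by (auto dest: eventually_happens)
  have "norm (tr n s \<omega>) \<le> real n" for s \<omega> by (simp add: tr_def)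
  from simple_dense_bounded[OF T trp _ this e4(1)]
  obtain N \<tau> \<xi> where s: "simple_data M T F N \<tau> \<xi>" "nn_energy M T (\<lambda>s \<omega>. tr n s \<omega> - simple_process N \<tau> \<xi> s \<omega>) < e4" by auto
  have "nn_energy M T (\<lambda>s \<omega>. \<phi> s \<omega> - simple_process N \<tau> \<xi> s \<omega>) \<le>
    2 * nn_energy M T (\<lambda>s \<omega>. \<phi> s \<omega> - tr n s \<omega>) + 2 * nn_energy M T (\<lambda>s \<omega>. tr n s \<omega> - simple_process N \<tau> \<xi> s \<omega>)"
    using elem_proc_clipped[OF simple_data_elem[OF s(1)]]
    by (intro nn_energy_triangle cm) (simp add: simple_process_eq_elem_proc)
  also have "\<dots> < 2 * e4 + 2 * e4"
    using n s(2) by (intro add_strict_mono ennreal_mult_strict_left_mono) auto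
  finally show ?thesis using s(1) e4(2) by (meson less_le_trans)
qed

section \<open>Mean-square limits of elementary integrals\<close>

lemma elem_l2mart:
  fixes \<xi> :: "nat \<Rightarrow> 'w \<Rightarrow> 'a::euclidean_space"
  assumes "brownian W" "elem_data N a b \<xi>"
  shows "l2mart T (elem_int W N a b \<xi>)"
  using elem_int_measurable[OF assms] elem_isometry(2)[OF assms] elem_martingale[OF assms]
  by (auto simp: l2mart_def)

lemma elem_continuous:
  fixes \<xi> :: "nat \<Rightarrow> 'w \<Rightarrow> 'a::euclidean_space"
  assumes W: "brownian W" and e: "elem_data N a b \<xi>"
  shows "AE \<omega> in M. continuous_on {0..T} (\<lambda>t. elem_int W N a b \<xi> t \<omega>)"
proof -
  have "AE \<omega> in M. continuous_on {0..} (\<lambda>t. W t \<omega>)" using W by (simp add: brownian_def)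
  then show ?thesis
  proof eventually_elim
    case (elim \<omega>)
    have "continuous_on {0..T} (\<lambda>t. W (min t c) \<omega>)" if "0 \<le> c" for c
      by (rule continuous_on_compose2[OF elim]) (use that in \<open>auto intro!: continuous_intros\<close>)
    moreover have "0 \<le> a k" "0 \<le> b k" if "k < N" for k using e that by (auto simp: elem_data_def)
    ultimately show ?case unfolding elem_int_def by (intro continuous_intros) auto
  qed
qed

text \<open>\<open>ito_integral\<close> relaxed: neither adaptedness nor continuity is imposed and
  the intervals are freely placed. Limits in this sense can be added without refining
  partitions.\<close>

definition ito_lim :: "real \<Rightarrow> (real \<Rightarrow> 'w \<Rightarrow> real) \<Rightarrow> (real \<Rightarrow> 'w \<Rightarrow> 'a::euclidean_space) \<Rightarrow> (real \<Rightarrow> 'w \<Rightarrow> 'a) \<Rightarrow> bool" where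
  "ito_lim T W \<phi> X \<longleftrightarrow> (\<exists>N a b \<xi>. (\<forall>k::nat. elem_data (N k) (a k) (b k) (\<xi> k)) \<and>
     (\<lambda>k. nn_energy M T (\<lambda>s \<omega>. \<phi> s \<omega> - elem_proc (N k) (a k) (b k) (\<xi> k) s \<omega>)) \<longlonglongrightarrow> 0 \<and>
     (\<forall>t\<in>{0..T}. (\<lambda>k. nn_sq M (\<lambda>\<omega>. X t \<omega> - elem_int W (N k) (a k) (b k) (\<xi> k) t \<omega>)) \<longlonglongrightarrow> 0))"

lemma ito_integral_lim:
  assumes "ito_integral M T F W \<phi> I"
  shows "ito_lim T W \<phi> I"
proof -
  obtain N \<tau> \<xi> where "\<forall>k::nat. simple_data M T F (N k) (\<tau> k) (\<xi> k)"
    "(\<lambda>k. nn_energy M T (\<lambda>s \<omega>. \<phi> s \<omega> - simple_process (N k) (\<tau> k) (\<xi> k) s \<omega>)) \<longlonglongrightarrow> 0"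
    "\<forall>t\<in>{0..T}. (\<lambda>k. nn_sq M (\<lambda>\<omega>. I t \<omega> - simple_integral W (N k) (\<tau> k) (\<xi> k) t \<omega>)) \<longlonglongrightarrow> 0"
    using assms unfolding ito_integral_def by blast
  then show ?thesis unfolding ito_lim_def simple_process_eq_elem_proc simple_integral_eq_elem_int
    by - (rule exI[of _ N], rule exI[of _ \<tau>], rule exI[of _ "\<lambda>k j. \<tau> k (Suc j)"], rule exI[of _ \<xi>], auto intro: simple_data_elem)
qed

text \<open>The Ito isometry up to a factor: passing from X to its approximation costs 2, and
  passing from the approximating integrand back to \<phi> costs another 2. Such a bound is all that
  uniqueness and the contraction ask for.\<close>

lemma ito_lim_bound:
  fixes \<phi> :: "real \<Rightarrow> 'w \<Rightarrow> 'a::euclidean_space"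
  assumes W: "brownian W" and l: "ito_lim T W \<phi> X" and t: "t \<in> {0..T}"
    and \<phi>: "clipped T \<phi> \<in> borel_measurable (M \<Otimes>\<^sub>M lborel)" and [measurable]: "X t \<in> borel_measurable M"
  shows "nn_sq M (X t) \<le> 4 * nn_energy M t \<phi>"
proof -
  obtain N a b \<xi> where e: "\<And>k::nat. elem_data (N k) (a k) (b k) (\<xi> k)"
    and l1: "(\<lambda>k. nn_energy M T (\<lambda>s \<omega>. \<phi> s \<omega> - elem_proc (N k) (a k) (b k) (\<xi> k) s \<omega>)) \<longlonglongrightarrow> 0"
    and l2: "(\<lambda>k. nn_sq M (\<lambda>\<omega>. X t \<omega> - elem_int W (N k) (a k) (b k) (\<xi> k) t \<omega>)) \<longlonglongrightarrow> 0"
    using l t unfolding ito_lim_def by blast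
  let ?S = "\<lambda>k. elem_proc (N k) (a k) (b k) (\<xi> k)" and ?X = "\<lambda>k. elem_int W (N k) (a k) (b k) (\<xi> k) t"
  have \<phi>t: "clipped t \<phi> \<in> borel_measurable (M \<Otimes>\<^sub>M lborel)" using clipped_measurable_le[OF \<phi>] t by simp
  have b: "nn_sq M (X t) \<le> 2 * nn_sq M (\<lambda>\<omega>. X t \<omega> - ?X k \<omega>) + (4 * nn_energy M T (\<lambda>s \<omega>. \<phi> s \<omega> - ?S k s \<omega>) + 4 * nn_energy M t \<phi>)" for k
  proof -
    have [measurable]: "?X k \<in> borel_measurable M" using F_measurable[OF elem_int_measurable[OF W e]] t by simp
    have "nn_sq M (X t) \<le> 2 * nn_sq M (\<lambda>\<omega>. X t \<omega> - ?X k \<omega>) + 2 * nn_sq M (?X k)"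
      using nn_sq_add_le[of "\<lambda>\<omega>. X t \<omega> - ?X k \<omega>" M "?X k"] by simp
    also have "nn_sq M (?X k) = nn_energy M t (?S k)" using t by (intro elem_isometry(1)[OF W e]) auto
    also have "nn_energy M t (?S k) \<le> 2 * nn_energy M t (\<lambda>s \<omega>. ?S k s \<omega> - \<phi> s \<omega>) + 2 * nn_energy M t \<phi>"
      using nn_energy_add_le[of t "\<lambda>s \<omega>. ?S k s \<omega> - \<phi> s \<omega>" M \<phi>] \<phi>t elem_proc_clipped[OF e]
      by (simp add: clipped_diff)
    also have "nn_energy M t (\<lambda>s \<omega>. ?S k s \<omega> - \<phi> s \<omega>) \<le> nn_energy M T (\<lambda>s \<omega>. \<phi> s \<omega> - ?S k s \<omega>)"
      using t by (subst nn_energy_commute) (auto intro: nn_energy_mono)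
    finally show ?thesis by (simp add: distrib_left mult.assoc[symmetric] mult_left_mono add_left_mono)
  qed
  have "(\<lambda>k. 2 * nn_sq M (\<lambda>\<omega>. X t \<omega> - ?X k \<omega>) + (4 * nn_energy M T (\<lambda>s \<omega>. \<phi> s \<omega> - ?S k s \<omega>) + 4 * nn_energy M t \<phi>))
    \<longlonglongrightarrow> 2 * 0 + (4 * 0 + 4 * nn_energy M t \<phi>)"
    by (intro tendsto_add tendsto_mult_ennreal tendsto_const l1 l2) auto
  then have lim: "(\<lambda>k. 2 * nn_sq M (\<lambda>\<omega>. X t \<omega> - ?X k \<omega>) + (4 * nn_energy M T (\<lambda>s \<omega>. \<phi> s \<omega> - ?S k s \<omega>) + 4 * nn_energy M t \<phi>))
    \<longlonglongrightarrow> 4 * nn_energy M t \<phi>" by simp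
  show ?thesis by (rule LIMSEQ_le_const[OF lim]) (use b in blast)
qed

text \<open>The two approximating sequences are concatenated index by index, so integrands and
  integrals are combined with the same coefficients.\<close>

lemma ito_lim_lincomb:
  fixes \<phi> \<psi> :: "real \<Rightarrow> 'w \<Rightarrow> 'a::euclidean_space"
  assumes W: "brownian W" and l: "ito_lim T W \<phi> X" "ito_lim T W \<psi> Y" and T: "0 \<le> T"
    and m: "clipped T \<phi> \<in> borel_measurable (M \<Otimes>\<^sub>M lborel)" "clipped T \<psi> \<in> borel_measurable (M \<Otimes>\<^sub>M lborel)"
    and X: "\<And>t. t \<in> {0..T} \<Longrightarrow> X t \<in> borel_measurable M" and Y: "\<And>t. t \<in> {0..T} \<Longrightarrow> Y t \<in> borel_measurable M"
  shows "ito_lim T W (\<lambda>s \<omega>. p *\<^sub>R \<phi> s \<omega> + q *\<^sub>R \<psi> s \<omega>) (\<lambda>s \<omega>. p *\<^sub>R X s \<omega> + q *\<^sub>R Y s \<omega>)"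
proof -
  obtain N a b \<xi> where e: "\<And>k::nat. elem_data (N k) (a k) (b k) (\<xi> k)"
    and l1: "(\<lambda>k. nn_energy M T (\<lambda>s \<omega>. \<phi> s \<omega> - elem_proc (N k) (a k) (b k) (\<xi> k) s \<omega>)) \<longlonglongrightarrow> 0"
    and l2: "\<And>t. t \<in> {0..T} \<Longrightarrow> (\<lambda>k. nn_sq M (\<lambda>\<omega>. X t \<omega> - elem_int W (N k) (a k) (b k) (\<xi> k) t \<omega>)) \<longlonglongrightarrow> 0"
    using l unfolding ito_lim_def by blast
  obtain N' a' b' \<xi>' where e': "\<And>k::nat. elem_data (N' k) (a' k) (b' k) (\<xi>' k)"
    and l1': "(\<lambda>k. nn_energy M T (\<lambda>s \<omega>. \<psi> s \<omega> - elem_proc (N' k) (a' k) (b' k) (\<xi>' k) s \<omega>)) \<longlonglongrightarrow> 0"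
    and l2': "\<And>t. t \<in> {0..T} \<Longrightarrow> (\<lambda>k. nn_sq M (\<lambda>\<omega>. Y t \<omega> - elem_int W (N' k) (a' k) (b' k) (\<xi>' k) t \<omega>)) \<longlonglongrightarrow> 0"
    using l unfolding ito_lim_def by blast
  let ?S = "\<lambda>k. elem_proc (N k) (a k) (b k) (\<xi> k)" and ?X = "\<lambda>k. elem_int W (N k) (a k) (b k) (\<xi> k)"
  let ?S' = "\<lambda>k. elem_proc (N' k) (a' k) (b' k) (\<xi>' k)" and ?X' = "\<lambda>k. elem_int W (N' k) (a' k) (b' k) (\<xi>' k)"
  have "\<forall>k. \<exists>A B Z. elem_data (N k + N' k) A B Z \<and>
     elem_proc (N k + N' k) A B Z = (\<lambda>s \<omega>. p *\<^sub>R ?S k s \<omega> + q *\<^sub>R ?S' k s \<omega>) \<and>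
     elem_int W (N k + N' k) A B Z = (\<lambda>s \<omega>. p *\<^sub>R ?X k s \<omega> + q *\<^sub>R ?X' k s \<omega>)"
    by (intro allI, rule elem_concat[OF e e', where p=p and q=q and W=W]) blast
  then obtain A B Z where z: "\<And>k. elem_data (N k + N' k) (A k) (B k) (Z k)"
    "\<And>k. elem_proc (N k + N' k) (A k) (B k) (Z k) = (\<lambda>s \<omega>. p *\<^sub>R ?S k s \<omega> + q *\<^sub>R ?S' k s \<omega>)"
    "\<And>k. elem_int W (N k + N' k) (A k) (B k) (Z k) = (\<lambda>s \<omega>. p *\<^sub>R ?X k s \<omega> + q *\<^sub>R ?X' k s \<omega>)"
    by metis
  show ?thesis unfolding ito_lim_def
  proof (rule exI[of _ "\<lambda>k. N k + N' k"], rule exI[of _ A], rule exI[of _ B], rule exI[of _ Z], intro conjI allI ballI)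
    show "elem_data (N k + N' k) (A k) (B k) (Z k)" for k by (rule z)
    have "(\<lambda>k. 2 * (ennreal (p\<^sup>2) * nn_energy M T (\<lambda>s \<omega>. \<phi> s \<omega> - ?S k s \<omega>)) + 2 * (ennreal (q\<^sup>2) * nn_energy M T (\<lambda>s \<omega>. \<psi> s \<omega> - ?S' k s \<omega>)))
       \<longlonglongrightarrow> 2 * (ennreal (p\<^sup>2) * 0) + 2 * (ennreal (q\<^sup>2) * 0)"
      by (intro tendsto_add tendsto_mult_ennreal tendsto_const l1 l1') auto
    then have lim: "(\<lambda>k. 2 * (ennreal (p\<^sup>2) * nn_energy M T (\<lambda>s \<omega>. \<phi> s \<omega> - ?S k s \<omega>)) + 2 * (ennreal (q\<^sup>2) * nn_energy M T (\<lambda>s \<omega>. \<psi> s \<omega> - ?S' k s \<omega>))) \<longlonglongrightarrow> 0"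
      by simp
    show "(\<lambda>k. nn_energy M T (\<lambda>s \<omega>. p *\<^sub>R \<phi> s \<omega> + q *\<^sub>R \<psi> s \<omega> - elem_proc (N k + N' k) (A k) (B k) (Z k) s \<omega>)) \<longlonglongrightarrow> 0"
    proof (rule tendsto_sandwich[OF _ _ tendsto_const lim])
      show "\<forall>\<^sub>F k in sequentially. nn_energy M T (\<lambda>s \<omega>. p *\<^sub>R \<phi> s \<omega> + q *\<^sub>R \<psi> s \<omega> - elem_proc (N k + N' k) (A k) (B k) (Z k) s \<omega>)
        \<le> 2 * (ennreal (p\<^sup>2) * nn_energy M T (\<lambda>s \<omega>. \<phi> s \<omega> - ?S k s \<omega>)) + 2 * (ennreal (q\<^sup>2) * nn_energy M T (\<lambda>s \<omega>. \<psi> s \<omega> - ?S' k s \<omega>))"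
      proof (intro always_eventually allI)
        fix k
        have mm: "clipped T (\<lambda>s \<omega>. \<phi> s \<omega> - ?S k s \<omega>) \<in> borel_measurable (M \<Otimes>\<^sub>M lborel)"
          "clipped T (\<lambda>s \<omega>. \<psi> s \<omega> - ?S' k s \<omega>) \<in> borel_measurable (M \<Otimes>\<^sub>M lborel)"
          using m elem_proc_clipped[OF e, of T k] elem_proc_clipped[OF e', of T k] by (simp_all add: clipped_diff)
        have "(\<lambda>s \<omega>. p *\<^sub>R \<phi> s \<omega> + q *\<^sub>R \<psi> s \<omega> - elem_proc (N k + N' k) (A k) (B k) (Z k) s \<omega>) =
          (\<lambda>s \<omega>. p *\<^sub>R (\<phi> s \<omega> - ?S k s \<omega>) + q *\<^sub>R (\<psi> s \<omega> - ?S' k s \<omega>))"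
          unfolding z by (simp add: algebra_simps)
        then show "nn_energy M T (\<lambda>s \<omega>. p *\<^sub>R \<phi> s \<omega> + q *\<^sub>R \<psi> s \<omega> - elem_proc (N k + N' k) (A k) (B k) (Z k) s \<omega>)
        \<le> 2 * (ennreal (p\<^sup>2) * nn_energy M T (\<lambda>s \<omega>. \<phi> s \<omega> - ?S k s \<omega>)) + 2 * (ennreal (q\<^sup>2) * nn_energy M T (\<lambda>s \<omega>. \<psi> s \<omega> - ?S' k s \<omega>))"
          using nn_energy_add_le[of T "\<lambda>s \<omega>. p *\<^sub>R (\<phi> s \<omega> - ?S k s \<omega>)" M "\<lambda>s \<omega>. q *\<^sub>R (\<psi> s \<omega> - ?S' k s \<omega>)"]
            mm nn_energy_scaleR[OF mm(1), of p] nn_energy_scaleR[OF mm(2), of q] borel_measurable_scaleR[OF borel_measurable_const mm(1), of p]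
            borel_measurable_scaleR[OF borel_measurable_const mm(2), of q]
          by (simp only: clipped_scaleR)
      qed
    qed simp
    fix t assume t: "t \<in> {0..T}"
    have "(\<lambda>k. 2 * (ennreal (p\<^sup>2) * nn_sq M (\<lambda>\<omega>. X t \<omega> - ?X k t \<omega>)) + 2 * (ennreal (q\<^sup>2) * nn_sq M (\<lambda>\<omega>. Y t \<omega> - ?X' k t \<omega>)))
       \<longlonglongrightarrow> 2 * (ennreal (p\<^sup>2) * 0) + 2 * (ennreal (q\<^sup>2) * 0)"
      by (intro tendsto_add tendsto_mult_ennreal tendsto_const l2[OF t] l2'[OF t]) auto
    then have lim: "(\<lambda>k. 2 * (ennreal (p\<^sup>2) * nn_sq M (\<lambda>\<omega>. X t \<omega> - ?X k t \<omega>)) + 2 * (ennreal (q\<^sup>2) * nn_sq M (\<lambda>\<omega>. Y t \<omega> - ?X' k t \<omega>))) \<longlonglongrightarrow> 0"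
      by simp
    show "(\<lambda>k. nn_sq M (\<lambda>\<omega>. p *\<^sub>R X t \<omega> + q *\<^sub>R Y t \<omega> - elem_int W (N k + N' k) (A k) (B k) (Z k) t \<omega>)) \<longlonglongrightarrow> 0"
    proof (rule tendsto_sandwich[OF _ _ tendsto_const lim])
      show "\<forall>\<^sub>F k in sequentially. nn_sq M (\<lambda>\<omega>. p *\<^sub>R X t \<omega> + q *\<^sub>R Y t \<omega> - elem_int W (N k + N' k) (A k) (B k) (Z k) t \<omega>)
        \<le> 2 * (ennreal (p\<^sup>2) * nn_sq M (\<lambda>\<omega>. X t \<omega> - ?X k t \<omega>)) + 2 * (ennreal (q\<^sup>2) * nn_sq M (\<lambda>\<omega>. Y t \<omega> - ?X' k t \<omega>))"
      proof (intro always_eventually allI)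
        fix k
        have [measurable]: "?X k t \<in> borel_measurable M" "?X' k t \<in> borel_measurable M"
          using F_measurable[OF elem_int_measurable[OF W e]] F_measurable[OF elem_int_measurable[OF W e']] t by auto
        note [measurable] = X[OF t] Y[OF t]
        have "p *\<^sub>R X t \<omega> + q *\<^sub>R Y t \<omega> - elem_int W (N k + N' k) (A k) (B k) (Z k) t \<omega> =
          p *\<^sub>R (X t \<omega> - ?X k t \<omega>) + q *\<^sub>R (Y t \<omega> - ?X' k t \<omega>)" for \<omega>
          unfolding z by (simp add: algebra_simps)
        moreover have "nn_sq M (\<lambda>\<omega>. p *\<^sub>R (X t \<omega> - ?X k t \<omega>) + q *\<^sub>R (Y t \<omega> - ?X' k t \<omega>)) \<le>
           2 * nn_sq M (\<lambda>\<omega>. p *\<^sub>R (X t \<omega> - ?X k t \<omega>)) + 2 * nn_sq M (\<lambda>\<omega>. q *\<^sub>R (Y t \<omega> - ?X' k t \<omega>))"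
          by (rule nn_sq_add_le) measurable
        moreover have "nn_sq M (\<lambda>\<omega>. p *\<^sub>R (X t \<omega> - ?X k t \<omega>)) = ennreal (p\<^sup>2) * nn_sq M (\<lambda>\<omega>. X t \<omega> - ?X k t \<omega>)"
          by (rule nn_sq_scaleR) measurable
        moreover have "nn_sq M (\<lambda>\<omega>. q *\<^sub>R (Y t \<omega> - ?X' k t \<omega>)) = ennreal (q\<^sup>2) * nn_sq M (\<lambda>\<omega>. Y t \<omega> - ?X' k t \<omega>)"
          by (rule nn_sq_scaleR) measurable
        ultimately show "nn_sq M (\<lambda>\<omega>. p *\<^sub>R X t \<omega> + q *\<^sub>R Y t \<omega> - elem_int W (N k + N' k) (A k) (B k) (Z k) t \<omega>)
        \<le> 2 * (ennreal (p\<^sup>2) * nn_sq M (\<lambda>\<omega>. X t \<omega> - ?X k t \<omega>)) + 2 * (ennreal (q\<^sup>2) * nn_sq M (\<lambda>\<omega>. Y t \<omega> - ?X' k t \<omega>))"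
          by (simp only:)
      qed
    qed simp
  qed
qed

end

section \<open>The Ito integral\<close>

text \<open>The norms of the increments decay geometrically with ratio sqrt (1/2), so the M-test
  applies to the telescoping series.\<close>

lemma uniform_limit_of_rapid:
  fixes f :: "nat \<Rightarrow> 'b \<Rightarrow> 'a::banach"
  assumes b: "0 \<le> b" and f: "\<And>n t. t \<in> A \<Longrightarrow> (norm (f (Suc n) t - f n t))\<^sup>2 \<le> b * (1/2) ^ n"
  shows "uniform_limit A f (\<lambda>t. lim (\<lambda>n. f n t)) sequentially"
proof -
  have "norm (f (Suc n) t - f n t) \<le> sqrt b * sqrt (1/2) ^ n" if "t \<in> A" for n t
  proof -
    have "norm (f (Suc n) t - f n t) \<le> sqrt (b * (1/2) ^ n)" using f[OF that] by (rule real_le_rsqrt)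
    then show ?thesis by (simp add: real_sqrt_mult real_sqrt_power)
  qed
  moreover have "summable (\<lambda>n. sqrt b * sqrt (1/2) ^ n)"
    by (intro summable_mult summable_geometric) (simp add: real_sqrt_divide)
  ultimately have "uniform_limit A (\<lambda>n t. \<Sum>i<n. f (Suc i) t - f i t) (\<lambda>t. \<Sum>i. f (Suc i) t - f i t) sequentially"
    by (rule Weierstrass_m_test)
  then obtain L where L: "uniform_limit A (\<lambda>n t. \<Sum>i<n. f (Suc i) t - f i t) L sequentially" by blast
  have "uniform_limit A (\<lambda>n t. f n t - f 0 t) L sequentially"
  proof -
    have "(\<Sum>i<n. f (Suc i) t - f i t) = f n t - f 0 t" for n t
      using sum_lessThan_telescope[of "\<lambda>i. f i t" n] by simp
    then show ?thesis using L by (simp only:)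
  qed
  moreover have "uniform_limit A (\<lambda>n::nat. f 0) (f 0) sequentially" by (rule uniform_limit_const)
  ultimately have "uniform_limit A (\<lambda>n t. (f n t - f 0 t) + f 0 t) (\<lambda>t. L t + f 0 t) sequentially"
    by (rule uniform_limit_add)
  then
  have u: "uniform_limit A f (\<lambda>t. L t + f 0 t) sequentially" by simp
  have "lim (\<lambda>n. f n t) = L t + f 0 t" if "t \<in> A" for t
    using tendsto_uniform_limitI[OF u that] by (rule limI)
  then show ?thesis using u by (simp cong: uniform_limit_cong')
qed

text \<open>A summation form of Borel-Cantelli: the sum of 2^n G n has finite expectation, so it is
  finite almost everywhere and bounds each of its terms. The decay 4^-n pays for summability and
  leaves 2^-n.\<close>

lemma AE_rapid:
  assumes [measurable]: "\<And>n::nat. G n \<in> borel_measurable M"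
    and c: "0 \<le> c" and G: "\<And>n. (\<integral>\<^sup>+ x. G n x \<partial>M) \<le> ennreal (c * (1/4) ^ n)"
  shows "AE x in M. \<exists>b\<ge>0. \<forall>n. G n x \<le> ennreal (b * (1/2) ^ n)"
proof -
  have "(\<integral>\<^sup>+ x. (\<Sum>n. ennreal (2 ^ n) * G n x) \<partial>M) = (\<Sum>n. ennreal (2 ^ n) * (\<integral>\<^sup>+ x. G n x \<partial>M))"
    by (subst nn_integral_suminf) (auto simp: nn_integral_cmult)
  also have "\<dots> \<le> (\<Sum>n. ennreal (c * (1/2) ^ n))"
  proof (intro suminf_le allI)
    fix n
    have "ennreal (2 ^ n) * (\<integral>\<^sup>+ x. G n x \<partial>M) \<le> ennreal (2 ^ n) * ennreal (c * (1/4) ^ n)"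
      by (intro mult_left_mono G) auto
    also have "\<dots> = ennreal (2 ^ n * (c * (1/4) ^ n))" using c by (intro ennreal_mult[symmetric]) auto
    also have "2 ^ n * (c * (1/4) ^ n) = c * (1/2) ^ n" by (simp add: power_divide power_mult_distrib[symmetric] divide_simps)
    finally show "ennreal (2 ^ n) * (\<integral>\<^sup>+ x. G n x \<partial>M) \<le> ennreal (c * (1/2) ^ n)" .
  qed auto
  also have "\<dots> < \<infinity>"
    using c by (subst suminf_ennreal2) (auto intro: summable_mult summable_geometric)
  finally have "AE x in M. (\<Sum>n. ennreal (2 ^ n) * G n x) \<noteq> \<infinity>"
    by (intro nn_integral_PInf_AE) auto
  then show ?thesis
  proof eventually_elim
    case (elim x)
    then obtain b where b: "0 \<le> b" "(\<Sum>n. ennreal (2 ^ n) * G n x) = ennreal b"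
      by (cases "\<Sum>n. ennreal (2 ^ n) * G n x") auto
    have "G n x \<le> ennreal (b * (1/2) ^ n)" for n
    proof -
      have "sum (\<lambda>n. ennreal (2 ^ n) * G n x) {n} \<le> (\<Sum>n. ennreal (2 ^ n) * G n x)"
        by (rule sum_le_suminf) auto
      then have 1: "ennreal (2 ^ n) * G n x \<le> ennreal b" using b by simp
      have "G n x = ennreal ((1/2) ^ n) * (ennreal (2 ^ n) * G n x)"
        by (simp add: mult.assoc[symmetric] ennreal_mult[symmetric] power_mult_distrib[symmetric])
      also have "\<dots> \<le> ennreal ((1/2) ^ n) * ennreal b" by (intro mult_left_mono 1) auto
      also have "\<dots> = ennreal (b * (1/2) ^ n)" using b by (simp add: ennreal_mult mult.commute)
      finally show ?thesis .
    qed
    then show ?case using b by blast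
  qed
qed

lemma continuous_on_set_integral:
  fixes f :: "real \<Rightarrow> 'a::euclidean_space"
  assumes f: "set_integrable lborel {0..T} f"
  shows "continuous_on {0..T} (\<lambda>t. LINT s:{0..t}|lborel. f s)"
proof -
  have "set_integrable lborel {0..t} f" if "t \<in> {0..T}" for t
    by (rule set_integrable_subset[OF f]) (use that in auto)
  then have eq: "integral {0..t} f = (LINT s:{0..t}|lborel. f s)" if "t \<in> {0..T}" for t
    using that by (intro set_borel_integral_eq_integral(2)[symmetric]) auto
  have "continuous_on {0..T} (\<lambda>t. integral {0..t} f)"
    by (rule indefinite_integral_continuous_1[OF set_borel_integral_eq_integral(1)[OF f]])
  then show ?thesis by (rule continuous_on_eq) (rule eq)
qed

context filtered_space begin

text \<open>Concatenation with coefficients 1 and -1 shows that the difference is again elementary,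
  so martingale property and isometry apply to it.\<close>

lemma elem_diff:
  fixes \<xi> :: "nat \<Rightarrow> 'w \<Rightarrow> 'a::euclidean_space"
  assumes W: "brownian W" and e: "elem_data N a b \<xi>" "elem_data N' a' b' \<xi>'"
  shows "l2mart T (\<lambda>t \<omega>. elem_int W N a b \<xi> t \<omega> - elem_int W N' a' b' \<xi>' t \<omega>)"
    and "0 \<le> t \<Longrightarrow> nn_sq M (\<lambda>\<omega>. elem_int W N a b \<xi> t \<omega> - elem_int W N' a' b' \<xi>' t \<omega>) =
      nn_energy M t (\<lambda>s \<omega>. elem_proc N a b \<xi> s \<omega> - elem_proc N' a' b' \<xi>' s \<omega>)"
proof -
  have "\<exists>A B Z. elem_data (N + N') A B Z \<and>
     elem_proc (N + N') A B Z = (\<lambda>s \<omega>. 1 *\<^sub>R elem_proc N a b \<xi> s \<omega> + (-1) *\<^sub>R elem_proc N' a' b' \<xi>' s \<omega>) \<and>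
     elem_int W (N + N') A B Z = (\<lambda>s \<omega>. 1 *\<^sub>R elem_int W N a b \<xi> s \<omega> + (-1) *\<^sub>R elem_int W N' a' b' \<xi>' s \<omega>)"
    by (rule elem_concat[OF e, where p=1 and q="-1" and W=W]) ((rule exI)+, intro conjI; assumption)
  then obtain A B Z where z: "elem_data (N + N') A B Z"
    "elem_proc (N + N') A B Z = (\<lambda>s \<omega>. 1 *\<^sub>R elem_proc N a b \<xi> s \<omega> + (-1) *\<^sub>R elem_proc N' a' b' \<xi>' s \<omega>)"
    "elem_int W (N + N') A B Z = (\<lambda>s \<omega>. 1 *\<^sub>R elem_int W N a b \<xi> s \<omega> + (-1) *\<^sub>R elem_int W N' a' b' \<xi>' s \<omega>)"
    by blast
  show "l2mart T (\<lambda>t \<omega>. elem_int W N a b \<xi> t \<omega> - elem_int W N' a' b' \<xi>' t \<omega>)"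
    using elem_l2mart[OF W z(1), of T] unfolding z(3) by simp
  show "0 \<le> t \<Longrightarrow> nn_sq M (\<lambda>\<omega>. elem_int W N a b \<xi> t \<omega> - elem_int W N' a' b' \<xi>' t \<omega>) =
      nn_energy M t (\<lambda>s \<omega>. elem_proc N a b \<xi> s \<omega> - elem_proc N' a' b' \<xi>' s \<omega>)"
    using elem_isometry(1)[OF W z(1), of t] unfolding z(2,3) by simp
qed

text \<open>Simple integrands approach \<phi> at rate 4^-n. Doob's inequality moves this rate to the
  suprema over [0, T], so almost every path converges uniformly and the limit stays
  continuous.\<close>

lemma ito_integral_exists:
  fixes \<phi> :: "real \<Rightarrow> 'w \<Rightarrow> 'a::euclidean_space"
  assumes W: "brownian W" and T: "0 < T" and \<phi>: "\<phi> \<in> L2_process M T F"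
  obtains I where "ito_integral M T F W \<phi> I"
proof -
  have "\<forall>n. \<exists>N \<tau> \<xi>. simple_data M T F N \<tau> \<xi> \<and> nn_energy M T (\<lambda>s \<omega>. \<phi> s \<omega> - simple_process N \<tau> \<xi> s \<omega>) < ennreal ((1/4) ^ n)"
    by (intro allI simple_dense[OF T \<phi>]) simp
  from choice[OF this] obtain N where "\<forall>n. \<exists>\<tau> \<xi>. simple_data M T F (N n) \<tau> \<xi> \<and> nn_energy M T (\<lambda>s \<omega>. \<phi> s \<omega> - simple_process (N n) \<tau> \<xi> s \<omega>) < ennreal ((1/4) ^ n)" ..
  from choice[OF this] obtain \<tau> where "\<forall>n. \<exists>\<xi>. simple_data M T F (N n) (\<tau> n) \<xi> \<and> nn_energy M T (\<lambda>s \<omega>. \<phi> s \<omega> - simple_process (N n) (\<tau> n) \<xi> s \<omega>) < ennreal ((1/4) ^ n)" ..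
  from choice[OF this] obtain \<xi> where "\<forall>n. simple_data M T F (N n) (\<tau> n) (\<xi> n) \<and> nn_energy M T (\<lambda>s \<omega>. \<phi> s \<omega> - simple_process (N n) (\<tau> n) (\<xi> n) s \<omega>) < ennreal ((1/4) ^ n)" ..
  then have sd: "\<And>n. simple_data M T F (N n) (\<tau> n) (\<xi> n)"
    and en: "\<And>n. nn_energy M T (\<lambda>s \<omega>. \<phi> s \<omega> - simple_process (N n) (\<tau> n) (\<xi> n) s \<omega>) < ennreal ((1/4) ^ n)"
    by simp_all
  note e = simple_data_elem[OF sd]
  define X where "X n = simple_integral W (N n) (\<tau> n) (\<xi> n)" for n
  define S where "S n = simple_process (N n) (\<tau> n) (\<xi> n)" for n
  have T': "T \<in> {0..T}" using T by simp
  have Sc: "clipped T (S n) \<in> borel_measurable (M \<Otimes>\<^sub>M lborel)" for n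
    unfolding S_def simple_process_eq_elem_proc by (rule elem_proc_clipped[OF e])
  have Xm: "X n t \<in> borel_measurable (F t)" if "0 \<le> t" for n t
    unfolding X_def simple_integral_eq_elem_int by (rule elem_int_measurable[OF W e that])
  have XM: "X n t \<in> borel_measurable M" if "0 \<le> t" for n t using F_measurable[OF Xm[OF that] that] .
  have Xmart: "l2mart T (X n)" for n unfolding X_def simple_integral_eq_elem_int by (rule elem_l2mart[OF W e])
  have Xd: "l2mart T (\<lambda>t \<omega>. X m t \<omega> - X n t \<omega>)" for m n
    unfolding X_def simple_integral_eq_elem_int by (rule elem_diff(1)[OF W e e])
  have Xcont: "AE \<omega> in M. continuous_on {0..T} (\<lambda>t. X n t \<omega>)" for n
    unfolding X_def simple_integral_eq_elem_int by (rule elem_continuous[OF W e])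
  have Xsq: "nn_sq M (\<lambda>\<omega>. X m t \<omega> - X n t \<omega>) \<le> ennreal (4 * (1/4) ^ n)" if mn: "n \<le> m" and t: "t \<in> {0..T}" for m n t
  proof -
    have "nn_sq M (\<lambda>\<omega>. X m t \<omega> - X n t \<omega>) = nn_energy M t (\<lambda>s \<omega>. S m s \<omega> - S n s \<omega>)"
      unfolding X_def S_def simple_integral_eq_elem_int simple_process_eq_elem_proc using t by (intro elem_diff(2)[OF W e e]) auto
    also have "\<dots> \<le> nn_energy M T (\<lambda>s \<omega>. S m s \<omega> - S n s \<omega>)" using t by (intro nn_energy_mono) auto
    also have "\<dots> \<le> 2 * nn_energy M T (\<lambda>s \<omega>. S m s \<omega> - \<phi> s \<omega>) + 2 * nn_energy M T (\<lambda>s \<omega>. \<phi> s \<omega> - S n s \<omega>)"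
      by (intro nn_energy_triangle Sc L2_process_clipped[OF \<phi> T'])
    also have "\<dots> \<le> 2 * ennreal ((1/4) ^ n) + 2 * ennreal ((1/4) ^ n)"
    proof (intro add_mono mult_left_mono)
      have "nn_energy M T (\<lambda>s \<omega>. S m s \<omega> - \<phi> s \<omega>) \<le> ennreal ((1/4) ^ m)"
        using en[of m] by (subst nn_energy_commute) (simp add: S_def less_imp_le)
      also have "\<dots> \<le> ennreal ((1/4) ^ n)" using mn by (intro ennreal_leI power_decreasing) auto
      finally show "nn_energy M T (\<lambda>s \<omega>. S m s \<omega> - \<phi> s \<omega>) \<le> ennreal ((1/4) ^ n)" .
      show "nn_energy M T (\<lambda>s \<omega>. \<phi> s \<omega> - S n s \<omega>) \<le> ennreal ((1/4) ^ n)" using en[of n] by (simp add: S_def less_imp_le)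
    qed auto
    also have "\<dots> = ennreal (2 * (1/4) ^ n) + ennreal (2 * (1/4) ^ n)" by (simp add: ennreal_mult)
    also have "\<dots> = ennreal (4 * (1/4) ^ n)" by (subst ennreal_plus[symmetric]) auto
    finally show ?thesis .
  qed
  \<comment> \<open>The 16 is Doob's 4 times the 4 of \<open>Xsq\<close>.\<close>
  have "\<forall>n. \<exists>G. G \<in> borel_measurable M \<and> (\<integral>\<^sup>+ \<omega>. G \<omega> \<partial>M) \<le> ennreal (16 * (1/4) ^ n) \<and>
    (AE \<omega> in M. (SUP t\<in>{0..T}. ennreal ((norm (X (Suc n) t \<omega> - X n t \<omega>))\<^sup>2)) \<le> G \<omega>)"
  proof
    fix n
    have c: "AE \<omega> in M. continuous_on {0..T} (\<lambda>t. X (Suc n) t \<omega> - X n t \<omega>)"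
      using Xcont[of n] Xcont[of "Suc n"] by eventually_elim (intro continuous_on_diff)
    show "\<exists>G. G \<in> borel_measurable M \<and> (\<integral>\<^sup>+ \<omega>. G \<omega> \<partial>M) \<le> ennreal (16 * (1/4) ^ n) \<and>
    (AE \<omega> in M. (SUP t\<in>{0..T}. ennreal ((norm (X (Suc n) t \<omega> - X n t \<omega>))\<^sup>2)) \<le> G \<omega>)"
    proof (rule doob_majorant[OF Xd T c])
      fix G assume G: "G \<in> borel_measurable M" "(\<integral>\<^sup>+ \<omega>. G \<omega> \<partial>M) \<le> 4 * nn_sq M (\<lambda>\<omega>. X (Suc n) T \<omega> - X n T \<omega>)"
        "AE \<omega> in M. (SUP t\<in>{0..T}. ennreal ((norm (X (Suc n) t \<omega> - X n t \<omega>))\<^sup>2)) \<le> G \<omega>"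
      have "4 * nn_sq M (\<lambda>\<omega>. X (Suc n) T \<omega> - X n T \<omega>) \<le> 4 * ennreal (4 * (1/4) ^ n)"
        by (intro mult_left_mono Xsq) (use T in auto)
      also have "\<dots> = ennreal 4 * ennreal (4 * (1/4) ^ n)" by simp
      also have "\<dots> = ennreal (4 * (4 * (1/4) ^ n))" by (rule ennreal_mult[symmetric]) auto
      finally have "4 * nn_sq M (\<lambda>\<omega>. X (Suc n) T \<omega> - X n T \<omega>) \<le> ennreal (16 * (1/4) ^ n)" by simp
      then show ?thesis using G by (intro exI[of _ G]) (auto intro: order_trans)
    qed
  qed
  from choice[OF this] obtain G where G0: "\<forall>n. G n \<in> borel_measurable M \<and> (\<integral>\<^sup>+ \<omega>. G n \<omega> \<partial>M) \<le> ennreal (16 * (1/4) ^ n) \<and>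
    (AE \<omega> in M. (SUP t\<in>{0..T}. ennreal ((norm (X (Suc n) t \<omega> - X n t \<omega>))\<^sup>2)) \<le> G n \<omega>)" ..
  then have G: "\<And>n. G n \<in> borel_measurable M" "\<And>n. (\<integral>\<^sup>+ \<omega>. G n \<omega> \<partial>M) \<le> ennreal (16 * (1/4) ^ n)"
    "\<And>n. AE \<omega> in M. (SUP t\<in>{0..T}. ennreal ((norm (X (Suc n) t \<omega> - X n t \<omega>))\<^sup>2)) \<le> G n \<omega>" by blast+
  \<comment> \<open>\<open>lim\<close> has a value also where the sequence diverges, so I is adapted
    at every time; convergence is claimed almost everywhere only.\<close>
  define I where "I t \<omega> = lim (\<lambda>n. X n t \<omega>)" for t \<omega>
  have Im: "I t \<in> borel_measurable (F t)" if "0 \<le> t" for t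
    unfolding I_def[abs_def] by (rule borel_measurable_lim_metric) (rule Xm[OF that])
  have IM: "I t \<in> borel_measurable M" if "0 \<le> t" for t using F_measurable[OF Im[OF that] that] .
  have "AE \<omega> in M. \<forall>n. (SUP t\<in>{0..T}. ennreal ((norm (X (Suc n) t \<omega> - X n t \<omega>))\<^sup>2)) \<le> G n \<omega>"
    using G(3) by (simp add: AE_all_countable)
  moreover have "AE \<omega> in M. \<exists>b\<ge>0. \<forall>n. G n \<omega> \<le> ennreal (b * (1/2) ^ n)"
    by (rule AE_rapid[OF G(1) _ G(2)]) simp
  ultimately have ul: "AE \<omega> in M. uniform_limit {0..T} (\<lambda>n t. X n t \<omega>) (\<lambda>t. I t \<omega>) sequentially"
  proof eventually_elim
    case (elim \<omega>)
    then obtain b where b: "b \<ge> 0" "\<And>n. G n \<omega> \<le> ennreal (b * (1/2) ^ n)" by blast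
    have "(norm (X (Suc n) t \<omega> - X n t \<omega>))\<^sup>2 \<le> b * (1/2) ^ n" if "t \<in> {0..T}" for n t
    proof -
      have "ennreal ((norm (X (Suc n) t \<omega> - X n t \<omega>))\<^sup>2) \<le> (SUP t\<in>{0..T}. ennreal ((norm (X (Suc n) t \<omega> - X n t \<omega>))\<^sup>2))"
        using that by (rule SUP_upper)
      also have "\<dots> \<le> G n \<omega>" using elim(1) by blast
      also have "\<dots> \<le> ennreal (b * (1/2) ^ n)" by (rule b)
      finally show ?thesis using b(1) by (subst (asm) ennreal_le_iff) auto
    qed
    from uniform_limit_of_rapid[where f="\<lambda>n t. X n t \<omega>" and A="{0..T}", OF b(1) this] show ?case by (simp add: I_def)
  qed
  have Icont: "AE \<omega> in M. continuous_on {0..T} (\<lambda>t. I t \<omega>)"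
  proof -
    have "AE \<omega> in M. \<forall>n. continuous_on {0..T} (\<lambda>t. X n t \<omega>)" using Xcont by (simp add: AE_all_countable)
    with ul show ?thesis
    proof eventually_elim
      case (elim \<omega>)
      show ?case by (rule uniform_limit_theorem[OF _ elim(1)]) (use elim(2) in auto)
    qed
  qed
  have lim: "(\<lambda>n. nn_sq M (\<lambda>\<omega>. I t \<omega> - X n t \<omega>)) \<longlonglongrightarrow> 0" if t: "t \<in> {0..T}" for t
  proof -
    have [measurable]: "X n t \<in> borel_measurable M" "I t \<in> borel_measurable M" for n using XM IM t by auto
    have b: "nn_sq M (\<lambda>\<omega>. I t \<omega> - X n t \<omega>) \<le> ennreal (4 * (1/4) ^ n)" for n
    proof -
      \<comment> \<open>Fatou's lemma transfers the Cauchy bound \<open>Xsq\<close> to the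
        limit.\<close>
      have "AE \<omega> in M. ennreal ((norm (I t \<omega> - X n t \<omega>))\<^sup>2) = liminf (\<lambda>m. ennreal ((norm (X m t \<omega> - X n t \<omega>))\<^sup>2))"
        using ul
      proof eventually_elim
        case (elim \<omega>)
        have "(\<lambda>m. ennreal ((norm (X m t \<omega> - X n t \<omega>))\<^sup>2)) \<longlonglongrightarrow> ennreal ((norm (I t \<omega> - X n t \<omega>))\<^sup>2)"
          by (intro tendsto_ennrealI tendsto_power tendsto_norm tendsto_diff tendsto_const tendsto_uniform_limitI[OF elim t])
        from lim_imp_Liminf[OF _ this] show ?case by simp
      qed
      then have "nn_sq M (\<lambda>\<omega>. I t \<omega> - X n t \<omega>) = (\<integral>\<^sup>+ \<omega>. liminf (\<lambda>m. ennreal ((norm (X m t \<omega> - X n t \<omega>))\<^sup>2)) \<partial>M)"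
        by (rule nn_integral_cong_AE)
      also have "\<dots> \<le> liminf (\<lambda>m. nn_sq M (\<lambda>\<omega>. X m t \<omega> - X n t \<omega>))"
        by (rule nn_integral_liminf) measurable
      also have "\<dots> \<le> liminf (\<lambda>m. ennreal (4 * (1/4) ^ n))"
        using Xsq[OF _ t, of n] by (intro Liminf_mono) (unfold eventually_sequentially, blast)
      also have "\<dots> = ennreal (4 * (1/4) ^ n)" by (simp add: Liminf_const)
      finally show ?thesis .
    qed
    have "(\<lambda>n. 4 * (1/4) ^ n :: real) \<longlonglongrightarrow> 4 * 0" by (intro tendsto_mult tendsto_const LIMSEQ_power_zero) simp
    then have "(\<lambda>n. ennreal (4 * (1/4) ^ n)) \<longlonglongrightarrow> ennreal 0" by (intro tendsto_ennrealI) simp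
    then have l: "(\<lambda>n. ennreal (4 * (1/4) ^ n)) \<longlonglongrightarrow> 0" by simp
    show ?thesis by (rule tendsto_sandwich[OF _ _ tendsto_const l]) (use b in auto)
  qed
  have "(\<lambda>n. nn_energy M T (\<lambda>s \<omega>. \<phi> s \<omega> - S n s \<omega>)) \<longlonglongrightarrow> 0"
  proof (rule tendsto_sandwich[OF _ _ tendsto_const])
    show "\<forall>\<^sub>F n in sequentially. nn_energy M T (\<lambda>s \<omega>. \<phi> s \<omega> - S n s \<omega>) \<le> ennreal ((1/4) ^ n)"
      using less_imp_le[OF en] by (simp add: S_def)
    have "(\<lambda>n. (1/4) ^ n :: real) \<longlonglongrightarrow> 0" by (intro LIMSEQ_power_zero) simp
    then show "(\<lambda>n. ennreal ((1/4) ^ n)) \<longlonglongrightarrow> 0" using tendsto_ennrealI by fastforce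
  qed simp
  then have "\<exists>N \<tau> \<xi>. (\<forall>k::nat. simple_data M T F (N k) (\<tau> k) (\<xi> k)) \<and>
    (\<lambda>k. nn_energy M T (\<lambda>s \<omega>. \<phi> s \<omega> - simple_process (N k) (\<tau> k) (\<xi> k) s \<omega>)) \<longlonglongrightarrow> 0 \<and>
    (\<forall>t\<in>{0..T}. (\<lambda>k. nn_sq M (\<lambda>\<omega>. I t \<omega> - simple_integral W (N k) (\<tau> k) (\<xi> k) t \<omega>)) \<longlonglongrightarrow> 0)"
    using sd lim unfolding X_def S_def by - (rule exI[of _ N], rule exI[of _ \<tau>], rule exI[of _ \<xi>], simp)
  moreover have "\<forall>t\<in>{0..T}. I t \<in> borel_measurable (F t)" using Im by simp
  ultimately have "ito_integral M T F W \<phi> I" unfolding ito_integral_def using \<phi> Icont by blast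
  then show thesis by (rule that)
qed

section \<open>Bounds, modifications and linearity of the Ito integral\<close>

lemma ito_integral_measurable:
  "ito_integral M T F W \<phi> I \<Longrightarrow> t \<in> {0..T} \<Longrightarrow> I t \<in> borel_measurable (F t)"
  "ito_integral M T F W \<phi> I \<Longrightarrow> t \<in> {0..T} \<Longrightarrow> I t \<in> borel_measurable M"
  by (auto simp: ito_integral_def intro: F_measurable)

lemma ito_integral_L2: "ito_integral M T F W \<phi> I \<Longrightarrow> \<phi> \<in> L2_process M T F"
  and ito_integral_continuous: "ito_integral M T F W \<phi> I \<Longrightarrow> AE \<omega> in M. continuous_on {0..T} (\<lambda>t. I t \<omega>)"
  by (simp_all add: ito_integral_def)

lemma ito_integral_bound:
  fixes \<phi> :: "real \<Rightarrow> 'w \<Rightarrow> 'a::euclidean_space"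
  assumes "brownian W" "ito_integral M T F W \<phi> I" "t \<in> {0..T}"
  shows "nn_sq M (I t) \<le> 4 * nn_energy M t \<phi>"
proof -
  have "T \<in> {0..T}" using assms(3) by auto
  then show ?thesis using assms
    by (intro ito_lim_bound[OF assms(1) ito_integral_lim[OF assms(2)] assms(3)]
        L2_process_clipped[OF ito_integral_L2[OF assms(2)]] ito_integral_measurable(2)[OF assms(2)]) auto
qed

lemma ito_integral_l2mart:
  fixes \<phi> :: "real \<Rightarrow> 'w \<Rightarrow> 'a::euclidean_space"
  assumes W: "brownian W" and I: "ito_integral M T F W \<phi> I"
  shows "l2mart T I"
proof -
  obtain N a b \<xi> where e: "\<And>k::nat. elem_data (N k) (a k) (b k) (\<xi> k)"
    and l: "\<And>t. t \<in> {0..T} \<Longrightarrow> (\<lambda>k. nn_sq M (\<lambda>\<omega>. I t \<omega> - elem_int W (N k) (a k) (b k) (\<xi> k) t \<omega>)) \<longlonglongrightarrow> 0"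
    using ito_integral_lim[OF I] unfolding ito_lim_def by blast
  show ?thesis by (rule l2mart_limit[OF elem_l2mart[OF W e] ito_integral_measurable(1)[OF I] l])
qed

text \<open>The approximation clause sees I only through mean squares at fixed times, so equality
  almost surely at each time is enough.\<close>

lemma ito_integral_modification:
  assumes I: "ito_integral M T F W \<phi> I" and J: "\<And>t. t \<in> {0..T} \<Longrightarrow> J t \<in> borel_measurable (F t)"
    and Jc: "AE \<omega> in M. continuous_on {0..T} (\<lambda>t. J t \<omega>)"
    and eq: "\<And>t. t \<in> {0..T} \<Longrightarrow> AE \<omega> in M. I t \<omega> = J t \<omega>"
  shows "ito_integral M T F W \<phi> J"
proof -
  have "(\<integral>\<^sup>+ \<omega>. ennreal ((norm (J t \<omega> - S \<omega>))\<^sup>2) \<partial>M) = (\<integral>\<^sup>+ \<omega>. ennreal ((norm (I t \<omega> - S \<omega>))\<^sup>2) \<partial>M)"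
    if "t \<in> {0..T}" for t S using eq[OF that] by (intro nn_integral_cong_AE) auto
  moreover obtain N \<tau> \<xi> where "\<And>k::nat. simple_data M T F (N k) (\<tau> k) (\<xi> k)"
    "(\<lambda>k. nn_energy M T (\<lambda>s \<omega>. \<phi> s \<omega> - simple_process (N k) (\<tau> k) (\<xi> k) s \<omega>)) \<longlonglongrightarrow> 0"
    "\<And>t. t \<in> {0..T} \<Longrightarrow> (\<lambda>k. nn_sq M (\<lambda>\<omega>. I t \<omega> - simple_integral W (N k) (\<tau> k) (\<xi> k) t \<omega>)) \<longlonglongrightarrow> 0"
    using I unfolding ito_integral_def by blast
  ultimately have "\<exists>N \<tau> \<xi>. (\<forall>k::nat. simple_data M T F (N k) (\<tau> k) (\<xi> k)) \<and>
    (\<lambda>k. nn_energy M T (\<lambda>s \<omega>. \<phi> s \<omega> - simple_process (N k) (\<tau> k) (\<xi> k) s \<omega>)) \<longlonglongrightarrow> 0 \<and>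
    (\<forall>t\<in>{0..T}. (\<lambda>k. nn_sq M (\<lambda>\<omega>. J t \<omega> - simple_integral W (N k) (\<tau> k) (\<xi> k) t \<omega>)) \<longlonglongrightarrow> 0)"
    by - (rule exI[of _ N], rule exI[of _ \<tau>], rule exI[of _ \<xi>], simp)
  then show ?thesis using I J Jc unfolding ito_integral_def by blast
qed

lemma AE_eq_of_nn_sq_diff:
  fixes f g :: "'w \<Rightarrow> 'a::euclidean_space"
  assumes [measurable]: "f \<in> borel_measurable M" "g \<in> borel_measurable M" and z: "nn_sq M (\<lambda>\<omega>. f \<omega> - g \<omega>) \<le> 0"
  shows "AE \<omega> in M. f \<omega> = g \<omega>"
proof -
  have "nn_sq M (\<lambda>\<omega>. f \<omega> - g \<omega>) = 0" using z by simp
  then have "AE \<omega> in M. ennreal ((norm (f \<omega> - g \<omega>))\<^sup>2) = 0" by (subst (asm) nn_integral_0_iff_AE) auto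
  then show ?thesis by eventually_elim (simp add: ennreal_eq_0_iff)
qed

lemma L2_process_lincomb:
  fixes \<phi> \<psi> :: "real \<Rightarrow> 'w \<Rightarrow> 'a::euclidean_space"
  assumes \<phi>: "\<phi> \<in> L2_process M T F" and \<psi>: "\<psi> \<in> L2_process M T F" and T: "0 < T"
  shows "(\<lambda>s \<omega>. p *\<^sub>R \<phi> s \<omega> + q *\<^sub>R \<psi> s \<omega>) \<in> L2_process M T F"
proof -
  have T': "T \<in> {0..T}" using T by simp
  note c = L2_process_clipped[OF \<phi> T'] L2_process_clipped[OF \<psi> T']
  have "nn_energy M T (\<lambda>s \<omega>. p *\<^sub>R \<phi> s \<omega> + q *\<^sub>R \<psi> s \<omega>) \<le> 2 * nn_energy M T (\<lambda>s \<omega>. p *\<^sub>R \<phi> s \<omega>) + 2 * nn_energy M T (\<lambda>s \<omega>. q *\<^sub>R \<psi> s \<omega>)"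
    by (intro nn_energy_add_le) (auto simp: clipped_scaleR intro!: borel_measurable_scaleR c)
  also have "\<dots> < \<infinity>"
    using \<phi> \<psi> by (simp add: nn_energy_scaleR c L2_process_def ennreal_mult_less_top)
  finally have "nn_energy M T (\<lambda>s \<omega>. p *\<^sub>R \<phi> s \<omega> + q *\<^sub>R \<psi> s \<omega>) < \<infinity>" .
  moreover have "progressive T F (\<lambda>s \<omega>. p *\<^sub>R \<phi> s \<omega> + q *\<^sub>R \<psi> s \<omega>)"
    using \<phi> \<psi> by (auto simp: L2_process_def progressive_iff clipped_add clipped_scaleR
        intro!: borel_measurable_add borel_measurable_scaleR)
  ultimately show ?thesis by (simp add: L2_process_def)
qed

text \<open>\<open>ito_integral\<close> asks for simple integrands over one partition, whereas
  concatenation yields only elementary ones. So an integral K of the combined integrand is taken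
  from the existence theorem; K minus the combined integrals is an \<open>ito_lim\<close> of the
  zero integrand, hence zero almost surely at each time.\<close>

lemma ito_integral_lincomb:
  fixes \<phi> \<psi> :: "real \<Rightarrow> 'w \<Rightarrow> 'a::euclidean_space"
  assumes W: "brownian W" and T: "0 < T" and I: "ito_integral M T F W \<phi> I" and J: "ito_integral M T F W \<psi> J"
  shows "ito_integral M T F W (\<lambda>s \<omega>. p *\<^sub>R \<phi> s \<omega> + q *\<^sub>R \<psi> s \<omega>) (\<lambda>s \<omega>. p *\<^sub>R I s \<omega> + q *\<^sub>R J s \<omega>)"
proof (rule ito_integral_exists[OF W T L2_process_lincomb[OF ito_integral_L2[OF I] ito_integral_L2[OF J] T]])
  fix K assume K: "ito_integral M T F W (\<lambda>s \<omega>. p *\<^sub>R \<phi> s \<omega> + q *\<^sub>R \<psi> s \<omega>) K"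
  have T': "T \<in> {0..T}" and T0: "0 \<le> T" using T by auto
  let ?\<chi> = "\<lambda>s \<omega>. p *\<^sub>R \<phi> s \<omega> + q *\<^sub>R \<psi> s \<omega>" and ?L = "\<lambda>s \<omega>. p *\<^sub>R I s \<omega> + q *\<^sub>R J s \<omega>"
  note c = L2_process_clipped[OF ito_integral_L2[OF I] T'] L2_process_clipped[OF ito_integral_L2[OF J] T']
    L2_process_clipped[OF ito_integral_L2[OF K] T']
  note m = ito_integral_measurable(2)[OF I] ito_integral_measurable(2)[OF J] ito_integral_measurable(2)[OF K]
  have Lm: "?L t \<in> borel_measurable M" if "t \<in> {0..T}" for t using m(1,2)[OF that] by measurable
  have l: "ito_lim T W ?\<chi> ?L"
    by (rule ito_lim_lincomb[OF W ito_integral_lim[OF I] ito_integral_lim[OF J] T0 c(1,2) m(1,2)])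
  have "ito_lim T W (\<lambda>s \<omega>. 1 *\<^sub>R ?\<chi> s \<omega> + (-1) *\<^sub>R ?\<chi> s \<omega>) (\<lambda>s \<omega>. 1 *\<^sub>R K s \<omega> + (-1) *\<^sub>R ?L s \<omega>)"
    by (rule ito_lim_lincomb[OF W ito_integral_lim[OF K] l T0 c(3,3) m(3) Lm])
  then have l0: "ito_lim T W (\<lambda>s \<omega>. 0) (\<lambda>s \<omega>. K s \<omega> - ?L s \<omega>)" by (simp add: algebra_simps)
  have eq: "AE \<omega> in M. K t \<omega> = ?L t \<omega>" if t: "t \<in> {0..T}" for t
  proof (rule AE_eq_of_nn_sq_diff[OF m(3)[OF t] Lm[OF t]])
    have "(\<lambda>\<omega>. K t \<omega> - ?L t \<omega>) \<in> borel_measurable M" using m(3)[OF t] Lm[OF t] by measurable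
    then have "nn_sq M (\<lambda>\<omega>. K t \<omega> - ?L t \<omega>) \<le> 4 * nn_energy M t (\<lambda>s \<omega>. 0 :: 'a)"
      by (intro ito_lim_bound[OF W l0 t]) (simp_all add: clipped_0)
    then show "nn_sq M (\<lambda>\<omega>. K t \<omega> - ?L t \<omega>) \<le> 0" by (simp add: nn_energy_def)
  qed
  show ?thesis
  proof (rule ito_integral_modification[OF K _ _ eq])
    show "?L t \<in> borel_measurable (F t)" if "t \<in> {0..T}" for t
      using ito_integral_measurable(1)[OF I that] ito_integral_measurable(1)[OF J that] by measurable
    show "AE \<omega> in M. continuous_on {0..T} (\<lambda>t. ?L t \<omega>)"
      using ito_integral_continuous[OF I] ito_integral_continuous[OF J]
      by eventually_elim (intro continuous_intros)
  qed
qed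

text \<open>X is approximated by its values at the next grid point to the right. Cutting this point
  at t keeps the value \<open>F t\<close>-measurable, and right-continuity gives
  convergence.\<close>

lemma progressive_right_continuous:
  fixes X :: "real \<Rightarrow> 'w \<Rightarrow> 'a::euclidean_space"
  assumes X: "\<And>t. t \<in> {0..T} \<Longrightarrow> X t \<in> borel_measurable (F t)"
    and rc: "\<And>\<omega> t. \<omega> \<in> space M \<Longrightarrow> t \<in> {0..<T} \<Longrightarrow> ((\<lambda>s. X s \<omega>) \<longlongrightarrow> X t \<omega>) (at_right t)"
  shows "progressive T F X"
  unfolding progressive_def
proof
  fix t assume t: "t \<in> {0..T}"
  let ?R = "restrict_space borel {0..t} \<Otimes>\<^sub>M F t"
  \<comment> \<open>Floor plus one leads strictly to the right of s; the cut at t makes it exactly t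
    when s = t.\<close>
  define r where "r n s = min t ((of_int \<lfloor>real (Suc n) * s\<rfloor> + 1) / real (Suc n))" for n s
  have fm: "(\<lambda>p. X (r n (fst p)) (snd p)) \<in> borel_measurable ?R" for n
  proof -
    have "(\<lambda>s. s) \<in> measurable (restrict_space borel {0..t}) (borel :: real measure)" by (rule measurable_restrict_space1) simp
    then have "(\<lambda>p. (\<lambda>s. s) (fst p)) \<in> borel_measurable ?R" by (rule measurable_compose[OF measurable_fst])
    then have [measurable]: "fst \<in> borel_measurable ?R" by simp
    have "(\<lambda>p. nat \<lfloor>real (Suc n) * fst p\<rfloor>) \<in> measurable ?R (count_space UNIV)" by measurable
    moreover have "(\<lambda>p. X (min t ((real k + 1) / real (Suc n))) (snd p)) \<in> borel_measurable ?R" for k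
    proof (rule measurable_compose[OF measurable_snd])
      show "X (min t ((real k + 1) / real (Suc n))) \<in> borel_measurable (F t)"
        using t by (intro F_measurable_mono[OF X]) (auto simp: min_def)
    qed
    ultimately have "(\<lambda>p. X (min t ((real (nat \<lfloor>real (Suc n) * fst p\<rfloor>) + 1) / real (Suc n))) (snd p)) \<in> borel_measurable ?R"
      by (rule measurable_compose_countable[rotated])
    moreover have "(\<lambda>p. X (min t ((real (nat \<lfloor>real (Suc n) * fst p\<rfloor>) + 1) / real (Suc n))) (snd p)) \<in> borel_measurable ?R \<longleftrightarrow>
      (\<lambda>p. X (r n (fst p)) (snd p)) \<in> borel_measurable ?R"
      by (rule measurable_cong) (auto simp: r_def space_pair_measure space_restrict_space)
    ultimately show ?thesis by simp
  qed
  have "(\<lambda>p. X (fst p) (snd p)) \<in> borel_measurable ?R"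
  proof (rule borel_measurable_LIMSEQ_metric[OF fm])
    fix p assume "p \<in> space ?R"
    then have p: "fst p \<in> {0..t}" "snd p \<in> space M" by (auto simp: space_pair_measure space_restrict_space)
    show "(\<lambda>n. X (r n (fst p)) (snd p)) \<longlonglongrightarrow> X (fst p) (snd p)"
    proof (cases "fst p = t")
      case True
      have "r n t = t" for n
      proof -
        have "real (Suc n) * t \<le> of_int \<lfloor>real (Suc n) * t\<rfloor> + 1" by linarith
        then have "t \<le> (of_int \<lfloor>real (Suc n) * t\<rfloor> + 1) / real (Suc n)" by (simp add: field_simps)
        then show ?thesis by (simp add: r_def)
      qed
      then show ?thesis using True by simp
    next
      case False
      let ?s = "fst p"
      have st: "?s < t" "0 \<le> ?s" using False p by auto
      have gt: "?s < r n ?s" for n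
      proof -
        have "real (Suc n) * ?s < of_int \<lfloor>real (Suc n) * ?s\<rfloor> + 1" by linarith
        then have "?s < (of_int \<lfloor>real (Suc n) * ?s\<rfloor> + 1) / real (Suc n)" by (simp add: field_simps)
        then show ?thesis using st by (simp add: r_def)
      qed
      have le: "r n ?s \<le> ?s + 1 / real (Suc n)" for n
      proof -
        have "of_int \<lfloor>real (Suc n) * ?s\<rfloor> + 1 \<le> real (Suc n) * ?s + 1" by linarith
        then have "(of_int \<lfloor>real (Suc n) * ?s\<rfloor> + 1) / real (Suc n) \<le> (real (Suc n) * ?s + 1) / real (Suc n)"
          by (rule divide_right_mono) simp
        then show ?thesis by (simp add: r_def add_divide_distrib min.coboundedI2)
      qed
      have "(\<lambda>n. ?s + 1 / real (Suc n)) \<longlonglongrightarrow> ?s + 0"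
        by (intro tendsto_add tendsto_const LIMSEQ_Suc[OF lim_1_over_n])
      then have "(\<lambda>n. r n ?s) \<longlonglongrightarrow> ?s"
        by (intro tendsto_sandwich[of "\<lambda>_. ?s" "\<lambda>n. r n ?s" sequentially "\<lambda>n. ?s + 1 / real (Suc n)"])
          (use gt le in \<open>auto intro!: always_eventually less_imp_le\<close>)
      then have "filterlim (\<lambda>n. r n ?s) (at_right ?s) sequentially"
        using gt by (auto simp: filterlim_at intro!: always_eventually less_imp_neq[THEN not_sym])
      moreover have "((\<lambda>s. X s (snd p)) \<longlongrightarrow> X ?s (snd p)) (at_right ?s)"
        using st t by (intro rc p) auto
      ultimately show ?thesis by (rule filterlim_compose[rotated])
    qed
  qed
  then show "(\<lambda>(s, \<omega>). X s \<omega>) \<in> borel_measurable ?R" by (simp add: split_beta')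
qed

lemma progressive_adapted:
  fixes X :: "real \<Rightarrow> 'w \<Rightarrow> 'a::euclidean_space"
  assumes "progressive T F X" and t: "t \<in> {0..T}"
  shows "X t \<in> borel_measurable (F t)"
proof -
  have "clipped t X \<in> borel_measurable (F t \<Otimes>\<^sub>M borel)" using assms by (simp add: progressive_iff)
  from measurable_Pair1[OF this, of t] show ?thesis using t by (simp add: clipped_def)
qed

text \<open>Paths in an exceptional null set are set to zero. The null set belongs to every
  \<open>F t\<close>, so adaptedness survives and all paths become continuous.\<close>

lemma progressive_modification:
  fixes X :: "real \<Rightarrow> 'w \<Rightarrow> 'a::euclidean_space"
  assumes X: "\<And>t. t \<in> {0..T} \<Longrightarrow> X t \<in> borel_measurable (F t)"
    and c: "AE \<omega> in M. continuous_on {0..T} (\<lambda>t. X t \<omega>)"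
  obtains Y where "progressive T F Y" "\<And>\<omega>. \<omega> \<in> space M \<Longrightarrow> continuous_on {0..T} (\<lambda>t. Y t \<omega>)"
    "AE \<omega> in M. \<forall>t. Y t \<omega> = X t \<omega>"
proof -
  obtain N where N: "{\<omega> \<in> space M. \<not> continuous_on {0..T} (\<lambda>t. X t \<omega>)} \<subseteq> N" "N \<in> null_sets M"
    using c by (auto elim!: AE_E simp: null_sets_def)
  define Y where "Y t \<omega> = (if \<omega> \<in> N then 0 else X t \<omega>)" for t \<omega>
  have cont: "continuous_on {0..T} (\<lambda>t. Y t \<omega>)" if "\<omega> \<in> space M" for \<omega>
    using N(1) that by (cases "\<omega> \<in> N") (auto simp: Y_def)
  show thesis
  proof (rule that[of Y])
    show "progressive T F Y"
    proof (rule progressive_right_continuous)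
      fix t assume t: "t \<in> {0..T}"
      have "N \<in> sets (F t)" using N(2) F_null by auto
      then have "N \<inter> space (F t) \<in> sets (F t)" by (intro sets.Int sets.top)
      then show "Y t \<in> borel_measurable (F t)" unfolding Y_def[abs_def] using X[OF t] by (intro measurable_If_set) auto
    next
      fix \<omega> t assume w: "\<omega> \<in> space M" and t: "t \<in> {0..<T}"
      have "((\<lambda>s. Y s \<omega>) \<longlongrightarrow> Y t \<omega>) (at t within {0..T})"
        using cont[OF w] t by (auto simp: continuous_on_def)
      then have "((\<lambda>s. Y s \<omega>) \<longlongrightarrow> Y t \<omega>) (at t within {t..T})"
        by (rule tendsto_within_subset) (use t in auto)
      then show "((\<lambda>s. Y s \<omega>) \<longlongrightarrow> Y t \<omega>) (at_right t)"
        using t by (simp add: at_within_Icc_at_right)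
    qed
    show "AE \<omega> in M. \<forall>t. Y t \<omega> = X t \<omega>"
      using AE_not_in[OF N(2)] by eventually_elim (simp add: Y_def)
  qed (rule cont)
qed

lemma drift_measurable:
  fixes \<beta> :: "real \<Rightarrow> 'w \<Rightarrow> 'a::euclidean_space"
  assumes p: "progressive T F \<beta>" and t: "t \<in> {0..T}"
  shows "(\<lambda>\<omega>. LINT s:{0..t}|lborel. \<beta> s \<omega>) \<in> borel_measurable (F t)"
proof -
  have [measurable]: "clipped t \<beta> \<in> borel_measurable (F t \<Otimes>\<^sub>M borel)" using p t by (simp add: progressive_iff)
  have "(\<lambda>\<omega>. LINT s|lborel. clipped t \<beta> (\<omega>, s)) \<in> borel_measurable (F t)" by measurable
  then show ?thesis by (simp add: set_lebesgue_integral_def clipped_def)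
qed

end

section \<open>Linear stochastic differential equations\<close>

lemma ennreal_norm_set_integral_le:
  fixes f :: "real \<Rightarrow> 'a::euclidean_space"
  shows "ennreal (norm (LINT s:{0..t}|lborel. f s)) \<le> (\<integral>\<^sup>+ s. ennreal (norm (f s)) * indicator {0..t} s \<partial>lborel)"
proof (cases "integrable lborel (\<lambda>s. indicator {0..t} s *\<^sub>R f s)")
  case True
  have "ennreal (norm (LINT s:{0..t}|lborel. f s)) \<le> (\<integral>\<^sup>+ s. ennreal (norm (indicator {0..t} s *\<^sub>R f s)) \<partial>lborel)"
    unfolding set_lebesgue_integral_def by (rule integral_norm_bound_ennreal[OF True])
  also have "\<dots> = (\<integral>\<^sup>+ s. ennreal (norm (f s)) * indicator {0..t} s \<partial>lborel)"
    by (intro nn_integral_cong) (auto simp: indicator_def)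
  finally show ?thesis .
qed (simp add: set_lebesgue_integral_def not_integrable_integral_eq)

lemma ennreal_power2: "0 \<le> x \<Longrightarrow> ennreal (x\<^sup>2) = (ennreal x)\<^sup>2"
  by (simp add: ennreal_power)

text \<open>k need not be bounded, so it is split at a height n: the part above n has integral below
  1/8, and the part below contributes at most n exp(c t) / c, which a large c makes small. This
  replaces a Lipschitz constant.\<close>

lemma exponential_weight:
  fixes k :: "real \<Rightarrow> real"
  assumes [measurable]: "k \<in> borel_measurable borel" and k0: "\<And>s. 0 \<le> k s"
    and fin: "(\<integral>\<^sup>+ s. ennreal (k s) * indicator {0..T} s \<partial>lborel) < \<infinity>"
  obtains c where "0 < c" "\<And>t. t \<in> {0..T} \<Longrightarrow>
    (\<integral>\<^sup>+ s. ennreal (k s) * ennreal (exp (c * s)) * indicator {0..t} s \<partial>lborel) \<le> ennreal (exp (c * t) / 4)"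
proof -
  \<comment> \<open>The part of the kernel above height n; its integral tends to 0.\<close>
  define h where "h n s = ennreal (k s) * indicator {s. real n < k s} s * indicator {0..T} s" for n s
  have "(\<lambda>n. \<integral>\<^sup>+ s. h n s \<partial>lborel) \<longlonglongrightarrow> (\<integral>\<^sup>+ s. 0 \<partial>(lborel :: real measure))"
  proof (rule nn_integral_dominated_convergence[where w="\<lambda>s. ennreal (k s) * indicator {0..T} s" and u=h and u'="\<lambda>s. 0"])
    show "AE s in lborel. h n s \<le> ennreal (k s) * indicator {0..T} s" for n
      by (intro AE_I2) (auto simp: h_def indicator_def)
    show "AE s in lborel. (\<lambda>n. h n s) \<longlonglongrightarrow> 0"
    proof (rule AE_I2)
      fix s
      obtain n0 :: nat where n0: "k s \<le> real n0" using real_arch_simple by blast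
      have "eventually (\<lambda>n. h n s = 0) sequentially"
        using eventually_ge_at_top[of n0]
      proof eventually_elim
        case (elim n)
        then have "k s \<le> real n" using n0 by linarith
        then show ?case by (simp add: h_def)
      qed
      then show "(\<lambda>n. h n s) \<longlonglongrightarrow> 0" by (rule tendsto_eventually)
    qed
  qed (use fin in \<open>auto simp: h_def[abs_def]\<close>)
  then have "(\<lambda>n. \<integral>\<^sup>+ s. h n s \<partial>lborel) \<longlonglongrightarrow> 0" by simp
  from order_tendstoD(2)[OF this, of "ennreal (1/8)"]
  obtain n where n: "(\<integral>\<^sup>+ s. h n s \<partial>lborel) < ennreal (1/8)" by (auto dest: eventually_happens)
  \<comment> \<open>Makes n / c at most 1/8, so that with the tail the total is 1/4; the added 1
    keeps c positive for n = 0.\<close>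
  define c where "c = 8 * (real n + 1)"
  have c0: "0 < c" by (simp add: c_def)
  have "(\<integral>\<^sup>+ s. ennreal (k s) * ennreal (exp (c * s)) * indicator {0..t} s \<partial>lborel) \<le> ennreal (exp (c * t) / 4)"
    if t: "t \<in> {0..T}" for t
  proof -
    have "(\<integral>\<^sup>+ s. ennreal (k s) * ennreal (exp (c * s)) * indicator {0..t} s \<partial>lborel) \<le>
      (\<integral>\<^sup>+ s. h n s * ennreal (exp (c * t)) + ennreal (real n) * (ennreal (exp (c * s)) * indicator {0..t} s) \<partial>lborel)"
    proof (rule nn_integral_mono)
      fix s
      show "ennreal (k s) * ennreal (exp (c * s)) * indicator {0..t} s \<le>
        h n s * ennreal (exp (c * t)) + ennreal (real n) * (ennreal (exp (c * s)) * indicator {0..t} s)"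
      proof (cases "s \<in> {0..t}")
        case True
        show ?thesis
        proof (cases "real n < k s")
          case nk: True
          have "ennreal (k s) * ennreal (exp (c * s)) \<le> ennreal (k s) * ennreal (exp (c * t))"
            using True c0 by (intro mult_left_mono ennreal_leI) auto
          then show ?thesis using True nk t by (simp add: h_def add_increasing2)
        next
          case nk: False
          have "ennreal (k s) * ennreal (exp (c * s)) \<le> ennreal (real n) * ennreal (exp (c * s))"
            using nk by (intro mult_right_mono ennreal_leI) auto
          then show ?thesis using True by (simp add: add_increasing)
        qed
      qed simp
    qed
    also have "\<dots> = (\<integral>\<^sup>+ s. h n s \<partial>lborel) * ennreal (exp (c * t)) + ennreal (real n) * (\<integral>\<^sup>+ s. ennreal (exp (c * s)) * indicator {0..t} s \<partial>lborel)"
      by (simp add: nn_integral_add nn_integral_multc nn_integral_cmult h_def)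
    also have "(\<integral>\<^sup>+ s. ennreal (exp (c * s)) * indicator {0..t} s \<partial>lborel) = ennreal (exp (c * t) / c - exp (c * 0) / c)"
      using t c0 by (intro nn_integral_FTC_Icc) (auto intro!: derivative_eq_intros)
    also have "(\<integral>\<^sup>+ s. h n s \<partial>lborel) * ennreal (exp (c * t)) + ennreal (real n) * ennreal (exp (c * t) / c - exp (c * 0) / c)
      \<le> ennreal (1/8) * ennreal (exp (c * t)) + ennreal (real n) * ennreal (exp (c * t) / c)"
      using n c0 by (intro add_mono mult_right_mono mult_left_mono ennreal_leI) auto
    also have "\<dots> = ennreal (1/8 * exp (c * t)) + ennreal (real n * (exp (c * t) / c))"
      using c0 by (intro arg_cong2[where f="(+)"] ennreal_mult[symmetric]) auto
    also have "\<dots> = ennreal (1/8 * exp (c * t) + real n * (exp (c * t) / c))"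
      using c0 by (intro ennreal_plus[symmetric]) auto
    also have "\<dots> \<le> ennreal (exp (c * t) / 4)"
    proof (rule ennreal_leI)
      have "real n / c \<le> 1/8" by (simp add: c_def divide_simps)
      then have "real n / c * exp (c * t) \<le> 1/8 * exp (c * t)" by (intro mult_right_mono) auto
      moreover have "real n / c * exp (c * t) = real n * (exp (c * t) / c)" by simp
      ultimately show "1/8 * exp (c * t) + real n * (exp (c * t) / c) \<le> exp (c * t) / 4" by linarith
    qed
    finally show ?thesis .
  qed
  then show thesis using c0 that by blast
qed

context filtered_space begin

section \<open>Weighted norms of processes\<close>

lemma nn_energy_tonelli:
  fixes \<phi> :: "real \<Rightarrow> 'w \<Rightarrow> 'a::euclidean_space"
  assumes [measurable]: "clipped t \<phi> \<in> borel_measurable (M \<Otimes>\<^sub>M lborel)"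
  shows "nn_energy M t \<phi> = (\<integral>\<^sup>+ s. nn_sq M (\<phi> s) * indicator {0..t} s \<partial>lborel)"
proof -
  interpret P: pair_sigma_finite M "lborel :: real measure" ..
  have "nn_energy M t \<phi> = nn_sq (M \<Otimes>\<^sub>M lborel) (clipped t \<phi>)" by (rule nn_energy_clipped) measurable
  also have "\<dots> = (\<integral>\<^sup>+ s. \<integral>\<^sup>+ \<omega>. ennreal ((norm (clipped t \<phi> (\<omega>, s)))\<^sup>2) \<partial>M \<partial>lborel)"
    by (rule P.nn_integral_snd[symmetric]) measurable
  also have "\<dots> = (\<integral>\<^sup>+ s. nn_sq M (\<phi> s) * indicator {0..t} s \<partial>lborel)"
    by (intro nn_integral_cong) (auto simp: clipped_def indicator_def)
  finally show ?thesis .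
qed

lemma nn_sq_process_measurable:
  fixes \<phi> :: "real \<Rightarrow> 'w \<Rightarrow> 'a::euclidean_space"
  assumes [measurable]: "clipped t \<phi> \<in> borel_measurable (M \<Otimes>\<^sub>M lborel)"
  shows "(\<lambda>s. nn_sq M (\<phi> s) * indicator {0..t} s) \<in> borel_measurable borel"
proof -
  have "(\<lambda>s. \<integral>\<^sup>+ \<omega>. ennreal ((norm (clipped t \<phi> (\<omega>, s)))\<^sup>2) \<partial>M) \<in> borel_measurable lborel"
    by measurable
  moreover have "(\<lambda>s. \<integral>\<^sup>+ \<omega>. ennreal ((norm (clipped t \<phi> (\<omega>, s)))\<^sup>2) \<partial>M) = (\<lambda>s. nn_sq M (\<phi> s) * indicator {0..t} s)"
    by (auto simp: clipped_def indicator_def)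
  ultimately show ?thesis by simp
qed

lemma path_measurable:
  fixes \<phi> :: "real \<Rightarrow> 'w \<Rightarrow> 'a::euclidean_space"
  assumes "clipped t \<phi> \<in> borel_measurable (M \<Otimes>\<^sub>M lborel)" "\<omega> \<in> space M"
  shows "(\<lambda>s. indicator {0..t} s *\<^sub>R \<phi> s \<omega>) \<in> borel_measurable borel"
  using measurable_Pair2[OF assms] by (simp add: clipped_def)

text \<open>The drift is only L^1 in time, so its natural norm is that of L^2(\<Omega>; L^1(0, t));
  this is the inner norm.\<close>

definition path_L1 :: "real \<Rightarrow> (real \<Rightarrow> 'w \<Rightarrow> 'a::euclidean_space) \<Rightarrow> 'w \<Rightarrow> ennreal" where
  "path_L1 t \<phi> \<omega> = (\<integral>\<^sup>+ s. ennreal (norm (\<phi> s \<omega>)) * indicator {0..t} s \<partial>lborel)"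

lemma path_L1_measurable:
  fixes \<phi> :: "real \<Rightarrow> 'w \<Rightarrow> 'a::euclidean_space"
  assumes [measurable]: "clipped t \<phi> \<in> borel_measurable (M \<Otimes>\<^sub>M lborel)"
  shows "path_L1 t \<phi> \<in> borel_measurable M"
proof -
  have "(\<lambda>\<omega>. \<integral>\<^sup>+ s. ennreal (norm (clipped t \<phi> (\<omega>, s))) \<partial>lborel) \<in> borel_measurable M" by measurable
  moreover have "(\<lambda>\<omega>. \<integral>\<^sup>+ s. ennreal (norm (clipped t \<phi> (\<omega>, s))) \<partial>lborel) = path_L1 t \<phi>"
    unfolding path_L1_def by (intro ext nn_integral_cong) (auto simp: clipped_def indicator_def)
  ultimately show ?thesis by simp
qed

lemma path_L1_mono: "t \<le> T \<Longrightarrow> path_L1 t \<phi> \<omega> \<le> path_L1 T \<phi> \<omega>"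
  unfolding path_L1_def by (intro nn_integral_mono) (auto simp: indicator_def)

lemma path_L1_add_le:
  fixes \<phi> \<psi> :: "real \<Rightarrow> 'w \<Rightarrow> 'a::euclidean_space"
  assumes m: "clipped t \<phi> \<in> borel_measurable (M \<Otimes>\<^sub>M lborel)" "clipped t \<psi> \<in> borel_measurable (M \<Otimes>\<^sub>M lborel)"
    and w: "\<omega> \<in> space M"
  shows "path_L1 t (\<lambda>s \<omega>. \<phi> s \<omega> + \<psi> s \<omega>) \<omega> \<le> path_L1 t \<phi> \<omega> + path_L1 t \<psi> \<omega>"
proof -
  note [measurable] = path_measurable[OF m(1) w] path_measurable[OF m(2) w]
  have "path_L1 t (\<lambda>s \<omega>. \<phi> s \<omega> + \<psi> s \<omega>) \<omega> \<le>
    (\<integral>\<^sup>+ s. ennreal (norm (indicator {0..t} s *\<^sub>R \<phi> s \<omega>)) + ennreal (norm (indicator {0..t} s *\<^sub>R \<psi> s \<omega>)) \<partial>lborel)"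
    unfolding path_L1_def
    by (intro nn_integral_mono) (auto simp: indicator_def ennreal_plus[symmetric] simp del: ennreal_plus intro!: ennreal_leI norm_triangle_ineq)
  also have "\<dots> = (\<integral>\<^sup>+ s. ennreal (norm (indicator {0..t} s *\<^sub>R \<phi> s \<omega>)) \<partial>lborel) + (\<integral>\<^sup>+ s. ennreal (norm (indicator {0..t} s *\<^sub>R \<psi> s \<omega>)) \<partial>lborel)"
    by (rule nn_integral_add) measurable
  also have "\<dots> = path_L1 t \<phi> \<omega> + path_L1 t \<psi> \<omega>"
    unfolding path_L1_def by (intro arg_cong2[where f="(+)"] nn_integral_cong) (auto simp: indicator_def)
  finally show ?thesis .
qed

lemma path_L1_square_add_le:
  fixes \<phi> \<psi> :: "real \<Rightarrow> 'w \<Rightarrow> 'a::euclidean_space"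
  assumes c: "clipped t \<phi> \<in> borel_measurable (M \<Otimes>\<^sub>M lborel)" "clipped t \<psi> \<in> borel_measurable (M \<Otimes>\<^sub>M lborel)"
  shows "(\<integral>\<^sup>+ \<omega>. (path_L1 t (\<lambda>s \<omega>. \<phi> s \<omega> + \<psi> s \<omega>) \<omega>)\<^sup>2 \<partial>M) \<le>
    2 * (\<integral>\<^sup>+ \<omega>. (path_L1 t \<phi> \<omega>)\<^sup>2 \<partial>M) + 2 * (\<integral>\<^sup>+ \<omega>. (path_L1 t \<psi> \<omega>)\<^sup>2 \<partial>M)"
proof -
  note [measurable] = path_L1_measurable[OF c(1)] path_L1_measurable[OF c(2)]
  have sq: "(a + b)\<^sup>2 \<le> 2 * a\<^sup>2 + 2 * (b::ennreal)\<^sup>2" for a b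
  proof (cases "a = \<top> \<or> b = \<top>")
    case True
    then show ?thesis by (auto simp: power2_eq_square ennreal_mult_top)
  next
    case False
    then obtain a' b' where ab: "a = ennreal a'" "b = ennreal b'" "0 \<le> a'" "0 \<le> b'" by (cases a; cases b) auto
    have "(a' + b')\<^sup>2 \<le> 2 * a'\<^sup>2 + 2 * b'\<^sup>2" using sum_squares_bound[of a' b'] by (simp add: power2_sum)
    then have "ennreal ((a' + b')\<^sup>2) \<le> ennreal (2 * a'\<^sup>2 + 2 * b'\<^sup>2)" by (rule ennreal_leI)
    then show ?thesis using ab(3,4) unfolding ab(1,2) by (simp add: ennreal_power2 ennreal_mult ennreal_plus)
  qed
  have "(\<integral>\<^sup>+ \<omega>. (path_L1 t (\<lambda>s \<omega>. \<phi> s \<omega> + \<psi> s \<omega>) \<omega>)\<^sup>2 \<partial>M) \<le>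
    (\<integral>\<^sup>+ \<omega>. 2 * (path_L1 t \<phi> \<omega>)\<^sup>2 + 2 * (path_L1 t \<psi> \<omega>)\<^sup>2 \<partial>M)"
    by (intro nn_integral_mono order_trans[OF power_mono[OF path_L1_add_le[OF c]] sq]) auto
  also have "\<dots> = 2 * (\<integral>\<^sup>+ \<omega>. (path_L1 t \<phi> \<omega>)\<^sup>2 \<partial>M) + 2 * (\<integral>\<^sup>+ \<omega>. (path_L1 t \<psi> \<omega>)\<^sup>2 \<partial>M)"
    by (simp add: nn_integral_add nn_integral_cmult)
  finally show ?thesis .
qed

text \<open>Cauchy-Schwarz in time separates sqrt k from y. With k the squared size of a coefficient
  it handles an L^2 coefficient times an L^2 process, a product that is only integrable in
  time.\<close>

lemma path_L1_cauchy_schwarz: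
  fixes \<phi> :: "real \<Rightarrow> 'w \<Rightarrow> 'a::euclidean_space" and y :: "real \<Rightarrow> 'w \<Rightarrow> 'b::euclidean_space" and k :: "real \<Rightarrow> real"
  assumes [measurable]: "k \<in> borel_measurable borel" and k0: "\<And>s. 0 \<le> k s"
    and y: "clipped t y \<in> borel_measurable (M \<Otimes>\<^sub>M lborel)"
    and b: "\<And>s \<omega>. s \<in> {0..t} \<Longrightarrow> norm (\<phi> s \<omega>) \<le> sqrt (k s) * norm (y s \<omega>)"
  shows "(\<integral>\<^sup>+ \<omega>. (path_L1 t \<phi> \<omega>)\<^sup>2 \<partial>M) \<le>
    (\<integral>\<^sup>+ s. ennreal (k s) * indicator {0..t} s \<partial>lborel) * nn_energy M t y"
proof -
  let ?K = "\<integral>\<^sup>+ s. ennreal (k s) * indicator {0..t} s \<partial>lborel"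
  let ?Y = "\<lambda>\<omega>. \<integral>\<^sup>+ s. ennreal ((norm (y s \<omega>))\<^sup>2) * indicator {0..t} s \<partial>lborel"
  have pw: "(path_L1 t \<phi> \<omega>)\<^sup>2 \<le> ?K * ?Y \<omega>" if w: "\<omega> \<in> space M" for \<omega>
  proof -
    let ?f = "\<lambda>s. ennreal (sqrt (k s)) * indicator {0..t} s"
    let ?g = "\<lambda>s. ennreal (norm (indicator {0..t} s *\<^sub>R y s \<omega>))"
    have gm: "?g \<in> borel_measurable lborel" using path_measurable[OF y w] by measurable
    have "path_L1 t \<phi> \<omega> \<le> (\<integral>\<^sup>+ s. ?f s * ?g s \<partial>lborel)"
      unfolding path_L1_def
    proof (rule nn_integral_mono)
      fix s
      show "ennreal (norm (\<phi> s \<omega>)) * indicator {0..t} s \<le> ?f s * ?g s"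
      proof (cases "s \<in> {0..t}")
        case True
        have "ennreal (norm (\<phi> s \<omega>)) \<le> ennreal (sqrt (k s) * norm (y s \<omega>))" by (intro ennreal_leI b True)
        also have "\<dots> = ennreal (sqrt (k s)) * ennreal (norm (y s \<omega>))"
          using k0[of s] by (subst ennreal_mult) auto
        finally show ?thesis using True by simp
      qed simp
    qed
    then have "(path_L1 t \<phi> \<omega>)\<^sup>2 \<le> (\<integral>\<^sup>+ s. ?f s * ?g s \<partial>lborel)\<^sup>2" by (rule power_mono) simp
    also have "\<dots> \<le> (\<integral>\<^sup>+ s. (?f s)\<^sup>2 \<partial>lborel) * (\<integral>\<^sup>+ s. (?g s)\<^sup>2 \<partial>lborel)"
      by (rule Cauchy_Schwarz_nn_integral[OF _ gm]) measurable
    also have "(\<integral>\<^sup>+ s. (?f s)\<^sup>2 \<partial>lborel) = ?K"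
      using k0 by (intro nn_integral_cong) (auto simp: indicator_def ennreal_power2[symmetric])
    also have "(\<integral>\<^sup>+ s. (?g s)\<^sup>2 \<partial>lborel) = ?Y \<omega>"
      by (intro nn_integral_cong) (auto simp: indicator_def ennreal_power2[symmetric])
    finally show ?thesis .
  qed
  have "(\<integral>\<^sup>+ \<omega>. (path_L1 t \<phi> \<omega>)\<^sup>2 \<partial>M) \<le> (\<integral>\<^sup>+ \<omega>. ?K * ?Y \<omega> \<partial>M)"
    by (intro nn_integral_mono pw)
  also have "\<dots> = ?K * nn_energy M t y"
    unfolding nn_energy_def
  proof (rule nn_integral_cmult)
    have "(\<lambda>\<omega>. \<integral>\<^sup>+ s. ennreal ((norm (clipped t y (\<omega>, s)))\<^sup>2) \<partial>lborel) \<in> borel_measurable M" using y by measurable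
    moreover have "(\<lambda>\<omega>. \<integral>\<^sup>+ s. ennreal ((norm (clipped t y (\<omega>, s)))\<^sup>2) \<partial>lborel) = ?Y"
      by (intro ext nn_integral_cong) (auto simp: clipped_def indicator_def)
    ultimately show "?Y \<in> borel_measurable M" by simp
  qed
  finally show ?thesis .
qed

lemma nn_energy_sqrt_weight:
  fixes x :: "real \<Rightarrow> 'w \<Rightarrow> 'a::euclidean_space" and k :: "real \<Rightarrow> real"
  assumes [measurable]: "k \<in> borel_measurable borel" and k0: "\<And>s. 0 \<le> k s"
    and x: "clipped t x \<in> borel_measurable (M \<Otimes>\<^sub>M lborel)"
  shows "clipped t (\<lambda>s \<omega>. sqrt (k s) *\<^sub>R x s \<omega>) \<in> borel_measurable (M \<Otimes>\<^sub>M lborel)"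
    and "nn_energy M t (\<lambda>s \<omega>. sqrt (k s) *\<^sub>R x s \<omega>) = (\<integral>\<^sup>+ s. ennreal (k s) * (nn_sq M (x s) * indicator {0..t} s) \<partial>lborel)"
proof -
  let ?y = "\<lambda>s \<omega>. sqrt (k s) *\<^sub>R x s \<omega>"
  note [measurable] = x
  show y: "clipped t ?y \<in> borel_measurable (M \<Otimes>\<^sub>M lborel)"
  proof -
    have "(\<lambda>p. sqrt (k (snd p)) *\<^sub>R clipped t x p) \<in> borel_measurable (M \<Otimes>\<^sub>M lborel)" by measurable
    moreover have "(\<lambda>p. sqrt (k (snd p)) *\<^sub>R clipped t x p) = clipped t ?y" by (auto simp: clipped_def)
    ultimately show ?thesis by simp
  qed
  have "nn_energy M t ?y = (\<integral>\<^sup>+ s. nn_sq M (?y s) * indicator {0..t} s \<partial>lborel)"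
    by (rule nn_energy_tonelli[OF y])
  also have "\<dots> = (\<integral>\<^sup>+ s. ennreal (k s) * (nn_sq M (x s) * indicator {0..t} s) \<partial>lborel)"
  proof (rule nn_integral_cong)
    fix s
    show "nn_sq M (?y s) * indicator {0..t} s = ennreal (k s) * (nn_sq M (x s) * indicator {0..t} s)"
    proof (cases "s \<in> {0..t}")
      case True
      then have "x s \<in> borel_measurable M" using measurable_Pair1[OF x, of s] by (simp add: clipped_def)
      then have "nn_sq M (?y s) = ennreal ((sqrt (k s))\<^sup>2) * nn_sq M (x s)" by (rule nn_sq_scaleR)
      then show ?thesis using True k0[of s] by simp
    qed simp
  qed
  finally show "nn_energy M t ?y = (\<integral>\<^sup>+ s. ennreal (k s) * (nn_sq M (x s) * indicator {0..t} s) \<partial>lborel)" .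
qed

text \<open>For a kernel that is only L^1, one factor sqrt k is integrated on its own and the other
  stays as a weight on x. The result has E|x(s)|^2 under the integral, as a Volterra estimate
  requires.\<close>

lemma path_L1_weighted:
  fixes x \<phi> :: "real \<Rightarrow> 'w \<Rightarrow> 'a::euclidean_space" and k :: "real \<Rightarrow> real"
  assumes [measurable]: "k \<in> borel_measurable borel" and k0: "\<And>s. 0 \<le> k s"
    and x: "clipped t x \<in> borel_measurable (M \<Otimes>\<^sub>M lborel)"
    and b: "\<And>s \<omega>. s \<in> {0..t} \<Longrightarrow> norm (\<phi> s \<omega>) \<le> k s * norm (x s \<omega>)"
  shows "(\<integral>\<^sup>+ \<omega>. (path_L1 t \<phi> \<omega>)\<^sup>2 \<partial>M) \<le>
    (\<integral>\<^sup>+ s. ennreal (k s) * indicator {0..t} s \<partial>lborel) * (\<integral>\<^sup>+ s. ennreal (k s) * (nn_sq M (x s) * indicator {0..t} s) \<partial>lborel)"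
proof -
  have "norm (\<phi> s \<omega>) \<le> sqrt (k s) * norm (sqrt (k s) *\<^sub>R x s \<omega>)" if "s \<in> {0..t}" for s \<omega>
    using b[OF that, of \<omega>] k0[of s] by (simp add: mult.assoc[symmetric])
  from path_L1_cauchy_schwarz[OF assms(1) k0 nn_energy_sqrt_weight(1)[OF assms(1) k0 x] this]
  show ?thesis unfolding nn_energy_sqrt_weight(2)[OF assms(1) k0 x] .
qed

text \<open>The null set of each identity depends on t; countably many dyadic times share one, and
  continuity extends the identity to all t.\<close>

lemma AE_all_eq_of_continuous:
  fixes X Y :: "real \<Rightarrow> 'w \<Rightarrow> 'a::euclidean_space"
  assumes T: "0 < T" and X: "AE \<omega> in M. continuous_on {0..T} (\<lambda>t. X t \<omega>)" and Y: "AE \<omega> in M. continuous_on {0..T} (\<lambda>t. Y t \<omega>)"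
    and eq: "\<And>t. t \<in> {0..T} \<Longrightarrow> AE \<omega> in M. X t \<omega> = Y t \<omega>"
  shows "AE \<omega> in M. \<forall>t\<in>{0..T}. X t \<omega> = Y t \<omega>"
proof -
  have d: "T * real k / 2 ^ n \<in> {0..T}" if "k \<le> (2::nat) ^ n" for n k :: nat
  proof -
    have "real k \<le> 2 ^ n" using that by (metis of_nat_le_iff of_nat_numeral of_nat_power)
    then show ?thesis using T by (auto simp: divide_simps)
  qed
  have "AE \<omega> in M. \<forall>n. \<forall>k\<in>{..(2::nat) ^ n}. X (T * real k / 2 ^ n) \<omega> = Y (T * real k / 2 ^ n) \<omega>"
    using d eq by (simp add: AE_all_countable AE_finite_all)
  with X Y show ?thesis
  proof eventually_elim
    case (elim \<omega>)
    show ?case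
    proof
      fix t assume t: "t \<in> {0..T}"
      obtain k where k: "\<And>n. k n \<le> (2::nat) ^ n" and lim: "(\<lambda>n. T * real (k n) / 2 ^ n) \<longlonglongrightarrow> t"
        using dyadic_approx[OF T t] by blast
      have "(\<lambda>n. X (T * real (k n) / 2 ^ n) \<omega>) \<longlonglongrightarrow> X t \<omega>" "(\<lambda>n. Y (T * real (k n) / 2 ^ n) \<omega>) \<longlonglongrightarrow> Y t \<omega>"
        using continuous_on_tendsto_compose[OF elim(1) lim t] continuous_on_tendsto_compose[OF elim(2) lim t] d[OF k] by auto
      moreover have "X (T * real (k n) / 2 ^ n) \<omega> = Y (T * real (k n) / 2 ^ n) \<omega>" for n using elim(3) k by auto
      ultimately show "X t \<omega> = Y t \<omega>" using LIMSEQ_unique by auto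
    qed
  qed
qed

text \<open>Fatou's lemma, so that a Cauchy estimate survives in the limit.\<close>

lemma nn_sq_limit_le:
  fixes X :: "nat \<Rightarrow> 'w \<Rightarrow> 'a::euclidean_space"
  assumes [measurable]: "\<And>m. X m \<in> borel_measurable M" "Y \<in> borel_measurable M"
    and l: "AE \<omega> in M. (\<lambda>m. X m \<omega>) \<longlonglongrightarrow> Z \<omega>" and b: "\<And>m. n \<le> m \<Longrightarrow> nn_sq M (\<lambda>\<omega>. X m \<omega> - Y \<omega>) \<le> b"
  shows "nn_sq M (\<lambda>\<omega>. Z \<omega> - Y \<omega>) \<le> b"
proof -
  have "AE \<omega> in M. ennreal ((norm (Z \<omega> - Y \<omega>))\<^sup>2) = liminf (\<lambda>m. ennreal ((norm (X m \<omega> - Y \<omega>))\<^sup>2))"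
    using l
  proof eventually_elim
    case (elim \<omega>)
    have "(\<lambda>m. ennreal ((norm (X m \<omega> - Y \<omega>))\<^sup>2)) \<longlonglongrightarrow> ennreal ((norm (Z \<omega> - Y \<omega>))\<^sup>2)"
      by (intro tendsto_ennrealI tendsto_power tendsto_norm tendsto_diff tendsto_const elim)
    from lim_imp_Liminf[OF _ this] show ?case by simp
  qed
  then have "nn_sq M (\<lambda>\<omega>. Z \<omega> - Y \<omega>) = (\<integral>\<^sup>+ \<omega>. liminf (\<lambda>m. ennreal ((norm (X m \<omega> - Y \<omega>))\<^sup>2)) \<partial>M)"
    by (rule nn_integral_cong_AE)
  also have "\<dots> \<le> liminf (\<lambda>m. nn_sq M (\<lambda>\<omega>. X m \<omega> - Y \<omega>))"
    by (rule nn_integral_liminf) measurable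
  also have "\<dots> \<le> liminf (\<lambda>m. b)"
    using b by (intro Liminf_mono) (unfold eventually_sequentially, blast)
  also have "\<dots> = b" by (simp add: Liminf_const)
  finally show ?thesis .
qed

end

text \<open>Random linear coefficients with deterministic kernels: kA bounds A itself and kC the
  squares of C and Cb, in line with L^1 and L^2 integrability. The regime process is hidden in the
  dependence on \<omega>.\<close>

locale linear_sde = filtered_space M F for M :: "'w measure" and F +
  fixes T :: real and W Wb :: "real \<Rightarrow> 'w \<Rightarrow> real"
    and A C Cb :: "real \<Rightarrow> 'w \<Rightarrow> 'a::euclidean_space \<Rightarrow> 'a" and kA kC :: "real \<Rightarrow> real"
  assumes T: "0 < T" and W: "brownian W" and Wb: "brownian Wb"
    and lin: "\<And>s \<omega>. linear (A s \<omega>)" "\<And>s \<omega>. linear (C s \<omega>)" "\<And>s \<omega>. linear (Cb s \<omega>)"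
    and prog: "\<And>x. progressive T F x \<Longrightarrow> progressive T F (\<lambda>s \<omega>. A s \<omega> (x s \<omega>))"
      "\<And>x. progressive T F x \<Longrightarrow> progressive T F (\<lambda>s \<omega>. C s \<omega> (x s \<omega>))"
      "\<And>x. progressive T F x \<Longrightarrow> progressive T F (\<lambda>s \<omega>. Cb s \<omega> (x s \<omega>))"
    and k_measurable [measurable]: "kA \<in> borel_measurable borel" "kC \<in> borel_measurable borel"
    and k_nonneg: "\<And>s. 0 \<le> kA s" "\<And>s. 0 \<le> kC s"
    and k_finite: "(\<integral>\<^sup>+ s. ennreal (kA s) * indicator {0..T} s \<partial>lborel) < \<infinity>"
      "(\<integral>\<^sup>+ s. ennreal (kC s) * indicator {0..T} s \<partial>lborel) < \<infinity>"
    and bound: "\<And>s \<omega> v. s \<in> {0..T} \<Longrightarrow> norm (A s \<omega> v) \<le> kA s * norm v"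
      "\<And>s \<omega> v. s \<in> {0..T} \<Longrightarrow> (norm (C s \<omega> v))\<^sup>2 \<le> kC s * (norm v)\<^sup>2"
      "\<And>s \<omega> v. s \<in> {0..T} \<Longrightarrow> (norm (Cb s \<omega> v))\<^sup>2 \<le> kC s * (norm v)\<^sup>2"
begin

text \<open>Solutions of the equation are the fixed points \<open>step f g gb x x\<close>.\<close>

definition step :: "(real \<Rightarrow> 'w \<Rightarrow> 'a) \<Rightarrow> (real \<Rightarrow> 'w \<Rightarrow> 'a) \<Rightarrow> (real \<Rightarrow> 'w \<Rightarrow> 'a) \<Rightarrow>
    (real \<Rightarrow> 'w \<Rightarrow> 'a) \<Rightarrow> (real \<Rightarrow> 'w \<Rightarrow> 'a) \<Rightarrow> bool" where
  "step f g gb x y \<longleftrightarrow> progressive T F x \<and> progressive T F y \<and> (AE \<omega> in M. continuous_on {0..T} (\<lambda>t. y t \<omega>)) \<and>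
     (AE \<omega> in M. set_integrable lborel {0..T} (\<lambda>s. A s \<omega> (x s \<omega>) + f s \<omega>)) \<and>
     (\<exists>I Ib. ito_integral M T F W (\<lambda>s \<omega>. C s \<omega> (x s \<omega>) + g s \<omega>) I \<and>
        ito_integral M T F Wb (\<lambda>s \<omega>. Cb s \<omega> (x s \<omega>) + gb s \<omega>) Ib \<and>
        (AE \<omega> in M. \<forall>t\<in>{0..T}. y t \<omega> = (LINT s:{0..t}|lborel. A s \<omega> (x s \<omega>) + f s \<omega>) + I t \<omega> + Ib t \<omega>))"

text \<open>The iteration runs in this norm, with the supremum over time outside the expectation.
  The stronger norm of \<open>state_solution\<close> is recovered from Doob's inequality.\<close>

definition bounded_L2 :: "(real \<Rightarrow> 'w \<Rightarrow> 'a) \<Rightarrow> bool" where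
  "bounded_L2 x \<longleftrightarrow> progressive T F x \<and> (\<exists>K::real. 0 \<le> K \<and> (\<forall>t\<in>{0..T}. nn_sq M (x t) \<le> ennreal K))"

section \<open>The right-hand side of the equation as a linear map\<close>

lemma T_mem: "T \<in> {0..T}" "0 \<in> {0..T}"
  using T by auto

lemma progressive_M: "progressive T F (x :: real \<Rightarrow> 'w \<Rightarrow> 'a) \<Longrightarrow> t \<in> {0..T} \<Longrightarrow> x t \<in> borel_measurable M"
  using progressive_adapted[of T x t] by (auto intro: F_measurable)

lemma progressive_lincomb:
  "progressive T F (x :: real \<Rightarrow> 'w \<Rightarrow> 'a) \<Longrightarrow> progressive T F y \<Longrightarrow> progressive T F (\<lambda>s \<omega>. p *\<^sub>R x s \<omega> + q *\<^sub>R y s \<omega>)"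
  by (auto simp: progressive_iff clipped_add clipped_scaleR intro!: borel_measurable_add borel_measurable_scaleR)

lemma step_lincomb:
  assumes 1: "step f g gb x y" and 2: "step f' g' gb' x' y'"
  shows "step (\<lambda>s \<omega>. p *\<^sub>R f s \<omega> + q *\<^sub>R f' s \<omega>) (\<lambda>s \<omega>. p *\<^sub>R g s \<omega> + q *\<^sub>R g' s \<omega>) (\<lambda>s \<omega>. p *\<^sub>R gb s \<omega> + q *\<^sub>R gb' s \<omega>)
    (\<lambda>s \<omega>. p *\<^sub>R x s \<omega> + q *\<^sub>R x' s \<omega>) (\<lambda>s \<omega>. p *\<^sub>R y s \<omega> + q *\<^sub>R y' s \<omega>)"
proof -
  obtain I Ib where I: "ito_integral M T F W (\<lambda>s \<omega>. C s \<omega> (x s \<omega>) + g s \<omega>) I"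
    "ito_integral M T F Wb (\<lambda>s \<omega>. Cb s \<omega> (x s \<omega>) + gb s \<omega>) Ib"
    "AE \<omega> in M. \<forall>t\<in>{0..T}. y t \<omega> = (LINT s:{0..t}|lborel. A s \<omega> (x s \<omega>) + f s \<omega>) + I t \<omega> + Ib t \<omega>"
    using 1 unfolding step_def by blast
  obtain I' Ib' where I': "ito_integral M T F W (\<lambda>s \<omega>. C s \<omega> (x' s \<omega>) + g' s \<omega>) I'"
    "ito_integral M T F Wb (\<lambda>s \<omega>. Cb s \<omega> (x' s \<omega>) + gb' s \<omega>) Ib'"
    "AE \<omega> in M. \<forall>t\<in>{0..T}. y' t \<omega> = (LINT s:{0..t}|lborel. A s \<omega> (x' s \<omega>) + f' s \<omega>) + I' t \<omega> + Ib' t \<omega>"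
    using 2 unfolding step_def by blast
  have i: "AE \<omega> in M. set_integrable lborel {0..T} (\<lambda>s. A s \<omega> (x s \<omega>) + f s \<omega>)"
    "AE \<omega> in M. set_integrable lborel {0..T} (\<lambda>s. A s \<omega> (x' s \<omega>) + f' s \<omega>)" using 1 2 by (auto simp: step_def)
  have c: "AE \<omega> in M. continuous_on {0..T} (\<lambda>t. y t \<omega>)" "AE \<omega> in M. continuous_on {0..T} (\<lambda>t. y' t \<omega>)"
    using 1 2 by (auto simp: step_def)
  have l: "L (p *\<^sub>R v + q *\<^sub>R v') + (p *\<^sub>R w + q *\<^sub>R w') = p *\<^sub>R (L v + w) + q *\<^sub>R (L v' + w')" if "linear L"
    for L :: "'a \<Rightarrow> 'a" and v v' w w'
    using that by (simp add: linear_add linear_scale algebra_simps)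
  show ?thesis unfolding step_def l[OF lin(1)] l[OF lin(2)] l[OF lin(3)]
  proof (intro conjI exI)
    show "progressive T F (\<lambda>s \<omega>. p *\<^sub>R x s \<omega> + q *\<^sub>R x' s \<omega>)" "progressive T F (\<lambda>s \<omega>. p *\<^sub>R y s \<omega> + q *\<^sub>R y' s \<omega>)"
      using 1 2 by (auto simp: step_def intro!: progressive_lincomb)
    show "AE \<omega> in M. continuous_on {0..T} (\<lambda>t. p *\<^sub>R y t \<omega> + q *\<^sub>R y' t \<omega>)"
      using c by eventually_elim (intro continuous_intros)
    show "AE \<omega> in M. set_integrable lborel {0..T} (\<lambda>s. p *\<^sub>R (A s \<omega> (x s \<omega>) + f s \<omega>) + q *\<^sub>R (A s \<omega> (x' s \<omega>) + f' s \<omega>))"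
      using i by eventually_elim (rule set_integral_add(1); rule set_integrable_scaleR_right; assumption)
    show "ito_integral M T F W (\<lambda>s \<omega>. p *\<^sub>R (C s \<omega> (x s \<omega>) + g s \<omega>) + q *\<^sub>R (C s \<omega> (x' s \<omega>) + g' s \<omega>)) (\<lambda>s \<omega>. p *\<^sub>R I s \<omega> + q *\<^sub>R I' s \<omega>)"
      by (rule ito_integral_lincomb[OF W T I(1) I'(1)])
    show "ito_integral M T F Wb (\<lambda>s \<omega>. p *\<^sub>R (Cb s \<omega> (x s \<omega>) + gb s \<omega>) + q *\<^sub>R (Cb s \<omega> (x' s \<omega>) + gb' s \<omega>)) (\<lambda>s \<omega>. p *\<^sub>R Ib s \<omega> + q *\<^sub>R Ib' s \<omega>)"
      by (rule ito_integral_lincomb[OF Wb T I(2) I'(2)])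
    show "AE \<omega> in M. \<forall>t\<in>{0..T}. p *\<^sub>R y t \<omega> + q *\<^sub>R y' t \<omega> =
      (LINT s:{0..t}|lborel. p *\<^sub>R (A s \<omega> (x s \<omega>) + f s \<omega>) + q *\<^sub>R (A s \<omega> (x' s \<omega>) + f' s \<omega>)) +
      (p *\<^sub>R I t \<omega> + q *\<^sub>R I' t \<omega>) + (p *\<^sub>R Ib t \<omega> + q *\<^sub>R Ib' t \<omega>)"
      using I(3) I'(3) i
    proof eventually_elim
      case (elim \<omega>)
      show ?case
      proof
        fix t assume t: "t \<in> {0..T}"
        have s: "set_integrable lborel {0..t} (\<lambda>s. A s \<omega> (x s \<omega>) + f s \<omega>)" "set_integrable lborel {0..t} (\<lambda>s. A s \<omega> (x' s \<omega>) + f' s \<omega>)"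
          using t by (auto intro: set_integrable_subset[OF elim(3)] set_integrable_subset[OF elim(4)])
        have "(LINT s:{0..t}|lborel. p *\<^sub>R (A s \<omega> (x s \<omega>) + f s \<omega>) + q *\<^sub>R (A s \<omega> (x' s \<omega>) + f' s \<omega>)) =
          p *\<^sub>R (LINT s:{0..t}|lborel. A s \<omega> (x s \<omega>) + f s \<omega>) + q *\<^sub>R (LINT s:{0..t}|lborel. A s \<omega> (x' s \<omega>) + f' s \<omega>)"
          using s by (subst set_integral_add(2)) (auto intro: set_integrable_scaleR_right)
        then show "p *\<^sub>R y t \<omega> + q *\<^sub>R y' t \<omega> =
          (LINT s:{0..t}|lborel. p *\<^sub>R (A s \<omega> (x s \<omega>) + f s \<omega>) + q *\<^sub>R (A s \<omega> (x' s \<omega>) + f' s \<omega>)) +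
          (p *\<^sub>R I t \<omega> + q *\<^sub>R I' t \<omega>) + (p *\<^sub>R Ib t \<omega> + q *\<^sub>R Ib' t \<omega>)"
          using elim(1,2) t by (simp add: algebra_simps)
      qed
    qed
  qed
qed

lemma energy_le:
  fixes x :: "real \<Rightarrow> 'w \<Rightarrow> 'a"
  assumes x: "progressive T F x" and t: "t \<in> {0..T}" and L: "progressive T F (\<lambda>s \<omega>. L s \<omega> (x s \<omega>))"
    and b: "\<And>s \<omega> v. s \<in> {0..T} \<Longrightarrow> (norm (L s \<omega> v :: 'a))\<^sup>2 \<le> kC s * (norm v)\<^sup>2"
  shows "nn_energy M t (\<lambda>s \<omega>. L s \<omega> (x s \<omega>)) \<le> (\<integral>\<^sup>+ s. ennreal (kC s) * (nn_sq M (x s) * indicator {0..t} s) \<partial>lborel)"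
proof -
  have "nn_energy M t (\<lambda>s \<omega>. L s \<omega> (x s \<omega>)) = (\<integral>\<^sup>+ s. nn_sq M (\<lambda>\<omega>. L s \<omega> (x s \<omega>)) * indicator {0..t} s \<partial>lborel)"
    by (rule nn_energy_tonelli[OF progressive_clipped[OF L t]])
  also have "\<dots> \<le> (\<integral>\<^sup>+ s. ennreal (kC s) * (nn_sq M (x s) * indicator {0..t} s) \<partial>lborel)"
  proof (rule nn_integral_mono)
    fix s
    show "nn_sq M (\<lambda>\<omega>. L s \<omega> (x s \<omega>)) * indicator {0..t} s \<le> ennreal (kC s) * (nn_sq M (x s) * indicator {0..t} s)"
    proof (cases "s \<in> {0..t}")
      case True
      then have s: "s \<in> {0..T}" using t by auto
      note [measurable] = progressive_M[OF x s]
      have "nn_sq M (\<lambda>\<omega>. L s \<omega> (x s \<omega>)) \<le> (\<integral>\<^sup>+ \<omega>. ennreal (kC s) * ennreal ((norm (x s \<omega>))\<^sup>2) \<partial>M)"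
        using k_nonneg(2)[of s] by (intro nn_integral_mono) (simp add: ennreal_mult[symmetric] ennreal_leI b[OF s])
      also have "\<dots> = ennreal (kC s) * nn_sq M (x s)" by (rule nn_integral_cmult) measurable
      finally show ?thesis using True by simp
    qed simp
  qed
  finally show ?thesis .
qed

text \<open>The first term is the 4 of \<open>norm_sum3_sq\<close> times the bound of
  \<open>path_L1_weighted\<close>. The 32 is 2 times 4 times 4: two noise terms, the same 4, and the
  4 of \<open>ito_integral_bound\<close>.\<close>

definition \<kappa> :: "real \<Rightarrow> real" where
  "\<kappa> s = 4 * enn2real (\<integral>\<^sup>+ s. ennreal (kA s) * indicator {0..T} s \<partial>lborel) * kA s + 32 * kC s"

lemma \<kappa>_nonneg: "0 \<le> \<kappa> s"
  using k_nonneg by (simp add: \<kappa>_def)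

lemma \<kappa>_measurable [measurable]: "\<kappa> \<in> borel_measurable borel"
  unfolding \<kappa>_def[abs_def] by measurable

lemma \<kappa>_finite: "(\<integral>\<^sup>+ s. ennreal (\<kappa> s) * indicator {0..T} s \<partial>lborel) < \<infinity>"
proof -
  let ?a = "enn2real (\<integral>\<^sup>+ s. ennreal (kA s) * indicator {0..T} s \<partial>lborel)"
  have "(\<integral>\<^sup>+ s. ennreal (\<kappa> s) * indicator {0..T} s \<partial>lborel) =
    (\<integral>\<^sup>+ s. ennreal (4 * ?a) * (ennreal (kA s) * indicator {0..T} s) + 32 * (ennreal (kC s) * indicator {0..T} s) \<partial>lborel)"
    using k_nonneg by (intro nn_integral_cong) (auto simp: \<kappa>_def ennreal_mult indicator_def)
  also have "\<dots> = ennreal (4 * ?a) * (\<integral>\<^sup>+ s. ennreal (kA s) * indicator {0..T} s \<partial>lborel) + 32 * (\<integral>\<^sup>+ s. ennreal (kC s) * indicator {0..T} s \<partial>lborel)"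
    by (simp add: nn_integral_add nn_integral_cmult)
  also have "\<dots> < \<infinity>" using k_finite by (simp add: ennreal_mult_less_top)
  finally show ?thesis .
qed

lemma norm_sum3_sq: "(norm (a + b + c :: 'a))\<^sup>2 \<le> 4 * (norm a)\<^sup>2 + 4 * (norm b)\<^sup>2 + 4 * (norm c)\<^sup>2"
  using norm_add_sq_le[of "a + b" c] norm_add_sq_le[of a b] zero_le_power2[of "norm c"] by linarith

text \<open>A Volterra estimate: the output at time t is controlled by the input up to t through an
  integrable kernel. The drift is bounded by Cauchy-Schwarz in time, the two noise terms by the
  isometry up to a factor.\<close>

lemma step_bound:
  assumes s: "step (\<lambda>s \<omega>. 0) (\<lambda>s \<omega>. 0) (\<lambda>s \<omega>. 0) z w" and t: "t \<in> {0..T}"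
  shows "nn_sq M (w t) \<le> (\<integral>\<^sup>+ s. ennreal (\<kappa> s) * (nn_sq M (z s) * indicator {0..t} s) \<partial>lborel)"
proof -
  have z: "progressive T F z" using s by (simp add: step_def)
  obtain I Ib where I: "ito_integral M T F W (\<lambda>s \<omega>. C s \<omega> (z s \<omega>)) I" "ito_integral M T F Wb (\<lambda>s \<omega>. Cb s \<omega> (z s \<omega>)) Ib"
    "AE \<omega> in M. \<forall>t\<in>{0..T}. w t \<omega> = (LINT s:{0..t}|lborel. A s \<omega> (z s \<omega>)) + I t \<omega> + Ib t \<omega>"
    using s unfolding step_def by auto
  let ?m = "\<lambda>s. nn_sq M (z s) * indicator {0..t} s"
  let ?d = "\<lambda>s \<omega>. A s \<omega> (z s \<omega>)"
  let ?a = "\<integral>\<^sup>+ s. ennreal (kA s) * indicator {0..T} s \<partial>lborel"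
  have zc: "clipped t z \<in> borel_measurable (M \<Otimes>\<^sub>M lborel)" by (rule progressive_clipped[OF z t])
  have dc: "clipped t ?d \<in> borel_measurable (M \<Otimes>\<^sub>M lborel)" by (rule progressive_clipped[OF prog(1)[OF z] t])
  have [measurable]: "?m \<in> borel_measurable borel" by (rule nn_sq_process_measurable[OF zc])
  note [measurable] = path_L1_measurable[OF dc] ito_integral_measurable(2)[OF I(1) t] ito_integral_measurable(2)[OF I(2) t]
  have "AE \<omega> in M. ennreal ((norm (w t \<omega>))\<^sup>2) \<le> 4 * (path_L1 t ?d \<omega>)\<^sup>2 + 4 * ennreal ((norm (I t \<omega>))\<^sup>2) + 4 * ennreal ((norm (Ib t \<omega>))\<^sup>2)"
    using I(3)
  proof eventually_elim
    case (elim \<omega>)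
    let ?D = "LINT s:{0..t}|lborel. A s \<omega> (z s \<omega>)"
    have "ennreal ((norm (w t \<omega>))\<^sup>2) \<le> ennreal (4 * (norm ?D)\<^sup>2 + 4 * (norm (I t \<omega>))\<^sup>2 + 4 * (norm (Ib t \<omega>))\<^sup>2)"
      using elim t norm_sum3_sq by (intro ennreal_leI) auto
    also have "\<dots> = 4 * (ennreal (norm ?D))\<^sup>2 + 4 * ennreal ((norm (I t \<omega>))\<^sup>2) + 4 * ennreal ((norm (Ib t \<omega>))\<^sup>2)"
      by (simp add: ennreal_plus ennreal_mult ennreal_power2)
    also have "\<dots> \<le> 4 * (path_L1 t ?d \<omega>)\<^sup>2 + 4 * ennreal ((norm (I t \<omega>))\<^sup>2) + 4 * ennreal ((norm (Ib t \<omega>))\<^sup>2)"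
      by (intro add_mono mult_left_mono power_mono order_refl) (auto simp: path_L1_def ennreal_norm_set_integral_le)
    finally show ?case .
  qed
  then have "nn_sq M (w t) \<le> (\<integral>\<^sup>+ \<omega>. 4 * (path_L1 t ?d \<omega>)\<^sup>2 + 4 * ennreal ((norm (I t \<omega>))\<^sup>2) + 4 * ennreal ((norm (Ib t \<omega>))\<^sup>2) \<partial>M)"
    by (rule nn_integral_mono_AE)
  also have "\<dots> = 4 * (\<integral>\<^sup>+ \<omega>. (path_L1 t ?d \<omega>)\<^sup>2 \<partial>M) + 4 * nn_sq M (I t) + 4 * nn_sq M (Ib t)"
    by (simp add: nn_integral_add nn_integral_cmult)
  also have "\<dots> \<le> 4 * (?a * (\<integral>\<^sup>+ s. ennreal (kA s) * ?m s \<partial>lborel)) +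
      4 * (4 * (\<integral>\<^sup>+ s. ennreal (kC s) * ?m s \<partial>lborel)) + 4 * (4 * (\<integral>\<^sup>+ s. ennreal (kC s) * ?m s \<partial>lborel))"
  proof (intro add_mono mult_left_mono)
    have "(\<integral>\<^sup>+ \<omega>. (path_L1 t ?d \<omega>)\<^sup>2 \<partial>M) \<le> (\<integral>\<^sup>+ s. ennreal (kA s) * indicator {0..t} s \<partial>lborel) * (\<integral>\<^sup>+ s. ennreal (kA s) * ?m s \<partial>lborel)"
      using t by (intro path_L1_weighted k_nonneg k_measurable zc bound(1)) auto
    also have "\<dots> \<le> ?a * (\<integral>\<^sup>+ s. ennreal (kA s) * ?m s \<partial>lborel)"
      using t by (intro mult_right_mono nn_integral_mono) (auto simp: indicator_def)
    finally show "(\<integral>\<^sup>+ \<omega>. (path_L1 t ?d \<omega>)\<^sup>2 \<partial>M) \<le> ?a * (\<integral>\<^sup>+ s. ennreal (kA s) * ?m s \<partial>lborel)" .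
    show "nn_sq M (I t) \<le> 4 * (\<integral>\<^sup>+ s. ennreal (kC s) * ?m s \<partial>lborel)"
      by (rule order_trans[OF ito_integral_bound[OF W I(1) t] mult_left_mono[OF energy_le[OF z t prog(2)[OF z] bound(2)]]]) auto
    show "nn_sq M (Ib t) \<le> 4 * (\<integral>\<^sup>+ s. ennreal (kC s) * ?m s \<partial>lborel)"
      by (rule order_trans[OF ito_integral_bound[OF Wb I(2) t] mult_left_mono[OF energy_le[OF z t prog(3)[OF z] bound(3)]]]) auto
  qed auto
  also have "\<dots> = 4 * ?a * (\<integral>\<^sup>+ s. ennreal (kA s) * ?m s \<partial>lborel) + 32 * (\<integral>\<^sup>+ s. ennreal (kC s) * ?m s \<partial>lborel)"
    by (simp add: mult.assoc[symmetric] add.assoc distrib_right[symmetric])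
  also have "\<dots> = (\<integral>\<^sup>+ s. 4 * ?a * (ennreal (kA s) * ?m s) + 32 * (ennreal (kC s) * ?m s) \<partial>lborel)"
    by (simp add: nn_integral_add nn_integral_cmult)
  also have "\<dots> = (\<integral>\<^sup>+ s. ennreal (\<kappa> s) * ?m s \<partial>lborel)"
  proof (rule nn_integral_cong)
    fix s
    \<comment> \<open>Finiteness of the integral of kA undoes the \<open>enn2real\<close> in
      \<open>\<kappa>\<close>.\<close>
    have "ennreal (\<kappa> s) = 4 * ?a * ennreal (kA s) + 32 * ennreal (kC s)"
      using k_nonneg k_finite(1) by (simp add: \<kappa>_def ennreal_mult ennreal_plus)
    then show "4 * ?a * (ennreal (kA s) * ?m s) + 32 * (ennreal (kC s) * ?m s) = ennreal (\<kappa> s) * ?m s"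
      by (simp add: distrib_right mult.assoc)
  qed
  finally show ?thesis .
qed

end

lemma two_mult_ennreal: "0 \<le> a \<Longrightarrow> 2 * ennreal a = ennreal (2 * a)"
  by (simp add: ennreal_mult)

lemma ennreal_finite_of_square: "x\<^sup>2 \<noteq> \<infinity> \<Longrightarrow> x < (\<infinity> :: ennreal)"
  by (cases x) (auto simp: power2_eq_square ennreal_top_mult)

context linear_sde begin

text \<open>The drift forcing is measured in L^2(\<Omega>; L^1) because B is only L^2 in time, so
  that B u is no more than integrable there.\<close>

definition admissible_forcing :: "(real \<Rightarrow> 'w \<Rightarrow> 'a) \<Rightarrow> (real \<Rightarrow> 'w \<Rightarrow> 'a) \<Rightarrow> (real \<Rightarrow> 'w \<Rightarrow> 'a) \<Rightarrow> bool" where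
  "admissible_forcing f g gb \<longleftrightarrow> progressive T F f \<and> (\<integral>\<^sup>+ \<omega>. (path_L1 T f \<omega>)\<^sup>2 \<partial>M) < \<infinity> \<and>
     g \<in> L2_process M T F \<and> gb \<in> L2_process M T F"

section \<open>Picard iteration in an exponentially weighted norm\<close>

lemma weighted_integral_finite:
  assumes k: "k \<in> borel_measurable borel" "(\<integral>\<^sup>+ s. ennreal (k s) * indicator {0..T} s \<partial>lborel) < \<infinity>"
    and K: "\<And>s. s \<in> {0..T} \<Longrightarrow> nn_sq M (x s) \<le> ennreal K"
  shows "(\<integral>\<^sup>+ s. ennreal (k s) * (nn_sq M (x s) * indicator {0..T} s) \<partial>lborel) \<le>
      ennreal K * (\<integral>\<^sup>+ s. ennreal (k s) * indicator {0..T} s \<partial>lborel)"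
    and "(\<integral>\<^sup>+ s. ennreal (k s) * (nn_sq M (x s) * indicator {0..T} s) \<partial>lborel) < \<infinity>"
proof -
  note [measurable] = k(1)
  have "(\<integral>\<^sup>+ s. ennreal (k s) * (nn_sq M (x s) * indicator {0..T} s) \<partial>lborel) \<le>
    (\<integral>\<^sup>+ s. ennreal K * (ennreal (k s) * indicator {0..T} s) \<partial>lborel)"
  proof (rule nn_integral_mono)
    fix s
    show "ennreal (k s) * (nn_sq M (x s) * indicator {0..T} s) \<le> ennreal K * (ennreal (k s) * indicator {0..T} s)"
    proof (cases "s \<in> {0..T}")
      case True
      then show ?thesis using mult_left_mono[OF K[OF True], of "ennreal (k s)"] by (simp add: mult.commute)
    qed simp
  qed
  also have "\<dots> = ennreal K * (\<integral>\<^sup>+ s. ennreal (k s) * indicator {0..T} s \<partial>lborel)"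
    by (rule nn_integral_cmult) measurable
  finally show 1: "(\<integral>\<^sup>+ s. ennreal (k s) * (nn_sq M (x s) * indicator {0..T} s) \<partial>lborel) \<le>
      ennreal K * (\<integral>\<^sup>+ s. ennreal (k s) * indicator {0..T} s \<partial>lborel)" .
  have "ennreal K * (\<integral>\<^sup>+ s. ennreal (k s) * indicator {0..T} s \<partial>lborel) < \<infinity>"
    using k(2) by (simp add: ennreal_mult_less_top)
  with 1 show "(\<integral>\<^sup>+ s. ennreal (k s) * (nn_sq M (x s) * indicator {0..T} s) \<partial>lborel) < \<infinity>" by (rule le_less_trans)
qed

lemma energy_L2_process:
  fixes x :: "real \<Rightarrow> 'w \<Rightarrow> 'a"
  assumes x: "bounded_L2 x" and g: "g \<in> L2_process M T F" and L: "progressive T F (\<lambda>s \<omega>. L s \<omega> (x s \<omega>))"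
    and b: "\<And>s \<omega> v. s \<in> {0..T} \<Longrightarrow> (norm (L s \<omega> v :: 'a))\<^sup>2 \<le> kC s * (norm v)\<^sup>2"
  shows "(\<lambda>s \<omega>. L s \<omega> (x s \<omega>) + g s \<omega>) \<in> L2_process M T F"
proof -
  obtain K where K: "\<And>t. t \<in> {0..T} \<Longrightarrow> nn_sq M (x t) \<le> ennreal K" using x unfolding bounded_L2_def by blast
  have xp: "progressive T F x" using x by (simp add: bounded_L2_def)
  have "nn_energy M T (\<lambda>s \<omega>. L s \<omega> (x s \<omega>)) < \<infinity>"
    by (rule le_less_trans[OF energy_le[OF xp T_mem(1) L b] weighted_integral_finite(2)[OF k_measurable(2) k_finite(2) K]])
  then have "(\<lambda>s \<omega>. L s \<omega> (x s \<omega>)) \<in> L2_process M T F" using L by (simp add: L2_process_def)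
  from L2_process_lincomb[OF this g T, of 1 1] show ?thesis by simp
qed

text \<open>One Picard step. The output is defined through the integrals, then changed on a null set
  to become progressive. Its supremum over time is square integrable because the drift is bounded by
  its \<open>path_L1\<close> norm and both stochastic integrals have Doob majorants.\<close>

lemma step_exists:
  assumes x: "bounded_L2 x" and f: "admissible_forcing f g gb"
  obtains y where "step f g gb x y" "(\<integral>\<^sup>+ \<omega>. (SUP t\<in>{0..T}. ennreal ((norm (y t \<omega>))\<^sup>2)) \<partial>M) < \<infinity>"
proof -
  obtain K where K: "\<And>t. t \<in> {0..T} \<Longrightarrow> nn_sq M (x t) \<le> ennreal K" using x unfolding bounded_L2_def by blast
  have xp: "progressive T F x" using x by (simp add: bounded_L2_def)
  have fp: "progressive T F f" and g: "g \<in> L2_process M T F" and gb: "gb \<in> L2_process M T F"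
    and ff: "(\<integral>\<^sup>+ \<omega>. (path_L1 T f \<omega>)\<^sup>2 \<partial>M) < \<infinity>" using f by (auto simp: admissible_forcing_def)
  obtain I where I: "ito_integral M T F W (\<lambda>s \<omega>. C s \<omega> (x s \<omega>) + g s \<omega>) I"
    by (rule ito_integral_exists[OF W T energy_L2_process[OF x g prog(2)[OF xp] bound(2)]])
  obtain Ib where Ib: "ito_integral M T F Wb (\<lambda>s \<omega>. Cb s \<omega> (x s \<omega>) + gb s \<omega>) Ib"
    by (rule ito_integral_exists[OF Wb T energy_L2_process[OF x gb prog(3)[OF xp] bound(3)]])
  let ?d = "\<lambda>s \<omega>. A s \<omega> (x s \<omega>) + f s \<omega>" and ?a = "\<lambda>s \<omega>. A s \<omega> (x s \<omega>)"
  have dp: "progressive T F ?d"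
    using prog(1)[OF xp] fp by (auto simp: progressive_iff clipped_add intro!: borel_measurable_add)
  note c = progressive_clipped[OF prog(1)[OF xp] T_mem(1)] progressive_clipped[OF fp T_mem(1)] progressive_clipped[OF dp T_mem(1)]
  note pm[measurable] = path_L1_measurable[OF c(1)] path_L1_measurable[OF c(2)] path_L1_measurable[OF c(3)]
  have D2: "(\<integral>\<^sup>+ \<omega>. (path_L1 T ?d \<omega>)\<^sup>2 \<partial>M) < \<infinity>"
  proof -
    have "(\<integral>\<^sup>+ \<omega>. (path_L1 T ?d \<omega>)\<^sup>2 \<partial>M) \<le> 2 * (\<integral>\<^sup>+ \<omega>. (path_L1 T ?a \<omega>)\<^sup>2 \<partial>M) + 2 * (\<integral>\<^sup>+ \<omega>. (path_L1 T f \<omega>)\<^sup>2 \<partial>M)"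
      by (rule path_L1_square_add_le[OF c(1,2)])
    also have "\<dots> < \<infinity>"
    proof -
      have "(\<integral>\<^sup>+ \<omega>. (path_L1 T ?a \<omega>)\<^sup>2 \<partial>M) \<le> (\<integral>\<^sup>+ s. ennreal (kA s) * indicator {0..T} s \<partial>lborel) * (\<integral>\<^sup>+ s. ennreal (kA s) * (nn_sq M (x s) * indicator {0..T} s) \<partial>lborel)"
        by (intro path_L1_weighted k_nonneg k_measurable progressive_clipped[OF xp T_mem(1)] bound(1)) auto
      also have "\<dots> < \<infinity>" using k_finite(1) weighted_integral_finite(2)[OF k_measurable(1) k_finite(1) K]
        by (simp add: ennreal_mult_less_top)
      finally show ?thesis using ff by (simp add: ennreal_mult_less_top)
    qed
    finally show ?thesis .
  qed
  have "AE \<omega> in M. (path_L1 T ?d \<omega>)\<^sup>2 \<noteq> \<infinity>" using D2 by (intro nn_integral_PInf_AE) auto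
  \<comment> \<open>A finite second moment makes the pathwise L^1 norm finite almost surely, hence
    the drift integrable in time.\<close>
  with AE_space have int: "AE \<omega> in M. set_integrable lborel {0..T} (\<lambda>s. ?d s \<omega>)"
  proof eventually_elim
    case (elim \<omega>)
    from ennreal_finite_of_square[OF elim(2)] have "path_L1 T ?d \<omega> < \<infinity>" .
    also have "path_L1 T ?d \<omega> = (\<integral>\<^sup>+ s. ennreal (norm (indicator {0..T} s *\<^sub>R ?d s \<omega>)) \<partial>lborel)"
      unfolding path_L1_def by (intro nn_integral_cong) (auto simp: indicator_def)
    finally show ?case unfolding set_integrable_def
      using path_measurable[OF c(3) elim(1)] by (intro integrableI_bounded) auto
  qed
  define y0 where "y0 t \<omega> = (LINT s:{0..t}|lborel. ?d s \<omega>) + I t \<omega> + Ib t \<omega>" for t \<omega>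
  have y0m: "y0 t \<in> borel_measurable (F t)" if "t \<in> {0..T}" for t
    unfolding y0_def[abs_def]
    by (intro borel_measurable_add drift_measurable[OF dp that] ito_integral_measurable(1)[OF I that] ito_integral_measurable(1)[OF Ib that])
  have y0c: "AE \<omega> in M. continuous_on {0..T} (\<lambda>t. y0 t \<omega>)"
    using int ito_integral_continuous[OF I] ito_integral_continuous[OF Ib]
    unfolding y0_def by eventually_elim (intro continuous_on_add continuous_on_set_integral)
  obtain y where y: "progressive T F y" "\<And>\<omega>. \<omega> \<in> space M \<Longrightarrow> continuous_on {0..T} (\<lambda>t. y t \<omega>)"
    "AE \<omega> in M. \<forall>t. y t \<omega> = y0 t \<omega>"
    using progressive_modification[OF y0m y0c] by blast
  have "step f g gb x y" unfolding step_def
  proof (intro conjI exI)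
    show "AE \<omega> in M. continuous_on {0..T} (\<lambda>t. y t \<omega>)" using y(2) by (rule AE_I2)
    show "AE \<omega> in M. \<forall>t\<in>{0..T}. y t \<omega> = (LINT s:{0..t}|lborel. ?d s \<omega>) + I t \<omega> + Ib t \<omega>"
      using y(3) by eventually_elim (simp add: y0_def)
  qed (fact xp y(1) int I Ib)+
  moreover have "(\<integral>\<^sup>+ \<omega>. (SUP t\<in>{0..T}. ennreal ((norm (y t \<omega>))\<^sup>2)) \<partial>M) < \<infinity>"
  proof (rule doob_majorant[OF ito_integral_l2mart[OF W I] T ito_integral_continuous[OF I]],
      rule doob_majorant[OF ito_integral_l2mart[OF Wb Ib] T ito_integral_continuous[OF Ib]])
    fix G Gb
    assume G: "G \<in> borel_measurable M" "(\<integral>\<^sup>+ \<omega>. G \<omega> \<partial>M) \<le> 4 * nn_sq M (I T)"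
        "AE \<omega> in M. (SUP t\<in>{0..T}. ennreal ((norm (I t \<omega>))\<^sup>2)) \<le> G \<omega>"
      and Gb: "Gb \<in> borel_measurable M" "(\<integral>\<^sup>+ \<omega>. Gb \<omega> \<partial>M) \<le> 4 * nn_sq M (Ib T)"
        "AE \<omega> in M. (SUP t\<in>{0..T}. ennreal ((norm (Ib t \<omega>))\<^sup>2)) \<le> Gb \<omega>"
    note [measurable] = G(1) Gb(1)
    have "AE \<omega> in M. (SUP t\<in>{0..T}. ennreal ((norm (y t \<omega>))\<^sup>2)) \<le> 4 * (path_L1 T ?d \<omega>)\<^sup>2 + 4 * G \<omega> + 4 * Gb \<omega>"
      using y(3) G(3) Gb(3)
    proof eventually_elim
      case (elim \<omega>)
      show ?case
      proof (rule SUP_least)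
        fix t assume t: "t \<in> {0..T}"
        let ?D = "LINT s:{0..t}|lborel. ?d s \<omega>"
        have "ennreal ((norm (y t \<omega>))\<^sup>2) \<le> ennreal (4 * (norm ?D)\<^sup>2 + 4 * (norm (I t \<omega>))\<^sup>2 + 4 * (norm (Ib t \<omega>))\<^sup>2)"
          using elim(1) norm_sum3_sq by (intro ennreal_leI) (auto simp: y0_def)
        also have "\<dots> = 4 * (ennreal (norm ?D))\<^sup>2 + 4 * ennreal ((norm (I t \<omega>))\<^sup>2) + 4 * ennreal ((norm (Ib t \<omega>))\<^sup>2)"
          by (simp add: ennreal_plus ennreal_mult ennreal_power2)
        also have "\<dots> \<le> 4 * (path_L1 T ?d \<omega>)\<^sup>2 + 4 * G \<omega> + 4 * Gb \<omega>"
        proof (intro add_mono mult_left_mono power_mono)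
          show "ennreal (norm ?D) \<le> path_L1 T ?d \<omega>"
            using t by (intro order_trans[OF _ path_L1_mono[of t T]]) (auto simp: path_L1_def ennreal_norm_set_integral_le)
          show "ennreal ((norm (I t \<omega>))\<^sup>2) \<le> G \<omega>" by (rule order_trans[OF SUP_upper[OF t] elim(2)])
          show "ennreal ((norm (Ib t \<omega>))\<^sup>2) \<le> Gb \<omega>" by (rule order_trans[OF SUP_upper[OF t] elim(3)])
        qed auto
        finally show "ennreal ((norm (y t \<omega>))\<^sup>2) \<le> 4 * (path_L1 T ?d \<omega>)\<^sup>2 + 4 * G \<omega> + 4 * Gb \<omega>" .
      qed
    qed
    then have "(\<integral>\<^sup>+ \<omega>. (SUP t\<in>{0..T}. ennreal ((norm (y t \<omega>))\<^sup>2)) \<partial>M) \<le> (\<integral>\<^sup>+ \<omega>. 4 * (path_L1 T ?d \<omega>)\<^sup>2 + 4 * G \<omega> + 4 * Gb \<omega> \<partial>M)"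
      by (rule nn_integral_mono_AE)
    also have "\<dots> = 4 * (\<integral>\<^sup>+ \<omega>. (path_L1 T ?d \<omega>)\<^sup>2 \<partial>M) + 4 * (\<integral>\<^sup>+ \<omega>. G \<omega> \<partial>M) + 4 * (\<integral>\<^sup>+ \<omega>. Gb \<omega> \<partial>M)"
      by (simp add: nn_integral_add nn_integral_cmult)
    also have "\<dots> < \<infinity>"
    proof -
      have "(\<integral>\<^sup>+ \<omega>. G \<omega> \<partial>M) < \<infinity>"
        by (rule le_less_trans[OF G(2)]) (use l2mart_finite[OF ito_integral_l2mart[OF W I] T_mem(1)] in \<open>simp add: ennreal_mult_less_top\<close>)
      moreover have "(\<integral>\<^sup>+ \<omega>. Gb \<omega> \<partial>M) < \<infinity>"
        by (rule le_less_trans[OF Gb(2)]) (use l2mart_finite[OF ito_integral_l2mart[OF Wb Ib] T_mem(1)] in \<open>simp add: ennreal_mult_less_top\<close>)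
      ultimately show ?thesis using D2 by (simp add: ennreal_mult_less_top)
    qed
    finally show ?thesis .
  qed
  ultimately show thesis by (rule that)
qed

lemma bounded_L2_of_sup:
  assumes "progressive T F x" and s: "(\<integral>\<^sup>+ \<omega>. (SUP t\<in>{0..T}. ennreal ((norm (x t \<omega>))\<^sup>2)) \<partial>M) < \<infinity>"
  shows "bounded_L2 x"
proof -
  obtain K where K: "0 \<le> K" "(\<integral>\<^sup>+ \<omega>. (SUP t\<in>{0..T}. ennreal ((norm (x t \<omega>))\<^sup>2)) \<partial>M) = ennreal K"
    using s by (cases "\<integral>\<^sup>+ \<omega>. (SUP t\<in>{0..T}. ennreal ((norm (x t \<omega>))\<^sup>2)) \<partial>M") auto
  have "nn_sq M (x t) \<le> ennreal K" if "t \<in> {0..T}" for t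
    unfolding K(2)[symmetric] using that by (intro nn_integral_mono SUP_upper)
  then show ?thesis using assms(1) K(1) by (auto simp: bounded_L2_def)
qed

text \<open>Equal forcings cancel, so every comparison takes place in the homogeneous
  equation.\<close>

lemma step_diff:
  assumes "step f g gb x y" "step f g gb x' y'"
  shows "step (\<lambda>s \<omega>. 0) (\<lambda>s \<omega>. 0) (\<lambda>s \<omega>. 0) (\<lambda>s \<omega>. x s \<omega> - x' s \<omega>) (\<lambda>s \<omega>. y s \<omega> - y' s \<omega>)"
  using step_lincomb[OF assms, of 1 "-1"] by simp

lemma step_progressive: "step f g gb x y \<Longrightarrow> progressive T F x" "step f g gb x y \<Longrightarrow> progressive T F y"
  by (auto simp: step_def)

lemma step_continuous: "step f g gb x y \<Longrightarrow> AE \<omega> in M. continuous_on {0..T} (\<lambda>t. y t \<omega>)"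
  by (auto simp: step_def)

text \<open>The rate of the weight: with respect to sup_t exp(-\<mu> t) E|x(t)|^2 a homogeneous step
  shrinks by the factor 1/4.\<close>

definition \<mu> :: real where
  "\<mu> = (SOME c. 0 < c \<and> (\<forall>t\<in>{0..T}.
     (\<integral>\<^sup>+ s. ennreal (\<kappa> s) * ennreal (exp (c * s)) * indicator {0..t} s \<partial>lborel) \<le> ennreal (exp (c * t) / 4)))"

lemma \<mu>: "0 < \<mu>" "t \<in> {0..T} \<Longrightarrow>
    (\<integral>\<^sup>+ s. ennreal (\<kappa> s) * ennreal (exp (\<mu> * s)) * indicator {0..t} s \<partial>lborel) \<le> ennreal (exp (\<mu> * t) / 4)"
proof -
  have "\<exists>c. 0 < c \<and> (\<forall>t\<in>{0..T}.
     (\<integral>\<^sup>+ s. ennreal (\<kappa> s) * ennreal (exp (c * s)) * indicator {0..t} s \<partial>lborel) \<le> ennreal (exp (c * t) / 4))"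
    by (rule exponential_weight[OF \<kappa>_measurable \<kappa>_nonneg \<kappa>_finite]) blast
  from someI_ex[OF this] show "0 < \<mu>" "t \<in> {0..T} \<Longrightarrow>
    (\<integral>\<^sup>+ s. ennreal (\<kappa> s) * ennreal (exp (\<mu> * s)) * indicator {0..t} s \<partial>lborel) \<le> ennreal (exp (\<mu> * t) / 4)"
    unfolding \<mu>_def by blast+
qed

text \<open>Inserting the weighted bound into \<open>step_bound\<close> leaves the kernel integral
  that \<open>\<mu>\<close> was chosen for. The hypothesis with K plays the part of a norm bound,
  which avoids the weighted supremum itself.\<close>

lemma step_contraction:
  assumes s: "step (\<lambda>s \<omega>. 0) (\<lambda>s \<omega>. 0) (\<lambda>s \<omega>. 0) z w" and K: "0 \<le> K"
    and z: "\<And>t. t \<in> {0..T} \<Longrightarrow> nn_sq M (z t) \<le> ennreal (K * exp (\<mu> * t))" and t: "t \<in> {0..T}"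
  shows "nn_sq M (w t) \<le> ennreal (K / 4 * exp (\<mu> * t))"
proof -
  have "nn_sq M (w t) \<le> (\<integral>\<^sup>+ s. ennreal (\<kappa> s) * (nn_sq M (z s) * indicator {0..t} s) \<partial>lborel)" by (rule step_bound[OF s t])
  also have "\<dots> \<le> (\<integral>\<^sup>+ s. ennreal K * (ennreal (\<kappa> s) * ennreal (exp (\<mu> * s)) * indicator {0..t} s) \<partial>lborel)"
  proof (rule nn_integral_mono)
    fix s
    show "ennreal (\<kappa> s) * (nn_sq M (z s) * indicator {0..t} s) \<le> ennreal K * (ennreal (\<kappa> s) * ennreal (exp (\<mu> * s)) * indicator {0..t} s)"
    proof (cases "s \<in> {0..t}")
      case True
      then have "nn_sq M (z s) \<le> ennreal K * ennreal (exp (\<mu> * s))" using z[of s] t K by (simp add: ennreal_mult)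
      from mult_left_mono[OF this, of "ennreal (\<kappa> s)"] show ?thesis using True by (simp add: mult_ac)
    qed simp
  qed
  also have "\<dots> = ennreal K * (\<integral>\<^sup>+ s. ennreal (\<kappa> s) * ennreal (exp (\<mu> * s)) * indicator {0..t} s \<partial>lborel)"
    by (rule nn_integral_cmult) measurable
  also have "\<dots> \<le> ennreal K * ennreal (exp (\<mu> * t) / 4)" by (intro mult_left_mono \<mu>(2)[OF t]) simp
  also have "\<dots> = ennreal (K * (exp (\<mu> * t) / 4))" using K by (intro ennreal_mult[symmetric]) auto
  finally show ?thesis by simp
qed

lemma bounded_L2_weighted:
  assumes "bounded_L2 x"
  shows "\<exists>K\<ge>0. \<forall>t\<in>{0..T}. nn_sq M (x t) \<le> ennreal (K * exp (\<mu> * t))"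
proof -
  obtain K where K: "0 \<le> K" "\<And>t. t \<in> {0..T} \<Longrightarrow> nn_sq M (x t) \<le> ennreal K"
    using assms unfolding bounded_L2_def by blast
  have "nn_sq M (x t) \<le> ennreal (K * exp (\<mu> * t))" if "t \<in> {0..T}" for t
  proof (rule order_trans[OF K(2)[OF that] ennreal_leI])
    have "1 \<le> exp (\<mu> * t)" using \<mu>(1) that by simp
    then show "K \<le> K * exp (\<mu> * t)" using K(1) by (simp add: mult_le_cancel_left1)
  qed
  then show ?thesis using K(1) by blast
qed

lemma ennreal_le_zero_of_geometric:
  assumes "\<And>n. a \<le> ennreal (c * (1/4) ^ n)"
  shows "a \<le> 0"
proof -
  have "(\<lambda>n. c * (1/4) ^ n :: real) \<longlonglongrightarrow> c * 0" by (intro tendsto_mult tendsto_const LIMSEQ_power_zero) simp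
  then have "(\<lambda>n. ennreal (c * (1/4) ^ n)) \<longlonglongrightarrow> ennreal (c * 0)" by (rule tendsto_ennrealI)
  then have l: "(\<lambda>n. ennreal (c * (1/4) ^ n)) \<longlonglongrightarrow> 0" by simp
  show ?thesis by (rule LIMSEQ_le_const[OF l]) (use assms in blast)
qed

text \<open>A fixed point obeys its own bound with K replaced by K / 4, hence with K / 4^n for all
  n.\<close>

lemma step_unique:
  assumes s: "step (\<lambda>s \<omega>. 0) (\<lambda>s \<omega>. 0) (\<lambda>s \<omega>. 0) z z" and b: "bounded_L2 z"
  shows "AE \<omega> in M. \<forall>t\<in>{0..T}. z t \<omega> = 0"
proof -
  obtain K where K: "0 \<le> K" "\<And>t. t \<in> {0..T} \<Longrightarrow> nn_sq M (z t) \<le> ennreal (K * exp (\<mu> * t))"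
    using bounded_L2_weighted[OF b] by blast
  have n: "nn_sq M (z t) \<le> ennreal (K * (1/4) ^ n * exp (\<mu> * t))" if "t \<in> {0..T}" for t n
    using that
  proof (induction n arbitrary: t)
    case (Suc n)
    have "nn_sq M (z t) \<le> ennreal (K * (1/4) ^ n / 4 * exp (\<mu> * t))"
      by (rule step_contraction[OF s _ Suc.IH Suc.prems]) (use K in auto)
    then show ?case by simp
  qed (use K in simp)
  have "AE \<omega> in M. z t \<omega> = 0" if t: "t \<in> {0..T}" for t
  proof (rule AE_eq_of_nn_sq_diff)
    show "z t \<in> borel_measurable M" by (rule progressive_M[OF step_progressive(1)[OF s] t])
    have "nn_sq M (z t) \<le> ennreal (K * exp (\<mu> * t) * (1/4) ^ n)" for n using n[OF t, of n] by (simp add: mult_ac)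
    then have "nn_sq M (z t) \<le> 0" by (rule ennreal_le_zero_of_geometric)
    then show "nn_sq M (\<lambda>\<omega>. z t \<omega> - 0) \<le> 0" by simp
  qed simp
  then show ?thesis
    using AE_all_eq_of_continuous[OF T step_continuous[OF s], of "\<lambda>t \<omega>. 0"] by simp
qed

lemma step_modify:
  assumes s: "step f g gb x y" and y': "progressive T F y'" "AE \<omega> in M. continuous_on {0..T} (\<lambda>t. y' t \<omega>)"
    and eq: "AE \<omega> in M. \<forall>t\<in>{0..T}. y t \<omega> = y' t \<omega>"
  shows "step f g gb x y'"
proof -
  obtain I Ib where I: "ito_integral M T F W (\<lambda>s \<omega>. C s \<omega> (x s \<omega>) + g s \<omega>) I"
    "ito_integral M T F Wb (\<lambda>s \<omega>. Cb s \<omega> (x s \<omega>) + gb s \<omega>) Ib"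
    "AE \<omega> in M. \<forall>t\<in>{0..T}. y t \<omega> = (LINT s:{0..t}|lborel. A s \<omega> (x s \<omega>) + f s \<omega>) + I t \<omega> + Ib t \<omega>"
    using s unfolding step_def by blast
  have "AE \<omega> in M. \<forall>t\<in>{0..T}. y' t \<omega> = (LINT s:{0..t}|lborel. A s \<omega> (x s \<omega>) + f s \<omega>) + I t \<omega> + Ib t \<omega>"
    using I(3) eq by eventually_elim auto
  then show ?thesis using s y' I(1,2) unfolding step_def by blast
qed

text \<open>Picard iteration from a bounded start. The limit x of the iterates is progressive with
  bounded second moments, but nothing is known yet about its paths. One further step produces y with
  continuous paths and y t = x t almost surely for each t; a second one shows that y reproduces
  itself.\<close>

lemma solution_exists:
  assumes f: "admissible_forcing f g gb"
  obtains x where "step f g gb x x" "(\<integral>\<^sup>+ \<omega>. (SUP t\<in>{0..T}. ennreal ((norm (x t \<omega>))\<^sup>2)) \<partial>M) < \<infinity>"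
proof -
  have "progressive T F (\<lambda>s \<omega>. 0 :: 'a)" by (simp add: progressive_iff clipped_0)
  then have z: "bounded_L2 (\<lambda>s \<omega>. 0)" unfolding bounded_L2_def by (auto intro!: exI[of _ 0])
  \<comment> \<open>Dependent choice: a step is a relation, so each iterate is a chosen output for
    the previous one.\<close>
  have "\<exists>X. \<forall>n::nat. bounded_L2 (X n) \<and> step f g gb (X n) (X (Suc n))"
  proof (rule dependent_nat_choice[where P="\<lambda>n x. bounded_L2 x" and Q="\<lambda>n x y. step f g gb x y"])
    show "\<exists>x. bounded_L2 x" using z by blast
    fix x and n :: nat assume x: "bounded_L2 x"
    show "\<exists>y. bounded_L2 y \<and> step f g gb x y"
      by (rule step_exists[OF x f]) (use bounded_L2_of_sup step_progressive(2) in blast)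
  qed
  then obtain X where Xb: "\<And>n. bounded_L2 (X n)" and Xs: "\<And>n. step f g gb (X n) (X (Suc n))" by blast
  have Xp: "progressive T F (X n)" for n using Xb[of n] by (simp add: bounded_L2_def)
  have XM: "X n t \<in> borel_measurable M" if "t \<in> {0..T}" for n t by (rule progressive_M[OF Xp that])
  obtain c where c: "0 \<le> c" "\<And>t. t \<in> {0..T} \<Longrightarrow> nn_sq M (\<lambda>\<omega>. X (Suc 0) t \<omega> - X 0 t \<omega>) \<le> ennreal (c * exp (\<mu> * t))"
  proof -
    obtain K0 where K0: "0 \<le> K0" "\<And>t. t \<in> {0..T} \<Longrightarrow> nn_sq M (X 0 t) \<le> ennreal (K0 * exp (\<mu> * t))"
      using bounded_L2_weighted[OF Xb] by blast
    obtain K1 where K1: "0 \<le> K1" "\<And>t. t \<in> {0..T} \<Longrightarrow> nn_sq M (X (Suc 0) t) \<le> ennreal (K1 * exp (\<mu> * t))"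
      using bounded_L2_weighted[OF Xb] by blast
    have "nn_sq M (\<lambda>\<omega>. X (Suc 0) t \<omega> - X 0 t \<omega>) \<le> ennreal ((2 * K1 + 2 * K0) * exp (\<mu> * t))" if t: "t \<in> {0..T}" for t
    proof -
      have "nn_sq M (\<lambda>\<omega>. X (Suc 0) t \<omega> - X 0 t \<omega>) \<le> 2 * nn_sq M (X (Suc 0) t) + 2 * nn_sq M (X 0 t)"
        using nn_sq_add_le[of "X (Suc 0) t" M "\<lambda>\<omega>. - X 0 t \<omega>"] XM[OF t] by simp
      also have "\<dots> \<le> 2 * ennreal (K1 * exp (\<mu> * t)) + 2 * ennreal (K0 * exp (\<mu> * t))"
        by (intro add_mono mult_left_mono K0 K1 t) auto
      also have "\<dots> = ennreal (2 * (K1 * exp (\<mu> * t))) + ennreal (2 * (K0 * exp (\<mu> * t)))"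
        using K0(1) K1(1) by (simp add: ennreal_mult)
      also have "\<dots> = ennreal (2 * (K1 * exp (\<mu> * t)) + 2 * (K0 * exp (\<mu> * t)))"
        using K0(1) K1(1) by (intro ennreal_plus[symmetric]) auto
      finally show ?thesis by (simp add: algebra_simps)
    qed
    moreover have "0 \<le> 2 * K1 + 2 * K0" using K0 K1 by simp
    ultimately show thesis using that by blast
  qed
  have d: "nn_sq M (\<lambda>\<omega>. X (Suc n) t \<omega> - X n t \<omega>) \<le> ennreal (c * (1/4) ^ n * exp (\<mu> * t))" if "t \<in> {0..T}" for n t
    using that
  proof (induction n arbitrary: t)
    case (Suc n)
    have "nn_sq M (\<lambda>\<omega>. X (Suc (Suc n)) t \<omega> - X (Suc n) t \<omega>) \<le> ennreal (c * (1/4) ^ n / 4 * exp (\<mu> * t))"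
      by (rule step_contraction[OF step_diff[OF Xs Xs] _ Suc.IH Suc.prems]) (use c in auto)
    then show ?case by simp
  qed (use c in simp)
  define b where "b = c * exp (\<mu> * T)"
  have b0: "0 \<le> b" using c by (simp add: b_def)
  have d': "nn_sq M (\<lambda>\<omega>. X (Suc n) t \<omega> - X n t \<omega>) \<le> ennreal (b * (1/4) ^ n)" if t: "t \<in> {0..T}" for n t
  proof (rule order_trans[OF d[OF t] ennreal_leI])
    have "exp (\<mu> * t) \<le> exp (\<mu> * T)" using t \<mu>(1) by simp
    then have "c * (1/4) ^ n * exp (\<mu> * t) \<le> c * (1/4) ^ n * exp (\<mu> * T)" using c by (intro mult_left_mono) auto
    then show "c * (1/4) ^ n * exp (\<mu> * t) \<le> b * (1/4) ^ n" by (simp add: b_def mult_ac)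
  qed
  \<comment> \<open>The constant 4 b solves the recursion 2 (4 b / 4) + 2 b = 4 b that comes from
    the squared triangle inequality.\<close>
  have e: "nn_sq M (\<lambda>\<omega>. X (n + k) t \<omega> - X n t \<omega>) \<le> ennreal (4 * b * (1/4) ^ n)" if t: "t \<in> {0..T}" for n k t
  proof (induction k arbitrary: n)
    case (Suc k)
    have "nn_sq M (\<lambda>\<omega>. X (n + Suc k) t \<omega> - X n t \<omega>) \<le>
      2 * nn_sq M (\<lambda>\<omega>. X (Suc n + k) t \<omega> - X (Suc n) t \<omega>) + 2 * nn_sq M (\<lambda>\<omega>. X (Suc n) t \<omega> - X n t \<omega>)"
      using nn_sq_triangle[OF XM[OF t] XM[OF t] XM[OF t], of "Suc n + k" n "Suc n"] by simp
    also have "\<dots> \<le> 2 * ennreal (4 * b * (1/4) ^ Suc n) + 2 * ennreal (b * (1/4) ^ n)"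
      by (intro add_mono mult_left_mono Suc.IH d' t) auto
    also have "\<dots> = ennreal (2 * (4 * b * (1/4) ^ Suc n)) + ennreal (2 * (b * (1/4) ^ n))"
      using b0 by (intro arg_cong2[where f="(+)"] two_mult_ennreal) auto
    also have "\<dots> = ennreal (2 * (4 * b * (1/4) ^ Suc n) + 2 * (b * (1/4) ^ n))"
      using b0 by (intro ennreal_plus[symmetric]) auto
    also have "2 * (4 * b * (1/4) ^ Suc n) + 2 * (b * (1/4) ^ n) = 4 * b * (1/4) ^ n" by simp
    finally show ?case .
  qed (use b0 in simp)
  \<comment> \<open>\<open>lim\<close> is taken everywhere, which keeps x progressive; convergence
    holds almost surely at each time.\<close>
  define x where "x t \<omega> = lim (\<lambda>n. X n t \<omega>)" for t \<omega>
  have xp: "progressive T F x"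
    unfolding progressive_def
  proof
    fix t assume t: "t \<in> {0..T}"
    have "(\<lambda>p. lim (\<lambda>n. X n (fst p) (snd p))) \<in> borel_measurable (restrict_space borel {0..t} \<Otimes>\<^sub>M F t)"
      using Xp t by (intro borel_measurable_lim_metric) (simp add: progressive_def split_beta')
    then show "(\<lambda>(s, \<omega>). x s \<omega>) \<in> borel_measurable (restrict_space borel {0..t} \<Otimes>\<^sub>M F t)"
      by (simp add: x_def split_beta')
  qed
  have conv: "AE \<omega> in M. (\<lambda>n. X n t \<omega>) \<longlonglongrightarrow> x t \<omega>" if t: "t \<in> {0..T}" for t
  proof -
    note [measurable] = XM[OF t]
    have "AE \<omega> in M. \<exists>b\<ge>0. \<forall>n. ennreal ((norm (X (Suc n) t \<omega> - X n t \<omega>))\<^sup>2) \<le> ennreal (b * (1/2) ^ n)"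
      by (rule AE_rapid[OF _ b0 d'[OF t]]) measurable
    then show ?thesis
    proof eventually_elim
      case (elim \<omega>)
      then obtain r where r: "0 \<le> r" "\<And>n. ennreal ((norm (X (Suc n) t \<omega> - X n t \<omega>))\<^sup>2) \<le> ennreal (r * (1/2) ^ n)" by blast
      have "(norm (X (Suc n) t \<omega> - X n t \<omega>))\<^sup>2 \<le> r * (1/2) ^ n" for n
        using r(2)[of n] r(1) by (subst (asm) ennreal_le_iff) auto
      then have "uniform_limit {t} (\<lambda>n t. X n t \<omega>) (\<lambda>t. lim (\<lambda>n. X n t \<omega>)) sequentially"
        by (intro uniform_limit_of_rapid[OF r(1)]) auto
      from tendsto_uniform_limitI[OF this, of t] show ?case by (simp add: x_def)
    qed
  qed
  have xX: "nn_sq M (\<lambda>\<omega>. x t \<omega> - X n t \<omega>) \<le> ennreal (4 * b * (1/4) ^ n)" if t: "t \<in> {0..T}" for t n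
  proof (rule nn_sq_limit_le[OF XM[OF t] XM[OF t] conv[OF t]])
    fix m assume "n \<le> m"
    then obtain k where "m = n + k" using le_Suc_ex by blast
    then show "nn_sq M (\<lambda>\<omega>. X m t \<omega> - X n t \<omega>) \<le> ennreal (4 * b * (1/4) ^ n)" using e[OF t] by simp
  qed
  have xM: "x t \<in> borel_measurable M" if "t \<in> {0..T}" for t by (rule progressive_M[OF xp that])
  have xb: "bounded_L2 x"
  proof -
    obtain K where K: "0 \<le> K" "\<And>t. t \<in> {0..T} \<Longrightarrow> nn_sq M (X 0 t) \<le> ennreal K" using Xb[of 0] unfolding bounded_L2_def by blast
    have "nn_sq M (x t) \<le> ennreal (8 * b + 2 * K)" if t: "t \<in> {0..T}" for t
    proof -
      have "nn_sq M (x t) \<le> 2 * nn_sq M (\<lambda>\<omega>. x t \<omega> - X 0 t \<omega>) + 2 * nn_sq M (X 0 t)"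
        using nn_sq_add_le[of "\<lambda>\<omega>. x t \<omega> - X 0 t \<omega>" M "X 0 t"] xM[OF t] XM[OF t] by simp
      also have "\<dots> \<le> 2 * ennreal (4 * b) + 2 * ennreal K"
        using xX[OF t, of 0] by (intro add_mono mult_left_mono K t) auto
      also have "\<dots> = ennreal (2 * (4 * b)) + ennreal (2 * K)" using b0 K(1) by (intro arg_cong2[where f="(+)"] two_mult_ennreal) auto
      also have "\<dots> = ennreal (2 * (4 * b) + 2 * K)" using b0 K(1) by (intro ennreal_plus[symmetric]) auto
      finally show ?thesis by simp
    qed
    moreover have "0 \<le> 8 * b + 2 * K" using b0 K by simp
    ultimately show ?thesis using xp unfolding bounded_L2_def by blast
  qed
  \<comment> \<open>y has continuous paths as the output of a step. It agrees with x at each time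
    because y - X (Suc n) is a step of x - X n, which tends to 0.\<close>
  obtain y where y: "step f g gb x y" "(\<integral>\<^sup>+ \<omega>. (SUP t\<in>{0..T}. ennreal ((norm (y t \<omega>))\<^sup>2)) \<partial>M) < \<infinity>"
    by (rule step_exists[OF xb f])
  note yp = step_progressive(2)[OF y(1)]
  have yM: "y t \<in> borel_measurable M" if "t \<in> {0..T}" for t by (rule progressive_M[OF yp that])
  have yx: "nn_sq M (\<lambda>\<omega>. y t \<omega> - x t \<omega>) \<le> 0" if t: "t \<in> {0..T}" for t
  proof (rule ennreal_le_zero_of_geometric)
    fix n
    \<comment> \<open>The unweighted bound implies the weighted one, as exp(\<mu> r) \<ge>
      1.\<close>
    have w: "nn_sq M (\<lambda>\<omega>. x r \<omega> - X n r \<omega>) \<le> ennreal (4 * b * (1/4) ^ n * exp (\<mu> * r))" if "r \<in> {0..T}" for r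
    proof (rule order_trans[OF xX[OF that] ennreal_leI])
      have "1 \<le> exp (\<mu> * r)" using \<mu>(1) that by simp
      then show "4 * b * (1/4) ^ n \<le> 4 * b * (1/4) ^ n * exp (\<mu> * r)"
        using mult_left_mono[of 1 "exp (\<mu> * r)" "4 * b * (1/4) ^ n"] b0 by simp
    qed
    have 1: "nn_sq M (\<lambda>\<omega>. y t \<omega> - X (Suc n) t \<omega>) \<le> ennreal (4 * b * (1/4) ^ n / 4 * exp (\<mu> * t))"
      by (rule step_contraction[OF step_diff[OF y(1) Xs] _ w t]) (use b0 in auto)
    have 2: "nn_sq M (\<lambda>\<omega>. X (Suc n) t \<omega> - x t \<omega>) \<le> ennreal (4 * b * (1/4) ^ Suc n)"
      using xX[OF t, of "Suc n"] by (subst nn_sq_commute)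
    have "nn_sq M (\<lambda>\<omega>. y t \<omega> - x t \<omega>) \<le> 2 * nn_sq M (\<lambda>\<omega>. y t \<omega> - X (Suc n) t \<omega>) + 2 * nn_sq M (\<lambda>\<omega>. X (Suc n) t \<omega> - x t \<omega>)"
      by (rule nn_sq_triangle[OF yM[OF t] XM[OF t] xM[OF t]])
    also have "\<dots> \<le> 2 * ennreal (4 * b * (1/4) ^ n / 4 * exp (\<mu> * t)) + 2 * ennreal (4 * b * (1/4) ^ Suc n)"
      by (intro add_mono mult_left_mono 1 2) auto
    also have "\<dots> = ennreal (2 * (4 * b * (1/4) ^ n / 4 * exp (\<mu> * t))) + ennreal (2 * (4 * b * (1/4) ^ Suc n))"
      using b0 by (intro arg_cong2[where f="(+)"] two_mult_ennreal) auto
    also have "\<dots> = ennreal (2 * (4 * b * (1/4) ^ n / 4 * exp (\<mu> * t)) + 2 * (4 * b * (1/4) ^ Suc n))"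
      using b0 by (intro ennreal_plus[symmetric]) auto
    also have "2 * (4 * b * (1/4) ^ n / 4 * exp (\<mu> * t)) + 2 * (4 * b * (1/4) ^ Suc n) = (2 * b * exp (\<mu> * t) + 2 * b) * (1/4) ^ n"
      by (simp add: algebra_simps)
    finally show "nn_sq M (\<lambda>\<omega>. y t \<omega> - x t \<omega>) \<le> ennreal ((2 * b * exp (\<mu> * t) + 2 * b) * (1/4) ^ n)" .
  qed
  have yb: "bounded_L2 y" by (rule bounded_L2_of_sup[OF yp y(2)])
  \<comment> \<open>So far y is a step of x. The step z of y differs from y by a step of y - x,
    which vanishes at each time, so \<open>step_contraction\<close> with K = 0 gives z = y.\<close>
  obtain z where z: "step f g gb y z" "(\<integral>\<^sup>+ \<omega>. (SUP t\<in>{0..T}. ennreal ((norm (z t \<omega>))\<^sup>2)) \<partial>M) < \<infinity>"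
    by (rule step_exists[OF yb f])
  have "AE \<omega> in M. z t \<omega> = y t \<omega>" if t: "t \<in> {0..T}" for t
  proof (rule AE_eq_of_nn_sq_diff)
    show "z t \<in> borel_measurable M" by (rule progressive_M[OF step_progressive(2)[OF z(1)] t])
    show "y t \<in> borel_measurable M" by (rule yM[OF t])
    have "nn_sq M (\<lambda>\<omega>. z t \<omega> - y t \<omega>) \<le> ennreal (0 / 4 * exp (\<mu> * t))"
      by (rule step_contraction[OF step_diff[OF z(1) y(1)] _ _ t]) (use yx in auto)
    then show "nn_sq M (\<lambda>\<omega>. z t \<omega> - y t \<omega>) \<le> 0" by simp
  qed
  then have "AE \<omega> in M. \<forall>t\<in>{0..T}. z t \<omega> = y t \<omega>"
    by (rule AE_all_eq_of_continuous[OF T step_continuous[OF z(1)] step_continuous[OF y(1)]])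
  then have "step f g gb y y"
    by (rule step_modify[OF z(1) yp step_continuous[OF y(1)]])
  then show thesis using y(2) by (rule that)
qed

end

section \<open>The state equation\<close>

lemma norm_matrix_vector_mult_le: "norm ((X :: real^'n^'m) *v x) \<le> norm X * norm x"
proof -
  have "norm (X *v x) = L2_set (\<lambda>i. \<bar>X $ i \<bullet> x\<bar>) UNIV"
    by (simp add: norm_vec_def matrix_vector_mul_component)
  also have "\<dots> \<le> L2_set (\<lambda>i. norm (X $ i) * norm x) UNIV"
    by (intro L2_set_mono Cauchy_Schwarz_ineq2) auto
  also have "\<dots> = norm X * norm x" by (simp add: norm_vec_def[of X] L2_set_left_distrib)
  finally show ?thesis .
qed

lemma continuous_on_matrix_vector_mult:
  "continuous_on UNIV (\<lambda>p. (fst p :: real^'n^'m) *v (snd p :: real^'n))"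
  unfolding matrix_vector_mult_def by (intro continuous_intros)

text \<open>Selecting a block of a block matrix is linear, so integrability of the assembled
  coefficients passes to their blocks.\<close>

lemma Lp_fun_linear:
  fixes f :: "real \<Rightarrow> 'a::euclidean_space" and L :: "'a \<Rightarrow> 'b::euclidean_space"
  assumes f: "Lp_fun p T f" and L: "linear L" and p: "0 < p"
  shows "Lp_fun p T (\<lambda>s. L (f s))"
proof -
  obtain K where K: "0 < K" "\<And>x. norm (L x) \<le> norm x * K"
    using bounded_linear.pos_bounded[OF linear_conv_bounded_linear[THEN iffD1, OF L]] by blast
  have Lm: "L \<in> borel_measurable borel" by (rule borel_measurable_continuous_onI[OF linear_continuous_on[OF linear_conv_bounded_linear[THEN iffD1, OF L]]])
  have m: "(\<lambda>s. indicator {0..T} s *\<^sub>R f s) \<in> borel_measurable lborel" using f by (simp add: Lp_fun_def set_borel_measurable_def)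
  have "set_borel_measurable lborel {0..T} (\<lambda>s. L (f s))"
    using measurable_compose[OF m, of L borel] Lm L by (simp add: set_borel_measurable_def linear_scale)
  moreover have "(\<integral>\<^sup>+ s. ennreal (norm (L (f s)) powr p) * indicator {0..T} s \<partial>lborel) < \<infinity>"
  proof -
    have "(\<integral>\<^sup>+ s. ennreal (norm (L (f s)) powr p) * indicator {0..T} s \<partial>lborel) \<le>
      (\<integral>\<^sup>+ s. ennreal (K powr p) * (ennreal (norm (f s) powr p) * indicator {0..T} s) \<partial>lborel)"
    proof (rule nn_integral_mono)
      fix s
      have "norm (L (f s)) powr p \<le> (K * norm (f s)) powr p"
        using K(2)[of "f s"] p by (intro powr_mono2) (auto simp: mult.commute)
      also have "\<dots> = K powr p * norm (f s) powr p" using K by (simp add: powr_mult)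
      finally have "ennreal (norm (L (f s)) powr p) \<le> ennreal (K powr p) * ennreal (norm (f s) powr p)"
        by (simp add: ennreal_mult[symmetric] ennreal_leI)
      then show "ennreal (norm (L (f s)) powr p) * indicator {0..T} s \<le> ennreal (K powr p) * (ennreal (norm (f s) powr p) * indicator {0..T} s)"
        by (auto simp: indicator_def)
    qed
    also have "\<dots> = ennreal (K powr p) * (\<integral>\<^sup>+ s. ennreal (norm (f s) powr p) * indicator {0..T} s \<partial>lborel)"
    proof (rule nn_integral_cmult)
      have "(\<lambda>s. ennreal (norm (indicator {0..T} s *\<^sub>R f s) powr p) * indicator {0..T} s) \<in> borel_measurable lborel" using m by measurable
      moreover have "(\<lambda>s. ennreal (norm (indicator {0..T} s *\<^sub>R f s) powr p) * indicator {0..T} s) = (\<lambda>s. ennreal (norm (f s) powr p) * indicator {0..T} s)"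
        by (auto simp: indicator_def)
      ultimately show "(\<lambda>s. ennreal (norm (f s) powr p) * indicator {0..T} s) \<in> borel_measurable lborel" by simp
    qed
    also have "\<dots> < \<infinity>" using f by (simp add: Lp_fun_def ennreal_mult_less_top)
    finally show ?thesis .
  qed
  ultimately show ?thesis by (simp add: Lp_fun_def)
qed

lemma Linf_fun_linear:
  fixes f :: "real \<Rightarrow> 'a::euclidean_space" and L :: "'a \<Rightarrow> 'b::euclidean_space"
  assumes f: "Linf_fun T f" and L: "linear L"
  shows "Linf_fun T (\<lambda>s. L (f s))"
proof -
  obtain K where K: "0 < K" "\<And>x. norm (L x) \<le> norm x * K"
    using bounded_linear.pos_bounded[OF linear_conv_bounded_linear[THEN iffD1, OF L]] by blast
  have Lm: "L \<in> borel_measurable borel" by (rule borel_measurable_continuous_onI[OF linear_continuous_on[OF linear_conv_bounded_linear[THEN iffD1, OF L]]])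
  have m: "(\<lambda>s. indicator {0..T} s *\<^sub>R f s) \<in> borel_measurable lborel" using f by (simp add: Linf_fun_def set_borel_measurable_def)
  have "set_borel_measurable lborel {0..T} (\<lambda>s. L (f s))"
    using measurable_compose[OF m, of L borel] Lm L by (simp add: set_borel_measurable_def linear_scale)
  moreover obtain B where B: "AE s in lborel. s \<in> {0..T} \<longrightarrow> norm (f s) \<le> B" using f by (auto simp: Linf_fun_def)
  have "AE s in lborel. s \<in> {0..T} \<longrightarrow> norm (L (f s)) \<le> B * K"
    using B
  proof eventually_elim
    case (elim s)
    show ?case
    proof
      assume "s \<in> {0..T}"
      then have "norm (f s) * K \<le> B * K" using elim K(1) by (intro mult_right_mono) auto
      then show "norm (L (f s)) \<le> B * K" using K(2)[of "f s"] by linarith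
    qed
  qed
  ultimately show ?thesis by (auto simp: Linf_fun_def)
qed

lemma Lp_fun_hcat:
  fixes X :: "real \<Rightarrow> real^'b::finite^'a::finite" and Y :: "real \<Rightarrow> real^'c::finite^'a"
  assumes "Lp_fun p T (\<lambda>s. hcat (X s) (Y s))" "0 < p"
  shows "Lp_fun p T X" "Lp_fun p T Y"
proof -
  have "linear (\<lambda>H :: real^('b + 'c)^'a. \<chi> i a. H $ i $ Inl a :: real^'b^'a)" by (rule linearI) (simp_all add: vec_eq_iff)
  from Lp_fun_linear[OF assms(1) this assms(2)] show "Lp_fun p T X" by (simp add: hcat_def vec_lambda_eta)
  have "linear (\<lambda>H :: real^('b + 'c)^'a. \<chi> i a. H $ i $ Inr a :: real^'c^'a)" by (rule linearI) (simp_all add: vec_eq_iff)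
  from Lp_fun_linear[OF assms(1) this assms(2)] show "Lp_fun p T Y" by (simp add: hcat_def vec_lambda_eta)
qed

lemma Linf_fun_hcat:
  fixes X :: "real \<Rightarrow> real^'b::finite^'a::finite" and Y :: "real \<Rightarrow> real^'c::finite^'a"
  assumes "Linf_fun T (\<lambda>s. hcat (X s) (Y s))"
  shows "Linf_fun T X" "Linf_fun T Y"
proof -
  have "linear (\<lambda>H :: real^('b + 'c)^'a. \<chi> i a. H $ i $ Inl a :: real^'b^'a)" by (rule linearI) (simp_all add: vec_eq_iff)
  from Linf_fun_linear[OF assms(1) this] show "Linf_fun T X" by (simp add: hcat_def vec_lambda_eta)
  have "linear (\<lambda>H :: real^('b + 'c)^'a. \<chi> i a. H $ i $ Inr a :: real^'c^'a)" by (rule linearI) (simp_all add: vec_eq_iff)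
  from Linf_fun_linear[OF assms(1) this] show "Linf_fun T Y" by (simp add: hcat_def vec_lambda_eta)
qed

lemma Lp_fun_vcat:
  fixes X :: "real \<Rightarrow> real^'a::finite^'b::finite" and Y :: "real \<Rightarrow> real^'a^'c::finite"
  assumes "Lp_fun p T (\<lambda>s. vcat (X s) (Y s))" "0 < p"
  shows "Lp_fun p T X" "Lp_fun p T Y"
proof -
  have "linear (\<lambda>H :: real^'a^('b + 'c). \<chi> i a. H $ Inl i $ a :: real^'a^'b)" by (rule linearI) (simp_all add: vec_eq_iff)
  from Lp_fun_linear[OF assms(1) this assms(2)] show "Lp_fun p T X" by (simp add: vcat_def vec_lambda_eta)
  have "linear (\<lambda>H :: real^'a^('b + 'c). \<chi> i a. H $ Inr i $ a :: real^'a^'c)" by (rule linearI) (simp_all add: vec_eq_iff)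
  from Lp_fun_linear[OF assms(1) this assms(2)] show "Lp_fun p T Y" by (simp add: vcat_def vec_lambda_eta)
qed

lemma Linf_fun_block_diag:
  fixes X :: "real \<Rightarrow> real^'b::finite^'b" and Y :: "real \<Rightarrow> real^'c::finite^'c"
  assumes "Linf_fun T (\<lambda>s. block_diag (X s) (Y s))"
  shows "Linf_fun T X" "Linf_fun T Y"
proof -
  have "linear (\<lambda>H :: real^('b + 'c)^('b + 'c). \<chi> i a. H $ Inl i $ Inl a :: real^'b^'b)" by (rule linearI) (simp_all add: vec_eq_iff)
  from Linf_fun_linear[OF assms(1) this] show "Linf_fun T X" by (simp add: block_diag_def vec_lambda_eta)
  have "linear (\<lambda>H :: real^('b + 'c)^('b + 'c). \<chi> i a. H $ Inr i $ Inr a :: real^'c^'c)" by (rule linearI) (simp_all add: vec_eq_iff)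
  from Linf_fun_linear[OF assms(1) this] show "Linf_fun T Y" by (simp add: block_diag_def vec_lambda_eta)
qed

text \<open>Summing over the finitely many regimes gives a deterministic bound for a coefficient in
  whatever regime is present. With the indicator it is Borel on the whole line although the
  coefficients are only known to be measurable on [0, T].\<close>

definition majorant :: "real \<Rightarrow> nat \<Rightarrow> (real \<Rightarrow> 's::finite \<Rightarrow> 'a::real_normed_vector) \<Rightarrow> real \<Rightarrow> real" where
  "majorant T p K s = (\<Sum>j\<in>UNIV. norm (indicator {0..T} s *\<^sub>R K s j) ^ p)"

lemma majorant_nonneg: "0 \<le> majorant T p K s"
  by (auto simp: majorant_def intro!: sum_nonneg)

lemma majorant_ge: "s \<in> {0..T} \<Longrightarrow> norm (K s j) ^ p \<le> majorant T p K s"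
  unfolding majorant_def using member_le_sum[of j UNIV "\<lambda>j. norm (indicator {0..T} s *\<^sub>R K s j) ^ p"] by simp

lemma majorant_Lp:
  fixes K :: "real \<Rightarrow> 's::finite \<Rightarrow> 'a::euclidean_space"
  assumes K: "\<And>j. Lp_fun (real p) T (\<lambda>s. K s j)" and p: "0 < p"
  shows "majorant T p K \<in> borel_measurable borel"
    and "(\<integral>\<^sup>+ s. ennreal (majorant T p K s) * indicator {0..T} s \<partial>lborel) < \<infinity>"
proof -
  have [measurable]: "(\<lambda>s. indicator {0..T} s *\<^sub>R K s j) \<in> borel_measurable borel" for j
    using K[of j] by (simp add: Lp_fun_def set_borel_measurable_def)
  show "majorant T p K \<in> borel_measurable borel" unfolding majorant_def[abs_def] by measurable
  have "(\<integral>\<^sup>+ s. ennreal (majorant T p K s) * indicator {0..T} s \<partial>lborel) =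
    (\<integral>\<^sup>+ s. (\<Sum>j\<in>UNIV. ennreal (norm (indicator {0..T} s *\<^sub>R K s j) ^ p)) \<partial>lborel)"
    using p by (intro nn_integral_cong) (auto simp: majorant_def indicator_def sum_ennreal power_0_left)
  also have "\<dots> = (\<Sum>j\<in>UNIV. \<integral>\<^sup>+ s. ennreal (norm (indicator {0..T} s *\<^sub>R K s j) ^ p) \<partial>lborel)"
    by (rule nn_integral_sum) measurable
  also have "\<dots> = (\<Sum>j\<in>UNIV. \<integral>\<^sup>+ s. ennreal (norm (K s j) powr real p) * indicator {0..T} s \<partial>lborel)"
  proof (intro sum.cong refl nn_integral_cong)
    fix j s
    \<comment> \<open>At 0 the real and the natural power agree because p is positive.\<close>
    have "norm (K s j) powr real p = norm (K s j) ^ p"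
      using p by (cases "norm (K s j) = 0") (auto simp: powr_realpow)
    then show "ennreal (norm (indicator {0..T} s *\<^sub>R K s j) ^ p) = ennreal (norm (K s j) powr real p) * indicator {0..T} s"
      using p by (auto simp: indicator_def)
  qed
  also have "\<dots> < \<infinity>" using K by (auto simp: Lp_fun_def)
  finally show "(\<integral>\<^sup>+ s. ennreal (majorant T p K s) * indicator {0..T} s \<partial>lborel) < \<infinity>" .
qed

locale lq_problem =
  fixes M :: "'w measure" and T :: real and W Wb :: "real \<Rightarrow> 'w \<Rightarrow> real"
    and \<alpha> :: "real \<Rightarrow> 'w \<Rightarrow> 's::finite"
    and c :: "('n::finite, 'm::finite, 'k::finite, 's) coeffs"
  assumes T_pos: "0 < T" and prob: "prob_space M"
    and bm: "brownian_motion M W" "brownian_motion M Wb"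
    and \<alpha>_measurable: "\<And>t. 0 \<le> t \<Longrightarrow> \<alpha> t \<in> measurable M (count_space UNIV)"
    and \<alpha>_right: "\<And>\<omega> t. \<omega> \<in> space M \<Longrightarrow> 0 \<le> t \<Longrightarrow> \<forall>\<^sub>F s in at_right t. \<alpha> s \<omega> = \<alpha> t \<omega>"
    and noise: "independent_noise M W Wb \<alpha>"
    and integrable: "integrable_coeffs T c" and nonneg: "nonneg_cost_coeffs T c"
begin

abbreviation \<F> :: "real \<Rightarrow> 'w measure" where "\<F> \<equiv> filt_F M W Wb \<alpha>"

lemma W_measurable: "0 \<le> t \<Longrightarrow> W t \<in> borel_measurable M" "0 \<le> t \<Longrightarrow> Wb t \<in> borel_measurable M"
  using bm by (auto simp: brownian_motion_def)

sublocale filtered_space M \<F>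
  by (rule prob_space.filtered_space_filt_F[OF prob W_measurable \<alpha>_measurable])

lemma brownian_W: "brownian W"
  by (rule brownian_filt_F[OF bm(1) noise W_measurable(2) \<alpha>_measurable])

lemma brownian_Wb: "brownian Wb"
  using brownian_filt_F[OF bm(2) independent_noise_swap[OF noise] W_measurable(1) \<alpha>_measurable]
  by (simp add: filt_F_swap[of M W])

lemma \<alpha>_adapted: "0 \<le> t \<Longrightarrow> \<alpha> t \<in> measurable (\<F> t) (count_space UNIV)"
proof (rule process_events_measurable[of t "{0..t}" M \<alpha> "count_space UNIV"])
  show "process_events M (count_space UNIV) \<alpha> {0..t} \<subseteq> sets (\<F> t)"
    unfolding filt_F_def
    by (subst sets_measure_of) (auto simp: process_events_space null_sets_space)
qed auto

text \<open>The chain lives in a discrete space; real indicators of its regimes are right-continuous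
  because the chain is locally constant to the right.\<close>

lemma regime_progressive: "progressive T \<F> (\<lambda>s \<omega>. indicator {j} (\<alpha> s \<omega>) :: real)"
proof (rule progressive_right_continuous)
  fix t assume "t \<in> {0..T}"
  then show "(\<lambda>\<omega>. indicator {j} (\<alpha> t \<omega>) :: real) \<in> borel_measurable (\<F> t)"
    by (intro measurable_compose[OF \<alpha>_adapted]) auto
next
  fix \<omega> t assume "\<omega> \<in> space M" "t \<in> {0..<T}"
  then have "\<forall>\<^sub>F s in at_right t. \<alpha> s \<omega> = \<alpha> t \<omega>" by (intro \<alpha>_right) auto
  then have "\<forall>\<^sub>F s in at_right t. (indicator {j} (\<alpha> s \<omega>) :: real) = indicator {j} (\<alpha> t \<omega>)"
    by eventually_elim simp
  then show "((\<lambda>s. indicator {j} (\<alpha> s \<omega>) :: real) \<longlongrightarrow> indicator {j} (\<alpha> t \<omega>)) (at_right t)"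
    by (rule tendsto_eventually)
qed

text \<open>A coefficient along the chain is the finite sum over j of the indicator of regime j
  times a deterministic function.\<close>

lemma coefficient_progressive:
  fixes K :: "real \<Rightarrow> 's \<Rightarrow> 'a::euclidean_space"
  assumes K: "\<And>j. set_borel_measurable lborel {0..T} (\<lambda>s. K s j)"
  shows "progressive T \<F> (\<lambda>s \<omega>. K s (\<alpha> s \<omega>))"
  unfolding progressive_iff
proof
  fix t assume t: "t \<in> {0..T}"
  have [measurable]: "(\<lambda>s. indicator {0..T} s *\<^sub>R K s j) \<in> borel_measurable borel" for j
    using K[of j] by (simp add: set_borel_measurable_def)
  have [measurable]: "clipped t (\<lambda>s \<omega>. indicator {j} (\<alpha> s \<omega>) :: real) \<in> borel_measurable (\<F> t \<Otimes>\<^sub>M borel)" for j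
    using regime_progressive[of j] t by (simp add: progressive_iff)
  have "(\<lambda>p. \<Sum>j\<in>UNIV. clipped t (\<lambda>s \<omega>. indicator {j} (\<alpha> s \<omega>) :: real) p *\<^sub>R (indicator {0..T} (snd p) *\<^sub>R K (snd p) j)) \<in> borel_measurable (\<F> t \<Otimes>\<^sub>M borel)"
  proof (rule borel_measurable_sum, rule borel_measurable_scaleR)
    fix j
    show "(\<lambda>p. indicat_real {0..T} (snd p) *\<^sub>R K (snd p) j) \<in> borel_measurable (\<F> t \<Otimes>\<^sub>M borel)"
      by (rule measurable_compose[OF measurable_snd]) measurable
  qed measurable
  moreover have "(\<lambda>p. \<Sum>j\<in>UNIV. clipped t (\<lambda>s \<omega>. indicator {j} (\<alpha> s \<omega>) :: real) p *\<^sub>R (indicator {0..T} (snd p) *\<^sub>R K (snd p) j)) =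
    clipped t (\<lambda>s \<omega>. K s (\<alpha> s \<omega>))"
  proof
    fix p :: "'w \<times> real"
    have "(\<Sum>j\<in>UNIV. clipped t (\<lambda>s \<omega>. indicator {j} (\<alpha> s \<omega>) :: real) p *\<^sub>R (indicator {0..T} (snd p) *\<^sub>R K (snd p) j)) =
      (\<Sum>j\<in>UNIV. if j = \<alpha> (snd p) (fst p) then indicator {0..t} (snd p) *\<^sub>R K (snd p) j else 0)"
      using t by (intro sum.cong) (auto simp: clipped_def indicator_def split_beta')
    then show "(\<Sum>j\<in>UNIV. clipped t (\<lambda>s \<omega>. indicator {j} (\<alpha> s \<omega>) :: real) p *\<^sub>R (indicator {0..T} (snd p) *\<^sub>R K (snd p) j)) =
      clipped t (\<lambda>s \<omega>. K s (\<alpha> s \<omega>)) p" by (simp add: clipped_def split_beta')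
  qed
  ultimately show "clipped t (\<lambda>s \<omega>. K s (\<alpha> s \<omega>)) \<in> borel_measurable (\<F> t \<Otimes>\<^sub>M borel)" by simp
qed

lemma progressive_bilinear:
  fixes \<phi> :: "real \<Rightarrow> 'w \<Rightarrow> 'a::euclidean_space" and \<psi> :: "real \<Rightarrow> 'w \<Rightarrow> 'b::euclidean_space"
    and h :: "'a \<Rightarrow> 'b \<Rightarrow> 'd::euclidean_space"
  assumes "progressive T \<F> \<phi>" "progressive T \<F> \<psi>" and h: "continuous_on UNIV (\<lambda>p. h (fst p) (snd p))"
  shows "progressive T \<F> (\<lambda>s \<omega>. h (\<phi> s \<omega>) (\<psi> s \<omega>))"
  unfolding progressive_def
proof
  fix t assume "t \<in> {0..T}"
  then have "(\<lambda>p. h (\<phi> (fst p) (snd p)) (\<psi> (fst p) (snd p))) \<in> borel_measurable (restrict_space borel {0..t} \<Otimes>\<^sub>M \<F> t)"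
    using assms(1,2) by (intro borel_measurable_continuous_Pair[OF _ _ h]) (auto simp: progressive_def split_beta')
  then show "(\<lambda>(s, \<omega>). h (\<phi> s \<omega>) (\<psi> s \<omega>)) \<in> borel_measurable (restrict_space borel {0..t} \<Otimes>\<^sub>M \<F> t)"
    by (simp add: split_beta')
qed

lemma coefficient_mult_progressive:
  fixes K :: "real \<Rightarrow> 's \<Rightarrow> real^'a^'b"
  assumes "\<And>j. set_borel_measurable lborel {0..T} (\<lambda>s. K s j)" "progressive T \<F> x"
  shows "progressive T \<F> (\<lambda>s \<omega>. K s (\<alpha> s \<omega>) *v x s \<omega>)"
  by (rule progressive_bilinear[OF coefficient_progressive[OF assms(1)] assms(2) continuous_on_matrix_vector_mult])

section \<open>Integrability of the coefficients and of the forcing\<close>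

lemma coeffs:
  "Lp_fun 1 T (\<lambda>s. cA c s j)" "Lp_fun 2 T (\<lambda>s. cC c s j)" "Lp_fun 2 T (\<lambda>s. cCb c s j)"
  "Lp_fun 2 T (\<lambda>s. cB1 c s j)" "Lp_fun 2 T (\<lambda>s. cB2 c s j)"
  "Linf_fun T (\<lambda>s. cD1 c s j)" "Linf_fun T (\<lambda>s. cD2 c s j)"
  "Linf_fun T (\<lambda>s. cDb1 c s j)" "Linf_fun T (\<lambda>s. cDb2 c s j)"
  "Lp_fun 1 T (\<lambda>s. cQ c s j)" "Lp_fun 2 T (\<lambda>s. cS1 c s j)" "Lp_fun 2 T (\<lambda>s. cS2 c s j)"
  "Linf_fun T (\<lambda>s. cR1 c s j)" "Linf_fun T (\<lambda>s. cR2 c s j)"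
proof -
  have h: "Lp_fun 2 T (\<lambda>s. hcat (cB1 c s j) (cB2 c s j))" "Linf_fun T (\<lambda>s. hcat (cD1 c s j) (cD2 c s j))"
    "Linf_fun T (\<lambda>s. hcat (cDb1 c s j) (cDb2 c s j))" "Lp_fun 2 T (\<lambda>s. vcat (cS1 c s j) (cS2 c s j))"
    "Linf_fun T (\<lambda>s. block_diag (cR1 c s j) (cR2 c s j))"
    using integrable by (auto simp: integrable_coeffs_def cS_def cR_def)
  show "Lp_fun 2 T (\<lambda>s. cB1 c s j)" "Lp_fun 2 T (\<lambda>s. cB2 c s j)" by (rule Lp_fun_hcat[OF h(1)]; simp)+
  show "Linf_fun T (\<lambda>s. cD1 c s j)" "Linf_fun T (\<lambda>s. cD2 c s j)" by (rule Linf_fun_hcat[OF h(2)])+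
  show "Linf_fun T (\<lambda>s. cDb1 c s j)" "Linf_fun T (\<lambda>s. cDb2 c s j)" by (rule Linf_fun_hcat[OF h(3)])+
  show "Lp_fun 2 T (\<lambda>s. cS1 c s j)" "Lp_fun 2 T (\<lambda>s. cS2 c s j)" by (rule Lp_fun_vcat[OF h(4)]; simp)+
  show "Linf_fun T (\<lambda>s. cR1 c s j)" "Linf_fun T (\<lambda>s. cR2 c s j)" by (rule Linf_fun_block_diag[OF h(5)])+
  show "Lp_fun 1 T (\<lambda>s. cA c s j)" "Lp_fun 2 T (\<lambda>s. cC c s j)" "Lp_fun 2 T (\<lambda>s. cCb c s j)" "Lp_fun 1 T (\<lambda>s. cQ c s j)"
    using integrable by (auto simp: integrable_coeffs_def)
qed

lemma Lp_measurable: "Lp_fun p T f \<Longrightarrow> set_borel_measurable lborel {0..T} f"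
  and Linf_measurable: "Linf_fun T f \<Longrightarrow> set_borel_measurable lborel {0..T} f"
  by (simp_all add: Lp_fun_def Linf_fun_def)

definition kA :: "real \<Rightarrow> real" where "kA = majorant T 1 (cA c)"
definition kC :: "real \<Rightarrow> real" where "kC s = majorant T 2 (cC c) s + majorant T 2 (cCb c) s"

lemma matrix_sq_le:
  fixes K :: "real \<Rightarrow> 's \<Rightarrow> real^'a^'b"
  assumes "s \<in> {0..T}"
  shows "(norm (K s j *v v))\<^sup>2 \<le> majorant T 2 K s * (norm v)\<^sup>2"
proof -
  have "(norm (K s j *v v))\<^sup>2 \<le> (norm (K s j) * norm v)\<^sup>2" by (intro power_mono norm_matrix_vector_mult_le) auto
  also have "\<dots> = (norm (K s j))\<^sup>2 * (norm v)\<^sup>2" by (simp add: power_mult_distrib)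
  also have "\<dots> \<le> majorant T 2 K s * (norm v)\<^sup>2" by (intro mult_right_mono majorant_ge assms) auto
  finally show ?thesis .
qed

sublocale sde: linear_sde M \<F> T W Wb "\<lambda>s \<omega> v. cA c s (\<alpha> s \<omega>) *v v" "\<lambda>s \<omega> v. cC c s (\<alpha> s \<omega>) *v v"
    "\<lambda>s \<omega> v. cCb c s (\<alpha> s \<omega>) *v v" kA kC
proof (rule linear_sde.intro[OF filtered_space_axioms linear_sde_axioms.intro])
  \<comment> \<open>The exponents are restated as casts of naturals, the form in which
    \<open>majorant_Lp\<close> takes them.\<close>
  have L1: "\<And>j. Lp_fun (real 1) T (\<lambda>s. cA c s j)" and L2: "\<And>j. Lp_fun (real 2) T (\<lambda>s. cC c s j)" "\<And>j. Lp_fun (real 2) T (\<lambda>s. cCb c s j)"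
    using coeffs by simp_all
  note mA = majorant_Lp[where K="cA c" and p=1, OF L1] note mC = majorant_Lp[where K="cC c" and p=2, OF L2(1)] note mCb = majorant_Lp[where K="cCb c" and p=2, OF L2(2)]
  show "0 < T" by (rule T_pos)
  show "brownian W" by (rule brownian_W)
  show "brownian Wb" by (rule brownian_Wb)
  show "linear (\<lambda>v. cA c s (\<alpha> s \<omega>) *v v)" for s \<omega>
    by (rule matrix_vector_mul_linear)
  show "linear (\<lambda>v. cC c s (\<alpha> s \<omega>) *v v)" for s \<omega>
    by (rule matrix_vector_mul_linear)
  show "linear (\<lambda>v. cCb c s (\<alpha> s \<omega>) *v v)" for s \<omega>
    by (rule matrix_vector_mul_linear)
  show "progressive T \<F> (\<lambda>s \<omega>. cA c s (\<alpha> s \<omega>) *v x s \<omega>)" "progressive T \<F> (\<lambda>s \<omega>. cC c s (\<alpha> s \<omega>) *v x s \<omega>)"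
    "progressive T \<F> (\<lambda>s \<omega>. cCb c s (\<alpha> s \<omega>) *v x s \<omega>)" if "progressive T \<F> x" for x
    using that by (intro coefficient_mult_progressive Lp_measurable[OF coeffs(1)] Lp_measurable[OF coeffs(2)] Lp_measurable[OF coeffs(3)]; assumption)+
  show "kA \<in> borel_measurable borel" using mA by (simp add: kA_def)
  have [measurable]: "majorant T 2 (cC c) \<in> borel_measurable borel" "majorant T 2 (cCb c) \<in> borel_measurable borel"
    using mC mCb by simp_all
  show "kC \<in> borel_measurable borel" unfolding kC_def[abs_def] by measurable
  show "0 \<le> kA s" "0 \<le> kC s" for s by (simp_all add: kA_def kC_def majorant_nonneg add_nonneg_nonneg)
  show "(\<integral>\<^sup>+ s. ennreal (kA s) * indicator {0..T} s \<partial>lborel) < \<infinity>" using mA by (simp add: kA_def)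
  show "(\<integral>\<^sup>+ s. ennreal (kC s) * indicator {0..T} s \<partial>lborel) < \<infinity>"
  proof -
    have "(\<integral>\<^sup>+ s. ennreal (kC s) * indicator {0..T} s \<partial>lborel) =
      (\<integral>\<^sup>+ s. ennreal (majorant T 2 (cC c) s) * indicator {0..T} s + ennreal (majorant T 2 (cCb c) s) * indicator {0..T} s \<partial>lborel)"
      by (intro nn_integral_cong) (simp add: kC_def ennreal_plus majorant_nonneg distrib_right)
    also have "\<dots> = (\<integral>\<^sup>+ s. ennreal (majorant T 2 (cC c) s) * indicator {0..T} s \<partial>lborel) + (\<integral>\<^sup>+ s. ennreal (majorant T 2 (cCb c) s) * indicator {0..T} s \<partial>lborel)"
      by (rule nn_integral_add) measurable
    also have "\<dots> < \<infinity>" using mC mCb by simp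
    finally show ?thesis .
  qed
  fix s \<omega> and v :: "real^'n" assume s: "s \<in> {0..T}"
  have "norm (cA c s (\<alpha> s \<omega>) *v v) \<le> norm (cA c s (\<alpha> s \<omega>)) * norm v" by (rule norm_matrix_vector_mult_le)
  also have "\<dots> \<le> kA s * norm v" using majorant_ge[OF s, of "cA c" "\<alpha> s \<omega>" 1] by (intro mult_right_mono) (auto simp: kA_def)
  finally show "norm (cA c s (\<alpha> s \<omega>) *v v) \<le> kA s * norm v" .
  have "majorant T 2 (cC c) s * (norm v)\<^sup>2 \<le> kC s * (norm v)\<^sup>2" "majorant T 2 (cCb c) s * (norm v)\<^sup>2 \<le> kC s * (norm v)\<^sup>2"
    by (intro mult_right_mono; simp add: kC_def majorant_nonneg)+
  then show "(norm (cC c s (\<alpha> s \<omega>) *v v))\<^sup>2 \<le> kC s * (norm v)\<^sup>2" "(norm (cCb c s (\<alpha> s \<omega>) *v v))\<^sup>2 \<le> kC s * (norm v)\<^sup>2"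
    using matrix_sq_le[OF s, of "cC c" "\<alpha> s \<omega>" v] matrix_sq_le[OF s, of "cCb c" "\<alpha> s \<omega>" v] by linarith+
qed

text \<open>The essential bounds of the finitely many regimes are added, and one null set of times
  serves all of them.\<close>

lemma bounded_coefficient:
  fixes D :: "real \<Rightarrow> 's \<Rightarrow> 'a::euclidean_space"
  assumes "\<And>j. Linf_fun T (\<lambda>s. D s j)"
  obtains K where "0 \<le> K" "AE s in lborel. s \<in> {0..T} \<longrightarrow> (\<forall>j. norm (D s j) \<le> K)"
proof -
  have "\<forall>j. \<exists>K. AE s in lborel. s \<in> {0..T} \<longrightarrow> norm (D s j) \<le> K" using assms by (auto simp: Linf_fun_def)
  from choice[OF this] obtain K where K: "\<forall>j. AE s in lborel. s \<in> {0..T} \<longrightarrow> norm (D s j) \<le> K j" ..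
  then have "AE s in lborel. \<forall>j. s \<in> {0..T} \<longrightarrow> norm (D s j) \<le> K j" by (subst AE_all_countable) blast
  then have "AE s in lborel. s \<in> {0..T} \<longrightarrow> (\<forall>j. norm (D s j) \<le> (\<Sum>j\<in>UNIV. \<bar>K j\<bar>))"
  proof eventually_elim
    case (elim s)
    show ?case
    proof (intro impI allI)
      fix j assume "s \<in> {0..T}"
      then have "norm (D s j) \<le> K j" using elim by blast
      then have "norm (D s j) \<le> \<bar>K j\<bar>" by linarith
      also have "\<dots> \<le> (\<Sum>j\<in>UNIV. \<bar>K j\<bar>)" by (rule member_le_sum) auto
      finally show "norm (D s j) \<le> (\<Sum>j\<in>UNIV. \<bar>K j\<bar>)" .
    qed
  qed
  moreover have "0 \<le> (\<Sum>j\<in>UNIV. \<bar>K j\<bar>)" by (intro sum_nonneg) auto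
  ultimately show thesis using that by blast
qed

lemma bounded_coefficient_L2:
  fixes D :: "real \<Rightarrow> 's \<Rightarrow> real^'a^'b"
  assumes D: "\<And>j. Linf_fun T (\<lambda>s. D s j)" and u: "u \<in> L2_process M T \<F>"
  shows "(\<lambda>s \<omega>. D s (\<alpha> s \<omega>) *v u s \<omega>) \<in> L2_process M T \<F>"
proof -
  obtain K where K: "0 \<le> K" "AE s in lborel. s \<in> {0..T} \<longrightarrow> (\<forall>j. norm (D s j) \<le> K)"
    by (rule bounded_coefficient[OF D])
  have p: "progressive T \<F> (\<lambda>s \<omega>. D s (\<alpha> s \<omega>) *v u s \<omega>)"
    using u by (intro coefficient_mult_progressive Linf_measurable[OF D]) (simp add: L2_process_def)
  have "nn_energy M T (\<lambda>s \<omega>. D s (\<alpha> s \<omega>) *v u s \<omega>) \<le> nn_energy M T (\<lambda>s \<omega>. K *\<^sub>R u s \<omega>)"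
    unfolding nn_energy_def
  proof (rule nn_integral_mono, rule nn_integral_mono_AE)
    fix \<omega>
    show "AE s in lborel. ennreal ((norm (D s (\<alpha> s \<omega>) *v u s \<omega>))\<^sup>2) * indicator {0..T} s \<le>
      ennreal ((norm (K *\<^sub>R u s \<omega>))\<^sup>2) * indicator {0..T} s"
      using K(2)
    proof eventually_elim
      case (elim s)
      show ?case
      proof (cases "s \<in> {0..T}")
        case True
        have "norm (D s (\<alpha> s \<omega>) *v u s \<omega>) \<le> norm (D s (\<alpha> s \<omega>)) * norm (u s \<omega>)" by (rule norm_matrix_vector_mult_le)
        also have "\<dots> \<le> K * norm (u s \<omega>)" using elim True by (intro mult_right_mono) auto
        finally show ?thesis using True K(1) by (intro mult_right_mono ennreal_leI power_mono) auto
      qed simp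
    qed
  qed
  also have "\<dots> = ennreal (K\<^sup>2) * nn_energy M T u"
    by (rule nn_energy_scaleR[OF L2_process_clipped[OF u sde.T_mem(1)]])
  also have "\<dots> < \<infinity>" using u by (simp add: L2_process_def ennreal_mult_less_top)
  finally show ?thesis using p by (simp add: L2_process_def)
qed

text \<open>\<open>path_L1_cauchy_schwarz\<close> with the squared majorant as kernel, which is
  integrable because B is L^2 in time.\<close>

lemma square_integrable_coefficient_path_L1:
  fixes B :: "real \<Rightarrow> 's \<Rightarrow> real^'a^'b"
  assumes B: "\<And>j. Lp_fun 2 T (\<lambda>s. B s j)" and u: "u \<in> L2_process M T \<F>"
  shows "(\<integral>\<^sup>+ \<omega>. (path_L1 T (\<lambda>s \<omega>. B s (\<alpha> s \<omega>) *v u s \<omega>) \<omega>)\<^sup>2 \<partial>M) < \<infinity>"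
proof -
  have B': "\<And>j. Lp_fun (real 2) T (\<lambda>s. B s j)" using B by simp
  note m = majorant_Lp[where K=B and p=2, OF B']
  have "(\<integral>\<^sup>+ \<omega>. (path_L1 T (\<lambda>s \<omega>. B s (\<alpha> s \<omega>) *v u s \<omega>) \<omega>)\<^sup>2 \<partial>M) \<le>
    (\<integral>\<^sup>+ s. ennreal (majorant T 2 B s) * indicator {0..T} s \<partial>lborel) * nn_energy M T u"
  proof (rule path_L1_cauchy_schwarz[OF _ majorant_nonneg L2_process_clipped[OF u sde.T_mem(1)]])
    fix s \<omega> assume s: "s \<in> {0..T}"
    have "norm (B s (\<alpha> s \<omega>) *v u s \<omega>) = sqrt ((norm (B s (\<alpha> s \<omega>) *v u s \<omega>))\<^sup>2)" by simp
    also have "\<dots> \<le> sqrt (majorant T 2 B s * (norm (u s \<omega>))\<^sup>2)" by (intro real_sqrt_le_mono matrix_sq_le s)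
    also have "\<dots> = sqrt (majorant T 2 B s) * norm (u s \<omega>)" by (simp add: real_sqrt_mult)
    finally show "norm (B s (\<alpha> s \<omega>) *v u s \<omega>) \<le> sqrt (majorant T 2 B s) * norm (u s \<omega>)" .
  qed (use m in simp)
  also have "\<dots> < \<infinity>" using m(2) u by (simp add: L2_process_def ennreal_mult_less_top)
  finally show ?thesis .
qed

definition forcing :: "(real \<Rightarrow> 's \<Rightarrow> real^'m^'n) \<Rightarrow> (real \<Rightarrow> 's \<Rightarrow> real^'k^'n) \<Rightarrow> (real \<Rightarrow> 'w \<Rightarrow> real^'m) \<Rightarrow> (real \<Rightarrow> 'w \<Rightarrow> real^'k) \<Rightarrow> real \<Rightarrow> 'w \<Rightarrow> real^'n" where
  "forcing X Y u v s \<omega> = X s (\<alpha> s \<omega>) *v u s \<omega> + Y s (\<alpha> s \<omega>) *v v s \<omega>"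

lemma forcing_lincomb:
  "forcing X Y (\<lambda>s \<omega>. p *\<^sub>R u s \<omega> + q *\<^sub>R u' s \<omega>) (\<lambda>s \<omega>. p *\<^sub>R v s \<omega> + q *\<^sub>R v' s \<omega>) =
    (\<lambda>s \<omega>. p *\<^sub>R forcing X Y u v s \<omega> + q *\<^sub>R forcing X Y u' v' s \<omega>)"
  by (intro ext) (simp add: forcing_def matrix_vector_right_distrib matrix_vector_mult_scaleR scaleR_add_right)

text \<open>The control terms form the forcing, so the abstract existence and uniqueness results
  apply to the state equation.\<close>

lemma state_solution_iff:
  "state_solution M T W Wb \<alpha> c u v x \<longleftrightarrow>
    sde.step (forcing (cB1 c) (cB2 c) u v) (forcing (cD1 c) (cD2 c) u v) (forcing (cDb1 c) (cDb2 c) u v) x x \<and>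
    (\<integral>\<^sup>+ \<omega>. (SUP t\<in>{0..T}. ennreal ((norm (x t \<omega>))\<^sup>2)) \<partial>M) < \<infinity>"
  unfolding state_solution_def sde.step_def forcing_def Let_def add.assoc by blast

lemma forcing_admissible:
  assumes u: "u \<in> L2_process M T \<F>" and v: "v \<in> L2_process M T \<F>"
  shows "sde.admissible_forcing (forcing (cB1 c) (cB2 c) u v) (forcing (cD1 c) (cD2 c) u v) (forcing (cDb1 c) (cDb2 c) u v)"
proof -
  have up: "progressive T \<F> u" and vp: "progressive T \<F> v" using u v by (auto simp: L2_process_def)
  have p: "progressive T \<F> (\<lambda>s \<omega>. cB1 c s (\<alpha> s \<omega>) *v u s \<omega>)" "progressive T \<F> (\<lambda>s \<omega>. cB2 c s (\<alpha> s \<omega>) *v v s \<omega>)"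
    by (intro coefficient_mult_progressive Lp_measurable[OF coeffs(4)] up; assumption)
      (intro coefficient_mult_progressive Lp_measurable[OF coeffs(5)] vp; assumption)
  note pc = progressive_clipped[OF p(1) sde.T_mem(1)] progressive_clipped[OF p(2) sde.T_mem(1)]
  have "progressive T \<F> (forcing (cB1 c) (cB2 c) u v)"
    using sde.progressive_lincomb[OF p, of 1 1] by (simp add: forcing_def[abs_def])
  moreover have "(\<integral>\<^sup>+ \<omega>. (path_L1 T (forcing (cB1 c) (cB2 c) u v) \<omega>)\<^sup>2 \<partial>M) < \<infinity>"
    unfolding forcing_def[abs_def]
    by (rule le_less_trans[OF path_L1_square_add_le[OF pc]])
      (use square_integrable_coefficient_path_L1[where B="cB1 c", OF coeffs(4) u] square_integrable_coefficient_path_L1[where B="cB2 c", OF coeffs(5) v]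
        in \<open>simp add: ennreal_mult_less_top\<close>)
  moreover have "forcing (cD1 c) (cD2 c) u v \<in> L2_process M T \<F>"
    using L2_process_lincomb[OF bounded_coefficient_L2[where D="cD1 c", OF coeffs(6) u] bounded_coefficient_L2[where D="cD2 c", OF coeffs(7) v] T_pos, of 1 1]
    by (simp add: forcing_def[abs_def])
  moreover have "forcing (cDb1 c) (cDb2 c) u v \<in> L2_process M T \<F>"
    using L2_process_lincomb[OF bounded_coefficient_L2[where D="cDb1 c", OF coeffs(8) u] bounded_coefficient_L2[where D="cDb2 c", OF coeffs(9) v] T_pos, of 1 1]
    by (simp add: forcing_def[abs_def])
  ultimately show ?thesis by (simp add: sde.admissible_forcing_def)
qed

text \<open>Existence is what gives meaning to the choice in \<open>state\<close>.\<close>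

lemma state_solves:
  assumes "u \<in> L2_process M T \<F>" "v \<in> L2_process M T \<F>"
  shows "state_solution M T W Wb \<alpha> c u v (state M T W Wb \<alpha> c u v)"
proof -
  have "\<exists>x. state_solution M T W Wb \<alpha> c u v x"
    by (rule sde.solution_exists[OF forcing_admissible[OF assms]]) (auto simp: state_solution_iff)
  then show ?thesis unfolding state_def by (rule someI_ex)
qed

lemma state_solution_progressive: "state_solution M T W Wb \<alpha> c u v x \<Longrightarrow> progressive T \<F> x"
  by (auto simp: state_solution_iff dest: sde.step_progressive)

lemma state_solution_bounded: "state_solution M T W Wb \<alpha> c u v x \<Longrightarrow> sde.bounded_L2 x"
  using sde.bounded_L2_of_sup[OF state_solution_progressive] by (simp add: state_solution_iff)

lemma bounded_L2_lincomb:
  assumes "sde.bounded_L2 x" "sde.bounded_L2 y"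
  shows "sde.bounded_L2 (\<lambda>s \<omega>. p *\<^sub>R x s \<omega> + q *\<^sub>R y s \<omega>)"
proof -
  obtain K where K: "0 \<le> K" "\<And>t. t \<in> {0..T} \<Longrightarrow> nn_sq M (x t) \<le> ennreal K" using assms unfolding sde.bounded_L2_def by blast
  obtain L where L: "0 \<le> L" "\<And>t. t \<in> {0..T} \<Longrightarrow> nn_sq M (y t) \<le> ennreal L" using assms unfolding sde.bounded_L2_def by blast
  have p: "progressive T \<F> x" "progressive T \<F> y" using assms by (auto simp: sde.bounded_L2_def)
  have "nn_sq M (\<lambda>\<omega>. p *\<^sub>R x t \<omega> + q *\<^sub>R y t \<omega>) \<le> ennreal (2 * (p\<^sup>2 * K) + 2 * (q\<^sup>2 * L))" if t: "t \<in> {0..T}" for t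
  proof -
    note m[measurable] = sde.progressive_M[OF p(1) t] sde.progressive_M[OF p(2) t]
    have "nn_sq M (\<lambda>\<omega>. p *\<^sub>R x t \<omega> + q *\<^sub>R y t \<omega>) \<le> 2 * nn_sq M (\<lambda>\<omega>. p *\<^sub>R x t \<omega>) + 2 * nn_sq M (\<lambda>\<omega>. q *\<^sub>R y t \<omega>)"
      by (rule nn_sq_add_le) measurable
    also have "\<dots> = 2 * (ennreal (p\<^sup>2) * nn_sq M (x t)) + 2 * (ennreal (q\<^sup>2) * nn_sq M (y t))"
      by (simp only: nn_sq_scaleR[OF m(1)] nn_sq_scaleR[OF m(2)])
    also have "\<dots> \<le> 2 * (ennreal (p\<^sup>2) * ennreal K) + 2 * (ennreal (q\<^sup>2) * ennreal L)"
      by (intro add_mono mult_left_mono K L t) auto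
    also have "\<dots> = ennreal (2 * (p\<^sup>2 * K)) + ennreal (2 * (q\<^sup>2 * L))"
      using K(1) L(1) by (simp add: ennreal_mult)
    also have "\<dots> = ennreal (2 * (p\<^sup>2 * K) + 2 * (q\<^sup>2 * L))" using K(1) L(1) by (intro ennreal_plus[symmetric]) auto
    finally show ?thesis .
  qed
  moreover have "0 \<le> 2 * (p\<^sup>2 * K) + 2 * (q\<^sup>2 * L)" using K(1) L(1) by simp
  ultimately show ?thesis using sde.progressive_lincomb[OF p] unfolding sde.bounded_L2_def by blast
qed

text \<open>The combined states solve the equation with the combined forcing. Their difference from
  the chosen state solves the homogeneous equation with bounded second moments, hence
  vanishes.\<close>

lemma state_lincomb:
  assumes u: "u \<in> L2_process M T \<F>" "v \<in> L2_process M T \<F>" and u': "u' \<in> L2_process M T \<F>" "v' \<in> L2_process M T \<F>"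
  shows "AE \<omega> in M. \<forall>t\<in>{0..T}. state M T W Wb \<alpha> c (\<lambda>s \<omega>. p *\<^sub>R u s \<omega> + q *\<^sub>R u' s \<omega>) (\<lambda>s \<omega>. p *\<^sub>R v s \<omega> + q *\<^sub>R v' s \<omega>) t \<omega> =
    p *\<^sub>R state M T W Wb \<alpha> c u v t \<omega> + q *\<^sub>R state M T W Wb \<alpha> c u' v' t \<omega>"
proof -
  let ?u = "\<lambda>s \<omega>. p *\<^sub>R u s \<omega> + q *\<^sub>R u' s \<omega>" and ?v = "\<lambda>s \<omega>. p *\<^sub>R v s \<omega> + q *\<^sub>R v' s \<omega>"
  let ?x = "state M T W Wb \<alpha> c u v" and ?x' = "state M T W Wb \<alpha> c u' v'" and ?y = "state M T W Wb \<alpha> c ?u ?v"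
  note s = state_solves[OF u] state_solves[OF u']
    state_solves[OF L2_process_lincomb[OF u(1) u'(1) T_pos, of p q] L2_process_lincomb[OF u(2) u'(2) T_pos, of p q]]
  have l: "sde.step (forcing (cB1 c) (cB2 c) ?u ?v) (forcing (cD1 c) (cD2 c) ?u ?v) (forcing (cDb1 c) (cDb2 c) ?u ?v)
      (\<lambda>s \<omega>. p *\<^sub>R ?x s \<omega> + q *\<^sub>R ?x' s \<omega>) (\<lambda>s \<omega>. p *\<^sub>R ?x s \<omega> + q *\<^sub>R ?x' s \<omega>)"
    unfolding forcing_lincomb using s(1,2) by (intro sde.step_lincomb) (auto simp: state_solution_iff)
  have y: "sde.step (forcing (cB1 c) (cB2 c) ?u ?v) (forcing (cD1 c) (cD2 c) ?u ?v) (forcing (cDb1 c) (cDb2 c) ?u ?v) ?y ?y"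
    using s(3) by (simp add: state_solution_iff)
  have "sde.bounded_L2 (\<lambda>s \<omega>. 1 *\<^sub>R ?y s \<omega> + (-1) *\<^sub>R (p *\<^sub>R ?x s \<omega> + q *\<^sub>R ?x' s \<omega>))"
    by (intro bounded_L2_lincomb state_solution_bounded[OF s(1)] state_solution_bounded[OF s(2)] state_solution_bounded[OF s(3)])
  then have "sde.bounded_L2 (\<lambda>s \<omega>. ?y s \<omega> - (p *\<^sub>R ?x s \<omega> + q *\<^sub>R ?x' s \<omega>))" by (simp add: algebra_simps)
  from sde.step_unique[OF sde.step_diff[OF y l] this] show ?thesis
    by eventually_elim simp
qed

end

section \<open>The cost as a quadratic form\<close>

lemma sum_UNIV_Plus:
  "(\<Sum>i\<in>UNIV. f (i :: 'a::finite + 'b::finite)) = (\<Sum>a\<in>UNIV. f (Inl a)) + (\<Sum>b\<in>UNIV. f (Inr b))"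
  by (simp add: UNIV_Plus_UNIV[symmetric] sum.Plus del: UNIV_Plus_UNIV)

text \<open>Stacks both controls into one, so that the hypotheses on the assembled R and S are used
  in a single completion of the square.\<close>

definition vec_join :: "real^'m \<Rightarrow> real^'k \<Rightarrow> real^('m::finite + 'k::finite)" where
  "vec_join u v = (\<chi> i. case i of Inl a \<Rightarrow> u $ a | Inr b \<Rightarrow> v $ b)"

lemma vcat_inner_vec_join:
  fixes S1 :: "real^'n::finite^'m::finite" and S2 :: "real^'n^'k::finite"
  shows "(vcat S1 S2 *v x) \<bullet> vec_join u v = (S1 *v x) \<bullet> u + (S2 *v x) \<bullet> v"
  by (simp add: inner_vec_def sum_UNIV_Plus vcat_def vec_join_def matrix_vector_mult_def)

lemma block_diag_inner_vec_join:
  fixes R1 :: "real^'m::finite^'m" and R2 :: "real^'k::finite^'k"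
  shows "(block_diag R1 R2 *v vec_join u v) \<bullet> vec_join u v = (R1 *v u) \<bullet> u + (R2 *v v) \<bullet> v"
  by (simp add: inner_vec_def sum_UNIV_Plus block_diag_def vec_join_def matrix_vector_mult_def)

text \<open>Positive definiteness makes the kernel trivial, so an inverse exists, and the choice in
  \<open>matrix_inv\<close> then returns one.\<close>

lemma ge_scalar_invertible:
  fixes R :: "real^'n::finite^'n"
  assumes "ge_scalar R \<delta>" "0 < \<delta>"
  shows "R ** matrix_inv R = mat 1"
proof -
  have "z = 0" if "R *v z = 0" for z
  proof -
    have "\<delta> * (z \<bullet> z) \<le> z \<bullet> (R *v z)" using assms(1) by (simp add: ge_scalar_def)
    then have "z \<bullet> z \<le> 0" using that assms(2) by (simp add: mult_le_0_iff)
    then show "z = 0" by (metis inner_gt_zero_iff not_less)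
  qed
  then obtain B where B: "B ** R = mat 1" using matrix_left_invertible_ker[of R] by blast
  then have "\<exists>B. R ** B = mat 1 \<and> B ** R = mat 1" using matrix_left_right_inverse[of B R] by blast
  then show ?thesis unfolding matrix_inv_def by (rule someI2_ex) simp
qed

text \<open>Completion of the square: the cost is the quadratic form of R at w + z plus that of the
  Schur complement at x, and both are nonnegative.\<close>

lemma quadratic_cost_nonneg:
  fixes Q :: "real^'n::finite^'n" and R :: "real^'m::finite^'m" and S :: "real^'n^'m"
  assumes sym: "symmetric_matrix R" and R: "ge_scalar R \<delta>" "0 < \<delta>"
    and Q: "ge_scalar (Q - transpose S ** matrix_inv R ** S) 0"
  shows "0 \<le> (Q *v x) \<bullet> x + (R *v w) \<bullet> w + 2 * ((S *v x) \<bullet> w)"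
proof -
  \<comment> \<open>the cost is minimal at \<open>w = - z\<close>\<close>
  define z where "z = matrix_inv R *v (S *v x)"
  have Rz: "R *v z = S *v x"
    unfolding z_def by (simp add: matrix_vector_mul_assoc ge_scalar_invertible[OF R] matrix_mul_assoc)
  have "(R *v w) \<bullet> z = (R *v z) \<bullet> w"
    using sym dot_lmul_matrix[of z R w] by (simp add: symmetric_matrix_def transpose_matrix_vector[symmetric] inner_commute)
  then have sq: "(w + z) \<bullet> (R *v (w + z)) = (R *v w) \<bullet> w + 2 * ((S *v x) \<bullet> w) + (S *v x) \<bullet> z"
    by (simp add: matrix_vector_right_distrib inner_add_left inner_add_right Rz inner_commute)
  have "\<delta> * ((w + z) \<bullet> (w + z)) \<le> (w + z) \<bullet> (R *v (w + z))" using R(1) unfolding ge_scalar_def by blast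
  moreover have "0 \<le> \<delta> * ((w + z) \<bullet> (w + z))" using R(2) by simp
  moreover have "0 \<le> x \<bullet> ((Q - transpose S ** matrix_inv R ** S) *v x)" using Q by (simp add: ge_scalar_def)
  moreover have "x \<bullet> ((transpose S ** matrix_inv R ** S) *v x) = (S *v x) \<bullet> z"
    unfolding z_def matrix_vector_mul_assoc[symmetric] transpose_matrix_vector
    by (metis dot_lmul_matrix inner_commute)
  ultimately show ?thesis
    unfolding sq by (simp add: matrix_vector_mult_diff_rdistrib inner_diff_right inner_commute)
qed

context lq_problem
begin

section \<open>The cost along a path\<close>

lemma progressive_inner_coefficient:
  fixes K :: "real \<Rightarrow> 's \<Rightarrow> real^'a^'b"
  assumes "\<And>j. set_borel_measurable lborel {0..T} (\<lambda>s. K s j)" "progressive T \<F> y" "progressive T \<F> z"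
  shows "progressive T \<F> (\<lambda>s \<omega>. (K s (\<alpha> s \<omega>) *v y s \<omega>) \<bullet> z s \<omega>)"
  by (rule progressive_bilinear[OF coefficient_mult_progressive[OF assms(1,2)] assms(3)])
    (auto intro!: continuous_intros)

lemma progressive_add_mult:
  assumes "progressive T \<F> y" "progressive T \<F> z"
  shows "progressive T \<F> (\<lambda>s \<omega>. y s \<omega> + (r::real) * z s \<omega> :: real)"
  by (rule progressive_bilinear[OF assms]) (auto intro!: continuous_intros)

definition cost_rate :: "real \<Rightarrow> 's \<Rightarrow> real^'n \<Rightarrow> real^'m \<Rightarrow> real^'k \<Rightarrow> real" where
  "cost_rate s j x u v = (cQ c s j *v x) \<bullet> x + (cR1 c s j *v u) \<bullet> u + (cR2 c s j *v v) \<bullet> v +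
    2 * ((cS1 c s j *v x) \<bullet> u) + 2 * ((cS2 c s j *v x) \<bullet> v)"

definition running_cost :: "(real \<Rightarrow> 'w \<Rightarrow> real^'n) \<Rightarrow> (real \<Rightarrow> 'w \<Rightarrow> real^'m) \<Rightarrow> (real \<Rightarrow> 'w \<Rightarrow> real^'k) \<Rightarrow> real \<Rightarrow> 'w \<Rightarrow> real" where
  "running_cost x u v s \<omega> = cost_rate s (\<alpha> s \<omega>) (x s \<omega>) (u s \<omega>) (v s \<omega>)"

definition terminal_cost :: "(real \<Rightarrow> 'w \<Rightarrow> real^'n) \<Rightarrow> 'w \<Rightarrow> real" where
  "terminal_cost x \<omega> = (cG c (\<alpha> T \<omega>) *v x T \<omega>) \<bullet> x T \<omega>"

text \<open>The state is a separate argument, so that a linear combination of states can be inserted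
  and compared with the state of the combined controls.\<close>

definition path_cost :: "(real \<Rightarrow> 'w \<Rightarrow> real^'n) \<Rightarrow> (real \<Rightarrow> 'w \<Rightarrow> real^'m) \<Rightarrow> (real \<Rightarrow> 'w \<Rightarrow> real^'k) \<Rightarrow> 'w \<Rightarrow> real" where
  "path_cost x u v \<omega> = terminal_cost x \<omega> + (LINT s:{0..T}|lborel. running_cost x u v s \<omega>)"

lemma J0_eq: "J0 M T W Wb \<alpha> c u v = (LINT \<omega>|M. path_cost (state M T W Wb \<alpha> c u v) u v \<omega>)"
  by (simp add: J0_def path_cost_def terminal_cost_def running_cost_def cost_rate_def Let_def)

lemma cost_rate_scale: "cost_rate s j (r *\<^sub>R x) (r *\<^sub>R u) (r *\<^sub>R v) = r\<^sup>2 * cost_rate s j x u v"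
  by (simp add: cost_rate_def matrix_vector_mult_scaleR power2_eq_square algebra_simps)

lemma cost_rate_parallelogram:
  "cost_rate s j (x + x') (u + u') (v + v') + cost_rate s j (x - x') (u - u') (v - v') =
    2 * cost_rate s j x u v + 2 * cost_rate s j x' u' v'"
  by (simp add: cost_rate_def matrix_vector_right_distrib matrix_vector_mult_diff_distrib inner_add_left inner_add_right
      inner_diff_left inner_diff_right)

text \<open>A single null set of times serves all regimes and all vectors, so random paths may be
  substituted.\<close>

lemma cost_rate_nonneg: "AE s in lborel. s \<in> {0..T} \<longrightarrow> (\<forall>j x u v. 0 \<le> cost_rate s j x u v)"
proof -
  have "AE s in lborel. s \<in> {0..T} \<longrightarrow> (\<forall>x u v. 0 \<le> cost_rate s j x u v)" for j
  proof -
    obtain \<delta> where \<delta>: "0 < \<delta>" "AE s in lborel. s \<in> {0..T} \<longrightarrow> ge_scalar (cR c s j) \<delta>"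
      using nonneg by (auto simp: nonneg_cost_coeffs_def)
    have "AE s in lborel. s \<in> {0..T} \<longrightarrow> symmetric_matrix (cR c s j)"
      "AE s in lborel. s \<in> {0..T} \<longrightarrow> ge_scalar (cQ c s j - transpose (cS c s j) ** matrix_inv (cR c s j) ** cS c s j) 0"
      using integrable nonneg by (auto simp: integrable_coeffs_def nonneg_cost_coeffs_def)
    then show ?thesis using \<delta>(2)
    proof eventually_elim
      case (elim s)
      have "0 \<le> cost_rate s j x u v" if "s \<in> {0..T}" for x u v
        using quadratic_cost_nonneg[of "cR c s j" \<delta> "cQ c s j" "cS c s j" x "vec_join u v"] elim that \<delta>(1)
        by (simp add: cost_rate_def cS_def cR_def vcat_inner_vec_join block_diag_inner_vec_join)
      then show ?case by blast
    qed
  qed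
  then have "AE s in lborel. \<forall>j. s \<in> {0..T} \<longrightarrow> (\<forall>x u v. 0 \<le> cost_rate s j x u v)" by (subst AE_all_countable) blast
  then show ?thesis by eventually_elim blast
qed

text \<open>The cross terms are split by Young's inequality between the image of x under S and the
  control. So S enters squared as a factor of |x|^2, where integrability in time is enough, and the
  controls keep bounded factors.\<close>

lemma cost_rate_bound:
  "\<exists>q L. q \<in> borel_measurable borel \<and> (\<forall>s. 0 \<le> q s) \<and>
    (\<integral>\<^sup>+ s. ennreal (q s) * indicator {0..T} s \<partial>lborel) < \<infinity> \<and> 0 \<le> L \<and>
    (AE s in lborel. s \<in> {0..T} \<longrightarrow> (\<forall>j x u v. \<bar>cost_rate s j x u v\<bar> \<le> q s * (norm x)\<^sup>2 + L * (norm u)\<^sup>2 + L * (norm v)\<^sup>2))"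
proof -
  obtain K1 where K1: "0 \<le> K1" "AE s in lborel. s \<in> {0..T} \<longrightarrow> (\<forall>j. norm (cR1 c s j) \<le> K1)"
    by (rule bounded_coefficient[where D="cR1 c", OF coeffs(13)])
  obtain K2 where K2: "0 \<le> K2" "AE s in lborel. s \<in> {0..T} \<longrightarrow> (\<forall>j. norm (cR2 c s j) \<le> K2)"
    by (rule bounded_coefficient[where D="cR2 c", OF coeffs(14)])
  have l: "\<And>j. Lp_fun (real 1) T (\<lambda>s. cQ c s j)" "\<And>j. Lp_fun (real 2) T (\<lambda>s. cS1 c s j)" "\<And>j. Lp_fun (real 2) T (\<lambda>s. cS2 c s j)"
    using coeffs by simp_all
  note mQ = majorant_Lp[where K="cQ c" and p=1, OF l(1)] note m1 = majorant_Lp[where K="cS1 c" and p=2, OF l(2)]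
  note m2 = majorant_Lp[where K="cS2 c" and p=2, OF l(3)]
  have [measurable]: "majorant T (Suc 0) (cQ c) \<in> borel_measurable borel" "majorant T 2 (cS1 c) \<in> borel_measurable borel"
    "majorant T 2 (cS2 c) \<in> borel_measurable borel"
    using mQ m1 m2 by simp_all
  define q where "q s = majorant T 1 (cQ c) s + majorant T 2 (cS1 c) s + majorant T 2 (cS2 c) s" for s
  have qm: "q \<in> borel_measurable borel" unfolding q_def[abs_def] One_nat_def by measurable
  have q0: "0 \<le> q s" for s by (simp add: q_def majorant_nonneg)
  have "(\<integral>\<^sup>+ s. ennreal (q s) * indicator {0..T} s \<partial>lborel) =
    (\<integral>\<^sup>+ s. ennreal (majorant T 1 (cQ c) s) * indicator {0..T} s + ennreal (majorant T 2 (cS1 c) s) * indicator {0..T} s +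
      ennreal (majorant T 2 (cS2 c) s) * indicator {0..T} s \<partial>lborel)"
    by (intro nn_integral_cong) (simp add: q_def ennreal_plus majorant_nonneg distrib_right)
  also have "\<dots> = (\<integral>\<^sup>+ s. ennreal (majorant T 1 (cQ c) s) * indicator {0..T} s \<partial>lborel) +
      (\<integral>\<^sup>+ s. ennreal (majorant T 2 (cS1 c) s) * indicator {0..T} s \<partial>lborel) +
      (\<integral>\<^sup>+ s. ennreal (majorant T 2 (cS2 c) s) * indicator {0..T} s \<partial>lborel)"
    by (simp add: nn_integral_add)
  also have "\<dots> < \<infinity>" using mQ(2) m1(2) m2(2) by simp
  finally have qi: "(\<integral>\<^sup>+ s. ennreal (q s) * indicator {0..T} s \<partial>lborel) < \<infinity>" .
  \<comment> \<open>The larger of the bounds for R1 and R2, plus 1 for the control part of the cross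
    term.\<close>
  define L where "L = max K1 K2 + 1"
  have "AE s in lborel. s \<in> {0..T} \<longrightarrow> (\<forall>j x u v. \<bar>cost_rate s j x u v\<bar> \<le> q s * (norm x)\<^sup>2 + L * (norm u)\<^sup>2 + L * (norm v)\<^sup>2)"
    using K1(2) K2(2)
  proof eventually_elim
    case (elim s)
    have "\<bar>cost_rate s j x u v\<bar> \<le> q s * (norm x)\<^sup>2 + L * (norm u)\<^sup>2 + L * (norm v)\<^sup>2" if s: "s \<in> {0..T}" for j x u v
    proof -
      have "\<bar>(cQ c s j *v x) \<bullet> x\<bar> \<le> norm (cQ c s j) * norm x * norm x"
        using Cauchy_Schwarz_ineq2[of "cQ c s j *v x" x] mult_right_mono[OF norm_matrix_vector_mult_le[of "cQ c s j" x] norm_ge_zero[of x]] by linarith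
      also have "\<dots> \<le> majorant T 1 (cQ c) s * (norm x)\<^sup>2"
        using mult_right_mono[OF majorant_ge[OF s, of "cQ c" j 1], of "(norm x)\<^sup>2"] by (simp add: power2_eq_square mult.assoc)
      finally have 1: "\<bar>(cQ c s j *v x) \<bullet> x\<bar> \<le> majorant T 1 (cQ c) s * (norm x)\<^sup>2" .
      have "\<bar>(cR1 c s j *v u) \<bullet> u\<bar> \<le> norm (cR1 c s j) * norm u * norm u"
        using Cauchy_Schwarz_ineq2[of "cR1 c s j *v u" u] mult_right_mono[OF norm_matrix_vector_mult_le[of "cR1 c s j" u] norm_ge_zero[of u]] by linarith
      also have "\<dots> = norm (cR1 c s j) * (norm u)\<^sup>2" by (simp add: power2_eq_square)
      also have "\<dots> \<le> (L - 1) * (norm u)\<^sup>2" using elim s by (intro mult_right_mono) (auto simp: L_def intro: le_max_iff_disj[THEN iffD2])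
      finally have 2: "\<bar>(cR1 c s j *v u) \<bullet> u\<bar> \<le> (L - 1) * (norm u)\<^sup>2" .
      have "\<bar>(cR2 c s j *v v) \<bullet> v\<bar> \<le> norm (cR2 c s j) * norm v * norm v"
        using Cauchy_Schwarz_ineq2[of "cR2 c s j *v v" v] mult_right_mono[OF norm_matrix_vector_mult_le[of "cR2 c s j" v] norm_ge_zero[of v]] by linarith
      also have "\<dots> = norm (cR2 c s j) * (norm v)\<^sup>2" by (simp add: power2_eq_square)
      also have "\<dots> \<le> (L - 1) * (norm v)\<^sup>2" using elim s by (intro mult_right_mono) (auto simp: L_def intro: le_max_iff_disj[THEN iffD2])
      finally have 3: "\<bar>(cR2 c s j *v v) \<bullet> v\<bar> \<le> (L - 1) * (norm v)\<^sup>2" .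
      have am': "2 * \<bar>a \<bullet> b\<bar> \<le> (norm a)\<^sup>2 + (norm b)\<^sup>2" for a b :: "real^'k"
        using Cauchy_Schwarz_ineq2[of a b] sum_squares_bound[of "norm a" "norm b"] by linarith
      have am'': "2 * \<bar>a \<bullet> b\<bar> \<le> (norm a)\<^sup>2 + (norm b)\<^sup>2" for a b :: "real^'m"
        using Cauchy_Schwarz_ineq2[of a b] sum_squares_bound[of "norm a" "norm b"] by linarith
      have 4: "2 * \<bar>(cS1 c s j *v x) \<bullet> u\<bar> \<le> majorant T 2 (cS1 c) s * (norm x)\<^sup>2 + (norm u)\<^sup>2"
        using am''[of "cS1 c s j *v x" u] matrix_sq_le[OF s, of "cS1 c" j x] by linarith
      have 5: "2 * \<bar>(cS2 c s j *v x) \<bullet> v\<bar> \<le> majorant T 2 (cS2 c) s * (norm x)\<^sup>2 + (norm v)\<^sup>2"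
        using am'[of "cS2 c s j *v x" v] matrix_sq_le[OF s, of "cS2 c" j x] by linarith
      have r: "q s * (norm x)\<^sup>2 + L * (norm u)\<^sup>2 + L * (norm v)\<^sup>2 =
        majorant T 1 (cQ c) s * (norm x)\<^sup>2 + (L - 1) * (norm u)\<^sup>2 + (L - 1) * (norm v)\<^sup>2 +
        (majorant T 2 (cS1 c) s * (norm x)\<^sup>2 + (norm u)\<^sup>2) + (majorant T 2 (cS2 c) s * (norm x)\<^sup>2 + (norm v)\<^sup>2)"
        by (simp add: q_def algebra_simps)
      show ?thesis unfolding r cost_rate_def using 1 2 3 4 5 by linarith
    qed
    then show ?case by blast
  qed
  moreover have "0 \<le> L" using K1(1) by (simp add: L_def)
  ultimately show ?thesis using qm q0 qi by blast
qed

lemma running_cost_progressive: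
  assumes "progressive T \<F> x" "progressive T \<F> u" "progressive T \<F> v"
  shows "progressive T \<F> (running_cost x u v)"
proof -
  note q = progressive_inner_coefficient[where K="cQ c", OF Lp_measurable[OF coeffs(10)] assms(1) assms(1)]
    progressive_inner_coefficient[where K="cR1 c", OF Linf_measurable[OF coeffs(13)] assms(2) assms(2)]
    progressive_inner_coefficient[where K="cR2 c", OF Linf_measurable[OF coeffs(14)] assms(3) assms(3)]
    progressive_inner_coefficient[where K="cS1 c", OF Lp_measurable[OF coeffs(11)] assms(1) assms(2)]
    progressive_inner_coefficient[where K="cS2 c", OF Lp_measurable[OF coeffs(12)] assms(1) assms(3)]
  have "progressive T \<F> (\<lambda>s \<omega>. (cQ c s (\<alpha> s \<omega>) *v x s \<omega>) \<bullet> x s \<omega> + 1 * ((cR1 c s (\<alpha> s \<omega>) *v u s \<omega>) \<bullet> u s \<omega>) +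
    1 * ((cR2 c s (\<alpha> s \<omega>) *v v s \<omega>) \<bullet> v s \<omega>) + 2 * ((cS1 c s (\<alpha> s \<omega>) *v x s \<omega>) \<bullet> u s \<omega>) + 2 * ((cS2 c s (\<alpha> s \<omega>) *v x s \<omega>) \<bullet> v s \<omega>))"
    by (rule progressive_add_mult[OF progressive_add_mult[OF progressive_add_mult[OF progressive_add_mult[OF q(1) q(2)] q(3)] q(4)] q(5)])
  then show ?thesis unfolding running_cost_def[abs_def] cost_rate_def mult_1 .
qed

text \<open>q |x|^2 is the squared norm of sqrt q x, whose energy is finite because second moments
  are bounded in time and q is integrable; the remaining terms are control energies.\<close>

lemma running_cost_integrable:
  assumes x: "sde.bounded_L2 x" and u: "u \<in> L2_process M T \<F>" and v: "v \<in> L2_process M T \<F>"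
  shows "integrable (M \<Otimes>\<^sub>M lborel) (clipped T (running_cost x u v))"
proof -
  obtain q L where q: "q \<in> borel_measurable borel" "\<And>s. 0 \<le> q s"
    "(\<integral>\<^sup>+ s. ennreal (q s) * indicator {0..T} s \<partial>lborel) < \<infinity>" and L: "0 \<le> L"
    and b: "AE s in lborel. s \<in> {0..T} \<longrightarrow> (\<forall>j x u v. \<bar>cost_rate s j x u v\<bar> \<le> q s * (norm x)\<^sup>2 + L * (norm u)\<^sup>2 + L * (norm v)\<^sup>2)"
    using cost_rate_bound by blast
  obtain K where K: "\<And>t. t \<in> {0..T} \<Longrightarrow> nn_sq M (x t) \<le> ennreal K" using x unfolding sde.bounded_L2_def by blast
  have p: "progressive T \<F> x" "progressive T \<F> u" "progressive T \<F> v" using x u v by (auto simp: sde.bounded_L2_def L2_process_def)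
  note cx = progressive_clipped[OF p(1) sde.T_mem(1)]
  let ?y = "\<lambda>s \<omega>. sqrt (q s) *\<^sub>R x s \<omega>"
  note [measurable] = progressive_clipped[OF p(2) sde.T_mem(1)] progressive_clipped[OF p(3) sde.T_mem(1)]
    progressive_clipped[OF running_cost_progressive[OF p] sde.T_mem(1)] nn_energy_sqrt_weight(1)[OF q(1,2) cx]
  have y: "nn_energy M T ?y < \<infinity>"
    unfolding nn_energy_sqrt_weight(2)[OF q(1,2) cx] by (rule sde.weighted_integral_finite(2)[OF q(1,3) K])
  show ?thesis
  proof (rule integrableI_bounded)
    have "(\<integral>\<^sup>+ p. ennreal (norm (clipped T (running_cost x u v) p)) \<partial>(M \<Otimes>\<^sub>M lborel)) =
      (\<integral>\<^sup>+ \<omega>. \<integral>\<^sup>+ s. ennreal (norm (clipped T (running_cost x u v) (\<omega>, s))) \<partial>lborel \<partial>M)"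
      by (rule lborel.nn_integral_fst[symmetric]) measurable
    also have "\<dots> \<le> (\<integral>\<^sup>+ \<omega>. \<integral>\<^sup>+ s. ennreal ((norm (clipped T ?y (\<omega>, s)))\<^sup>2) + ennreal L * ennreal ((norm (clipped T u (\<omega>, s)))\<^sup>2) +
      ennreal L * ennreal ((norm (clipped T v (\<omega>, s)))\<^sup>2) \<partial>lborel \<partial>M)"
    proof (rule nn_integral_mono, rule nn_integral_mono_AE)
      fix \<omega>
      show "AE s in lborel. ennreal (norm (clipped T (running_cost x u v) (\<omega>, s))) \<le> ennreal ((norm (clipped T ?y (\<omega>, s)))\<^sup>2) +
        ennreal L * ennreal ((norm (clipped T u (\<omega>, s)))\<^sup>2) + ennreal L * ennreal ((norm (clipped T v (\<omega>, s)))\<^sup>2)"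
        using b
      proof eventually_elim
        case (elim s)
        have "norm (clipped T (running_cost x u v) (\<omega>, s)) \<le> (norm (clipped T ?y (\<omega>, s)))\<^sup>2 + L * (norm (clipped T u (\<omega>, s)))\<^sup>2 + L * (norm (clipped T v (\<omega>, s)))\<^sup>2"
        proof (cases "s \<in> {0..T}")
          case True
          then have "\<bar>running_cost x u v s \<omega>\<bar> \<le> q s * (norm (x s \<omega>))\<^sup>2 + L * (norm (u s \<omega>))\<^sup>2 + L * (norm (v s \<omega>))\<^sup>2"
            using elim unfolding running_cost_def by blast
          then show ?thesis using True q(2)[of s] by (simp add: clipped_def power_mult_distrib)
        qed (simp add: clipped_def)
        from ennreal_leI[OF this] show ?case using L by (simp add: ennreal_plus ennreal_mult)
      qed
    qed
    also have "\<dots> = (\<integral>\<^sup>+ p. ennreal ((norm (clipped T ?y p))\<^sup>2) + ennreal L * ennreal ((norm (clipped T u p))\<^sup>2) +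
      ennreal L * ennreal ((norm (clipped T v p))\<^sup>2) \<partial>(M \<Otimes>\<^sub>M lborel))"
      by (rule lborel.nn_integral_fst) measurable
    also have "\<dots> = nn_sq (M \<Otimes>\<^sub>M lborel) (clipped T ?y) + ennreal L * nn_sq (M \<Otimes>\<^sub>M lborel) (clipped T u) + ennreal L * nn_sq (M \<Otimes>\<^sub>M lborel) (clipped T v)"
      by (simp add: nn_integral_add nn_integral_cmult)
    also have "\<dots> = nn_energy M T ?y + ennreal L * nn_energy M T u + ennreal L * nn_energy M T v"
      by (subst (1 2 3) nn_energy_clipped) auto
    also have "\<dots> < \<infinity>" using y u v by (simp add: L2_process_def ennreal_mult_less_top)
    finally show "(\<integral>\<^sup>+ p. ennreal (norm (clipped T (running_cost x u v) p)) \<partial>(M \<Otimes>\<^sub>M lborel)) < \<infinity>" .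
  qed measurable
qed

lemma terminal_cost_integrable:
  assumes x: "sde.bounded_L2 x"
  shows "integrable M (terminal_cost x)"
proof -
  obtain K where K: "0 \<le> K" "\<And>t. t \<in> {0..T} \<Longrightarrow> nn_sq M (x t) \<le> ennreal K" using x unfolding sde.bounded_L2_def by blast
  have xT[measurable]: "x T \<in> borel_measurable M" using x sde.progressive_M[OF _ sde.T_mem(1)] by (simp add: sde.bounded_L2_def)
  have "nn_sq M (x T) < \<infinity>" using K(2)[OF sde.T_mem(1)] by (rule le_less_trans) simp
  then have "integrable M (\<lambda>\<omega>. (norm (x T \<omega>))\<^sup>2)" by (rule integrable_of_nn_sq(2)[OF xT])
  then have i: "integrable M (\<lambda>\<omega>. (\<Sum>j\<in>UNIV. norm (cG c j)) * (norm (x T \<omega>))\<^sup>2)" by simp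
  have G: "(\<lambda>\<omega>. cG c (\<alpha> T \<omega>)) \<in> borel_measurable M"
    using T_pos by (intro measurable_compose[OF \<alpha>_measurable]) auto
  have "(\<lambda>\<omega>. cG c (\<alpha> T \<omega>) *v x T \<omega>) \<in> borel_measurable M"
    by (rule borel_measurable_continuous_Pair[OF G xT continuous_on_matrix_vector_mult])
  then have m: "terminal_cost x \<in> borel_measurable M" unfolding terminal_cost_def[abs_def] by measurable
  show ?thesis
  proof (rule Bochner_Integration.integrable_bound[OF i m], rule AE_I2)
    fix \<omega>
    have "\<bar>terminal_cost x \<omega>\<bar> \<le> norm (cG c (\<alpha> T \<omega>)) * (norm (x T \<omega>))\<^sup>2"
      using Cauchy_Schwarz_ineq2[of "cG c (\<alpha> T \<omega>) *v x T \<omega>" "x T \<omega>"]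
        mult_right_mono[OF norm_matrix_vector_mult_le[of "cG c (\<alpha> T \<omega>)" "x T \<omega>"] norm_ge_zero[of "x T \<omega>"]]
      by (simp add: terminal_cost_def power2_eq_square)
    also have "\<dots> \<le> (\<Sum>j\<in>UNIV. norm (cG c j)) * (norm (x T \<omega>))\<^sup>2"
      by (intro mult_right_mono member_le_sum) auto
    finally show "norm (terminal_cost x \<omega>) \<le> norm ((\<Sum>j\<in>UNIV. norm (cG c j)) * (norm (x T \<omega>))\<^sup>2)" by simp
  qed
qed

lemma running_cost_path_integrable:
  assumes "sde.bounded_L2 x" "u \<in> L2_process M T \<F>" "v \<in> L2_process M T \<F>"
  shows "AE \<omega> in M. set_integrable lborel {0..T} (\<lambda>s. running_cost x u v s \<omega>)"
proof -
  interpret P: pair_sigma_finite M "lborel :: real measure" ..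
  show ?thesis
    using P.AE_integrable_fst'[OF running_cost_integrable[OF assms]] by (simp add: set_integrable_def clipped_def)
qed

lemma path_cost_integrable:
  assumes "sde.bounded_L2 x" "u \<in> L2_process M T \<F>" "v \<in> L2_process M T \<F>"
  shows "integrable M (path_cost x u v)"
proof -
  interpret P: pair_sigma_finite M "lborel :: real measure" ..
  have "integrable M (\<lambda>\<omega>. LINT s:{0..T}|lborel. running_cost x u v s \<omega>)"
    using P.integrable_fst'[OF running_cost_integrable[OF assms]] by (simp add: set_lebesgue_integral_def clipped_def)
  then show ?thesis
    unfolding path_cost_def[abs_def] by (intro Bochner_Integration.integrable_add terminal_cost_integrable[OF assms(1)])
qed

text \<open>Valid for every \<omega>, since the exceptional times of \<open>cost_rate_nonneg\<close>
  do not depend on it.\<close>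

lemma path_cost_nonneg: "0 \<le> path_cost x u v \<omega>"
proof -
  have "AE s in lborel. 0 \<le> indicator {0..T} s *\<^sub>R running_cost x u v s \<omega>"
    using cost_rate_nonneg by eventually_elim (auto simp: indicator_def running_cost_def)
  then have "0 \<le> (LINT s:{0..T}|lborel. running_cost x u v s \<omega>)"
    unfolding set_lebesgue_integral_def by (rule integral_nonneg_AE)
  moreover have "0 \<le> terminal_cost x \<omega>"
    using nonneg by (simp add: nonneg_cost_coeffs_def ge_scalar_def terminal_cost_def inner_commute)
  ultimately show ?thesis by (simp add: path_cost_def)
qed

lemma J0_nonneg: "0 \<le> J0 M T W Wb \<alpha> c u v"
  unfolding J0_eq by (intro integral_nonneg_AE AE_I2 path_cost_nonneg)

lemma path_cost_cong:
  "\<forall>t\<in>{0..T}. x t \<omega> = y t \<omega> \<Longrightarrow> path_cost x u v \<omega> = path_cost y u v \<omega>"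
  using T_pos by (auto simp: path_cost_def terminal_cost_def running_cost_def intro!: set_lebesgue_integral_cong)

text \<open>The state of the combined controls is indistinguishable from the combined states on
  [0, T], and \<open>path_cost\<close> sees only the values there.\<close>

lemma J0_lincomb:
  assumes u: "u \<in> L2_process M T \<F>" "v \<in> L2_process M T \<F>" and u': "u' \<in> L2_process M T \<F>" "v' \<in> L2_process M T \<F>"
  shows "integrable M (path_cost (\<lambda>s \<omega>. p *\<^sub>R state M T W Wb \<alpha> c u v s \<omega> + q *\<^sub>R state M T W Wb \<alpha> c u' v' s \<omega>)
      (\<lambda>s \<omega>. p *\<^sub>R u s \<omega> + q *\<^sub>R u' s \<omega>) (\<lambda>s \<omega>. p *\<^sub>R v s \<omega> + q *\<^sub>R v' s \<omega>))"
    and "J0 M T W Wb \<alpha> c (\<lambda>s \<omega>. p *\<^sub>R u s \<omega> + q *\<^sub>R u' s \<omega>) (\<lambda>s \<omega>. p *\<^sub>R v s \<omega> + q *\<^sub>R v' s \<omega>) =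
      (LINT \<omega>|M. path_cost (\<lambda>s \<omega>. p *\<^sub>R state M T W Wb \<alpha> c u v s \<omega> + q *\<^sub>R state M T W Wb \<alpha> c u' v' s \<omega>)
        (\<lambda>s \<omega>. p *\<^sub>R u s \<omega> + q *\<^sub>R u' s \<omega>) (\<lambda>s \<omega>. p *\<^sub>R v s \<omega> + q *\<^sub>R v' s \<omega>) \<omega>)"
proof -
  let ?z = "\<lambda>s \<omega>. p *\<^sub>R state M T W Wb \<alpha> c u v s \<omega> + q *\<^sub>R state M T W Wb \<alpha> c u' v' s \<omega>"
  let ?u = "\<lambda>s \<omega>. p *\<^sub>R u s \<omega> + q *\<^sub>R u' s \<omega>" and ?v = "\<lambda>s \<omega>. p *\<^sub>R v s \<omega> + q *\<^sub>R v' s \<omega>"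
  note l = L2_process_lincomb[OF u(1) u'(1) T_pos, of p q] L2_process_lincomb[OF u(2) u'(2) T_pos, of p q]
  note b = state_solution_bounded[OF state_solves[OF u]] state_solution_bounded[OF state_solves[OF u']]
    state_solution_bounded[OF state_solves[OF l]]
  show i: "integrable M (path_cost ?z ?u ?v)" by (rule path_cost_integrable[OF bounded_L2_lincomb[OF b(1,2)] l])
  show "J0 M T W Wb \<alpha> c ?u ?v = (LINT \<omega>|M. path_cost ?z ?u ?v \<omega>)"
    unfolding J0_eq
  proof (rule integral_cong_AE)
    show "AE \<omega> in M. path_cost (state M T W Wb \<alpha> c ?u ?v) ?u ?v \<omega> = path_cost ?z ?u ?v \<omega>"
      using state_lincomb[OF u u', of p q] by eventually_elim (rule path_cost_cong)
  qed (use i path_cost_integrable[OF b(3) l] in \<open>auto intro: borel_measurable_integrable\<close>)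
qed

lemma J0_scale:
  assumes u: "u \<in> L2_process M T \<F>" "v \<in> L2_process M T \<F>"
  shows "J0 M T W Wb \<alpha> c (\<lambda>s \<omega>. r *\<^sub>R u s \<omega>) (\<lambda>s \<omega>. r *\<^sub>R v s \<omega>) = r\<^sup>2 * J0 M T W Wb \<alpha> c u v"
proof -
  let ?x = "state M T W Wb \<alpha> c u v"
  have "path_cost (\<lambda>s \<omega>. r *\<^sub>R ?x s \<omega>) (\<lambda>s \<omega>. r *\<^sub>R u s \<omega>) (\<lambda>s \<omega>. r *\<^sub>R v s \<omega>) \<omega> = r\<^sup>2 * path_cost ?x u v \<omega>" for \<omega>
    by (simp add: path_cost_def terminal_cost_def running_cost_def cost_rate_scale matrix_vector_mult_scaleR
        power2_eq_square algebra_simps)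
  then show ?thesis using J0_lincomb(2)[OF u u, of r 0] by (simp add: J0_eq[of u v])
qed

text \<open>The law holds pointwise for \<open>cost_rate\<close>; to integrate it, all four running
  costs have to be integrable in time, which is true along almost every path.\<close>

lemma J0_parallelogram:
  assumes u: "u \<in> L2_process M T \<F>" "v \<in> L2_process M T \<F>" and u': "u' \<in> L2_process M T \<F>" "v' \<in> L2_process M T \<F>"
  shows "J0 M T W Wb \<alpha> c (\<lambda>s \<omega>. u s \<omega> + u' s \<omega>) (\<lambda>s \<omega>. v s \<omega> + v' s \<omega>) +
      J0 M T W Wb \<alpha> c (\<lambda>s \<omega>. u s \<omega> - u' s \<omega>) (\<lambda>s \<omega>. v s \<omega> - v' s \<omega>) =
    2 * J0 M T W Wb \<alpha> c u v + 2 * J0 M T W Wb \<alpha> c u' v'"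
proof -
  let ?x = "state M T W Wb \<alpha> c u v" and ?x' = "state M T W Wb \<alpha> c u' v'"
  let ?p = "path_cost (\<lambda>s \<omega>. ?x s \<omega> + ?x' s \<omega>) (\<lambda>s \<omega>. u s \<omega> + u' s \<omega>) (\<lambda>s \<omega>. v s \<omega> + v' s \<omega>)"
  let ?m = "path_cost (\<lambda>s \<omega>. ?x s \<omega> - ?x' s \<omega>) (\<lambda>s \<omega>. u s \<omega> - u' s \<omega>) (\<lambda>s \<omega>. v s \<omega> - v' s \<omega>)"
  note b = state_solution_bounded[OF state_solves[OF u]] state_solution_bounded[OF state_solves[OF u']]
  note p = J0_lincomb[OF u u', of 1 1, simplified] and m = J0_lincomb[OF u u', of 1 "-1", simplified]
  note bp = bounded_L2_lincomb[OF b, of 1 1, simplified] bounded_L2_lincomb[OF b, of 1 "-1", simplified]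
  note l = L2_process_lincomb[OF u(1) u'(1) T_pos, of 1 1, simplified] L2_process_lincomb[OF u(2) u'(2) T_pos, of 1 1, simplified]
    L2_process_lincomb[OF u(1) u'(1) T_pos, of 1 "-1", simplified] L2_process_lincomb[OF u(2) u'(2) T_pos, of 1 "-1", simplified]
  note i = path_cost_integrable[OF b(1) u] path_cost_integrable[OF b(2) u']
  have "AE \<omega> in M. ?p \<omega> + ?m \<omega> = 2 * path_cost ?x u v \<omega> + 2 * path_cost ?x' u' v' \<omega>"
    using running_cost_path_integrable[OF b(1) u] running_cost_path_integrable[OF b(2) u']
      running_cost_path_integrable[OF bp(1) l(1,2)] running_cost_path_integrable[OF bp(2) l(3,4)]
  proof eventually_elim
    case (elim \<omega>)
    have "(LINT s:{0..T}|lborel. running_cost (\<lambda>s \<omega>. ?x s \<omega> + ?x' s \<omega>) (\<lambda>s \<omega>. u s \<omega> + u' s \<omega>) (\<lambda>s \<omega>. v s \<omega> + v' s \<omega>) s \<omega>) +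
      (LINT s:{0..T}|lborel. running_cost (\<lambda>s \<omega>. ?x s \<omega> - ?x' s \<omega>) (\<lambda>s \<omega>. u s \<omega> - u' s \<omega>) (\<lambda>s \<omega>. v s \<omega> - v' s \<omega>) s \<omega>) =
      (LINT s:{0..T}|lborel. 2 * running_cost ?x u v s \<omega> + 2 * running_cost ?x' u' v' s \<omega>)"
      by (subst set_integral_add(2)[OF elim(3,4), symmetric]) (simp add: running_cost_def cost_rate_parallelogram)
    also have "\<dots> = 2 * (LINT s:{0..T}|lborel. running_cost ?x u v s \<omega>) + 2 * (LINT s:{0..T}|lborel. running_cost ?x' u' v' s \<omega>)"
      using elim(1,2) by (subst set_integral_add(2)) auto
    finally show ?case
      by (simp add: path_cost_def terminal_cost_def matrix_vector_right_distrib matrix_vector_mult_diff_distrib inner_add_left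
        inner_add_right inner_diff_left inner_diff_right)
  qed
  then have "(LINT \<omega>|M. ?p \<omega> + ?m \<omega>) = (LINT \<omega>|M. 2 * path_cost ?x u v \<omega> + 2 * path_cost ?x' u' v' \<omega>)"
    using p(1) m(1) i by (intro integral_cong_AE) (auto intro!: borel_measurable_integrable)
  then show ?thesis using p m i by (simp add: J0_eq[of u v] J0_eq[of u' v'])
qed

text \<open>Turns the iterated integral in \<open>energy\<close> into one over the product space,
  where additivity follows from a single integrability fact per process.\<close>

lemma L2_norm_sq_integrable:
  fixes v :: "real \<Rightarrow> 'w \<Rightarrow> 'a::euclidean_space"
  assumes v: "v \<in> L2_process M T \<F>"
  shows "integrable (M \<Otimes>\<^sub>M lborel) (\<lambda>p. (norm (clipped T v p))\<^sup>2)"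
    and "energy M T v = (LINT p|(M \<Otimes>\<^sub>M lborel). (norm (clipped T v p))\<^sup>2)"
proof -
  interpret P: pair_sigma_finite M "lborel :: real measure" ..
  note [measurable] = L2_process_clipped[OF v sde.T_mem(1)]
  have "nn_sq (M \<Otimes>\<^sub>M lborel) (clipped T v) < \<infinity>"
    using v nn_energy_clipped[OF L2_process_clipped[OF v sde.T_mem(1)]] by (simp add: L2_process_def)
  then show i: "integrable (M \<Otimes>\<^sub>M lborel) (\<lambda>p. (norm (clipped T v p))\<^sup>2)"
    by (intro integrableI_bounded) auto
  have "(norm (clipped T v (\<omega>, s)))\<^sup>2 = indicator {0..T} s *\<^sub>R (norm (v s \<omega>))\<^sup>2" for \<omega> s
    by (auto simp: clipped_def indicator_def)
  then show "energy M T v = (LINT p|(M \<Otimes>\<^sub>M lborel). (norm (clipped T v p))\<^sup>2)"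
    using P.integral_fst'[OF i] by (simp add: energy_def set_lebesgue_integral_def)
qed

lemma energy_scale:
  fixes v :: "real \<Rightarrow> 'w \<Rightarrow> 'a::euclidean_space"
  shows "energy M T (\<lambda>s \<omega>. r *\<^sub>R v s \<omega>) = r\<^sup>2 * energy M T v"
  by (simp add: energy_def power_mult_distrib)

lemma energy_parallelogram:
  fixes v w :: "real \<Rightarrow> 'w \<Rightarrow> 'a::euclidean_space"
  assumes v: "v \<in> L2_process M T \<F>" and w: "w \<in> L2_process M T \<F>"
  shows "energy M T (\<lambda>s \<omega>. v s \<omega> + w s \<omega>) + energy M T (\<lambda>s \<omega>. v s \<omega> - w s \<omega>) = 2 * energy M T v + 2 * energy M T w"
proof -
  have l: "(\<lambda>s \<omega>. v s \<omega> + w s \<omega>) \<in> L2_process M T \<F>" "(\<lambda>s \<omega>. v s \<omega> - w s \<omega>) \<in> L2_process M T \<F>"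
    using L2_process_lincomb[OF v w T_pos, of 1 1] L2_process_lincomb[OF v w T_pos, of 1 "-1"] by simp_all
  note i = L2_norm_sq_integrable(1)[OF v] L2_norm_sq_integrable(1)[OF w] L2_norm_sq_integrable(1)[OF l(1)] L2_norm_sq_integrable(1)[OF l(2)]
  have "energy M T (\<lambda>s \<omega>. v s \<omega> + w s \<omega>) + energy M T (\<lambda>s \<omega>. v s \<omega> - w s \<omega>) =
    (LINT p|(M \<Otimes>\<^sub>M lborel). (norm (clipped T v p + clipped T w p))\<^sup>2 + (norm (clipped T v p - clipped T w p))\<^sup>2)"
    using i(3,4) by (simp add: L2_norm_sq_integrable(2)[OF l(1)] L2_norm_sq_integrable(2)[OF l(2)] clipped_add clipped_diff)
  also have "\<dots> = (LINT p|(M \<Otimes>\<^sub>M lborel). 2 * (norm (clipped T v p))\<^sup>2 + 2 * (norm (clipped T w p))\<^sup>2)"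
    by (simp add: power2_norm_eq_inner inner_add_left inner_add_right inner_diff_left inner_diff_right inner_commute)
  also have "\<dots> = 2 * energy M T v + 2 * energy M T w"
    using i(1,2) by (simp add: L2_norm_sq_integrable(2)[OF v] L2_norm_sq_integrable(2)[OF w])
  finally show ?thesis .
qed

lemma energy_nonneg: "0 \<le> energy M T v"
  unfolding energy_def set_lebesgue_integral_def by (intro integral_nonneg_AE AE_I2) auto

lemma const_L2_process: "(\<lambda>s \<omega>. a :: 'a::euclidean_space) \<in> L2_process M T H"
  and energy_const: "energy M T (\<lambda>s \<omega>. a) = T * (norm a)\<^sup>2"
proof -
  have "nn_energy M T (\<lambda>s \<omega>. a) = ennreal ((norm a)\<^sup>2) * ennreal T"
    using T_pos by (simp add: nn_energy_def nn_integral_cmult_indicator emeasure_space_1)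
  then show "(\<lambda>s \<omega>. a) \<in> L2_process M T H"
    by (simp add: L2_process_def progressive_def ennreal_mult_less_top)
  show "energy M T (\<lambda>s \<omega>. a) = T * (norm a)\<^sup>2"
    using T_pos by (simp add: energy_def set_lebesgue_integral_def prob_space)
qed

section \<open>Controls adapted to the smaller filtration\<close>

lemma L2_process_mono:
  assumes s: "\<And>t. t \<in> {0..T} \<Longrightarrow> sets (G t) \<subseteq> sets (H t)" "\<And>t. space (G t) = space (H t)"
    and u: "u \<in> L2_process M T G"
  shows "u \<in> L2_process M T H"
proof -
  have "progressive T H u"
    unfolding progressive_def
  proof
    fix t assume t: "t \<in> {0..T}"
    have "(\<lambda>x. x) \<in> measurable (H t) (G t)" using s t by (auto simp: measurable_def)
    then have i: "(\<lambda>p. (fst p, snd p)) \<in> measurable (restrict_space borel {0..t} \<Otimes>\<^sub>M H t) (restrict_space borel {0..t} \<Otimes>\<^sub>M G t)"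
      by (intro measurable_Pair measurable_fst measurable_compose[OF measurable_snd])
    have "(\<lambda>(s, \<omega>). u s \<omega>) \<in> borel_measurable (restrict_space borel {0..t} \<Otimes>\<^sub>M G t)"
      using u t by (simp add: L2_process_def progressive_def)
    from measurable_compose[OF i this]
    show "(\<lambda>(s, \<omega>). u s \<omega>) \<in> borel_measurable (restrict_space borel {0..t} \<Otimes>\<^sub>M H t)"
      by (simp add: split_beta')
  qed
  then show ?thesis using u by (simp add: L2_process_def)
qed

lemma filt_G_subset:
  fixes u :: "real \<Rightarrow> 'w \<Rightarrow> 'a::euclidean_space"
  assumes "u \<in> L2_process M T (filt_G M W \<alpha>)"
  shows "u \<in> L2_process M T \<F>"
proof (rule L2_process_mono[OF _ _ assms])
  have sub: "process_events M borel W {0..t} \<union> process_events M (count_space UNIV) \<alpha> {0..t} \<union> null_sets M \<subseteq> Pow (space M)"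
    "process_events M borel W {0..t} \<union> process_events M borel Wb {0..t} \<union> process_events M (count_space UNIV) \<alpha> {0..t} \<union> null_sets M \<subseteq> Pow (space M)" for t
    by (intro Un_least process_events_space null_sets_space)+
  show "sets (filt_G M W \<alpha> t) \<subseteq> sets (\<F> t)" for t
    unfolding filt_G_def filt_F_def sets_measure_of[OF sub(1)] sets_measure_of[OF sub(2)] by (rule sigma_sets_mono') auto
  show "space (filt_G M W \<alpha> t) = space (\<F> t)" for t unfolding space_F by (simp add: filt_G_def space_measure_of[OF sub(1)])
qed

text \<open>The rescaled control has to be an admissible competitor in the upper value, hence
  adapted to the smaller filtration.\<close>

lemma filt_G_scale:
  fixes u :: "real \<Rightarrow> 'w \<Rightarrow> 'a::euclidean_space"
  assumes u: "u \<in> L2_process M T (filt_G M W \<alpha>)"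
  shows "(\<lambda>s \<omega>. r *\<^sub>R u s \<omega>) \<in> L2_process M T (filt_G M W \<alpha>)"
proof -
  have "nn_energy M T (\<lambda>s \<omega>. r *\<^sub>R u s \<omega>) < \<infinity>"
    using L2_process_lincomb[OF filt_G_subset[OF u] filt_G_subset[OF u] T_pos, of r 0] by (simp add: L2_process_def)
  moreover have "progressive T (filt_G M W \<alpha>) (\<lambda>s \<omega>. r *\<^sub>R u s \<omega>)"
    unfolding progressive_def
  proof
    fix t assume "t \<in> {0..T}"
    then have "(\<lambda>(s, \<omega>). u s \<omega>) \<in> borel_measurable (restrict_space borel {0..t} \<Otimes>\<^sub>M filt_G M W \<alpha> t)"
      using u by (simp add: L2_process_def progressive_def)
    from borel_measurable_scaleR[OF borel_measurable_const[of r] this]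
    show "(\<lambda>(s, \<omega>). r *\<^sub>R u s \<omega>) \<in> borel_measurable (restrict_space borel {0..t} \<Otimes>\<^sub>M filt_G M W \<alpha> t)"
      by (simp add: split_beta')
  qed
  ultimately show ?thesis by (simp add: L2_process_def)
qed

section \<open>The values\<close>

abbreviation J where "J \<equiv> J0 M T W Wb \<alpha> c"

abbreviation \<U> :: "(real \<Rightarrow> 'w \<Rightarrow> real^'m) set" where "\<U> \<equiv> L2_process M T (filt_G M W \<alpha>)"

abbreviation \<V> :: "(real \<Rightarrow> 'w \<Rightarrow> real^'k) set" where "\<V> \<equiv> L2_process M T \<F>"

lemma zero_L2_process: "(\<lambda>s \<omega>. 0 :: 'a::euclidean_space) \<in> L2_process M T H"
  by (rule const_L2_process)

lemma L2_process_plus_minus: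
  fixes v w :: "real \<Rightarrow> 'w \<Rightarrow> 'a::euclidean_space"
  assumes "v \<in> L2_process M T \<F>" "w \<in> L2_process M T \<F>"
  shows "(\<lambda>s \<omega>. v s \<omega> + w s \<omega>) \<in> L2_process M T \<F>" "(\<lambda>s \<omega>. v s \<omega> - w s \<omega>) \<in> L2_process M T \<F>"
    "(\<lambda>s \<omega>. r *\<^sub>R v s \<omega>) \<in> L2_process M T \<F>"
  using L2_process_lincomb[OF assms T_pos, of 1 1] L2_process_lincomb[OF assms T_pos, of 1 "-1"]
    L2_process_lincomb[OF assms T_pos, of r 0] by simp_all

lemma energy_diff_le:
  fixes v w :: "real \<Rightarrow> 'w \<Rightarrow> 'a::euclidean_space"
  assumes "v \<in> L2_process M T \<F>" "w \<in> L2_process M T \<F>"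
  shows "energy M T (\<lambda>s \<omega>. v s \<omega> - w s \<omega>) \<le> 2 * energy M T v + 2 * energy M T w"
  using energy_parallelogram[OF assms] energy_nonneg[of "\<lambda>s \<omega>. v s \<omega> + w s \<omega>"] by linarith

text \<open>The parallelogram law at (u, v) and (0, w): both terms on the left keep the same control
  u.\<close>

lemma J0_split:
  assumes u: "u \<in> L2_process M T \<F>" and v: "v \<in> \<V>" and w: "w \<in> \<V>"
  shows "J u (\<lambda>s \<omega>. v s \<omega> + w s \<omega>) + J u (\<lambda>s \<omega>. v s \<omega> - w s \<omega>) = 2 * J u v + 2 * J (\<lambda>s \<omega>. 0) w"
  using J0_parallelogram[OF u v zero_L2_process w] by simp

text \<open>For \<open>v\<close> of zero norm the bound comes from \<open>v \<plusminus> e\<close> with \<open>e \<noteq> 0\<close>.\<close>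

lemma J0_le_of_ratio:
  assumes u: "u \<in> L2_process M T \<F>" and e: "e \<in> \<V>" "energy M T e \<noteq> 0" and v: "v \<in> \<V>"
    and b: "\<And>v. v \<in> \<V> \<Longrightarrow> energy M T v \<noteq> 0 \<Longrightarrow> J u v \<le> g\<^sup>2 * energy M T v"
  shows "J u v \<le> g\<^sup>2 * energy M T v + g\<^sup>2 * energy M T e"
proof (cases "energy M T v = 0")
  case True
  let ?p = "\<lambda>s \<omega>. v s \<omega> + e s \<omega>" and ?m = "\<lambda>s \<omega>. v s \<omega> - e s \<omega>"
  note pm = L2_process_plus_minus(1,2)[OF v e(1)]
  have e0: "0 < energy M T e" using e(2) energy_nonneg[of e] by linarith
  \<comment> \<open>e = (v + e) - v, so v + e has nonzero energy when v has none; the same holds for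
    v - e.\<close>
  have "energy M T e \<le> 2 * energy M T ?p" using energy_diff_le[OF pm(1) v] True by simp
  then have 1: "J u ?p \<le> g\<^sup>2 * energy M T ?p" using e0 by (intro b pm) auto
  have "energy M T e \<le> 2 * energy M T ?m" using energy_diff_le[OF v pm(2)] True by simp
  then have 2: "J u ?m \<le> g\<^sup>2 * energy M T ?m" using e0 by (intro b pm) auto
  have "2 * J u v \<le> J u ?p + J u ?m" using J0_split[OF u v e(1)] J0_nonneg[of "\<lambda>s \<omega>. 0" e] by linarith
  also have "\<dots> \<le> g\<^sup>2 * (energy M T ?p + energy M T ?m)" using 1 2 by (simp add: distrib_left)
  also have "\<dots> = 2 * (g\<^sup>2 * energy M T v + g\<^sup>2 * energy M T e)"
    unfolding energy_parallelogram[OF v e(1)] by (simp add: algebra_simps)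
  finally show ?thesis by simp
next
  case False
  then show ?thesis using b[OF v False] energy_nonneg[of e] by (simp add: add_increasing2)
qed

lemma J0_gamma_scale:
  assumes "u \<in> L2_process M T \<F>" "v \<in> \<V>"
  shows "J0_gamma M T W Wb \<alpha> c \<gamma> (\<lambda>s \<omega>. r *\<^sub>R u s \<omega>) (\<lambda>s \<omega>. r *\<^sub>R v s \<omega>) = r\<^sup>2 * J0_gamma M T W Wb \<alpha> c \<gamma> u v"
  by (simp add: J0_gamma_def J0_scale[OF assms] energy_scale algebra_simps)

lemma ratio_le_iff:
  assumes "energy M T v \<noteq> 0" "0 < g"
  shows "sqrt (J u v) / sqrt (energy M T v) \<le> g \<longleftrightarrow> J u v \<le> g\<^sup>2 * energy M T v"
proof -
  have e: "0 < energy M T v" using assms(1) energy_nonneg[of v] by linarith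
  then have "sqrt (J u v) / sqrt (energy M T v) \<le> g \<longleftrightarrow> sqrt (J u v) \<le> sqrt (g\<^sup>2 * energy M T v)"
    using assms(2) by (simp add: divide_le_eq real_sqrt_mult)
  then show ?thesis by simp
qed

text \<open>The choice v = 0 already gives J(u, 0) \<ge> 0 for every u.\<close>

lemma upper_value_nonneg: "0 \<le> upper_value M T W Wb \<alpha> c \<gamma>"
  unfolding upper_value_def
proof (rule INF_greatest)
  fix u :: "real \<Rightarrow> 'w \<Rightarrow> real^'m" assume "u \<in> \<U>"
  have "0 \<le> ereal (J0_gamma M T W Wb \<alpha> c \<gamma> u (\<lambda>s \<omega>. 0))"
    using J0_nonneg energy_const[of "0 :: real^'k"] by (simp add: J0_gamma_def)
  also have "\<dots> \<le> (SUP v\<in>\<V>. ereal (J0_gamma M T W Wb \<alpha> c \<gamma> u v))"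
    by (rule SUP_upper[OF zero_L2_process])
  finally show "0 \<le> (SUP v\<in>\<V>. ereal (J0_gamma M T W Wb \<alpha> c \<gamma> u v))" .
qed

text \<open>By homogeneity, replacing u by r u multiplies the supremum over v by r^2, so any finite
  bound K can be made arbitrarily small.\<close>

lemma upper_value_zero:
  assumes u: "u \<in> \<U>" and b: "\<And>v. v \<in> \<V> \<Longrightarrow> J0_gamma M T W Wb \<alpha> c \<gamma> u v \<le> K"
  shows "upper_value M T W Wb \<alpha> c \<gamma> = 0"
proof (rule order.antisym[OF _ upper_value_nonneg], rule ereal_le_epsilon2)
  fix d :: real assume d: "0 < d"
  \<comment> \<open>Chosen so that r^2 (|K| + 1) = d; the added 1 covers K = 0.\<close>
  define r where "r = sqrt (d / (\<bar>K\<bar> + 1))"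
  have r: "0 < r" and r2: "r\<^sup>2 = d / (\<bar>K\<bar> + 1)" using d by (simp_all add: r_def)
  have rK: "r\<^sup>2 * K \<le> d"
  proof -
    have "r\<^sup>2 * K \<le> r\<^sup>2 * (\<bar>K\<bar> + 1)" by (intro mult_left_mono) auto
    also have "\<dots> = d" unfolding r2 by simp
    finally show ?thesis .
  qed
  have "upper_value M T W Wb \<alpha> c \<gamma> \<le> (SUP v\<in>\<V>. ereal (J0_gamma M T W Wb \<alpha> c \<gamma> (\<lambda>s \<omega>. r *\<^sub>R u s \<omega>) v))"
    unfolding upper_value_def by (rule INF_lower[OF filt_G_scale[OF u]])
  also have "\<dots> \<le> ereal d"
  proof (rule SUP_least)
    fix v assume v: "v \<in> \<V>"
    \<comment> \<open>v is written as r times v / r, so that the scaling acts on both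
      arguments.\<close>
    then have v': "(\<lambda>s \<omega>. (1 / r) *\<^sub>R v s \<omega>) \<in> \<V>" by (rule L2_process_plus_minus(3)[OF _ v])
    have "J0_gamma M T W Wb \<alpha> c \<gamma> (\<lambda>s \<omega>. r *\<^sub>R u s \<omega>) v = r\<^sup>2 * J0_gamma M T W Wb \<alpha> c \<gamma> u (\<lambda>s \<omega>. (1 / r) *\<^sub>R v s \<omega>)"
      using J0_gamma_scale[OF filt_G_subset[OF u] v', of \<gamma> r] r by simp
    also have "\<dots> \<le> r\<^sup>2 * K" by (intro mult_left_mono b v') auto
    also have "\<dots> \<le> d" by (rule rK)
    finally show "ereal (J0_gamma M T W Wb \<alpha> c \<gamma> (\<lambda>s \<omega>. r *\<^sub>R u s \<omega>) v) \<le> ereal d" by simp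
  qed
  finally show "upper_value M T W Wb \<alpha> c \<gamma> \<le> 0 + ereal d" by simp
qed

lemma exists_nonzero_disturbance: "\<exists>e\<in>\<V>. energy M T e \<noteq> 0"
proof (intro bexI[of _ "\<lambda>s \<omega>. 1"])
  have "(1 :: real^'k) \<noteq> 0" by simp
  then show "energy M T (\<lambda>s \<omega>. 1 :: real^'k) \<noteq> 0" using T_pos by (simp add: energy_const)
qed (rule const_L2_process)

lemma gamma_star_nonneg: "0 \<le> gamma_star M T W Wb \<alpha> c"
  unfolding gamma_star_def
proof (rule INF_greatest)
  fix u :: "real \<Rightarrow> 'w \<Rightarrow> real^'m" assume "u \<in> \<U>"
  obtain e where e: "e \<in> {v \<in> \<V>. energy M T v \<noteq> 0}" using exists_nonzero_disturbance by blast
  have "0 \<le> ereal (sqrt (J u e) / sqrt (energy M T e))" by (simp add: J0_nonneg energy_nonneg)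
  also have "\<dots> \<le> (SUP v\<in>{v \<in> \<V>. energy M T v \<noteq> 0}. ereal (sqrt (J u v) / sqrt (energy M T v)))"
    by (rule SUP_upper[OF e])
  finally show "0 \<le> (SUP v\<in>{v \<in> \<V>. energy M T v \<noteq> 0}. ereal (sqrt (J u v) / sqrt (energy M T v)))" .
qed

text \<open>The infimum over u need not be attained, so g is taken strictly above it and some u has
  all its ratios below g. For every \<gamma>' > g the functional at this u is bounded by a constant,
  which by scaling forces the value 0.\<close>

lemma gamma_bar_le_gamma_star: "gamma_bar M T W Wb \<alpha> c \<le> gamma_star M T W Wb \<alpha> c"
proof (rule dense_ge)
  fix z assume z: "gamma_star M T W Wb \<alpha> c < z"
  show "gamma_bar M T W Wb \<alpha> c \<le> z"
  proof (cases z)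
    case (real g)
    have g: "0 < g" using le_less_trans[OF gamma_star_nonneg z] real by simp
    obtain u where u: "u \<in> \<U>" and s: "(SUP v\<in>{v \<in> \<V>. energy M T v \<noteq> 0}. ereal (sqrt (J u v) / sqrt (energy M T v))) < ereal g"
      using z unfolding real gamma_star_def by (auto simp: INF_less_iff)
    have b: "J u v \<le> g\<^sup>2 * energy M T v" if "v \<in> \<V>" "energy M T v \<noteq> 0" for v
    proof -
      have "ereal (sqrt (J u v) / sqrt (energy M T v)) \<le> (SUP v\<in>{v \<in> \<V>. energy M T v \<noteq> 0}. ereal (sqrt (J u v) / sqrt (energy M T v)))"
        by (rule SUP_upper) (use that in simp)
      also note s
      finally show ?thesis using ratio_le_iff[OF that(2) g, of u] by simp
    qed
    \<comment> \<open>A disturbance of nonzero norm, to bound the functional also at v of zero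
      norm.\<close>
    obtain e where e: "e \<in> \<V>" "energy M T e \<noteq> 0" using exists_nonzero_disturbance by blast
    have "upper_value M T W Wb \<alpha> c \<gamma>' = 0" if \<gamma>': "g < \<gamma>'" for \<gamma>'
    proof (rule upper_value_zero[OF u])
      fix v assume v: "v \<in> \<V>"
      have "g\<^sup>2 * energy M T v \<le> \<gamma>'\<^sup>2 * energy M T v" using g \<gamma>' by (intro mult_right_mono power_mono energy_nonneg) auto
      then show "J0_gamma M T W Wb \<alpha> c \<gamma>' u v \<le> g\<^sup>2 * energy M T e"
        using J0_le_of_ratio[OF filt_G_subset[OF u] e v b] by (simp add: J0_gamma_def)
    qed
    then show ?thesis unfolding real gamma_bar_def using g by (intro INF_lower) simp
  next
    case MInf
    then show ?thesis using z by simp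
  qed simp
qed

lemma J0_zero_le_of_upper_value:
  assumes "upper_value M T W Wb \<alpha> c \<gamma> = 0" and v: "v \<in> \<V>"
  shows "J (\<lambda>s \<omega>. 0) v \<le> \<gamma>\<^sup>2 * energy M T v"
proof -
  let ?J = "J0_gamma M T W Wb \<alpha> c \<gamma>"
  have "upper_value M T W Wb \<alpha> c \<gamma> < 1" using assms(1) by simp
  then obtain u where u: "u \<in> \<U>" and s: "(SUP v\<in>\<V>. ereal (?J u v)) < 1"
    unfolding upper_value_def by (auto simp: INF_less_iff)
  have u1: "?J u w \<le> 1" if "w \<in> \<V>" for w
  proof -
    have "ereal (?J u w) \<le> (SUP v\<in>\<V>. ereal (?J u v))" by (rule SUP_upper[OF that])
    also note s
    finally show ?thesis by (simp add: one_ereal_def)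
  qed
  have b: "?J (\<lambda>s \<omega>. 0) w \<le> 1" if w: "w \<in> \<V>" for w
  proof -
    have m: "(\<lambda>s \<omega>. - w s \<omega>) \<in> \<V>" using L2_process_plus_minus(2)[OF zero_L2_process w] by simp
    have "J u w + J u (\<lambda>s \<omega>. - w s \<omega>) = 2 * J u (\<lambda>s \<omega>. 0) + 2 * J (\<lambda>s \<omega>. 0) w"
      using J0_split[OF filt_G_subset[OF u] zero_L2_process w] by simp
    moreover have "energy M T (\<lambda>s \<omega>. - w s \<omega>) = energy M T w" by (simp add: energy_def)
    ultimately show ?thesis
      using u1[OF w] u1[OF m] J0_nonneg[of u "\<lambda>s \<omega>. 0"] by (simp add: J0_gamma_def)
  qed
  have "?J (\<lambda>s \<omega>. 0) v \<le> 0"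
  proof (rule ccontr)
    assume "\<not> ?J (\<lambda>s \<omega>. 0) v \<le> 0"
    then have a: "0 < ?J (\<lambda>s \<omega>. 0) v" by simp
    \<comment> \<open>Scales a positive value to 2, above the bound 1.\<close>
    define r where "r = sqrt (2 / ?J (\<lambda>s \<omega>. 0) v)"
    have "r\<^sup>2 * ?J (\<lambda>s \<omega>. 0) v \<le> 1"
      using J0_gamma_scale[OF zero_L2_process v, of \<gamma> r] b[OF L2_process_plus_minus(3)[OF v v, of r]] by simp
    moreover have "r\<^sup>2 * ?J (\<lambda>s \<omega>. 0) v = 2" using a by (simp add: r_def)
    ultimately show False by simp
  qed
  then show ?thesis by (simp add: J0_gamma_def)
qed

text \<open>u = 0 is a competitor in \<open>gamma_star\<close>. A threshold g promises vanishing
  values only strictly above g, so the ratio is bounded by each h > g.\<close>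

lemma gamma_star_le_gamma_bar: "gamma_star M T W Wb \<alpha> c \<le> gamma_bar M T W Wb \<alpha> c"
  unfolding gamma_bar_def
proof (rule INF_greatest)
  fix g assume "g \<in> {\<gamma>. \<gamma> > 0 \<and> (\<forall>\<gamma>'>\<gamma>. upper_value M T W Wb \<alpha> c \<gamma>' = 0)}"
  then have g: "0 < g" and uv: "\<And>\<gamma>'. g < \<gamma>' \<Longrightarrow> upper_value M T W Wb \<alpha> c \<gamma>' = 0" by auto
  show "gamma_star M T W Wb \<alpha> c \<le> ereal g"
  proof (rule dense_ge)
    fix z assume z: "ereal g < z"
    show "gamma_star M T W Wb \<alpha> c \<le> z"
    proof (cases z)
      case (real h)
      then have h: "g < h" using z by simp
      have "gamma_star M T W Wb \<alpha> c \<le> (SUP v\<in>{v \<in> \<V>. energy M T v \<noteq> 0}. ereal (sqrt (J (\<lambda>s \<omega>. 0) v) / sqrt (energy M T v)))"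
        unfolding gamma_star_def by (rule INF_lower[OF zero_L2_process])
      also have "\<dots> \<le> ereal h"
      proof (rule SUP_least)
        fix v assume "v \<in> {v \<in> \<V>. energy M T v \<noteq> 0}"
        then have v: "v \<in> \<V>" "energy M T v \<noteq> 0" by auto
        have "sqrt (J (\<lambda>s \<omega>. 0) v) / sqrt (energy M T v) \<le> h"
          using J0_zero_le_of_upper_value[OF uv[OF h] v(1)] ratio_le_iff[OF v(2), of h] g h by simp
        then show "ereal (sqrt (J (\<lambda>s \<omega>. 0) v) / sqrt (energy M T v)) \<le> ereal h" by simp
      qed
      finally show ?thesis using real by simp
    next
      case MInf
      then show ?thesis using z by simp
    qed simp
  qed
qed

end

theorem proposition3p2:
  fixes M :: "'w measure"
    and T :: real
    and W Wb :: "real \<Rightarrow> 'w \<Rightarrow> real"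
    and \<alpha> :: "real \<Rightarrow> 'w \<Rightarrow> 's::finite"
    and \<Lambda> :: "'s \<Rightarrow> 's \<Rightarrow> real"
    and c :: "('n::finite, 'm::finite, 'k::finite, 's) coeffs"
    and i :: 's
  assumes "T > 0"
    and "prob_space M" and "complete_measure M"
    and "brownian_motion M W" and "brownian_motion M Wb"
    and "\<And>j l. j \<noteq> l \<Longrightarrow> \<Lambda> j l > 0" and "\<And>j. (\<Sum>l\<in>UNIV. \<Lambda> j l) = 0"
    and "markov_chain M \<Lambda> \<alpha>"
    and "independent_noise M W Wb \<alpha>"
    and "AE \<omega> in M. \<alpha> 0 \<omega> = i"
    and "integrable_coeffs T c"
    and "nonneg_cost_coeffs T c"
  shows "gamma_star M T W Wb \<alpha> c = gamma_bar M T W Wb \<alpha> c"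
proof -
  interpret lq_problem M T W Wb \<alpha> c
    by (rule lq_problem.intro) (use assms in \<open>simp_all add: markov_chain_def\<close>)
  show ?thesis by (rule antisym[OF gamma_star_le_gamma_bar gamma_bar_le_gamma_star])
qed

end
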